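(* For $\tau,\varepsilon>0$ let $\overline{U}_{\tau,\varepsilon}:[0,T]\to X$ be the left-continuous piecewise constant interpolant of a discrete solution $(U^n_{\tau,\varepsilon})_{n=0}^N$ of the viscous incremental problem $$U^n_{\tau,\varepsilon}\in\operatorname*{Argmin}_{U\in X}\Big\{\tau\Psi_\varepsilon\Big(\frac{U-U^{n-1}_{\tau,\varepsilon}}{\tau}\Big)+\mathcal E_{t_n}(U)\Big\},\qquad n=1,\dots,N,$$ with $U^0_{\tau,\varepsilon}\to u_0\in X$ as $\varepsilon,\tau\downarrow0$. Then all vanishing sequences $\tau_k,\varepsilon_k\downarrow0$ satisfying $$\lim_{k\to\infty}\frac{\varepsilon_k}{\tau_k}=+\infty$$ admit further subsequences (still denoted $(\tau_k)$ and $(\varepsilon_k)$) and a limit function $u\in BV([0,T];X)$ such that $\overline{U}_{\tau_k,\varepsilon_k}(t)\to u(t)$ for every $t\in[0,T]$ as $k\uparrow+\infty$, and $u$ is a $BV$ solution of the rate-independent system $(X,\mathcal E,\mathfrak p)$ induced by the vanishing viscosity contact potential $\mathfrak p$.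
   Context: Let $(X,\|\cdot\|_X)$ be a finite-dimensional real normed vector space with dual $X^*$ and pairing $\langle\cdot,\cdot\rangle$, and let $T>0$. $\Psi_0:X\to[0,+\infty)$ is a gauge: $\Psi_0(v)>0$ if $v\neq0$, $\Psi_0(v_1+v_2)\le\Psi_0(v_1)+\Psi_0(v_2)$, $\Psi_0(\lambda v)=\lambda\Psi_0(v)$ for all $\lambda\ge0$, $v,v_1,v_2\in X$. $K^*:=\{w\in X^*:\langle w,z\rangle\le\Psi_0(z)\ \forall z\in X\}$. The energy $\mathcal E\in C^1([0,T]\times X)$, written $\mathcal E_t(u)$, satisfies for some $C>0$ and all $(t,u)$: $\mathcal E_t(u)\ge -C$ and $|\partial_t\mathcal E_t(u)|\le C(1+\mathcal E_t(u)^+)$, with $(\cdot)^+$ the positive part; $D\mathcal E_t(u)\in X^*$ is the differential in $u$. Viscosity: $\Psi:X\to[0,+\infty)$ is convex, $\Psi(0)=0$, $\Psi(v)/\|v\|_X\to+\infty$ as $\|v\|_X\to+\infty$; for $\varepsilon>0$, $\Psi_\varepsilon(v):=\varepsilon^{-1}\Psi(\varepsilon v)$, and $\Psi_0(v)=\lim_{\varepsilon\downarrow0}\Psi_\varepsilon(v)$ for every $v$. The Legendre conjugate is $\Psi_\varepsilon^*=\varepsilon^{-1}\Psi^*$. The vanishing viscosity contact potential is $\mathfrak p(v,w):=\inf_{\varepsilon>0}\big(\Psi_\varepsilon(v)+\Psi_\varepsilon^*(w)\big)$, $v\in X$, $w\in X^*$. Time discretization: for a time step $\tau>0$, $t_n:=n\tau$,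 $0=t_0<t_1<\dots<t_{N-1}<T\le t_N$; if $t_N>T$, $\mathcal E_{t_N}$ is understood as $\mathcal E_T$. $\overline U_{\tau,\varepsilon}(t):=U^n_{\tau,\varepsilon}$ if $t\in(t_{n-1},t_n]$, and $\overline U_{\tau,\varepsilon}(0):=U^0_{\tau,\varepsilon}$. BV functions: elements of $BV([0,T];X)$ are defined at every point and have finite pointwise total variation. $u(t_\pm)$ are the right/left limits, with $u(0_-):=u(0)$, $u(T_+):=u(T)$; $J_u:=\{t\in[0,T]:u(t_-)\ne u(t)\text{ or }u(t)\neq u(t_+)\}$. The distributional derivative splits as $u'=u'_{\mathscr L}+u'_{\rm C}+u'_{J}$ (absolutely continuous, Cantor, jump part); $u'_{\rm co}:=u'_{\mathscr L}+u'_{\rm C}$ and $\mu:=\mathscr L^1+|u'_{\rm C}|$. Finsler cost: $\Delta_{\mathfrak p,\mathcal E}(t;u_0,u_1):=\inf\big\{\int_{r_0}^{r_1}\mathfrak p(\dot\vartheta(r),-D\mathcal E_t(\vartheta(r)))\,\mathrm dr:\ \vartheta\in AC([r_0,r_1];X),\ \vartheta(r_0)=u_0,\ \vartheta(r_1)=u_1\big\}$, and $\Delta_{\mathfrak p,\mathcal E}(t;u_-,u,u_+):=\Delta_{\mathfrak p,\mathcal E}(t;u_-,u)+\Delta_{\mathfrak p,\mathcal E}(t;u,u_+)$. Pseudo-total variation: $$\mathit{Var}_{\mathfrak p,\mathcal E}(u;[a,b]):=\int_a^b\Psi_0\Big(\frac{\mathrm d u'_{\rm co}}{\mathrm d\mu}\Big)\mathrm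 d\mu+\Delta_{\mathfrak p,\mathcal E}(a;u(a),u(a_+))+\Delta_{\mathfrak p,\mathcal E}(b;u(b_-),u(b))+\sum_{t\in J_u\cap(a,b)}\Delta_{\mathfrak p,\mathcal E}(t;u(t_-),u(t),u(t_+)).$$ $u\in BV([0,T];X)$ is a $BV$ solution of $(X,\mathcal E,\mathfrak p)$ if $-D\mathcal E_t(u(t))\in K^*$ for a.a. $t\in[0,T]\setminus J_u$ and, for all $t\in[0,T]$, $\mathit{Var}_{\mathfrak p,\mathcal E}(u;[0,t])+\mathcal E_t(u(t))=\mathcal E_0(u(0))+\int_0^t\partial_t\mathcal E_s(u(s))\,\mathrm ds$.
   Formalization: The pseudo-total variation over a degenerate interval [a,a] is taken to be 0; read literally, the formula would count the jump at a, and the energy identity at t=0 would forbid a jump at time 0, which does occur for unstable u_0. *)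

theory Defs
  imports "HOL-Analysis.Analysis"
begin

section \<open>Dissipation, viscosity and the contact potential\<close>

definition gauge_functional :: "('a::real_vector \<Rightarrow> real) \<Rightarrow> bool" where
  "gauge_functional \<Psi>0 \<longleftrightarrow>
     (\<forall>v. \<Psi>0 v \<ge> 0) \<and> (\<forall>v. v \<noteq> 0 \<longrightarrow> \<Psi>0 v > 0) \<and>
     (\<forall>v1 v2. \<Psi>0 (v1 + v2) \<le> \<Psi>0 v1 + \<Psi>0 v2) \<and>
     (\<forall>c\<ge>0. \<forall>v. \<Psi>0 (c *\<^sub>R v) = c * \<Psi>0 v)"

definition Kstar :: "('a::real_normed_vector \<Rightarrow> real) \<Rightarrow> ('a \<Rightarrow>\<^sub>L real) set" where
  "Kstar \<Psi>0 = {w. \<forall>z. blinfun_apply w z \<le> \<Psi>0 z}"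

definition rescaled :: "('a::real_vector \<Rightarrow> real) \<Rightarrow> real \<Rightarrow> 'a \<Rightarrow> real" where
  "rescaled \<Psi> \<epsilon> v = \<Psi> (\<epsilon> *\<^sub>R v) / \<epsilon>"

definition viscous_potential :: "('a::real_normed_vector \<Rightarrow> real) \<Rightarrow> bool" where
  "viscous_potential \<Psi> \<longleftrightarrow>
     (\<forall>v. \<Psi> v \<ge> 0) \<and> convex_on UNIV \<Psi> \<and> \<Psi> 0 = 0 \<and>
     filterlim (\<lambda>v. \<Psi> v / norm v) at_top at_infinity"

text \<open>The real-valued supremum is harmless: for a nonnegative superlinear function the set
  below is bounded above.\<close>

definition legendre :: "('a::real_normed_vector \<Rightarrow> real) \<Rightarrow> ('a \<Rightarrow>\<^sub>L real) \<Rightarrow> real" where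
  "legendre F w = (SUP v. blinfun_apply w v - F v)"

definition contact_potential ::
  "('a::real_normed_vector \<Rightarrow> real) \<Rightarrow> 'a \<Rightarrow> ('a \<Rightarrow>\<^sub>L real) \<Rightarrow> real" where
  "contact_potential \<Psi> v w =
     (INF \<epsilon>\<in>{0<..}. rescaled \<Psi> \<epsilon> v + legendre (rescaled \<Psi> \<epsilon>) w)"


section \<open>The energy\<close>

text \<open>Membership of E in C1([0,T] x X), with partial derivatives named dtE and DE. At the
  times 0 and T the time derivative is one-sided.\<close>

definition C1_energy ::
  "real \<Rightarrow> (real \<Rightarrow> 'a::real_normed_vector \<Rightarrow> real) \<Rightarrow> (real \<Rightarrow> 'a \<Rightarrow> real)
     \<Rightarrow> (real \<Rightarrow> 'a \<Rightarrow> ('a \<Rightarrow>\<^sub>L real)) \<Rightarrow> bool" where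
  "C1_energy T E dtE DE \<longleftrightarrow>
     (\<forall>t\<in>{0..T}. \<forall>u.
        ((\<lambda>x. E (fst x) (snd x)) has_derivative
           (\<lambda>h. dtE t u * fst h + blinfun_apply (DE t u) (snd h)))
        (at (t, u) within {0..T} \<times> UNIV)) \<and>
     continuous_on ({0..T} \<times> UNIV) (\<lambda>x. dtE (fst x) (snd x)) \<and>
     continuous_on ({0..T} \<times> UNIV) (\<lambda>x. DE (fst x) (snd x))"

definition energy_bounds ::
  "real \<Rightarrow> (real \<Rightarrow> 'a \<Rightarrow> real) \<Rightarrow> (real \<Rightarrow> 'a \<Rightarrow> real) \<Rightarrow> bool" where
  "energy_bounds T E dtE \<longleftrightarrow>
     (\<exists>C>0. \<forall>t\<in>{0..T}. \<forall>u. E t u \<ge> - C \<and> \<bar>dtE t u\<bar> \<le> C * (1 + max 0 (E t u)))"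


section \<open>The incremental problem\<close>

text \<open>The number N of steps, characterised by (N - 1) \<tau> < T \<le> N \<tau>.\<close>

definition num_steps :: "real \<Rightarrow> real \<Rightarrow> nat" where
  "num_steps T \<tau> = (LEAST N. T \<le> real N * \<tau>)"

definition discrete_solution ::
  "real \<Rightarrow> (real \<Rightarrow> 'a::real_normed_vector \<Rightarrow> real) \<Rightarrow> ('a \<Rightarrow> real) \<Rightarrow> real \<Rightarrow> real
     \<Rightarrow> (nat \<Rightarrow> 'a) \<Rightarrow> bool" where
  "discrete_solution T E \<Psi> \<tau> \<epsilon> U \<longleftrightarrow>
     (\<forall>n\<in>{1..num_steps T \<tau>}.
        is_arg_min (\<lambda>V. \<tau> * rescaled \<Psi> \<epsilon> ((V - U (n - 1)) /\<^sub>R \<tau>) + E (min (real n * \<tau>) T) V)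
          (\<lambda>_. True) (U n))"

text \<open>The least n with t \<le> n \<tau> is 0 for t = 0, and is the n with (n - 1) \<tau> < t \<le> n \<tau> for t > 0.\<close>

definition interpolant :: "real \<Rightarrow> (nat \<Rightarrow> 'a) \<Rightarrow> real \<Rightarrow> 'a" where
  "interpolant \<tau> U t = U (LEAST n. t \<le> real n * \<tau>)"


section \<open>Functions of bounded variation on [0,T]\<close>

definition pointwise_variation :: "(real \<Rightarrow> 'a::real_normed_vector) \<Rightarrow> real set \<Rightarrow> ennreal" where
  "pointwise_variation u S =
     (SUP (n, s)\<in>{(n::nat, s::nat \<Rightarrow> real). mono_on {..n} s \<and> s ` {..n} \<subseteq> S}.
        \<Sum>i<n. ennreal (norm (u (s (Suc i)) - u (s i))))"

definition BV_function :: "real \<Rightarrow> (real \<Rightarrow> 'a::real_normed_vector) \<Rightarrow> bool" where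
  "BV_function T u \<longleftrightarrow> pointwise_variation u {0..T} < \<infinity>"

definition left_lim :: "(real \<Rightarrow> 'a::real_normed_vector) \<Rightarrow> real \<Rightarrow> 'a" where
  "left_lim u t = (if t \<le> 0 then u 0 else Lim (at_left t) u)"

definition right_lim :: "real \<Rightarrow> (real \<Rightarrow> 'a::real_normed_vector) \<Rightarrow> real \<Rightarrow> 'a" where
  "right_lim T u t = (if t \<ge> T then u T else Lim (at_right t) u)"

definition jump_set :: "real \<Rightarrow> (real \<Rightarrow> 'a::real_normed_vector) \<Rightarrow> real set" where
  "jump_set T u = {t\<in>{0..T}. left_lim u t \<noteq> u t \<or> u t \<noteq> right_lim T u t}"


subsection \<open>Vector measures\<close>

text \<open>A finite vector-valued Borel measure on the line is a set function; by convention it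
  vanishes outside the Borel sets, so that it is determined by its values on them.\<close>

definition vector_measure :: "(real set \<Rightarrow> 'a::real_normed_vector) \<Rightarrow> bool" where
  "vector_measure \<nu> \<longleftrightarrow>
     (\<forall>A. A \<notin> sets borel \<longrightarrow> \<nu> A = 0) \<and>
     (\<forall>A::nat \<Rightarrow> real set. range A \<subseteq> sets borel \<longrightarrow> disjoint_family A \<longrightarrow>
        (\<lambda>i. \<nu> (A i)) sums \<nu> (\<Union>i. A i))"

definition total_variation :: "(real set \<Rightarrow> 'a::real_normed_vector) \<Rightarrow> real set \<Rightarrow> ennreal" where
  "total_variation \<nu> A =
     (SUP B\<in>{B::nat \<Rightarrow> real set. range B \<subseteq> sets borel \<and> disjoint_family B \<and> (\<Union>i. B i) = A}.
        \<Sum>i. ennreal (norm (\<nu> (B i))))"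

definition total_variation_measure :: "(real set \<Rightarrow> 'a::real_normed_vector) \<Rightarrow> real measure" where
  "total_variation_measure \<nu> = measure_of UNIV (sets borel) (total_variation \<nu>)"

text \<open>The Radon-Nikodym density of a vector measure with respect to a positive Borel
  measure, determined up to null sets of the latter.\<close>

definition vector_density ::
  "real measure \<Rightarrow> (real set \<Rightarrow> 'a::{banach,second_countable_topology}) \<Rightarrow> real \<Rightarrow> 'a" where
  "vector_density M \<nu> =
     (SOME f. integrable M f \<and> (\<forall>A\<in>sets borel. \<nu> A = (LINT t:A|M. f t)))"

text \<open>The integral of a scalar function against a vector measure, through the polar
  decomposition of the latter.\<close>

definition vector_measure_integral ::
  "(real set \<Rightarrow> 'a::{banach,second_countable_topology}) \<Rightarrow> (real \<Rightarrow> real) \<Rightarrow> 'a" where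
  "vector_measure_integral \<nu> \<phi> =
     (LINT t|total_variation_measure \<nu>.
        \<phi> t *\<^sub>R vector_density (total_variation_measure \<nu>) \<nu> t)"


subsection \<open>The distributional derivative and its parts\<close>

text \<open>The distributional derivative on the open interval from 0 to T, as a vector measure on
  the line carried by that interval. Since it is required to be a measure, testing with
  compactly supported C1 functions amounts to testing with smooth ones.\<close>

definition test_function :: "real \<Rightarrow> (real \<Rightarrow> real) \<Rightarrow> bool" where
  "test_function T \<phi> \<longleftrightarrow>
     \<phi> C1_differentiable_on UNIV \<and>
     compact (closure {t. \<phi> t \<noteq> 0}) \<and> closure {t. \<phi> t \<noteq> 0} \<subseteq> {0<..<T}"

definition distributional_derivative ::
  "real \<Rightarrow> (real \<Rightarrow> 'a::{banach,second_countable_topology}) \<Rightarrow> real set \<Rightarrow> 'a" where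
  "distributional_derivative T u =
     (THE \<nu>. vector_measure \<nu> \<and> (\<forall>A\<in>sets borel. \<nu> A = \<nu> (A \<inter> {0<..<T})) \<and>
        (\<forall>\<phi>. test_function T \<phi> \<longrightarrow>
           (LINT t:{0<..<T}|lborel. deriv \<phi> t *\<^sub>R u t) = - vector_measure_integral \<nu> \<phi>))"

text \<open>Lebesgue decomposition with respect to Lebesgue measure.\<close>

definition ac_part :: "(real set \<Rightarrow> 'a::real_normed_vector) \<Rightarrow> real set \<Rightarrow> 'a" where
  "ac_part \<nu> =
     (THE \<alpha>. vector_measure \<alpha> \<and> (\<forall>A\<in>null_sets lborel. \<alpha> A = 0) \<and>
        (\<exists>N\<in>null_sets lborel. \<forall>A\<in>sets borel. A \<inter> N = {} \<longrightarrow> \<nu> A - \<alpha> A = 0))"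

text \<open>The jump part is the purely atomic part.\<close>

definition jump_part :: "(real set \<Rightarrow> 'a::real_normed_vector) \<Rightarrow> real set \<Rightarrow> 'a" where
  "jump_part \<nu> A = (if A \<in> sets borel then (\<Sum>\<^sub>\<infinity>t\<in>A. \<nu> {t}) else 0)"

definition cantor_part :: "(real set \<Rightarrow> 'a::real_normed_vector) \<Rightarrow> real set \<Rightarrow> 'a" where
  "cantor_part \<nu> A = \<nu> A - ac_part \<nu> A - jump_part \<nu> A"

definition co_part :: "(real set \<Rightarrow> 'a::real_normed_vector) \<Rightarrow> real set \<Rightarrow> 'a" where
  "co_part \<nu> A = ac_part \<nu> A + cantor_part \<nu> A"

text \<open>The reference measure given by the sum of Lebesgue measure and the total variation of
  the Cantor part.\<close>

definition reference_measure :: "(real set \<Rightarrow> 'a::real_normed_vector) \<Rightarrow> real measure" where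
  "reference_measure \<nu> =
     measure_of UNIV (sets borel)
       (\<lambda>A. emeasure lborel A + total_variation (cantor_part \<nu>) A)"


section \<open>Finsler cost, pseudo-total variation and BV solutions\<close>

definition AC_curve :: "real \<Rightarrow> real \<Rightarrow> (real \<Rightarrow> 'a::real_normed_vector) \<Rightarrow> bool" where
  "AC_curve a b \<theta> \<longleftrightarrow>
     (\<forall>e>0. \<exists>d>0. \<forall>(n::nat) l r.
        (\<forall>i<n. a \<le> l i \<and> l i \<le> r i \<and> r i \<le> b) \<and>
        (\<forall>i<n. \<forall>j<n. i \<noteq> j \<longrightarrow> {l i<..<r i} \<inter> {l j<..<r j} = {}) \<and>
        (\<Sum>i<n. r i - l i) < d
        \<longrightarrow> (\<Sum>i<n. norm (\<theta> (r i) - \<theta> (l i))) < e)"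

text \<open>The argument D is the differential of the energy at a frozen time. The parameter
  interval is arbitrary, which is immaterial as p is positively 1-homogeneous in its first
  argument.\<close>

definition finsler_cost ::
  "('a::real_normed_vector \<Rightarrow> ('a \<Rightarrow>\<^sub>L real) \<Rightarrow> real) \<Rightarrow> ('a \<Rightarrow> ('a \<Rightarrow>\<^sub>L real))
     \<Rightarrow> 'a \<Rightarrow> 'a \<Rightarrow> ennreal" where
  "finsler_cost p D u0 u1 =
     Inf {(\<integral>\<^sup>+ r. ennreal (p (vector_derivative \<theta> (at r)) (- D (\<theta> r))) * indicator {r0..r1} r
             \<partial>lborel) | \<theta> r0 r1.
          r0 < r1 \<and> AC_curve r0 r1 \<theta> \<and> \<theta> r0 = u0 \<and> \<theta> r1 = u1}"

text \<open>On a degenerate interval the pseudo-total variation is 0; the formula is meant for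
  a < b (for a = b it would count a jump at a).\<close>

definition pseudo_variation ::
  "real \<Rightarrow> ('a::{banach,second_countable_topology} \<Rightarrow> real) \<Rightarrow> ('a \<Rightarrow> ('a \<Rightarrow>\<^sub>L real) \<Rightarrow> real)
     \<Rightarrow> (real \<Rightarrow> 'a \<Rightarrow> ('a \<Rightarrow>\<^sub>L real)) \<Rightarrow> (real \<Rightarrow> 'a) \<Rightarrow> real \<Rightarrow> real \<Rightarrow> ennreal" where
  "pseudo_variation T \<Psi>0 p DE u a b =
     (if a < b then
        (let u' = distributional_derivative T u; \<mu> = reference_measure u'
         in \<integral>\<^sup>+ t. ennreal (\<Psi>0 (vector_density \<mu> (co_part u') t)) * indicator {a..b} t \<partial>\<mu>)
        + finsler_cost p (DE a) (u a) (right_lim T u a)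
        + finsler_cost p (DE b) (left_lim u b) (u b)
        + (\<Sum>\<^sub>\<infinity>t\<in>jump_set T u \<inter> {a<..<b}.
             finsler_cost p (DE t) (left_lim u t) (u t)
             + finsler_cost p (DE t) (u t) (right_lim T u t))
      else 0)"

definition BV_solution ::
  "real \<Rightarrow> (real \<Rightarrow> 'a::{banach,second_countable_topology} \<Rightarrow> real) \<Rightarrow> (real \<Rightarrow> 'a \<Rightarrow> real)
     \<Rightarrow> (real \<Rightarrow> 'a \<Rightarrow> ('a \<Rightarrow>\<^sub>L real)) \<Rightarrow> ('a \<Rightarrow> real) \<Rightarrow> ('a \<Rightarrow> ('a \<Rightarrow>\<^sub>L real) \<Rightarrow> real)
     \<Rightarrow> (real \<Rightarrow> 'a) \<Rightarrow> bool" where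
  "BV_solution T E dtE DE \<Psi>0 p u \<longleftrightarrow>
     BV_function T u \<and>
     (AE t in lborel. t \<in> {0..T} - jump_set T u \<longrightarrow> - DE t (u t) \<in> Kstar \<Psi>0) \<and>
     (\<forall>t\<in>{0..T}.
        enn2ereal (pseudo_variation T \<Psi>0 p DE u 0 t) + ereal (E t (u t)) =
        ereal (E 0 (u 0) + (LINT s:{0..t}|lborel. dtE s (u s))))"

end

theory Submission
  imports Defs "HOL-Library.Diagonal_Subsequence"
begin

text \<open>The minimality of each step is an equality in the Fenchel inequality between the increment
  and the force taken at the end of the step. As \<epsilon>/\<tau> tends to infinity, superlinearity of the
  potential makes the steps uniformly small, so for a continuously differentiable energy the
  Fenchel equalities sum up to the discrete energy inequality with a vanishing error, and no
  variational interpolant is needed. The accumulated contact potential controls the variation, and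
  Helly's selection theorem gives pointwise limits u of the interpolants and P of the accumulated
  dissipations.

  The limit dissipation P bounds the pseudo-total variation from above. At a jump, polygonal lines
  through the discrete solution are admissible transitions, whose cost is controlled because the
  contact potential depends uniformly continuously on the force; this also avoids any
  reparametrisation of time. Away from the jumps, the dissipation of the density of u' is a
  supremum of finite sums of functionals w in K* applied to u', each below the Stieltjes measure of P.
  This yields one inequality of the energy balance.

  For the opposite inequality, energy plus pseudo-total variation minus work is shown to be
  nondecreasing up to an arbitrarily small multiple of time plus variation. This is a local property,
  verified at each time from the left and from the right, by a first order expansion of the energy
  at the corresponding one-sided limit, whose force lies in K*.\<close>

section \<open>Finite-dimensional spaces and sublinear functionals\<close>

text \<open>The sort of X says nothing about dimension, so compactness, continuity of linear maps
  and supporting functionals are first obtained from coordinates in a basis. The derivative, its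
  parts and the densities are introduced by descriptions and choices; before any estimate they have
  to be made computable, by constructing the Stieltjes measure of the curve and showing that the
  derivative can only be this measure and its parts only restrictions of it. The transition costs
  are infima over arbitrary absolutely continuous curves; their lower bounds rest on a chain rule
  almost everywhere along such curves, hence on Radon-Nikodym densities and Lebesgue
  differentiation. The derivative lives on the open interval, so jumps at 0 and T are charged
  through the transition costs alone. On the discrete side the first-order error of a step is a
  small factor times its length, and the lengths have a uniformly bounded sum; this is why uniform
  smallness of the single steps suffices. For forces in K* the gauge already gives the lower bound
  of the dissipation; across a jump the Fenchel inequality takes over.\<close>

lemma bounded_family_subseq:
  fixes a :: "nat \<Rightarrow> 'i \<Rightarrow> real"
  assumes "finite F" "\<And>i. i \<in> F \<Longrightarrow> bounded (range (\<lambda>n. a n i))"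
  shows "\<exists>r l. strict_mono (r::nat\<Rightarrow>nat) \<and> (\<forall>i\<in>F. (\<lambda>n. a (r n) i) \<longlonglongrightarrow> l i)"
  using assms
proof (induction F)
  case empty
  show ?case by (intro exI[of _ id]) (auto simp: strict_mono_def)
next
  case (insert j F)
  then obtain r l where r: "strict_mono (r::nat\<Rightarrow>nat)" "\<forall>i\<in>F. (\<lambda>n. a (r n) i) \<longlonglongrightarrow> l i" by blast
  have "bounded (range (\<lambda>n. a (r n) j))"
    by (rule bounded_subset[OF insert.prems(1)[of j]]) auto
  then obtain m s where s: "strict_mono s" "((\<lambda>n. a (r n) j) \<circ> s) \<longlonglongrightarrow> m"
    using bounded_imp_convergent_subsequence by blast
  have "(\<lambda>n. a ((r \<circ> s) n) i) \<longlonglongrightarrow> (l(j := m)) i" if "i \<in> insert j F" for i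
  proof (cases "i = j")
    case True then show ?thesis using s by (simp add: o_def)
  next
    case False
    then show ?thesis using that r(2) LIMSEQ_subseq_LIMSEQ[of "\<lambda>n. a (r n) i" "l i" s] s(1)
      by (auto simp: o_def)
  qed
  then show ?case using strict_mono_o[OF r(1) s(1)] by blast
qed

text \<open>A basis as a parameter keeps the norm of X arbitrary and supplies coordinates; the
  one-dimensional instance is reused later for real-valued curves.\<close>

locale finite_dim_basis =
  fixes B :: "'a::{banach,second_countable_topology} set"
  assumes finite_B: "finite B" and indep_B: "independent B" and span_B: "span B = UNIV"
begin

abbreviation "cf \<equiv> representation B"

lemma expand: "v = (\<Sum>b\<in>B. cf v b *\<^sub>R b)"
  using sum_representation_eq[of B v B] finite_B indep_B span_B by simp

lemma cf_add: "cf (x + y) b = cf x b + cf y b"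
  and cf_scale: "cf (c *\<^sub>R x) b = c * cf x b"
  using fun_cong[OF representation_add[OF indep_B, of y x], of b]
    fun_cong[OF representation_scale[OF indep_B, of x c], of b]
  by (simp_all add: span_B add.commute)

text \<open>Equivalence of norms. Otherwise there are vectors with coordinate sum 1 whose norms tend
  to 0; along a subsequence the coordinates converge, and their limit is a nontrivial linear
  relation between the basis vectors.\<close>

lemma cf_bound: "\<exists>C>0. \<forall>v. (\<Sum>b\<in>B. \<bar>cf v b\<bar>) \<le> C * norm v"
proof (rule ccontr)
  assume neg: "\<not> ?thesis"
  have "\<exists>v. (\<Sum>b\<in>B. \<bar>cf v b\<bar>) > real (Suc n) * norm v" for n
  proof (rule ccontr)
    assume "\<not> ?thesis"
    then have "\<forall>v. (\<Sum>b\<in>B. \<bar>cf v b\<bar>) \<le> real (Suc n) * norm v" by (simp add: not_less)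
    moreover have "real (Suc n) > 0" by simp
    ultimately show False using neg by blast
  qed
  then obtain v where v: "\<And>n. (\<Sum>b\<in>B. \<bar>cf (v n) b\<bar>) > real (Suc n) * norm (v n)" by metis
  define S where "S n = (\<Sum>b\<in>B. \<bar>cf (v n) b\<bar>)" for n
  have S: "S n > 0" for n
    using v[of n] unfolding S_def
    by (meson mult_nonneg_nonneg norm_ge_zero of_nat_0_le_iff order_le_less_trans)
  define x where "x n = v n /\<^sub>R S n" for n
  have cx: "cf (x n) b = cf (v n) b / S n" for n b
    by (simp add: x_def cf_scale divide_inverse mult.commute)
  have sx: "(\<Sum>b\<in>B. \<bar>cf (x n) b\<bar>) = 1" for n
    using S[of n] by (simp add: cx abs_div sum_divide_distrib[symmetric]) (simp add: S_def)
  have nx: "norm (x n) \<le> 1 / real (Suc n)" for n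
    using v[of n] S[of n] unfolding S_def[symmetric] x_def
    by (simp add: field_simps)
  have bd: "bounded (range (\<lambda>n. cf (x n) b))" if "b \<in> B" for b
  proof (rule boundedI[of _ 1], clarsimp)
    fix n
    have "\<bar>cf (x n) b\<bar> \<le> (\<Sum>b\<in>B. \<bar>cf (x n) b\<bar>)"
      using finite_B that by (intro member_le_sum) auto
    then show "\<bar>cf (x n) b\<bar> \<le> 1" using sx[of n] by simp
  qed
  from bounded_family_subseq[of B "\<lambda>n. cf (x n)", OF finite_B bd]
  obtain r l where r: "strict_mono (r::nat\<Rightarrow>nat)" and l: "\<forall>b\<in>B. (\<lambda>n. cf (x (r n)) b) \<longlonglongrightarrow> l b" by blast
  have "(\<lambda>n. \<Sum>b\<in>B. \<bar>cf (x (r n)) b\<bar>) \<longlonglongrightarrow> (\<Sum>b\<in>B. \<bar>l b\<bar>)"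
    using l by (intro tendsto_intros) auto
  then have l1: "(\<Sum>b\<in>B. \<bar>l b\<bar>) = 1" unfolding sx by (simp add: LIMSEQ_const_iff)
  have "(\<lambda>n. \<Sum>b\<in>B. cf (x (r n)) b *\<^sub>R b) \<longlonglongrightarrow> (\<Sum>b\<in>B. l b *\<^sub>R b)"
    using l by (intro tendsto_intros) auto
  then have "(\<lambda>n. x (r n)) \<longlonglongrightarrow> (\<Sum>b\<in>B. l b *\<^sub>R b)" unfolding expand[symmetric] .
  moreover have "x \<longlonglongrightarrow> 0"
    by (rule Lim_null_comparison[OF _ LIMSEQ_inverse_real_of_nat])
      (use nx in \<open>auto simp: inverse_eq_divide\<close>)
  then have "(\<lambda>n. x (r n)) \<longlonglongrightarrow> 0" using LIMSEQ_subseq_LIMSEQ[OF _ r] by (simp add: o_def)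
  ultimately have "(\<Sum>b\<in>B. l b *\<^sub>R b) = 0" by (rule LIMSEQ_unique)
  then have "\<forall>b\<in>B. l b = 0" using independentD[OF indep_B finite_B order_refl, of l] by simp
  then show False using l1 by simp
qed

definition cC :: real where "cC = (SOME C. C > 0 \<and> (\<forall>v. (\<Sum>b\<in>B. \<bar>cf v b\<bar>) \<le> C * norm v))"

lemma cC: "cC > 0" "(\<Sum>b\<in>B. \<bar>cf v b\<bar>) \<le> cC * norm v"
  using someI_ex[OF cf_bound] unfolding cC_def by blast+

lemma cf_le: assumes "b \<in> B" shows "\<bar>cf v b\<bar> \<le> cC * norm v"
proof -
  have "\<bar>cf v b\<bar> \<le> (\<Sum>b\<in>B. \<bar>cf v b\<bar>)" using finite_B assms by (intro member_le_sum) auto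
  then show ?thesis using cC(2)[of v] by linarith
qed

lemma bounded_linear_cf: "b \<in> B \<Longrightarrow> bounded_linear (\<lambda>v. cf v b)"
  by (rule bounded_linear_intro[of _ cC]) (simp_all add: cf_add cf_scale cf_le mult.commute[of "norm _" cC])

lemma bounded_subseq:
  fixes x :: "nat \<Rightarrow> 'a"
  assumes "bounded (range x)"
  shows "\<exists>r l. strict_mono (r::nat\<Rightarrow>nat) \<and> (\<lambda>n. x (r n)) \<longlonglongrightarrow> l"
proof -
  obtain M where M: "\<And>n. norm (x n) \<le> M" using assms by (auto simp: bounded_iff)
  have bd: "bounded (range (\<lambda>n. cf (x n) b))" if "b \<in> B" for b
    using cf_le[OF that] M cC(1)
    by (intro boundedI[of _ "cC * M"]) (auto intro!: order_trans[OF cf_le[OF that]] mult_left_mono)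
  from bounded_family_subseq[of B "\<lambda>n. cf (x n)", OF finite_B bd]
  obtain r l where r: "strict_mono (r::nat\<Rightarrow>nat)" and l: "\<forall>b\<in>B. (\<lambda>n. cf (x (r n)) b) \<longlonglongrightarrow> l b" by blast
  have "(\<lambda>n. \<Sum>b\<in>B. cf (x (r n)) b *\<^sub>R b) \<longlonglongrightarrow> (\<Sum>b\<in>B. l b *\<^sub>R b)"
    using l by (intro tendsto_intros) auto
  then have "(\<lambda>n. x (r n)) \<longlonglongrightarrow> (\<Sum>b\<in>B. l b *\<^sub>R b)" unfolding expand[symmetric] .
  then show ?thesis using r by blast
qed

lemma compact_bounded_closed:
  fixes S :: "'a set"
  assumes "bounded S" "closed S" shows "compact S"
  unfolding compact_def
proof (intro allI impI)
  fix f :: "nat \<Rightarrow> 'a" assume f: "\<forall>n. f n \<in> S"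
  have "bounded (range f)" using f by (intro bounded_subset[OF assms(1)]) auto
  from bounded_subseq[OF this] obtain r l where r: "strict_mono (r::nat\<Rightarrow>nat)" "(\<lambda>n. f (r n)) \<longlonglongrightarrow> l"
    by blast
  have "l \<in> S" by (rule closed_sequentially[OF assms(2) _ r(2)]) (use f in auto)
  then show "\<exists>l\<in>S. \<exists>r. strict_mono r \<and> (f \<circ> r) \<longlonglongrightarrow> l" using r by (auto simp: o_def)
qed

lemma bounded_linear_linear:
  fixes f :: "'a \<Rightarrow> 'b::real_normed_vector"
  assumes "linear f" shows "bounded_linear f"
proof -
  have f: "f v = (\<Sum>b\<in>B. cf v b *\<^sub>R f b)" for v
    using arg_cong[OF expand[of v], of f] by (simp add: linear_sum[OF assms] linear_cmul[OF assms])
  have "bounded_linear (\<lambda>v. \<Sum>b\<in>B. cf v b *\<^sub>R f b)"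
    by (intro bounded_linear_sum bounded_linear_scaleR_const bounded_linear_cf)
  moreover have "f = (\<lambda>v. \<Sum>b\<in>B. cf v b *\<^sub>R f b)" using f by blast
  ultimately show ?thesis by simp
qed

end

section \<open>Sublinear functionals and the finite-dimensional Hahn-Banach theorem\<close>

definition sublinear :: "('a::real_vector \<Rightarrow> real) \<Rightarrow> bool" where
  "sublinear N \<longleftrightarrow> (\<forall>x y. N (x + y) \<le> N x + N y) \<and> (\<forall>c\<ge>0. \<forall>x. N (c *\<^sub>R x) = c * N x)"

lemma sublinearD:
  assumes "sublinear N"
  shows "N (x + y) \<le> N x + N y" "c \<ge> 0 \<Longrightarrow> N (c *\<^sub>R x) = c * N x" "N 0 = 0" "0 \<le> N x + N (- x)"
proof -
  show a: "N (x + y) \<le> N x + N y" for x y using assms by (auto simp: sublinear_def)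
  show "c \<ge> 0 \<Longrightarrow> N (c *\<^sub>R x) = c * N x" using assms by (auto simp: sublinear_def)
  have "N (0 *\<^sub>R x) = 0 * N x" using assms unfolding sublinear_def by blast
  then show z: "N 0 = 0" by simp
  show "0 \<le> N x + N (- x)" using a[of x "-x"] z by simp
qed

text \<open>Passing from N to the functional below keeps it sublinear, does not increase it, and makes
  it linear along b.\<close>

lemma sublinear_reduce:
  fixes N :: "'a::real_vector \<Rightarrow> real"
  assumes N: "sublinear N"
  shows "\<exists>M. sublinear M \<and> (\<forall>x. M x \<le> N x) \<and> M (- b) \<le> - N b"
proof -
  \<comment> \<open>Subadditivity bounds the family below by \<open>- N (- x)\<close>, so the
    infimum is finite. The choice \<open>t = 0\<close> gives \<open>M x \<le> N x\<close>, and
    \<open>t = 1\<close> at the point \<open>- b\<close> gives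
    \<open>M (- b) \<le> - N b\<close>.\<close>
  define M where "M x = (INF t\<in>{0..}. N (x + t *\<^sub>R b) - t * N b)" for x
  have lb: "- N (- x) \<le> N (x + t *\<^sub>R b) - t * N b" if "t \<ge> 0" for x t
    using sublinearD(1)[OF N, of "x + t *\<^sub>R b" "- x"] sublinearD(2)[OF N, of t b] that by simp
  then have bd: "bdd_below ((\<lambda>t. N (x + t *\<^sub>R b) - t * N b) ` {0..})" for x
    by (intro bdd_belowI[of _ "- N (- x)"]) auto
  have le: "M x \<le> N (x + t *\<^sub>R b) - t * N b" if "t \<ge> 0" for x t
    unfolding M_def using that by (intro cINF_lower[OF bd]) auto
  have ge: "c \<le> M x" if "\<And>t. t \<ge> 0 \<Longrightarrow> c \<le> N (x + t *\<^sub>R b) - t * N b" for c x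
    unfolding M_def using that by (intro cINF_greatest) auto
  have add: "M (x + y) \<le> M x + M y" for x y
  proof -
    have "M (x + y) - (N (y + s *\<^sub>R b) - s * N b) \<le> M x" if s: "s \<ge> 0" for s
    proof (rule ge)
      fix t :: real assume t: "t \<ge> 0"
      have "M (x + y) \<le> N ((x + y) + (t + s) *\<^sub>R b) - (t + s) * N b" using s t by (intro le) auto
      also have "(x + y) + (t + s) *\<^sub>R b = (x + t *\<^sub>R b) + (y + s *\<^sub>R b)" by (simp add: algebra_simps)
      also have "N \<dots> \<le> N (x + t *\<^sub>R b) + N (y + s *\<^sub>R b)" by (rule sublinearD[OF N])
      finally show "M (x + y) - (N (y + s *\<^sub>R b) - s * N b) \<le> N (x + t *\<^sub>R b) - t * N b"
        by (simp add: algebra_simps)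
    qed
    then have "M (x + y) - M x \<le> M y" by (intro ge) (simp add: algebra_simps)
    then show ?thesis by simp
  qed
  have sc1: "M (c *\<^sub>R x) \<le> c * M x" if c: "c > 0" for c x
  proof -
    have "M (c *\<^sub>R x) / c \<le> M x"
    proof (rule ge)
      fix t :: real assume t: "t \<ge> 0"
      have "M (c *\<^sub>R x) \<le> N (c *\<^sub>R x + (c * t) *\<^sub>R b) - (c * t) * N b" using c t by (intro le) auto
      also have "c *\<^sub>R x + (c * t) *\<^sub>R b = c *\<^sub>R (x + t *\<^sub>R b)" by (simp add: algebra_simps)
      also have "N \<dots> = c * N (x + t *\<^sub>R b)" using c by (intro sublinearD[OF N]) auto
      finally show "M (c *\<^sub>R x) / c \<le> N (x + t *\<^sub>R b) - t * N b" using c by (simp add: field_simps)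
    qed
    then show ?thesis using c by (simp add: field_simps)
  qed
  have M0: "M 0 = 0"
  proof (rule antisym)
    show "M 0 \<le> 0" using le[of 0 0] sublinearD(3)[OF N] by simp
    show "0 \<le> M 0" using lb[of _ 0] sublinearD(3)[OF N] by (intro ge) auto
  qed
  have sc: "M (c *\<^sub>R x) = c * M x" if c: "c \<ge> 0" for c x
  proof (cases "c = 0")
    case False
    then have "M x \<le> inverse c * M (c *\<^sub>R x)" using sc1[of "inverse c" "c *\<^sub>R x"] c by simp
    then show ?thesis using sc1[of c x] c False by (simp add: field_simps)
  qed (simp add: M0)
  have "M x \<le> N x" for x using le[of 0 x] by simp
  moreover have "M (- b) \<le> - N b" using le[of 1 "- b"] sublinearD(3)[OF N] by simp
  moreover have "sublinear M" using add sc by (simp add: sublinear_def)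
  ultimately show ?thesis by blast
qed

text \<open>Linearity along a vector survives later reductions: the sum of the values at
  \<open>c\<close> and \<open>- c\<close> can only decrease, while sublinearity keeps it
  nonnegative. Hence one reduction per vector suffices.\<close>

lemma sublinear_reduce_finite:
  fixes N :: "'a::real_vector \<Rightarrow> real"
  assumes "finite F" "sublinear N"
  shows "\<exists>M. sublinear M \<and> (\<forall>x. M x \<le> N x) \<and> (\<forall>b\<in>F. M b + M (- b) = 0)"
  using assms
proof (induction F)
  case empty then show ?case by blast
next
  case (insert b F)
  then obtain M where M: "sublinear M" "\<forall>x. M x \<le> N x" "\<forall>b\<in>F. M b + M (- b) = 0" by blast
  from sublinear_reduce[OF M(1), of b]
  obtain L where L: "sublinear L" "\<forall>x. L x \<le> M x" "L (- b) \<le> - M b" by blast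
  have "L c + L (- c) = 0" if "c \<in> insert b F" for c
  proof -
    have "L c + L (- c) \<le> 0"
    proof (cases "c = b")
      case True
      have "L b + L (- b) \<le> 0" using L(2)[rule_format, of b] L(3) by linarith
      then show ?thesis using True by simp
    next
      case False
      then have "M c + M (- c) = 0" using that M(3) by blast
      then show ?thesis using L(2)[rule_format, of c] L(2)[rule_format, of "-c"] by linarith
    qed
    then show ?thesis using sublinearD(4)[OF L(1), of c] by linarith
  qed
  then show ?case using L M by (meson order_trans)
qed

text \<open>The first reduction, along \<open>v\<close>, secures the value at \<open>v\<close>. The
  reductions along the basis then force linearity everywhere, because the vectors with
  \<open>M x + M (- x) = 0\<close> form a subspace on which \<open>M\<close> is linear.\<close>

lemma (in finite_dim_basis) sublinear_support:
  fixes N :: "'a \<Rightarrow> real"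
  assumes N: "sublinear N"
  shows "\<exists>w::'a \<Rightarrow>\<^sub>L real. (\<forall>x. blinfun_apply w x \<le> N x) \<and> blinfun_apply w v = N v"
proof -
  obtain N1 where N1: "sublinear N1" "\<forall>x. N1 x \<le> N x" "N1 (- v) \<le> - N v"
    using sublinear_reduce[OF N] by blast
  obtain M where M: "sublinear M" "\<forall>x. M x \<le> N1 x" "\<forall>b\<in>B. M b + M (- b) = 0"
    using sublinear_reduce_finite[OF finite_B N1(1)] by blast
  define S where "S = {x. M x + M (- x) = 0}"
  have Sadd: "x + y \<in> S \<and> M (x + y) = M x + M y" if "x \<in> S" "y \<in> S" for x y
    using sublinearD(1)[OF M(1), of x y] sublinearD(1)[OF M(1), of "-x" "-y"]
      sublinearD(4)[OF M(1), of "x + y"] that by (simp add: S_def)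
  have Sneg: "- x \<in> S" "M (- x) = - M x" if "x \<in> S" for x using that by (auto simp: S_def)
  have Sscale: "c *\<^sub>R x \<in> S \<and> M (c *\<^sub>R x) = c * M x" if "x \<in> S" for c x
  proof -
    have "M (\<bar>c\<bar> *\<^sub>R x) = \<bar>c\<bar> * M x" "M (\<bar>c\<bar> *\<^sub>R (- x)) = \<bar>c\<bar> * M (- x)"
      by (intro sublinearD[OF M(1)]; simp)+
    then show ?thesis using that Sneg(2)[OF that]
      by (cases "c \<ge> 0") (auto simp: S_def)
  qed
  have "subspace S" unfolding subspace_def
    using Sadd Sscale sublinearD(3)[OF M(1)] by (simp add: S_def[THEN eqset_imp_iff, of 0])
  moreover have "B \<subseteq> S" using M(3) by (auto simp: S_def)
  ultimately have S: "S = UNIV" using span_minimal[of B S] span_B by auto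
  have lin: "linear M" using Sadd Sscale unfolding S by (intro linearI) auto
  define w where "w = Blinfun M"
  have w: "blinfun_apply w x = M x" for x
    unfolding w_def using bounded_linear_linear[OF lin] by (simp add: bounded_linear_Blinfun_apply)
  have "M v \<ge> N v" using N1(3) M(2)[rule_format, of "-v"] Sneg(2)[of v] S by simp
  moreover have "M x \<le> N x" for x using M(2) N1(2) order_trans by blast
  ultimately show ?thesis using w by (intro exI[of _ w]) (auto intro: antisym)
qed

section \<open>Viscous potentials and the contact potential\<close>

lemma (in finite_dim_basis) sublinear_bound:
  fixes N :: "'a \<Rightarrow> real"
  assumes N: "sublinear N"
  shows "\<exists>K>0. \<forall>v. N v \<le> K * norm v"
proof -
  define M where "M = (\<Sum>b\<in>B. \<bar>N b\<bar> + \<bar>N (- b)\<bar>)"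
  have M0: "M \<ge> 0" unfolding M_def by (intro sum_nonneg) auto
  have sum: "N (\<Sum>b\<in>F. f b) \<le> (\<Sum>b\<in>F. N (f b))" if "finite F" for F and f :: "'a \<Rightarrow> 'a"
    using that
  proof (induction F)
    case empty then show ?case using sublinearD(3)[OF N] by simp
  next
    case (insert x F)
    then show ?case using sublinearD(1)[OF N, of "f x" "\<Sum>b\<in>F. f b"] by simp
  qed
  have one: "N (c *\<^sub>R b) \<le> \<bar>c\<bar> * M" if "b \<in> B" for c b
  proof -
    have "\<bar>N b\<bar> + \<bar>N (- b)\<bar> \<le> M" unfolding M_def
      using finite_B that by (intro member_le_sum[of b B "\<lambda>b. \<bar>N b\<bar> + \<bar>N (- b)\<bar>"]) auto
    then have *: "N b \<le> M" "N (- b) \<le> M" by linarith+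
    have "N (c *\<^sub>R b) = \<bar>c\<bar> * (if c \<ge> 0 then N b else N (- b))"
      using sublinearD(2)[OF N, of c b] sublinearD(2)[OF N, of "- c" "- b"] by auto
    then show ?thesis using * by (auto intro!: mult_left_mono)
  qed
  have "N v \<le> cC * (M + 1) * norm v" for v
  proof -
    have "N v = N (\<Sum>b\<in>B. cf v b *\<^sub>R b)" by (subst expand[symmetric]) simp
    also have "\<dots> \<le> (\<Sum>b\<in>B. N (cf v b *\<^sub>R b))" by (rule sum[OF finite_B])
    also have "\<dots> \<le> (\<Sum>b\<in>B. \<bar>cf v b\<bar> * M)" by (intro sum_mono one)
    also have "\<dots> = (\<Sum>b\<in>B. \<bar>cf v b\<bar>) * M" by (simp add: sum_distrib_right)
    also have "\<dots> \<le> (cC * norm v) * (M + 1)"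
      using M0 cC(2)[of v] cC(1) by (intro mult_mono) auto
    finally show ?thesis by (simp add: ac_simps)
  qed
  moreover have "cC * (M + 1) > 0" using M0 cC(1) by simp
  ultimately show ?thesis by blast
qed

text \<open>Since the conjugate of rescaled \<Psi> e is legendre \<Psi> divided by e, the contact potential at
  (v, w) is this profile at v and c = legendre \<Psi> w.\<close>

definition contact_profile :: "('a::real_vector \<Rightarrow> real) \<Rightarrow> 'a \<Rightarrow> real \<Rightarrow> real" where
  "contact_profile \<Psi> v c = (INF e\<in>{0<..}. (\<Psi> (e *\<^sub>R v) + c) / e)"

locale viscous_system = finite_dim_basis B
  for B :: "'a::{banach,second_countable_topology} set" +
  fixes \<Psi> \<Psi>0 :: "'a \<Rightarrow> real"
  assumes gauge: "gauge_functional \<Psi>0"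
    and viscous: "viscous_potential \<Psi>"
    and small_viscosity: "\<And>v. ((\<lambda>\<eta>. rescaled \<Psi> \<eta> v) \<longlongrightarrow> \<Psi>0 v) (at_right 0)"
begin

lemma Psi_nonneg: "0 \<le> \<Psi> v" and Psi_zero: "\<Psi> 0 = 0" and convex_Psi: "convex_on UNIV \<Psi>"
  using viscous by (auto simp: viscous_potential_def)

lemma Psi_convexD: "0 \<le> s \<Longrightarrow> s \<le> 1 \<Longrightarrow> \<Psi> ((1 - s) *\<^sub>R x + s *\<^sub>R y) \<le> (1 - s) * \<Psi> x + s * \<Psi> y"
  using convex_onD[OF convex_Psi] by auto

text \<open>Difference quotients at 0 of a convex function vanishing there increase with the
  increment; the gauge is therefore a lower bound of all rescalings.\<close>

lemma rescaled_mono: assumes "0 < s" "s \<le> e" shows "rescaled \<Psi> s v \<le> rescaled \<Psi> e v"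
proof -
  have "\<Psi> (s *\<^sub>R v) \<le> (s / e) * \<Psi> (e *\<^sub>R v)"
    using Psi_convexD[of "s / e" 0 "e *\<^sub>R v"] assms Psi_zero by simp
  then show ?thesis using assms by (simp add: rescaled_def field_simps)
qed

lemma Psi0_le_rescaled: assumes "e > 0" shows "\<Psi>0 v \<le> rescaled \<Psi> e v"
proof (rule tendsto_upperbound[OF small_viscosity])
  show "\<forall>\<^sub>F \<eta> in at_right 0. rescaled \<Psi> \<eta> v \<le> rescaled \<Psi> e v"
    unfolding eventually_at_right_field using assms rescaled_mono by (intro exI[of _ e]) auto
qed simp

lemma sublinear_Psi0: "sublinear \<Psi>0"
  using gauge by (auto simp: gauge_functional_def sublinear_def)

lemma Psi0_nonneg: "0 \<le> \<Psi>0 v" using gauge by (auto simp: gauge_functional_def)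

lemma superlinear: "\<exists>\<rho>>0. \<forall>v. norm v \<ge> \<rho> \<longrightarrow> R * norm v \<le> \<Psi> v"
proof -
  have "filterlim (\<lambda>v. \<Psi> v / norm v) at_top at_infinity" using viscous by (simp add: viscous_potential_def)
  then have "\<forall>\<^sub>F v in at_infinity. R \<le> \<Psi> v / norm v" by (simp add: filterlim_at_top)
  then obtain b where b: "\<And>v. norm v \<ge> b \<Longrightarrow> R \<le> \<Psi> v / norm v" by (auto simp: eventually_at_infinity)
  have "R * norm v \<le> \<Psi> v" if "norm v \<ge> max b 1" for v
  proof -
    have "norm v > 0" using that by linarith
    then show ?thesis using b[of v] that by (simp add: field_simps)
  qed
  then show ?thesis by (intro exI[of _ "max b 1"]) auto
qed

section \<open>Conjugates of the viscosity potential and of its rescalings\<close>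

abbreviation "leg \<equiv> legendre \<Psi>"

lemma apply_le: "norm w \<le> R \<Longrightarrow> blinfun_apply w v \<le> R * norm v"
  for w :: "'a \<Rightarrow>\<^sub>L real"
  using norm_blinfun[of w v] mult_right_mono[of "norm w" R "norm v"] by auto

text \<open>Superlinearity with slope \<open>norm w\<close> lets every \<open>v\<close> beyond the
  radius \<rho> contribute at most 0, so the real supremum in \<open>legendre\<close> is a genuine
  one.\<close>

lemma bdd_legendre: "bdd_above (range (\<lambda>v. blinfun_apply w v - \<Psi> v))"
proof -
  obtain \<rho> where \<rho>: "\<rho> > 0" "\<And>v. norm v \<ge> \<rho> \<Longrightarrow> norm w * norm v \<le> \<Psi> v"
    using superlinear[of "norm w"] by blast
  have "blinfun_apply w v - \<Psi> v \<le> norm w * \<rho>" for v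
  proof (cases "norm v \<ge> \<rho>")
    case True
    have "0 \<le> norm w * \<rho>" using \<rho>(1) by simp
    then show ?thesis using \<rho>(2)[OF True] apply_le[of w "norm w" v] by simp
  next
    case False
    have "blinfun_apply w v \<le> norm w * norm v" by (intro apply_le) simp
    also have "\<dots> \<le> norm w * \<rho>" using False by (intro mult_left_mono) auto
    finally show ?thesis using Psi_nonneg[of v] by linarith
  qed
  then show ?thesis by (intro bdd_aboveI) auto
qed

lemma leg_ge: "blinfun_apply w v - \<Psi> v \<le> leg w"
  unfolding legendre_def by (rule cSUP_upper[OF _ bdd_legendre]) simp

lemma leg_nonneg: "0 \<le> leg w" using leg_ge[of w 0] Psi_zero by simp

text \<open>For forces of norm at most \<open>R\<close>, only vectors shorter than \<rho> can
  contribute a positive value, and on these the pairing depends on the force with slope at most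
  \<rho>.\<close>

lemma leg_lipschitz:
  "\<exists>\<rho>>0. \<forall>w w'. norm w \<le> R \<longrightarrow> norm w' \<le> R \<longrightarrow> leg w' \<le> leg w + \<rho> * norm (w' - w)"
proof -
  obtain \<rho> where \<rho>: "\<rho> > 0" "\<And>v. norm v \<ge> \<rho> \<Longrightarrow> R * norm v \<le> \<Psi> v"
    using superlinear[of R] by blast
  have "leg w' \<le> leg w + \<rho> * norm (w' - w)" if w: "norm w \<le> R" "norm w' \<le> R" for w w'
  proof -
    have "blinfun_apply w' v - \<Psi> v \<le> leg w + \<rho> * norm (w' - w)" for v
    proof (cases "norm v \<ge> \<rho>")
      case True
      then have "blinfun_apply w' v - \<Psi> v \<le> 0" using apply_le[OF w(2), of v] \<rho>(2)[of v] by simp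
      also have "0 \<le> leg w + \<rho> * norm (w' - w)" using leg_nonneg \<rho>(1) by simp
      finally show ?thesis .
    next
      case False
      have "blinfun_apply w' v - \<Psi> v = blinfun_apply w v - \<Psi> v + blinfun_apply (w' - w) v"
        by (simp add: blinfun.diff_left)
      moreover have "blinfun_apply (w' - w) v \<le> norm (w' - w) * norm v" by (intro apply_le) simp
      moreover have "\<dots> \<le> norm (w' - w) * \<rho>" using False by (intro mult_left_mono) auto
      ultimately show ?thesis using leg_ge[of w v] by (simp add: mult.commute)
    qed
    then show ?thesis unfolding legendre_def[of _ w'] by (intro cSUP_least) auto
  qed
  then show ?thesis using \<rho>(1) by blast
qed

lemma legendre_rescaled: assumes e: "e > 0" shows "legendre (rescaled \<Psi> e) w = leg w / e"
proof (rule antisym)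
  have *: "blinfun_apply w v - rescaled \<Psi> e v \<le> leg w / e" for v
  proof -
    have "(e * blinfun_apply w v - \<Psi> (e *\<^sub>R v)) / e \<le> leg w / e"
      using leg_ge[of w "e *\<^sub>R v"] e by (intro divide_right_mono) (auto simp: blinfun.scaleR_right)
    then show ?thesis using e by (simp add: rescaled_def diff_divide_distrib)
  qed
  then show "legendre (rescaled \<Psi> e) w \<le> leg w / e"
    unfolding legendre_def[of "rescaled \<Psi> e"] by (intro cSUP_least) auto
  have bd: "bdd_above (range (\<lambda>v. blinfun_apply w v - rescaled \<Psi> e v))"
    using * by (intro bdd_aboveI[of _ "leg w / e"]) auto
  have "leg w \<le> e * legendre (rescaled \<Psi> e) w" unfolding legendre_def[of \<Psi>]
  proof (rule cSUP_least)
    fix v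
    have "blinfun_apply w (v /\<^sub>R e) - rescaled \<Psi> e (v /\<^sub>R e) \<le> legendre (rescaled \<Psi> e) w"
      unfolding legendre_def[of "rescaled \<Psi> e"] by (rule cSUP_upper[OF _ bd]) simp
    then show "blinfun_apply w v - \<Psi> v \<le> e * legendre (rescaled \<Psi> e) w"
      using e by (simp add: rescaled_def blinfun.scaleR_right field_simps)
  qed simp
  then show "leg w / e \<le> legendre (rescaled \<Psi> e) w" using e by (simp add: field_simps)
qed

section \<open>The contact profile as a function of the velocity and of the conjugate value\<close>

abbreviation "hv \<equiv> contact_profile \<Psi>"

lemma contact_profile_le: assumes "c \<ge> 0" "e > 0" shows "hv v c \<le> (\<Psi> (e *\<^sub>R v) + c) / e"
  unfolding contact_profile_def
proof (rule cINF_lower)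
  show "bdd_below ((\<lambda>e. (\<Psi> (e *\<^sub>R v) + c) / e) ` {0<..})"
    using assms(1) Psi_nonneg by (intro bdd_belowI[of _ 0]) auto
qed (use assms in auto)

lemma contact_profile_ge: "(\<And>e. e > 0 \<Longrightarrow> x \<le> (\<Psi> (e *\<^sub>R v) + c) / e) \<Longrightarrow> x \<le> hv v c"
  unfolding contact_profile_def by (intro cINF_greatest) auto

lemma contact_profile_ge_Psi0: assumes "c \<ge> 0" shows "\<Psi>0 v \<le> hv v c"
proof (rule contact_profile_ge)
  fix e :: real assume e: "e > 0"
  show "\<Psi>0 v \<le> (\<Psi> (e *\<^sub>R v) + c) / e"
    using Psi0_le_rescaled[OF e, of v] assms e by (simp add: rescaled_def field_simps)
qed

lemma contact_profile_mono: assumes "0 \<le> c" "c \<le> c'" shows "hv v c \<le> hv v c'"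
proof (rule contact_profile_ge)
  fix e :: real assume e: "e > 0"
  have "hv v c \<le> (\<Psi> (e *\<^sub>R v) + c) / e" using contact_profile_le assms e by blast
  also have "\<dots> \<le> (\<Psi> (e *\<^sub>R v) + c') / e" using assms e by (simp add: divide_right_mono)
  finally show "hv v c \<le> (\<Psi> (e *\<^sub>R v) + c') / e" .
qed

text \<open>A scale \<open>e\<close> whose rescaling is close to the gauge is fixed first; then
  \<open>d\<close> is taken so small that \<open>d / e\<close> is only
  \<open>\<eta> / 2\<close>.\<close>

lemma contact_profile_right_continuous:
  assumes "\<eta> > 0" shows "\<exists>d>0. hv v d \<le> \<Psi>0 v + \<eta>"
proof -
  have "\<forall>\<^sub>F e in at_right 0. rescaled \<Psi> e v < \<Psi>0 v + \<eta> / 2"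
    using order_tendstoD(2)[OF small_viscosity] assms by simp
  then have "\<forall>\<^sub>F e in at_right 0. rescaled \<Psi> e v < \<Psi>0 v + \<eta> / 2 \<and> e > 0"
    using eventually_at_right_less by eventually_elim auto
  then obtain e where e: "rescaled \<Psi> e v < \<Psi>0 v + \<eta> / 2" "e > 0"
    by (metis (mono_tags, lifting) eventually_happens' trivial_limit_at_right_real)
  have "hv v (e * \<eta> / 2) \<le> (\<Psi> (e *\<^sub>R v) + e * \<eta> / 2) / e" using e assms by (intro contact_profile_le) auto
  also have "\<dots> \<le> \<Psi>0 v + \<eta>" using e by (simp add: rescaled_def field_simps)
  finally show ?thesis using e assms by (intro exI[of _ "e * \<eta> / 2"]) auto
qed

lemma contact_profile_zero: assumes "c \<ge> 0" shows "hv 0 c = 0"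
proof (rule antisym)
  show "hv 0 c \<le> 0"
  proof (rule field_le_epsilon)
    fix \<eta> :: real assume \<eta>: "\<eta> > 0"
    have "hv 0 c \<le> (\<Psi> (((c + 1) / \<eta>) *\<^sub>R 0) + c) / ((c + 1) / \<eta>)"
      using assms \<eta> by (intro contact_profile_le) auto
    also have "\<dots> \<le> \<eta>" using assms \<eta> Psi_zero by (simp add: field_simps)
    finally show "hv 0 c \<le> 0 + \<eta>" by simp
  qed
  show "0 \<le> hv 0 c" using assms Psi_zero by (intro contact_profile_ge) auto
qed

lemma contact_profile_scale_le: assumes "c \<ge> 0" "s > 0" shows "hv (s *\<^sub>R v) c \<le> s * hv v c"
proof -
  have "hv (s *\<^sub>R v) c / s \<le> hv v c"
  proof (rule contact_profile_ge)
    fix e :: real assume e: "e > 0"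
    have "hv (s *\<^sub>R v) c \<le> (\<Psi> ((e / s) *\<^sub>R (s *\<^sub>R v)) + c) / (e / s)" using assms e by (intro contact_profile_le) auto
    then show "hv (s *\<^sub>R v) c / s \<le> (\<Psi> (e *\<^sub>R v) + c) / e" using assms e by (simp add: field_simps)
  qed
  then show ?thesis using assms by (simp add: field_simps)
qed

lemma contact_profile_scale: assumes "c \<ge> 0" "s \<ge> 0" shows "hv (s *\<^sub>R v) c = s * hv v c"
proof (cases "s = 0")
  case True then show ?thesis using contact_profile_zero[OF assms(1)] by simp
next
  case False
  then have s: "s > 0" using assms by simp
  have "hv v c \<le> inverse s * hv (s *\<^sub>R v) c" using contact_profile_scale_le[OF assms(1), of "inverse s" "s *\<^sub>R v"] s by simp
  then show ?thesis using contact_profile_scale_le[OF assms(1) s, of v] s by (simp add: field_simps)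
qed

lemma contact_profile_add: assumes c: "c \<ge> 0" shows "hv (x + y) c \<le> hv x c + hv y c"
proof -
  have *: "hv (x + y) c \<le> (\<Psi> (a *\<^sub>R x) + c) / a + (\<Psi> (b *\<^sub>R y) + c) / b" if ab: "a > 0" "b > 0" for a b
  proof -
    \<comment> \<open>The scales combine harmonically, 1/e = 1/a + 1/b: then
      \<open>e *\<^sub>R (x + y)\<close> is a convex combination of \<open>a *\<^sub>R x\<close> and
      \<open>b *\<^sub>R y\<close>, and \<open>c / a\<close> and \<open>c / b\<close> add up to
      \<open>c / e\<close>.\<close>
    define e where "e = a * b / (a + b)"
    have e: "e > 0" using ab by (simp add: e_def)
    have "e *\<^sub>R (x + y) = (1 - a / (a + b)) *\<^sub>R (a *\<^sub>R x) + (a / (a + b)) *\<^sub>R (b *\<^sub>R y)"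
      using ab by (simp add: e_def scaleR_add_right field_simps)
    then have "\<Psi> (e *\<^sub>R (x + y)) \<le> (1 - a / (a + b)) * \<Psi> (a *\<^sub>R x) + (a / (a + b)) * \<Psi> (b *\<^sub>R y)"
      using Psi_convexD[of "a / (a + b)" "a *\<^sub>R x" "b *\<^sub>R y"] ab by simp
    then have "(\<Psi> (e *\<^sub>R (x + y)) + c) / e
        \<le> ((1 - a / (a + b)) * \<Psi> (a *\<^sub>R x) + (a / (a + b)) * \<Psi> (b *\<^sub>R y) + c) / e"
      using e by (intro divide_right_mono) auto
    also have "\<dots> = (\<Psi> (a *\<^sub>R x) + c) / a + (\<Psi> (b *\<^sub>R y) + c) / b"
      using ab by (simp add: e_def divide_simps) (simp add: algebra_simps)
    finally show ?thesis using contact_profile_le[OF c e, of "x + y"] by linarith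
  qed
  have "hv (x + y) c - hv y c \<le> hv x c"
  proof (rule contact_profile_ge)
    fix a :: real assume a: "a > 0"
    have "hv (x + y) c - (\<Psi> (a *\<^sub>R x) + c) / a \<le> hv y c"
      by (rule contact_profile_ge) (use *[OF a] in \<open>simp add: algebra_simps\<close>)
    then show "hv (x + y) c - hv y c \<le> (\<Psi> (a *\<^sub>R x) + c) / a" by simp
  qed
  then show ?thesis by simp
qed

lemma sublinear_hh: "c \<ge> 0 \<Longrightarrow> sublinear (\<lambda>v. hv v c)"
  by (auto simp: sublinear_def contact_profile_add contact_profile_scale)

lemma contact_profile_bound: assumes "M \<ge> 0" shows "\<exists>K>0. \<forall>c v. 0 \<le> c \<longrightarrow> c \<le> M \<longrightarrow> hv v c \<le> K * norm v"
  using sublinear_bound[OF sublinear_hh[OF assms]] contact_profile_mono by (meson order_trans)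

text \<open>An infimum of functions affine in \<open>c\<close> is concave.\<close>

lemma contact_profile_concave: assumes "0 \<le> C" "0 \<le> s" "s \<le> 1" shows "s * hv v C + (1 - s) * hv v 0 \<le> hv v (s * C)"
proof (rule contact_profile_ge)
  fix e :: real assume e: "e > 0"
  have "s * hv v C + (1 - s) * hv v 0 \<le> s * ((\<Psi> (e *\<^sub>R v) + C) / e) + (1 - s) * ((\<Psi> (e *\<^sub>R v) + 0) / e)"
    using assms e by (intro add_mono mult_left_mono contact_profile_le) auto
  also have "\<dots> = (\<Psi> (e *\<^sub>R v) + s * C) / e" using e by (simp add: field_simps)
  finally show "s * hv v C + (1 - s) * hv v 0 \<le> (\<Psi> (e *\<^sub>R v) + s * C) / e" .
qed

text \<open>A concave function on the half-line, reduced by its value at 0, is subadditive. This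
  turns a change of the conjugate into an additive error.\<close>

lemma contact_profile_increment: assumes "0 \<le> c" "0 \<le> d" shows "hv v (c + d) + hv v 0 \<le> hv v c + hv v d"
proof (cases "c + d = 0")
  case True
  then have "c = 0" "d = 0" using assms by auto
  then show ?thesis by simp
next
  case False
  then have cd: "c + d > 0" using assms by simp
  have 1: "c / (c + d) * hv v (c + d) + (1 - c / (c + d)) * hv v 0 \<le> hv v c"
    using contact_profile_concave[of "c + d" "c / (c + d)" v] cd assms by simp
  have 2: "d / (c + d) * hv v (c + d) + (1 - d / (c + d)) * hv v 0 \<le> hv v d"
    using contact_profile_concave[of "c + d" "d / (c + d)" v] cd assms by simp
  have 3: "d / (c + d) = 1 - c / (c + d)" using cd by (simp add: field_simps)
  show ?thesis using 1 2 unfolding 3 by (simp add: algebra_simps)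
qed

text \<open>A Dini argument on the unit sphere: pointwise right continuity at 0 becomes uniform,
  because the profile is monotone in \<open>c\<close> and, for bounded \<open>c\<close>, sublinear
  in \<open>v\<close> with a common bound. Homogeneity turns the error into a multiple of the
  norm.\<close>

lemma contact_profile_uniform: assumes \<eta>: "\<eta> > 0" shows "\<exists>d>0. \<forall>v. hv v d \<le> \<Psi>0 v + \<eta> * norm v"
proof (rule ccontr)
  assume neg: "\<not> ?thesis"
  define d where "d n = 1 / real (Suc n)" for n
  have d: "d n > 0" "d n \<le> 1" for n by (auto simp: d_def)
  have d0: "d \<longlonglongrightarrow> 0" unfolding d_def using LIMSEQ_inverse_real_of_nat by (simp add: inverse_eq_divide)
  have "\<exists>v. norm v = 1 \<and> hv v (d n) > \<Psi>0 v + \<eta>" for n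
  proof -
    obtain v where v: "hv v (d n) > \<Psi>0 v + \<eta> * norm v" using neg d(1)[of n] by (meson not_le)
    have v0: "v \<noteq> 0" using v contact_profile_zero[of "d n"] d(1)[of n] sublinearD(3)[OF sublinear_Psi0] by auto
    have e: "hv (v /\<^sub>R norm v) (d n) = inverse (norm v) * hv v (d n)"
      "\<Psi>0 (v /\<^sub>R norm v) = inverse (norm v) * \<Psi>0 v"
      using d(1)[of n] by (intro contact_profile_scale sublinearD(2)[OF sublinear_Psi0]; simp)+
    have "inverse (norm v) * (\<Psi>0 v + \<eta> * norm v) < inverse (norm v) * hv v (d n)"
      using v v0 by (intro mult_strict_left_mono) auto
    then have "hv (v /\<^sub>R norm v) (d n) > \<Psi>0 (v /\<^sub>R norm v) + \<eta>"
      using v0 unfolding e by (simp add: field_simps)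
    moreover have "norm (v /\<^sub>R norm v) = 1" using v0 by simp
    ultimately show ?thesis by blast
  qed
  then obtain v where v: "\<And>n. norm (v n) = 1" "\<And>n. hv (v n) (d n) > \<Psi>0 (v n) + \<eta>" by metis
  have "bounded (range v)" using v(1) by (intro boundedI[of _ 1]) auto
  from bounded_subseq[OF this] obtain r x where r: "strict_mono (r::nat\<Rightarrow>nat)" "(\<lambda>n. v (r n)) \<longlonglongrightarrow> x" by blast
  obtain K where K: "K > 0" "\<And>c v. 0 \<le> c \<Longrightarrow> c \<le> 1 \<Longrightarrow> hv v c \<le> K * norm v" using contact_profile_bound[of 1] by auto
  obtain K' where K': "K' > 0" "\<And>v. \<Psi>0 v \<le> K' * norm v" using sublinear_bound[OF sublinear_Psi0] by blast
  obtain d1 where d1: "d1 > 0" "hv x d1 \<le> \<Psi>0 x + \<eta> / 2" using contact_profile_right_continuous[of "\<eta>/2" x] \<eta> by auto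
  have "\<forall>\<^sub>F n in sequentially. d n < d1" using order_tendstoD(2)[OF d0] d1 by simp
  then have ev1: "\<forall>\<^sub>F n in sequentially. d (r n) < d1"
    using r(1) by (rule eventually_subseq[rotated])
  have "(\<lambda>n. (K + K') * norm (v (r n) - x)) \<longlonglongrightarrow> (K + K') * norm (x - x)"
    using r(2) by (intro tendsto_intros)
  then have ev2: "\<forall>\<^sub>F n in sequentially. (K + K') * norm (v (r n) - x) < \<eta> / 2"
    using \<eta> by (intro order_tendstoD(2)[of _ 0]) auto
  obtain n where n: "d (r n) < d1" "(K + K') * norm (v (r n) - x) < \<eta> / 2"
    using eventually_happens'[OF _ eventually_conj[OF ev1 ev2]] by auto
  have "hv (v (r n)) (d (r n)) \<le> hv x (d (r n)) + hv (v (r n) - x) (d (r n))"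
    using contact_profile_add[of "d (r n)" x "v (r n) - x"] d(1)[of "r n"] by simp
  also have "hv (v (r n) - x) (d (r n)) \<le> K * norm (v (r n) - x)" using K(2) d[of "r n"] by simp
  also have "hv x (d (r n)) \<le> hv x d1" using contact_profile_mono d(1)[of "r n"] n(1) by simp
  also have "hv x d1 \<le> \<Psi>0 x + \<eta> / 2" by (rule d1)
  also have "\<Psi>0 x \<le> \<Psi>0 (v (r n)) + \<Psi>0 (x - v (r n))"
    using sublinearD(1)[OF sublinear_Psi0, of "v (r n)" "x - v (r n)"] by simp
  also have "\<Psi>0 (x - v (r n)) \<le> K' * norm (v (r n) - x)" using K'(2)[of "x - v (r n)"] by (simp add: norm_minus_commute)
  finally show False using v(2)[of "r n"] n(2) by (simp add: algebra_simps)
qed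

section \<open>The contact potential and its dependence on the force\<close>

abbreviation "pp \<equiv> contact_potential \<Psi>"

lemma contact_eq: "pp v w = hv v (leg w)"
  unfolding contact_potential_def contact_profile_def
  by (intro INF_cong refl) (simp add: legendre_rescaled rescaled_def add_divide_distrib)

lemma pp_le: "e > 0 \<Longrightarrow> pp v w \<le> (\<Psi> (e *\<^sub>R v) + leg w) / e"
  unfolding contact_eq by (rule contact_profile_le[OF leg_nonneg])

lemma pp_ge_Psi0: "\<Psi>0 v \<le> pp v w" unfolding contact_eq by (rule contact_profile_ge_Psi0[OF leg_nonneg])

lemma pp_nonneg: "0 \<le> pp v w" using pp_ge_Psi0[of v w] Psi0_nonneg[of v] by linarith

text \<open>The Fenchel inequality at every scale. Applied to minus the differential of the energy,
  it bounds the cost of a transition below by the loss of energy.\<close>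

lemma pp_ge_apply: "blinfun_apply w v \<le> pp v w"
  unfolding contact_eq
proof (rule contact_profile_ge)
  fix e :: real assume "e > 0"
  then show "blinfun_apply w v \<le> (\<Psi> (e *\<^sub>R v) + leg w) / e"
    using leg_ge[of w "e *\<^sub>R v"] by (simp add: blinfun.scaleR_right field_simps)
qed

lemma pp_zero: "pp 0 w = 0" unfolding contact_eq by (rule contact_profile_zero[OF leg_nonneg])

lemma pp_bound: assumes "R \<ge> 0" shows "\<exists>K>0. \<forall>v w. norm w \<le> R \<longrightarrow> pp v w \<le> K * norm v"
proof -
  obtain \<rho> where \<rho>: "\<rho> > 0" "\<And>w w'. norm w \<le> R \<Longrightarrow> norm w' \<le> R \<Longrightarrow> leg w' \<le> leg w + \<rho> * norm (w' - w)"
    using leg_lipschitz[of R] by blast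
  have M: "leg w \<le> leg 0 + \<rho> * R" if "norm w \<le> R" for w
  proof -
    have "leg w \<le> leg 0 + \<rho> * norm w" using \<rho>(2)[of 0 w] that assms by simp
    moreover have "\<rho> * norm w \<le> \<rho> * R" using \<rho>(1) that by (intro mult_left_mono) auto
    ultimately show ?thesis by linarith
  qed
  have "0 \<le> leg 0 + \<rho> * R" using leg_nonneg \<rho>(1) assms by simp
  from contact_profile_bound[OF this] show ?thesis unfolding contact_eq using M leg_nonneg by blast
qed

text \<open>The force enters only through its conjugate, which is Lipschitz on balls. Raising the
  conjugate by \<open>d\<close> adds at most \<open>hv v d - hv v 0\<close>, and this is uniformly
  small relative to the norm of \<open>v\<close>.\<close>

lemma pp_modulus:
  assumes \<eta>: "\<eta> > 0"
  shows "\<exists>\<delta>>0. \<forall>w w' v. norm w \<le> R \<longrightarrow> norm w' \<le> R \<longrightarrow> norm (w' - w) < \<delta> \<longrightarrow> pp v w' \<le> pp v w + \<eta> * norm v"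
proof -
  obtain \<rho> where \<rho>: "\<rho> > 0" "\<And>w w'. norm w \<le> R \<Longrightarrow> norm w' \<le> R \<Longrightarrow> leg w' \<le> leg w + \<rho> * norm (w' - w)"
    using leg_lipschitz[of R] by blast
  obtain d where d: "d > 0" "\<And>v. hv v d \<le> \<Psi>0 v + \<eta> * norm v" using contact_profile_uniform[OF \<eta>] by blast
  have "pp v w' \<le> pp v w + \<eta> * norm v" if "norm w \<le> R" "norm w' \<le> R" "norm (w' - w) < d / \<rho>" for w w' v
  proof -
    have "\<rho> * norm (w' - w) \<le> d" using that(3) \<rho>(1) by (simp add: field_simps)
    then have "hv v (leg w') \<le> hv v (leg w + d)"
      using \<rho>(2)[OF that(1,2)] leg_nonneg by (intro contact_profile_mono) auto
    then show ?thesis unfolding contact_eq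
      using contact_profile_increment[of "leg w" d v] leg_nonneg[of w] d(1) d(2)[of v] contact_profile_ge_Psi0[of 0 v] by linarith
  qed
  then show ?thesis using \<rho>(1) d(1) by (intro exI[of _ "d / \<rho>"]) auto
qed

lemma Psi0_lipschitz: "\<exists>K>0. \<forall>x y. \<bar>\<Psi>0 x - \<Psi>0 y\<bar> \<le> K * norm (x - y)"
proof -
  obtain K where K: "K > 0" "\<And>v. \<Psi>0 v \<le> K * norm v" using sublinear_bound[OF sublinear_Psi0] by blast
  have *: "\<Psi>0 x - \<Psi>0 y \<le> K * norm (x - y)" for x y
    using sublinearD(1)[OF sublinear_Psi0, of y "x - y"] K(2)[of "x - y"] by simp
  have "\<bar>\<Psi>0 x - \<Psi>0 y\<bar> \<le> K * norm (x - y)" for x y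
    using *[of x y] *[of y x] by (simp add: abs_le_iff norm_minus_commute)
  then show ?thesis using K(1) by blast
qed

lemma continuous_Psi0: "continuous_on UNIV \<Psi>0"
proof -
  obtain K where "K > 0" "\<And>x y. \<bar>\<Psi>0 x - \<Psi>0 y\<bar> \<le> K * norm (x - y)" using Psi0_lipschitz by blast
  then have "K-lipschitz_on UNIV \<Psi>0" by (intro lipschitz_onI) (auto simp: dist_norm)
  then show ?thesis by (rule lipschitz_on_continuous_on)
qed

lemma Psi0_lower: "\<exists>c>0. \<forall>v. c * norm v \<le> \<Psi>0 v"
proof (cases "sphere (0::'a) 1 = {}")
  case True
  \<comment> \<open>An empty unit sphere means that X is the zero space, where any constant
    works.\<close>
  have z: "v = 0" for v :: 'a
  proof (rule ccontr)
    assume "v \<noteq> 0"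
    then have "v /\<^sub>R norm v \<in> sphere 0 1" by simp
    then show False using True by blast
  qed
  have "1 * norm v \<le> \<Psi>0 v" for v by (subst z[of v]) (simp only: norm_zero mult_1 Psi0_nonneg mult_zero_right)
  then show ?thesis by (intro exI[of _ 1]) auto
next
  case False
  have "bounded (sphere (0::'a) 1)" by (auto simp: bounded_iff)
  moreover have "closed {x::'a. norm x = 1}" by (intro closed_Collect_eq continuous_intros)
  then have "closed (sphere (0::'a) 1)" by (simp add: sphere_def)
  ultimately have "compact (sphere (0::'a) 1)" by (rule compact_bounded_closed)
  from continuous_attains_inf[OF this False continuous_on_subset[OF continuous_Psi0 subset_UNIV]]
  obtain x where x: "norm x = 1" "\<And>y. norm y = 1 \<Longrightarrow> \<Psi>0 x \<le> \<Psi>0 y" by auto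
  have "\<Psi>0 x * norm v \<le> \<Psi>0 v" for v
  proof (cases "v = 0")
    case True then show ?thesis using Psi0_nonneg by simp
  next
    case False
    then have "\<Psi>0 x \<le> \<Psi>0 (v /\<^sub>R norm v)" by (intro x(2)) simp
    also have "\<dots> = inverse (norm v) * \<Psi>0 v" by (intro sublinearD(2)[OF sublinear_Psi0]) simp
    finally show ?thesis using False by (simp add: field_simps)
  qed
  moreover have "x \<noteq> 0" using x(1) by auto
  then have "\<Psi>0 x > 0" using gauge unfolding gauge_functional_def by blast
  ultimately show ?thesis by blast
qed

text \<open>The pairing with \<open>e *\<^sub>R z\<close> is then at most
  \<open>\<Psi> (e *\<^sub>R z)\<close> for all scales; dividing by \<open>e\<close> and letting it
  tend to 0 leaves the gauge. In this way stability is read off from vanishing conjugates.\<close>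

lemma leg_le_zero_Kstar: assumes "leg w \<le> 0" shows "w \<in> Kstar \<Psi>0"
  unfolding Kstar_def
proof (safe)
  fix z
  have "blinfun_apply w z \<le> rescaled \<Psi> e z" if "e > 0" for e
    using leg_ge[of w "e *\<^sub>R z"] assms that
    by (simp add: rescaled_def blinfun.scaleR_right field_simps)
  then have "\<forall>\<^sub>F e in at_right 0. blinfun_apply w z \<le> rescaled \<Psi> e z"
    unfolding eventually_at_right_field by (intro exI[of _ 1]) auto
  then show "blinfun_apply w z \<le> \<Psi>0 z"
    by (intro tendsto_lowerbound[OF small_viscosity]) auto
qed

text \<open>A countable family in place of all of K* allows monotone convergence for the gauge of a
  density. Its members support the gauge at the points of a dense sequence.\<close>

lemma Kstar_countable_support:
  "\<exists>W::nat \<Rightarrow> 'a \<Rightarrow>\<^sub>L real. (\<forall>n. W n \<in> Kstar \<Psi>0) \<and> (\<forall>v \<eta>. \<eta> > 0 \<longrightarrow> (\<exists>n. \<Psi>0 v - \<eta> < blinfun_apply (W n) v))"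
proof -
  obtain D :: "'a set" where D: "countable D" "\<And>X. open X \<Longrightarrow> X \<noteq> {} \<Longrightarrow> \<exists>d\<in>D. d \<in> X"
    using countable_dense_setE by blast
  have "D \<noteq> {}" using D(2)[of UNIV] by auto
  then obtain q where q: "range (q::nat\<Rightarrow>'a) = D" using D(1) by (metis uncountable_def)
  have "\<exists>w. (\<forall>x. blinfun_apply w x \<le> \<Psi>0 x) \<and> blinfun_apply w (q n) = \<Psi>0 (q n)" for n
    using sublinear_support[OF sublinear_Psi0] by blast
  then obtain W where W: "\<And>n x. blinfun_apply (W n) x \<le> \<Psi>0 x" "\<And>n. blinfun_apply (W n) (q n) = \<Psi>0 (q n)" by metis
  obtain K where K: "K > 0" "\<And>v. \<Psi>0 v \<le> K * norm v" using sublinear_bound[OF sublinear_Psi0] by blast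
  have "\<exists>n. \<Psi>0 v - \<eta> < blinfun_apply (W n) v" if \<eta>: "\<eta> > 0" for v \<eta>
  proof -
    \<comment> \<open>Passing from \<open>v\<close> to the dense point and back costs the gauge of
      \<open>v - q n\<close> and of \<open>q n - v\<close>, each below
      \<open>\<eta> / 2\<close>.\<close>
    have "\<eta> / (2 * K) > 0" using \<eta> K(1) by simp
    then have "\<exists>d\<in>D. d \<in> ball v (\<eta> / (2 * K))" by (intro D(2)) auto
    then obtain n where n: "dist v (q n) < \<eta> / (2 * K)" using q by fastforce
    have "\<Psi>0 v \<le> \<Psi>0 (q n) + \<Psi>0 (v - q n)" using sublinearD(1)[OF sublinear_Psi0, of "q n" "v - q n"] by simp
    moreover have "blinfun_apply (W n) (q n - v) \<le> \<Psi>0 (q n - v)" by (rule W)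
    moreover have "blinfun_apply (W n) (q n - v) = \<Psi>0 (q n) - blinfun_apply (W n) v"
      using W(2) by (simp add: blinfun.diff_right)
    moreover have "\<Psi>0 (v - q n) \<le> K * dist v (q n)" "\<Psi>0 (q n - v) \<le> K * dist v (q n)"
      using K(2)[of "v - q n"] K(2)[of "q n - v"] by (auto simp: dist_norm norm_minus_commute)
    moreover have "2 * (K * dist v (q n)) < \<eta>" using n K(1) by (simp add: field_simps)
    ultimately show ?thesis by (intro exI[of _ n]) linarith
  qed
  then show ?thesis using W(1) by (intro exI[of _ W]) (auto simp: Kstar_def)
qed

end

section \<open>Vector measures\<close>

lemma vector_measureD:
  assumes "vector_measure \<nu>"
  shows "A \<notin> sets borel \<Longrightarrow> \<nu> A = 0"
    and "range F \<subseteq> sets borel \<Longrightarrow> disjoint_family F \<Longrightarrow> (\<lambda>i::nat. \<nu> (F i)) sums \<nu> (\<Union>i. F i)"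
  using assms by (auto simp: vector_measure_def)

lemma vm_empty: assumes "vector_measure \<nu>" shows "\<nu> {} = 0"
proof -
  have "(\<lambda>i::nat. \<nu> {}) sums \<nu> (\<Union>i::nat. {})"
    using vector_measureD(2)[OF assms, of "\<lambda>_. {}"] by (auto simp: disjoint_family_on_def)
  then show ?thesis using sums_summable summable_const_iff by blast
qed

lemma vm_Un:
  assumes v: "vector_measure \<nu>" and "A \<in> sets borel" "C \<in> sets borel" "A \<inter> C = {}"
  shows "\<nu> (A \<union> C) = \<nu> A + \<nu> C"
proof -
  have "(\<lambda>i. \<nu> (binaryset A C i)) sums \<nu> (\<Union>i. binaryset A C i)"
    using assms by (intro vector_measureD(2)[OF v]) (auto simp: range_binaryset_eq disjoint_family_on_def binaryset_def)
  then have "(\<lambda>i. \<nu> (binaryset A C i)) sums \<nu> (A \<union> C)" by (simp add: UN_binaryset_eq)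
  with binaryset_sums[of \<nu> A C, OF vm_empty[OF v]] show ?thesis using sums_unique2 by blast
qed

lemma vm_Diff:
  assumes v: "vector_measure \<nu>" and "A \<in> sets borel" "C \<in> sets borel" "C \<subseteq> A"
  shows "\<nu> (A - C) = \<nu> A - \<nu> C"
proof -
  have "(A - C) \<union> C = A" "(A - C) \<inter> C = {}" using assms(4) by auto
  then show ?thesis using vm_Un[OF v, of "A - C" C] assms by simp
qed

lemma vm_UN_finite:
  fixes D :: "nat \<Rightarrow> real set"
  assumes v: "vector_measure \<nu>" and "finite I" "\<And>i. i \<in> I \<Longrightarrow> D i \<in> sets borel" "disjoint_family_on D I"
  shows "\<nu> (\<Union>i\<in>I. D i) = (\<Sum>i\<in>I. \<nu> (D i))"
  using assms(2-)
proof (induction I)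
  case empty then show ?case using vm_empty[OF v] by simp
next
  case (insert j I)
  have "disjoint_family_on D I" using insert.prems(2) by (auto simp: disjoint_family_on_def)
  then have IH: "\<nu> (\<Union>i\<in>I. D i) = (\<Sum>i\<in>I. \<nu> (D i))" using insert by auto
  have "D j \<inter> (\<Union>i\<in>I. D i) = {}" using insert.prems(2) insert.hyps(2) by (fastforce simp: disjoint_family_on_def)
  moreover have "(\<Union>i\<in>I. D i) \<in> sets borel" using insert by (intro sets.finite_UN) auto
  ultimately show ?case using vm_Un[OF v, of "D j" "\<Union>i\<in>I. D i"] insert IH by simp
qed

lemma vm_incseq:
  assumes v: "vector_measure \<nu>" and A: "range A \<subseteq> sets borel" "incseq A"
  shows "(\<lambda>n. \<nu> (A n)) \<longlonglongrightarrow> \<nu> (\<Union>n. A n)"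
proof -
  have m: "disjointed A (Suc n) = A (Suc n) - A n" for n
    by (rule disjointed_mono) (use A(2) in \<open>simp add: incseq_def mono_def\<close>)
  have "range (disjointed A) \<subseteq> sets borel" using A(1) sets.range_disjointed_sets by blast
  then have "(\<lambda>i. \<nu> (disjointed A i)) sums \<nu> (\<Union>n. A n)"
    using vector_measureD(2)[OF v _ disjoint_family_disjointed, of A] by (simp add: UN_disjointed_eq)
  moreover have "(\<Sum>i<Suc n. \<nu> (disjointed A i)) = \<nu> (A n)" for n
  proof (induction n)
    case 0 then show ?case by (simp add: disjointed_def)
  next
    case (Suc n)
    have "\<nu> (A (Suc n) - A n) = \<nu> (A (Suc n)) - \<nu> (A n)"
      using A by (intro vm_Diff[OF v]) (auto simp: incseq_Suc_iff)
    then show ?case using Suc m[of n] by simp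
  qed
  ultimately show ?thesis unfolding sums_def using LIMSEQ_Suc by fastforce
qed

lemma vm_restrict:
  assumes v: "vector_measure \<nu>" and C: "C \<in> sets borel"
  shows "vector_measure (\<lambda>A. if A \<in> sets borel then \<nu> (A \<inter> C) else 0)"
  unfolding vector_measure_def
proof (safe)
  fix A :: "nat \<Rightarrow> real set" assume A: "range A \<subseteq> sets borel" "disjoint_family A"
  have "(\<lambda>i. \<nu> (A i \<inter> C)) sums \<nu> (\<Union>i. A i \<inter> C)"
    using A C by (intro vector_measureD(2)[OF v]) (auto simp: disjoint_family_on_def)
  moreover have "(\<Union>i. A i) \<in> sets borel" using A(1) by blast
  ultimately show "(\<lambda>i. if A i \<in> sets borel then \<nu> (A i \<inter> C) else 0) sums
       (if (\<Union>i. A i) \<in> sets borel then \<nu> ((\<Union>i. A i) \<inter> C) else 0)"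
    using A(1) by (simp add: range_subsetD)
qed simp

lemma vm_linear:
  assumes v: "vector_measure \<nu>" and "bounded_linear f"
  shows "vector_measure (\<lambda>A. f (\<nu> A))"
  using v bounded_linear.sums[OF assms(2)] linear_0[OF bounded_linear.linear[OF assms(2)]]
  unfolding vector_measure_def by auto

lemma vm_add: "vector_measure \<nu> \<Longrightarrow> vector_measure \<kappa> \<Longrightarrow> vector_measure (\<lambda>A. \<nu> A + \<kappa> A)"
  unfolding vector_measure_def by (auto intro!: sums_add)

lemma vm_diff: "vector_measure \<nu> \<Longrightarrow> vector_measure \<kappa> \<Longrightarrow> vector_measure (\<lambda>A. \<nu> A - \<kappa> A)"
  unfolding vector_measure_def by (auto intro!: sums_diff)

lemma vm_sum: "(\<And>b. b \<in> I \<Longrightarrow> vector_measure (\<nu> b)) \<Longrightarrow> vector_measure (\<lambda>A. \<Sum>b\<in>I. \<nu> b A)"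
  unfolding vector_measure_def by (auto intro!: sums_sum)

lemma vm_measure:
  assumes "finite_measure M" "sets M = sets borel"
  shows "vector_measure (measure M)"
proof -
  interpret finite_measure M by fact
  show ?thesis unfolding vector_measure_def
    using assms(2) by (auto simp: measure_notin_sets intro!: finite_measure_UNION)
qed

text \<open>Dynkin's argument for set functions with values in a normed space. The step for
  complements needs equal values on the whole line, which is not in the generator and is reached by
  exhaustion.\<close>

lemma vm_eqI:
  fixes \<nu> \<kappa> :: "real set \<Rightarrow> 'a::real_normed_vector"
  assumes v: "vector_measure \<nu>" and k: "vector_measure \<kappa>"
    and eq: "\<And>a b. a < b \<Longrightarrow> \<nu> {a<..<b} = \<kappa> {a<..<b}"
  shows "\<nu> = \<kappa>"
proof
  fix A
  show "\<nu> A = \<kappa> A"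
  proof (cases "A \<in> sets borel")
    case False then show ?thesis using vector_measureD(1)[OF v] vector_measureD(1)[OF k] by simp
  next
    case True
    define G where "G = range (\<lambda>(a, b). {a<..<b::real})"
    have G: "sigma_sets UNIV G = sets borel"
      unfolding borel_eq_box by (simp add: G_def sets_measure_of_conv case_prod_beta box_real)
    have eq': "\<nu> {a<..<b} = \<kappa> {a<..<b}" for a b
      using eq[of a b] vm_empty[OF v] vm_empty[OF k] by (cases "a < b") auto
    have u: "(\<Union>n. {- real n<..<real n}) = UNIV"
    proof (safe; simp)
      fix x :: real
      obtain n where "\<bar>x\<bar> < real n" using reals_Archimedean2 by blast
      then show "\<exists>n. - real n < x \<and> x < real n" by (intro exI[of _ n]) auto
    qed
    have inc: "incseq (\<lambda>n. {- real n<..<real n})" by (auto simp: incseq_def)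
    have U: "\<nu> UNIV = \<kappa> UNIV"
      using vm_incseq[OF v _ inc] vm_incseq[OF k _ inc] unfolding u eq'
      by (metis (no_types, lifting) LIMSEQ_unique borel_open image_subsetI open_greaterThanLessThan)
    have "Int_stable G" unfolding Int_stable_def G_def by auto
    moreover have "G \<subseteq> Pow UNIV" by simp
    moreover have "A \<in> sigma_sets UNIV G" using True G by simp
    ultimately show ?thesis
    proof (induction rule: sigma_sets_induct_disjoint)
      case (basic A) then show ?case using eq' by (auto simp: G_def)
    next
      case empty then show ?case using vm_empty v k by metis
    next
      case (compl A)
      then show ?case using vm_Diff[OF v, of UNIV A] vm_Diff[OF k, of UNIV A] U G by simp
    next
      case (union A)
      then have "range A \<subseteq> sets borel" using G by simp
      from vector_measureD(2)[OF v this union(1)] vector_measureD(2)[OF k this union(1)] union(3)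
      show ?case using sums_unique2 by auto
    qed
  qed
qed

subsection \<open>The total variation\<close>

lemma total_variation_upper:
  assumes "range D \<subseteq> sets borel" "disjoint_family D" "(\<Union>i. D i) = A"
  shows "(\<Sum>i. ennreal (norm (\<nu> (D i)))) \<le> total_variation \<nu> A"
  unfolding total_variation_def using assms by (intro SUP_upper) auto

lemma norm_le_total_variation:
  assumes v: "vector_measure \<nu>" and A: "A \<in> sets borel"
  shows "ennreal (norm (\<nu> A)) \<le> total_variation \<nu> A"
proof -
  have "(\<Sum>i. ennreal (norm (\<nu> (binaryset A {} i)))) \<le> total_variation \<nu> A"
    using A by (intro total_variation_upper) (auto simp: range_binaryset_eq disjoint_family_on_def binaryset_def UN_binaryset_eq)
  also have "(\<Sum>i. ennreal (norm (\<nu> (binaryset A {} i)))) = ennreal (norm (\<nu> A)) + ennreal (norm (\<nu> {}))"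
    by (rule suminf_binaryset_eq[where f="\<lambda>A. ennreal (norm (\<nu> A))"]) (simp add: vm_empty[OF v])
  finally show ?thesis by (simp add: vm_empty[OF v])
qed

lemma total_variation_superadd:
  assumes v: "vector_measure \<nu>" and "A \<in> sets borel" "C \<in> sets borel" "A \<inter> C = {}"
  shows "total_variation \<nu> A + total_variation \<nu> C \<le> total_variation \<nu> (A \<union> C)"
proof -
  let ?P = "\<lambda>A. {D::nat \<Rightarrow> real set. range D \<subseteq> sets borel \<and> disjoint_family D \<and> (\<Union>i. D i) = A}"
  let ?s = "\<lambda>D. \<Sum>i. ennreal (norm (\<nu> (D i)))"
  have ne: "?P A \<noteq> {}" if "A \<in> sets borel" for A
  proof -
    have "binaryset A {} \<in> ?P A" using that
      by (auto simp: range_binaryset_eq disjoint_family_on_def binaryset_def UN_binaryset_eq split: if_splits)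
    then show ?thesis by blast
  qed
  have key: "?s D + ?s F \<le> total_variation \<nu> (A \<union> C)" if D: "D \<in> ?P A" and F: "F \<in> ?P C" for D F
  proof -
    \<comment> \<open>The two partitions are interleaved into one sequence, even indices for
      \<open>A\<close> and odd ones for \<open>C\<close>.\<close>
    define H where "H n = (if even n then D (n div 2) else F (n div 2))" for n :: nat
    have DA: "D i \<subseteq> A" and FC: "F i \<subseteq> C" for i using D F by auto
    have "disjoint_family H"
      unfolding disjoint_family_on_def
    proof (intro ballI impI)
      fix m n :: nat assume mn: "m \<noteq> n"
      have dd: "D i \<inter> D j = {}" "F i \<inter> F j = {}" if "i \<noteq> j" for i j
        using D F that by (auto simp: disjoint_family_on_def)
      have df: "D i \<inter> F j = {}" for i j using DA[of i] FC[of j] assms(4) by blast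
      show "H m \<inter> H n = {}"
      proof (cases "even m = even n")
        case True
        then have "m mod 2 = n mod 2" by (simp add: mod2_eq_if)
        then have "m div 2 \<noteq> n div 2" using mn div_mult_mod_eq[of m 2] div_mult_mod_eq[of n 2] by auto
        then show ?thesis using dd True by (simp add: H_def)
      next
        case False
        then show ?thesis using df[of "m div 2" "n div 2"] df[of "n div 2" "m div 2"] by (auto simp: H_def)
      qed
    qed
    moreover have "(\<Union>i. H i) = A \<union> C"
    proof -
      have "(\<Union>i. H i) = (\<Union>i. H (2 * i)) \<union> (\<Union>i. H (2 * i + 1))"
      proof (intro set_eqI iffI)
        fix x assume "x \<in> (\<Union>i. H i)"
        then obtain n where n: "x \<in> H n" by blast
        show "x \<in> (\<Union>i. H (2 * i)) \<union> (\<Union>i. H (2 * i + 1))"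
          using n by (cases "even n") (auto elim!: evenE oddE)
      qed auto
      then show ?thesis using D F by (simp add: H_def)
    qed
    moreover have "range H \<subseteq> sets borel" using D F by (auto simp: H_def)
    ultimately have le: "?s H \<le> total_variation \<nu> (A \<union> C)" by (intro total_variation_upper)
    have part: "(\<Sum>i<2*m. ennreal (norm (\<nu> (H i)))) = (\<Sum>i<m. ennreal (norm (\<nu> (D i))) + ennreal (norm (\<nu> (F i))))" for m
      by (induction m) (auto simp: H_def ac_simps)
    have "?s D + ?s F = (\<Sum>i. ennreal (norm (\<nu> (D i))) + ennreal (norm (\<nu> (F i))))"
      by (intro suminf_add) auto
    also have "\<dots> \<le> ?s H"
      by (intro suminf_le_const, simp) (metis part sum_le_suminf summableI finite_lessThan zero_le)
    finally show ?thesis using le by (rule order_trans)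
  qed
  have "total_variation \<nu> A + total_variation \<nu> C = (SUP D\<in>?P A. ?s D + total_variation \<nu> C)"
    unfolding total_variation_def[of \<nu> A] by (intro ennreal_SUP_add_left[symmetric] ne assms)
  also have "\<dots> \<le> total_variation \<nu> (A \<union> C)"
  proof (rule SUP_least)
    fix D assume D: "D \<in> ?P A"
    have "?s D + total_variation \<nu> C = (SUP F\<in>?P C. ?s D + ?s F)"
      unfolding total_variation_def[of \<nu> C] by (intro ennreal_SUP_add_right ne assms)
    also have "\<dots> \<le> total_variation \<nu> (A \<union> C)" using D by (intro SUP_least key)
    finally show "?s D + total_variation \<nu> C \<le> total_variation \<nu> (A \<union> C)" .
  qed
  finally show ?thesis .
qed

lemma total_variation_mono:
  assumes v: "vector_measure \<nu>" and "A \<in> sets borel" "C \<in> sets borel" "A \<subseteq> C"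
  shows "total_variation \<nu> A \<le> total_variation \<nu> C"
proof -
  have "total_variation \<nu> A + total_variation \<nu> (C - A) \<le> total_variation \<nu> (A \<union> (C - A))"
    using assms by (intro total_variation_superadd[OF v]) auto
  moreover have "A \<union> (C - A) = C" using assms by auto
  ultimately show ?thesis by (metis add.right_neutral add_left_mono order_trans zero_le)
qed

lemma norm_sums_le:
  fixes f :: "nat \<Rightarrow> 'a::real_normed_vector"
  assumes "f sums s" shows "ennreal (norm s) \<le> (\<Sum>i. ennreal (norm (f i)))"
proof (rule LIMSEQ_le_const2)
  show "(\<lambda>n. ennreal (norm (\<Sum>i<n. f i))) \<longlonglongrightarrow> ennreal (norm s)"
    using assms unfolding sums_def by (intro tendsto_ennrealI tendsto_norm)
  have "ennreal (norm (\<Sum>i<n. f i)) \<le> (\<Sum>i. ennreal (norm (f i)))" for n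
  proof -
    have "ennreal (norm (\<Sum>i<n. f i)) \<le> ennreal (\<Sum>i<n. norm (f i))" by (intro ennreal_leI norm_sum)
    also have "\<dots> = (\<Sum>i<n. ennreal (norm (f i)))" by (simp add: sum_ennreal)
    also have "\<dots> \<le> (\<Sum>i. ennreal (norm (f i)))" by (intro sum_le_suminf) auto
    finally show ?thesis .
  qed
  then show "\<exists>N. \<forall>n\<ge>N. ennreal (norm (\<Sum>i<n. f i)) \<le> (\<Sum>i. ennreal (norm (f i)))" by blast
qed

text \<open>Superadditivity and monotonicity give one inequality. For the other, a partition of the
  union is cut by the sets \<open>A i\<close>, and the double series of norms is summed in the other
  order.\<close>

lemma total_variation_countably_additive:
  assumes v: "vector_measure \<nu>"
  shows "countably_additive (sets borel) (total_variation \<nu>)"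
  unfolding countably_additive_def
proof (intro allI impI)
  fix A :: "nat \<Rightarrow> real set"
  assume A: "range A \<subseteq> sets borel" "disjoint_family A" "(\<Union>i. A i) \<in> sets borel"
  have fin: "(\<Sum>i<n. total_variation \<nu> (A i)) \<le> total_variation \<nu> (\<Union>i<n. A i)" for n
  proof (induction n)
    case (Suc n)
    have "A i \<inter> A n = {}" if "i < n" for i using A(2) that by (simp add: disjoint_family_on_def)
    then have "(\<Union>i<n. A i) \<inter> A n = {}" by blast
    moreover have "(\<Union>i<n. A i) \<in> sets borel" "A n \<in> sets borel" using A(1) by auto
    ultimately have *: "total_variation \<nu> (\<Union>i<n. A i) + total_variation \<nu> (A n) \<le> total_variation \<nu> ((\<Union>i<n. A i) \<union> A n)"
      by (intro total_variation_superadd[OF v])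
    have "(\<Union>i<n. A i) \<union> A n = (\<Union>i<Suc n. A i)" by (auto simp: lessThan_Suc)
    then show ?case using order_trans[OF add_right_mono[OF Suc.IH] *] by (simp only: sum.lessThan_Suc)
  qed simp
  have ge: "(\<Sum>i. total_variation \<nu> (A i)) \<le> total_variation \<nu> (\<Union>i. A i)"
  proof (intro suminf_le_const, simp)
    fix n
    have "total_variation \<nu> (\<Union>i<n. A i) \<le> total_variation \<nu> (\<Union>i. A i)"
      using A by (intro total_variation_mono[OF v]) auto
    then show "(\<Sum>i<n. total_variation \<nu> (A i)) \<le> total_variation \<nu> (\<Union>i. A i)" using fin[of n] by (rule order_trans[rotated])
  qed
  have "total_variation \<nu> (\<Union>i. A i) \<le> (\<Sum>i. total_variation \<nu> (A i))"
    unfolding total_variation_def[of \<nu> "\<Union>i. A i"]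
  proof (rule SUP_least, safe)
    fix D :: "nat \<Rightarrow> real set" assume D: "range D \<subseteq> sets borel" "disjoint_family D" "(\<Union>i. D i) = (\<Union>i. A i)"
    have "(\<Sum>j. ennreal (norm (\<nu> (D j)))) \<le> (\<Sum>j. \<Sum>i. ennreal (norm (\<nu> (D j \<inter> A i))))"
    proof (intro suminf_le)
      fix j
      have "(\<lambda>i. \<nu> (D j \<inter> A i)) sums \<nu> (\<Union>i. D j \<inter> A i)"
        using A D by (intro vector_measureD(2)[OF v]) (auto simp: disjoint_family_on_def)
      moreover have "(\<Union>i. D j \<inter> A i) = D j" using D(3) by blast
      ultimately show "ennreal (norm (\<nu> (D j))) \<le> (\<Sum>i. ennreal (norm (\<nu> (D j \<inter> A i))))"
        using norm_sums_le by metis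
    qed auto
    \<comment> \<open>Written as an integral over counting measure, the outer series can be
      exchanged with the inner one.\<close>
    also have "\<dots> = (\<integral>\<^sup>+j. (\<Sum>i. ennreal (norm (\<nu> (D j \<inter> A i)))) \<partial>count_space UNIV)"
      by (simp add: nn_integral_count_space_nat)
    also have "\<dots> = (\<Sum>i. \<integral>\<^sup>+j. ennreal (norm (\<nu> (D j \<inter> A i))) \<partial>count_space UNIV)"
      by (intro nn_integral_suminf) auto
    also have "\<dots> = (\<Sum>i. \<Sum>j. ennreal (norm (\<nu> (D j \<inter> A i))))"
      by (simp add: nn_integral_count_space_nat)
    also have "\<dots> \<le> (\<Sum>i. total_variation \<nu> (A i))"
    proof (intro suminf_le total_variation_upper)
      fix i
      show "range (\<lambda>j. D j \<inter> A i) \<subseteq> sets borel" using A D by auto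
      show "disjoint_family (\<lambda>j. D j \<inter> A i)" using D(2) by (auto simp: disjoint_family_on_def)
      show "(\<Union>j. D j \<inter> A i) = A i" using D(3) by blast
    qed auto
    finally show "(\<Sum>j. ennreal (norm (\<nu> (D j)))) \<le> (\<Sum>i. total_variation \<nu> (A i))" .
  qed
  then show "(\<Sum>i. total_variation \<nu> (A i)) = total_variation \<nu> (\<Union>i. A i)" using ge by (rule antisym[rotated])
qed

lemma total_variation_empty: assumes v: "vector_measure \<nu>" shows "total_variation \<nu> {} = 0"
proof -
  have "total_variation \<nu> {} \<le> 0" unfolding total_variation_def
    using vm_empty[OF v] by (intro SUP_least) auto
  then show ?thesis by simp
qed

lemma total_variation_measure:
  assumes v: "vector_measure \<nu>"
  shows sets_total_variation_measure: "sets (total_variation_measure \<nu>) = sets borel"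
    and space_total_variation_measure: "space (total_variation_measure \<nu>) = UNIV"
    and emeasure_total_variation_measure:
      "A \<in> sets borel \<Longrightarrow> emeasure (total_variation_measure \<nu>) A = total_variation \<nu> A"
proof -
  have s: "sigma_sets UNIV (sets borel) = sets (borel::real measure)"
    using sets.sigma_sets_eq[of "borel::real measure"] by simp
  show se: "sets (total_variation_measure \<nu>) = sets borel"
    unfolding total_variation_measure_def by (simp add: sets_measure_of_conv s)
  show "space (total_variation_measure \<nu>) = UNIV"
    unfolding total_variation_measure_def by (simp add: space_measure_of_conv)
  assume A: "A \<in> sets borel"
  show "emeasure (total_variation_measure \<nu>) A = total_variation \<nu> A"
    by (rule emeasure_measure_of[OF total_variation_measure_def])
      (auto simp: se A positive_def total_variation_empty[OF v] total_variation_countably_additive[OF v])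
qed

text \<open>If the total variation were infinite on a set, one could split off pieces of size
  greater than 1 forever, contradicting convergence of the series over these pieces.\<close>

lemma total_variation_finite_real:
  fixes \<kappa> :: "real set \<Rightarrow> real"
  assumes v: "vector_measure \<kappa>"
  shows "total_variation \<kappa> UNIV < \<infinity>"
proof (rule ccontr)
  let ?V = "total_variation \<kappa>"
  assume "\<not> ?thesis"
  then have inf: "?V UNIV = \<infinity>" by (simp add: less_top[symmetric])
  have step: "\<exists>A\<subseteq>S. A \<in> sets borel \<and> \<bar>\<kappa> A\<bar> > 1 \<and> ?V (S - A) = \<infinity>"
    if S: "S \<in> sets borel" "?V S = \<infinity>" for S
  proof -
    \<comment> \<open>The charge of \<open>S\<close> is included so that a part \<open>A\<close>
      with charge beyond \<open>t\<close> leaves a remainder \<open>S - A\<close> whose charge also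
      exceeds 1 in absolute value; then either part may be split off.\<close>
    define t where "t = 1 + \<bar>\<kappa> S\<bar>"
    have "ennreal (2 * t) < ?V S" using S(2) by simp
    then obtain D :: "nat \<Rightarrow> real set" where D: "range D \<subseteq> sets borel" "disjoint_family D" "(\<Union>i. D i) = S"
      and s: "ennreal (2 * t) < (\<Sum>i. ennreal (norm (\<kappa> (D i))))"
      unfolding total_variation_def less_SUP_iff by auto
    have "\<exists>n. ennreal (2 * t) < (\<Sum>i<n. ennreal (norm (\<kappa> (D i))))"
    proof (rule ccontr)
      assume "\<not> ?thesis"
      then have "(\<Sum>i. ennreal (norm (\<kappa> (D i)))) \<le> ennreal (2 * t)" by (intro suminf_le_const) (auto simp: not_less)
      then show False using s by simp
    qed
    then obtain n where "ennreal (2 * t) < (\<Sum>i<n. ennreal (norm (\<kappa> (D i))))" by blast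
    then have "ennreal (2 * t) < ennreal (\<Sum>i<n. \<bar>\<kappa> (D i)\<bar>)" by (simp add: sum_ennreal)
    then have n: "2 * t < (\<Sum>i<n. \<bar>\<kappa> (D i)\<bar>)" unfolding t_def by (subst (asm) ennreal_less_iff) auto
    \<comment> \<open>Of the two signs, one carries at least half of the sum; hence the factor 2 in
      front of \<open>t\<close>.\<close>
    define P where "P = {i. i < n \<and> \<kappa> (D i) \<ge> 0}"
    define Q where "Q = {i. i < n \<and> \<kappa> (D i) < 0}"
    have fin: "finite P" "finite Q" by (auto simp: P_def Q_def)
    have U: "\<kappa> (\<Union>i\<in>I. D i) = (\<Sum>i\<in>I. \<kappa> (D i))" if "finite I" for I
      using D that by (intro vm_UN_finite[OF v]) (auto simp: disjoint_family_on_def)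
    have "{..<n} = P \<union> Q" "P \<inter> Q = {}" by (auto simp: P_def Q_def)
    then have "(\<Sum>i<n. \<bar>\<kappa> (D i)\<bar>) = (\<Sum>i\<in>P. \<bar>\<kappa> (D i)\<bar>) + (\<Sum>i\<in>Q. \<bar>\<kappa> (D i)\<bar>)"
      using fin by (simp add: sum.union_disjoint)
    also have "(\<Sum>i\<in>P. \<bar>\<kappa> (D i)\<bar>) = \<kappa> (\<Union>i\<in>P. D i)" unfolding U[OF fin(1)] by (intro sum.cong) (auto simp: P_def)
    also have "(\<Sum>i\<in>Q. \<bar>\<kappa> (D i)\<bar>) = - \<kappa> (\<Union>i\<in>Q. D i)" unfolding U[OF fin(2)] sum_negf[symmetric]
      by (intro sum.cong) (auto simp: Q_def)
    finally have "t < \<kappa> (\<Union>i\<in>P. D i) \<or> t < - \<kappa> (\<Union>i\<in>Q. D i)" using n by linarith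
    moreover have sub: "(\<Union>i\<in>I. D i) \<in> sets borel \<and> (\<Union>i\<in>I. D i) \<subseteq> S" if "finite I" for I using D that by auto
    ultimately have "\<exists>A. A \<in> sets borel \<and> A \<subseteq> S \<and> t < \<bar>\<kappa> A\<bar>"
    proof (elim disjE)
      assume "t < \<kappa> (\<Union>i\<in>P. D i)"
      then have "t < \<bar>\<kappa> (\<Union>i\<in>P. D i)\<bar>" by linarith
      then show ?thesis using sub fin(1) by blast
    next
      assume "t < - \<kappa> (\<Union>i\<in>Q. D i)"
      then have "t < \<bar>\<kappa> (\<Union>i\<in>Q. D i)\<bar>" by linarith
      then show ?thesis using sub fin(2) by blast
    qed
    then obtain A where A: "A \<in> sets borel" "A \<subseteq> S" "t < \<bar>\<kappa> A\<bar>" by blast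
    have d: "\<kappa> (S - A) = \<kappa> S - \<kappa> A" using S A by (intro vm_Diff[OF v])
    have big: "\<bar>\<kappa> A\<bar> > 1" "\<bar>\<kappa> (S - A)\<bar> > 1" using A(3) unfolding t_def d by auto
    have SA: "S - A \<in> sets borel" using S A by auto
    have UA: "A \<union> (S - A) = S" using A by auto
    have "?V S = ?V A + ?V (S - A)"
    proof -
      have "emeasure (total_variation_measure \<kappa>) A + emeasure (total_variation_measure \<kappa>) (S - A)
         = emeasure (total_variation_measure \<kappa>) (A \<union> (S - A))"
        using A SA by (intro plus_emeasure) (auto simp: sets_total_variation_measure[OF v])
      then show ?thesis unfolding UA using A(1) SA S(1) by (simp add: emeasure_total_variation_measure[OF v])
    qed
    \<comment> \<open>A part with infinite variation is kept for the next round, and the other one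
      is the piece split off.\<close>
    then have "?V A = \<infinity> \<or> ?V (S - A) = \<infinity>" using S(2) by (metis ennreal_add_eq_top infinity_ennreal_def)
    moreover have "S - (S - A) = A" using A by auto
    ultimately show ?thesis using A big SA by (metis Diff_subset)
  qed
  then obtain g where g: "\<And>S. S \<in> sets borel \<Longrightarrow> ?V S = \<infinity> \<Longrightarrow> g S \<subseteq> S \<and> g S \<in> sets borel \<and> \<bar>\<kappa> (g S)\<bar> > 1 \<and> ?V (S - g S) = \<infinity>"
    by metis
  define E where "E = rec_nat UNIV (\<lambda>_ S. S - g S)"
  have E0: "E 0 = UNIV" and ES: "E (Suc n) = E n - g (E n)" for n by (auto simp: E_def)
  have E: "E n \<in> sets borel \<and> ?V (E n) = \<infinity>" for n
    by (induction n) (use inf g in \<open>auto simp: E0 ES\<close>)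
  have dec: "E n \<subseteq> E m" if "m \<le> n" for m n using that
    by (induction rule: dec_induct) (auto simp: ES)
  have "g (E m) \<inter> g (E n) = {}" if "m < n" for m n
    using dec[of "Suc m" n] that g E[of n] by (auto simp: ES)
  then have "disjoint_family (\<lambda>n. g (E n))"
    unfolding disjoint_family_on_def by (metis inf_commute linorder_neq_iff)
  then have "(\<lambda>n. \<kappa> (g (E n))) sums \<kappa> (\<Union>n. g (E n))"
    using g E by (intro vector_measureD(2)[OF v]) auto
  then have "(\<lambda>n. \<kappa> (g (E n))) \<longlonglongrightarrow> 0" using summable_LIMSEQ_zero sums_summable by blast
  then have "\<forall>\<^sub>F n in sequentially. \<bar>\<kappa> (g (E n))\<bar> < 1" using order_tendstoD(2)[of "\<lambda>n. \<bar>\<kappa> (g (E n))\<bar>" 0] tendsto_rabs_zero zero_less_one by blast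
  then obtain n where "\<bar>\<kappa> (g (E n))\<bar> < 1" by (auto simp: eventually_sequentially)
  then show False using g E[of n] by fastforce
qed

text \<open>Each coordinate is a real-valued measure of finite variation, and the norm is at most a
  weighted sum of the absolute coordinates.\<close>

lemma (in finite_dim_basis) total_variation_finite:
  fixes \<nu> :: "real set \<Rightarrow> 'a"
  assumes v: "vector_measure \<nu>"
  shows "total_variation \<nu> UNIV < \<infinity>"
proof -
  have vb: "vector_measure (\<lambda>A. cf (\<nu> A) b)" if "b \<in> B" for b
    using vm_linear[OF v bounded_linear_cf[OF that]] .
  have "total_variation \<nu> UNIV \<le> (\<Sum>b\<in>B. ennreal (norm b) * total_variation (\<lambda>A. cf (\<nu> A) b) UNIV)"
    unfolding total_variation_def[of \<nu>]
  proof (rule SUP_least, safe)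
    fix D :: "nat \<Rightarrow> real set" assume D: "range D \<subseteq> sets borel" "disjoint_family D" "(\<Union>i. D i) = UNIV"
    have n: "norm x \<le> (\<Sum>b\<in>B. norm b * \<bar>cf x b\<bar>)" for x
    proof -
      have "norm x = norm (\<Sum>b\<in>B. cf x b *\<^sub>R b)" using expand[of x] by simp
      also have "\<dots> \<le> (\<Sum>b\<in>B. norm (cf x b *\<^sub>R b))" by (rule norm_sum)
      finally show ?thesis by (simp add: mult.commute)
    qed
    have "(\<Sum>i. ennreal (norm (\<nu> (D i)))) \<le> (\<Sum>i. \<Sum>b\<in>B. ennreal (norm b) * ennreal (norm (cf (\<nu> (D i)) b)))"
    proof (intro suminf_le)
      fix i
      have "ennreal (norm (\<nu> (D i))) \<le> ennreal (\<Sum>b\<in>B. norm b * \<bar>cf (\<nu> (D i)) b\<bar>)" by (intro ennreal_leI n)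
      also have "\<dots> = (\<Sum>b\<in>B. ennreal (norm b) * ennreal (norm (cf (\<nu> (D i)) b)))"
        by (subst sum_ennreal[symmetric]) (auto simp: ennreal_mult intro!: sum.cong)
      finally show "ennreal (norm (\<nu> (D i))) \<le> \<dots>" .
    qed auto
    also have "\<dots> = (\<Sum>b\<in>B. \<Sum>i. ennreal (norm b) * ennreal (norm (cf (\<nu> (D i)) b)))"
      by (intro suminf_sum) auto
    also have "\<dots> = (\<Sum>b\<in>B. ennreal (norm b) * (\<Sum>i. ennreal (norm (cf (\<nu> (D i)) b))))"
      by (simp add: ennreal_suminf_cmult)
    also have "\<dots> \<le> (\<Sum>b\<in>B. ennreal (norm b) * total_variation (\<lambda>A. cf (\<nu> A) b) UNIV)"
      using D by (intro sum_mono mult_left_mono total_variation_upper) auto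
    finally show "(\<Sum>i. ennreal (norm (\<nu> (D i)))) \<le> \<dots>" .
  qed
  also have "\<dots> < \<infinity>"
    using finite_B total_variation_finite_real[OF vb] by (auto simp: ennreal_mult_less_top)
  finally show ?thesis .
qed

lemma finite_measure_total_variation:
  assumes "vector_measure \<nu>" "total_variation \<nu> UNIV < \<infinity>"
  shows "finite_measure (total_variation_measure \<nu>)"
  using assms by (intro finite_measureI)
    (simp add: space_total_variation_measure emeasure_total_variation_measure)

subsection \<open>Densities and the Lebesgue decomposition\<close>

lemma measure_of_borel:
  fixes m :: "real set \<Rightarrow> ennreal"
  assumes "m {} = 0" "countably_additive (sets borel) m"
  defines "M \<equiv> measure_of UNIV (sets borel) m"
  shows "sets M = sets borel" "space M = UNIV" "A \<in> sets borel \<Longrightarrow> emeasure M A = m A"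
proof -
  have s: "sigma_sets UNIV (sets borel) = sets (borel::real measure)"
    using sets.sigma_sets_eq[of "borel::real measure"] by simp
  show se: "sets M = sets borel" unfolding M_def by (simp add: sets_measure_of_conv s)
  show "space M = UNIV" unfolding M_def by (simp add: space_measure_of_conv)
  assume A: "A \<in> sets borel"
  show "emeasure M A = m A"
    by (rule emeasure_measure_of[OF M_def[THEN meta_eq_to_obj_eq]]) (auto simp: se s A positive_def assms)
qed

lemma nonneg_vm_measure:
  fixes \<kappa> :: "real set \<Rightarrow> real"
  assumes v: "vector_measure \<kappa>" and nn: "\<And>A. 0 \<le> \<kappa> A"
  obtains M where "finite_measure M" "sets M = sets borel" "\<And>A. A \<in> sets borel \<Longrightarrow> measure M A = \<kappa> A"
proof -
  let ?m = "\<lambda>A. ennreal (\<kappa> A)"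
  have e: "?m {} = 0" using vm_empty[OF v] by simp
  have c: "countably_additive (sets borel) ?m" unfolding countably_additive_def
  proof (intro allI impI)
    fix A :: "nat \<Rightarrow> real set" assume "range A \<subseteq> sets borel" "disjoint_family A"
    then have "(\<lambda>i. \<kappa> (A i)) sums \<kappa> (\<Union>i. A i)" by (rule vector_measureD(2)[OF v])
    then show "(\<Sum>i. ?m (A i)) = ?m (\<Union>i. A i)" using nn by (metis suminf_ennreal2 sums_summable sums_unique)
  qed
  let ?M = "measure_of UNIV (sets borel) ?m"
  note M = measure_of_borel[of ?m, OF e c]
  show thesis
  proof
    show "finite_measure ?M" using M by (intro finite_measureI) simp
    show "sets ?M = sets borel" by (rule M)
    show "measure ?M A = \<kappa> A" if "A \<in> sets borel" for A using M(3)[OF that] nn by (simp add: measure_def)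
  qed
qed

lemma finite_measure_real_density:
  assumes "sigma_finite_measure M" and sM: "sets M = sets borel"
    and "finite_measure N" and sN: "sets N = sets borel"
    and ac: "\<And>A. A \<in> sets borel \<Longrightarrow> emeasure M A = 0 \<Longrightarrow> measure N A = 0"
  shows "\<exists>h::real \<Rightarrow> real. integrable M h \<and> (\<forall>A\<in>sets borel. measure N A = (LINT t:A|M. h t))"
proof -
  interpret M: sigma_finite_measure M by fact
  interpret N: finite_measure N by fact
  have ac': "absolutely_continuous M N"
    unfolding absolutely_continuous_def null_sets_def using ac sM sN by (auto simp: N.emeasure_eq_measure)
  have sNM: "sets N = sets M" using sM sN by simp
  obtain D where D: "D \<in> borel_measurable M" "AE x in M. RN_deriv M N x = ennreal (D x)"
    "AE x in N. 0 < D x" "\<And>x. 0 \<le> D x"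
    using M.real_RN_deriv[OF assms(3) ac' sNM] by blast
  have "N = density M (RN_deriv M N)" using M.density_RN_deriv[OF ac'] sM sN by simp
  also have "\<dots> = density M (\<lambda>x. ennreal (D x))" using D by (intro density_cong) auto
  finally have ND: "N = density M (\<lambda>x. ennreal (D x))" .
  have e: "emeasure N A = (\<integral>\<^sup>+x. ennreal (indicator A x * D x) \<partial>M)" if "A \<in> sets borel" for A
    using that sM D(1) by (subst ND) (auto simp: emeasure_density ennreal_mult' mult.commute ennreal_indicator intro!: nn_integral_cong split: split_indicator)
  have "integrable M D"
  proof (rule integrableI_nonneg[OF D(1)])
    have "(\<integral>\<^sup>+x. ennreal (D x) \<partial>M) = emeasure N UNIV" using e[of UNIV] by simp
    then show "(\<integral>\<^sup>+x. ennreal (D x) \<partial>M) < \<infinity>" by (simp add: N.emeasure_eq_measure)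
  qed (use D in auto)
  moreover have "measure N A = (LINT t:A|M. D t)" if A: "A \<in> sets borel" for A
  proof -
    have "(LINT t:A|M. D t) = enn2real (\<integral>\<^sup>+x. ennreal (indicator A x * D x) \<partial>M)"
      unfolding set_lebesgue_integral_def using A D sM
      by (subst integral_eq_nn_integral) (auto intro!: borel_measurable_times)
    then show ?thesis using e[OF A] by (simp add: measure_def)
  qed
  ultimately show ?thesis by blast
qed

text \<open>The signed measure is the difference of two finite positive ones, namely its sum with
  its total variation and the total variation itself. Both vanish on null sets of \<open>M\<close>,
  so the theorem for positive measures applies twice.\<close>

lemma real_vm_density:
  fixes \<kappa> :: "real set \<Rightarrow> real"
  assumes v: "vector_measure \<kappa>" and M: "sigma_finite_measure M" "sets M = sets borel"
    and ac: "\<And>A. A \<in> sets borel \<Longrightarrow> emeasure M A = 0 \<Longrightarrow> \<kappa> A = 0"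
  shows "\<exists>h::real \<Rightarrow> real. integrable M h \<and> (\<forall>A\<in>sets borel. \<kappa> A = (LINT t:A|M. h t))"
proof -
  let ?V = "total_variation_measure \<kappa>"
  interpret V: finite_measure ?V
    by (rule finite_measure_total_variation[OF v total_variation_finite_real[OF v]])
  have sV: "sets ?V = sets borel" by (rule sets_total_variation_measure[OF v])
  have Vz: "measure ?V A = 0" if "A \<in> sets borel" "emeasure M A = 0" for A
  proof -
    have z: "\<kappa> C = 0" if "C \<in> sets borel" "C \<subseteq> A" for C
      using emeasure_mono[of C A M] that \<open>A \<in> sets borel\<close> \<open>emeasure M A = 0\<close> M(2) by (intro ac) auto
    have "total_variation \<kappa> A \<le> 0" unfolding total_variation_def
    proof (rule SUP_least, safe)
      fix D :: "nat \<Rightarrow> real set" assume D: "range D \<subseteq> sets borel" "A = (\<Union>i. D i)"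
      have "\<kappa> (D i) = 0" for i using D by (intro z) auto
      then show "(\<Sum>i. ennreal (norm (\<kappa> (D i)))) \<le> 0" by simp
    qed
    then show ?thesis using emeasure_total_variation_measure[OF v that(1)] by (simp add: measure_def)
  qed
  have vV: "vector_measure (measure ?V)" using vm_measure sV V.finite_measure_axioms by blast
  define \<rho> where "\<rho> A = \<kappa> A + measure ?V A" for A
  have \<rho>: "vector_measure \<rho>" unfolding \<rho>_def by (rule vm_add[OF v vV])
  have "0 \<le> \<rho> A" for A
  proof (cases "A \<in> sets borel")
    case True
    have "ennreal \<bar>\<kappa> A\<bar> \<le> emeasure ?V A"
      using norm_le_total_variation[OF v True] emeasure_total_variation_measure[OF v True] by simp
    then show ?thesis by (simp add: V.emeasure_eq_measure \<rho>_def)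
  next
    case False then show ?thesis using vector_measureD(1)[OF \<rho>] by simp
  qed
  then obtain R where R: "finite_measure R" "sets R = sets borel" "\<And>A. A \<in> sets borel \<Longrightarrow> measure R A = \<rho> A"
    using nonneg_vm_measure[OF \<rho>] by blast
  obtain h1 where h1: "integrable M h1" "\<forall>A\<in>sets borel. measure R A = (LINT t:A|M. h1 t)"
    using finite_measure_real_density[OF M R(1,2)] R(3) ac Vz by (auto simp: \<rho>_def)
  obtain h2 where h2: "integrable M h2" "\<forall>A\<in>sets borel. measure ?V A = (LINT t:A|M. h2 t)"
    using finite_measure_real_density[OF M V.finite_measure_axioms sV] Vz by blast
  have "\<kappa> A = (LINT t:A|M. h1 t - h2 t)" if A: "A \<in> sets borel" for A
  proof -
    have "set_integrable M A h1" "set_integrable M A h2"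
      using integrable_mult_indicator[OF _ h1(1), of A] integrable_mult_indicator[OF _ h2(1), of A] A M(2)
      unfolding set_integrable_def by auto
    then have "(LINT t:A|M. h1 t - h2 t) = (LINT t:A|M. h1 t) - (LINT t:A|M. h2 t)" by (rule set_integral_diff)
    also have "\<dots> = \<kappa> A" using h1(2) h2(2) R(3)[OF A] A by (auto simp: \<rho>_def)
    finally show ?thesis by simp
  qed
  then show ?thesis using h1(1) h2(1) by (intro exI[of _ "\<lambda>t. h1 t - h2 t"]) auto
qed

context finite_dim_basis
begin

lemma vm_density_exists:
  fixes \<nu> :: "real set \<Rightarrow> 'a"
  assumes v: "vector_measure \<nu>" and M: "sigma_finite_measure M" "sets M = sets borel"
    and ac: "\<And>A. A \<in> sets borel \<Longrightarrow> emeasure M A = 0 \<Longrightarrow> \<nu> A = 0"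
  shows "\<exists>f. integrable M f \<and> (\<forall>A\<in>sets borel. \<nu> A = (LINT t:A|M. f t))"
proof -
  have "\<exists>h::real \<Rightarrow> real. integrable M h \<and> (\<forall>A\<in>sets borel. cf (\<nu> A) b = (LINT t:A|M. h t))" if b: "b \<in> B" for b
  proof (rule real_vm_density[OF vm_linear[OF v bounded_linear_cf[OF b]] M])
    fix A assume "A \<in> sets borel" "emeasure M A = 0"
    then show "cf (\<nu> A) b = 0" using ac[of A] cf_scale[of 0 0 b] by simp
  qed
  then obtain h :: "'a \<Rightarrow> real \<Rightarrow> real" where h: "\<And>b. b \<in> B \<Longrightarrow> integrable M (h b)"
    "\<And>b A. b \<in> B \<Longrightarrow> A \<in> sets borel \<Longrightarrow> cf (\<nu> A) b = (LINT t:A|M. h b t)" by metis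
  define f where "f t = (\<Sum>b\<in>B. h b t *\<^sub>R b)" for t
  have "\<nu> A = (LINT t:A|M. f t)" if A: "A \<in> sets borel" for A
  proof -
    have i: "integrable M (\<lambda>t. indicator A t *\<^sub>R h b t)" if "b \<in> B" for b
      using integrable_mult_indicator[OF _ h(1)[OF that]] A M(2) by simp
    have "(LINT t:A|M. f t) = (LINT t|M. (\<Sum>b\<in>B. (indicator A t *\<^sub>R h b t) *\<^sub>R b))"
      unfolding set_lebesgue_integral_def f_def by (simp add: scaleR_sum_right)
    also have "\<dots> = (\<Sum>b\<in>B. LINT t|M. (indicator A t *\<^sub>R h b t) *\<^sub>R b)"
      using i by (intro Bochner_Integration.integral_sum integrable_scaleR_left) auto
    also have "\<dots> = (\<Sum>b\<in>B. (LINT t:A|M. h b t) *\<^sub>R b)"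
      unfolding set_lebesgue_integral_def using i by (intro sum.cong refl integral_scaleR_left) auto
    also have "\<dots> = (\<Sum>b\<in>B. cf (\<nu> A) b *\<^sub>R b)" using h(2) A by simp
    finally show ?thesis unfolding expand[symmetric] by simp
  qed
  moreover have "integrable M f" unfolding f_def using h(1) by (intro Bochner_Integration.integrable_sum integrable_scaleR_left) auto
  ultimately show ?thesis by blast
qed

text \<open>The existence of a density makes the choice in \<open>vector_density\<close> select
  one.\<close>

lemma vector_density:
  fixes \<nu> :: "real set \<Rightarrow> 'a"
  assumes v: "vector_measure \<nu>" and M: "sigma_finite_measure M" "sets M = sets borel"
    and ac: "\<And>A. A \<in> sets borel \<Longrightarrow> emeasure M A = 0 \<Longrightarrow> \<nu> A = 0"
  shows "integrable M (vector_density M \<nu>)"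
    "A \<in> sets borel \<Longrightarrow> \<nu> A = (LINT t:A|M. vector_density M \<nu> t)"
  using someI_ex[OF vm_density_exists[OF assms]] unfolding vector_density_def by blast+

lemma total_variation_sigma_finite:
  fixes \<nu> :: "real set \<Rightarrow> 'a"
  assumes v: "vector_measure \<nu>"
  shows "finite_measure (total_variation_measure \<nu>)"
  by (rule finite_measure_total_variation[OF v total_variation_finite[OF v]])

lemma polar_density:
  fixes \<nu> :: "real set \<Rightarrow> 'a"
  assumes v: "vector_measure \<nu>"
  defines "M \<equiv> total_variation_measure \<nu>"
  shows "integrable M (vector_density M \<nu>)"
    "A \<in> sets borel \<Longrightarrow> \<nu> A = (LINT t:A|M. vector_density M \<nu> t)"
proof -
  interpret finite_measure M unfolding M_def by (rule total_variation_sigma_finite[OF v])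
  have ac: "\<nu> A = 0" if "A \<in> sets borel" "emeasure M A = 0" for A
    using norm_le_total_variation[OF v that(1)] that emeasure_total_variation_measure[OF v that(1)]
    by (simp add: M_def)
  have s: "sigma_finite_measure M" "sets M = sets borel"
    unfolding M_def[symmetric] by (unfold_locales) (simp add: M_def sets_total_variation_measure[OF v])
  show "integrable M (vector_density M \<nu>)"
    "A \<in> sets borel \<Longrightarrow> \<nu> A = (LINT t:A|M. vector_density M \<nu> t)"
    using vector_density[OF v s ac] by blast+
qed

text \<open>Exhaustion: a countable union of null sets attains the supremum of the total variation
  over all Lebesgue null sets. A disjoint null set charged by \<nu> could be added and would exceed
  the supremum.\<close>

lemma lebesgue_singular_carrier:
  fixes \<nu> :: "real set \<Rightarrow> 'a"
  assumes v: "vector_measure \<nu>"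
  shows "\<exists>N\<in>null_sets lborel. \<forall>A\<in>null_sets lborel. A \<inter> N = {} \<longrightarrow> \<nu> A = 0"
proof -
  let ?V = "total_variation_measure \<nu>"
  interpret V: finite_measure ?V by (rule total_variation_sigma_finite[OF v])
  have sV: "sets ?V = sets borel" by (rule sets_total_variation_measure[OF v])
  define S where "S = measure ?V ` null_sets lborel"
  have bS: "bdd_above S" unfolding S_def using V.bounded_measure by (intro bdd_aboveI) auto
  have neS: "S \<noteq> {}" unfolding S_def by auto
  have "\<exists>N\<in>null_sets lborel. Sup S - 1 / real (Suc n) < measure ?V N" for n
    using less_cSup_iff[OF neS bS, of "Sup S - 1 / real (Suc n)"] unfolding S_def by auto
  then obtain N where N: "\<And>n. N n \<in> null_sets lborel" "\<And>n. Sup S - 1 / real (Suc n) < measure ?V (N n)" by metis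
  define N' where "N' = (\<Union>n. N n)"
  have N': "N' \<in> null_sets lborel" unfolding N'_def using N(1) by blast
  have Nb: "N n \<in> sets borel" "N' \<in> sets borel" for n using null_setsD2[OF N(1)[of n]] null_setsD2[OF N'] by auto
  have ge: "Sup S \<le> measure ?V N'"
  proof (rule field_le_epsilon)
    fix e :: real assume "e > 0"
    then obtain n where n: "1 / real (Suc n) < e" using nat_approx_posE by metis
    have "measure ?V (N n) \<le> measure ?V N'" using Nb sV
      by (intro V.finite_measure_mono) (auto simp: N'_def)
    then show "Sup S \<le> measure ?V N' + e" using N(2)[of n] n by linarith
  qed
  have "\<nu> A = 0" if A: "A \<in> null_sets lborel" "A \<inter> N' = {}" for A
  proof -
    have Ab: "A \<in> sets borel" "N' \<in> sets borel" using A(1) N' by auto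
    have "measure ?V (N' \<union> A) \<le> Sup S" using A(1) N' bS unfolding S_def by (intro cSup_upper) auto
    moreover have "measure ?V (N' \<union> A) = measure ?V N' + measure ?V A"
      using Ab A(2) sV by (intro V.finite_measure_Union) auto
    ultimately have "measure ?V A \<le> 0" using ge by linarith
    then have "measure ?V A = 0" using measure_nonneg[of ?V A] by linarith
    then have "emeasure ?V A = 0" by (simp add: V.emeasure_eq_measure)
    then show ?thesis using norm_le_total_variation[OF v Ab(1)] emeasure_total_variation_measure[OF v Ab(1)] by simp
  qed
  then show ?thesis using N' by blast
qed

text \<open>The carrier is enlarged by the set J of atoms, so that the atoms do not enter the
  absolutely continuous part.\<close>

lemma ac_part_eq:
  fixes \<nu> :: "real set \<Rightarrow> 'a"
  assumes v: "vector_measure \<nu>" and J: "countable J"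
  obtains N where "N \<in> null_sets lborel" "J \<subseteq> N" "\<And>A. A \<in> null_sets lborel \<Longrightarrow> A \<inter> N = {} \<Longrightarrow> \<nu> A = 0"
    "ac_part \<nu> = (\<lambda>A. if A \<in> sets borel then \<nu> (A \<inter> - N) else 0)"
proof -
  obtain N0 where N0: "N0 \<in> null_sets lborel" "\<And>A. A \<in> null_sets lborel \<Longrightarrow> A \<inter> N0 = {} \<Longrightarrow> \<nu> A = 0"
    using lebesgue_singular_carrier[OF v] by blast
  have JN: "J \<in> null_sets lborel" using J by (rule countable_imp_null_set_lborel)
  define N where "N = N0 \<union> J"
  have N: "N \<in> null_sets lborel" unfolding N_def using N0(1) JN by blast
  have Nb: "N \<in> sets borel" using N by auto
  have z: "\<nu> A = 0" if "A \<in> null_sets lborel" "A \<inter> N = {}" for A using N0(2) that by (auto simp: N_def)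
  define \<alpha> where "\<alpha> = (\<lambda>A. if A \<in> sets borel then \<nu> (A \<inter> - N) else 0)"
  have \<alpha>: "vector_measure \<alpha>" unfolding \<alpha>_def using Nb by (intro vm_restrict[OF v]) auto
  have \<alpha>0: "\<alpha> A = 0" if "A \<in> null_sets lborel" for A
  proof -
    have "A \<inter> - N \<in> null_sets lborel" using that Nb by (intro null_set_Int2) auto
    then show ?thesis using that by (auto simp: \<alpha>_def intro!: z)
  qed
  have \<alpha>1: "\<nu> A - \<alpha> A = 0" if "A \<in> sets borel" "A \<inter> N = {}" for A
  proof -
    have "A \<inter> - N = A" using that by blast
    then show ?thesis using that by (simp add: \<alpha>_def)
  qed
  have "ac_part \<nu> = \<alpha>" unfolding ac_part_def
  proof (rule the_equality)
    show "vector_measure \<alpha> \<and> (\<forall>A\<in>null_sets lborel. \<alpha> A = 0) \<and>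
        (\<exists>N\<in>null_sets lborel. \<forall>A\<in>sets borel. A \<inter> N = {} \<longrightarrow> \<nu> A - \<alpha> A = 0)"
      using \<alpha> \<alpha>0 \<alpha>1 N by blast
  next
    fix \<kappa> assume \<kappa>: "vector_measure \<kappa> \<and> (\<forall>A\<in>null_sets lborel. \<kappa> A = 0) \<and>
        (\<exists>N\<in>null_sets lborel. \<forall>A\<in>sets borel. A \<inter> N = {} \<longrightarrow> \<nu> A - \<kappa> A = 0)"
    then obtain P where P: "P \<in> null_sets lborel" "\<And>A. A \<in> sets borel \<Longrightarrow> A \<inter> P = {} \<Longrightarrow> \<nu> A - \<kappa> A = 0" by blast
    have vk: "vector_measure \<kappa>" using \<kappa> by blast
    show "\<kappa> = \<alpha>"
    proof
      fix A
      show "\<kappa> A = \<alpha> A"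
      proof (cases "A \<in> sets borel")
        case False then show ?thesis using vector_measureD(1)[OF vk] by (simp add: \<alpha>_def)
      next
        case True
        \<comment> \<open>Off both exceptional sets the two candidates agree with \<nu>; on their
          union, which is Lebesgue null, both vanish.\<close>
        let ?Q = "N \<union> P"
        have Q: "?Q \<in> null_sets lborel" using N P(1) by auto
        then have Q: "?Q \<in> null_sets lborel" "?Q \<in> sets borel" using null_setsD2[OF Q] by auto
        have n: "A \<inter> ?Q \<in> null_sets lborel" using Q True by (intro null_set_Int1) auto
        have split: "\<rho> A = \<rho> (A - ?Q) + \<rho> (A \<inter> ?Q)" if "vector_measure \<rho>" for \<rho> :: "real set \<Rightarrow> 'a"
        proof -
          have "A = (A - ?Q) \<union> (A \<inter> ?Q)" by blast
          then show ?thesis using vm_Un[OF that, of "A - ?Q" "A \<inter> ?Q"] True Q(2) by (metis Diff_Int_distrib Diff_disjoint Int_Diff_disjoint inf.commute sets.Diff sets.Int)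
        qed
        have d: "(A - ?Q) \<in> sets borel" "(A - ?Q) \<inter> N = {}" "(A - ?Q) \<inter> P = {}" using True Q(2) by auto
        have "\<kappa> (A - ?Q) = \<alpha> (A - ?Q)" using P(2)[OF d(1,3)] \<alpha>1[OF d(1,2)] by simp
        moreover have "\<kappa> (A \<inter> ?Q) = 0" "\<alpha> (A \<inter> ?Q) = 0" using \<kappa> \<alpha>0 n by blast+
        ultimately show ?thesis using split[OF vk] split[OF \<alpha>] by simp
      qed
    qed
  qed
  then show thesis using that[OF N _ z] by (simp add: N_def \<alpha>_def)
qed

lemma jump_part_eq:
  fixes \<nu> :: "real set \<Rightarrow> 'a"
  assumes v: "vector_measure \<nu>" and J: "countable J" "\<And>t. t \<notin> J \<Longrightarrow> \<nu> {t} = 0" and A: "A \<in> sets borel"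
  shows "((\<lambda>t. \<nu> {t}) has_sum \<nu> (A \<inter> J)) (A \<inter> J)" "jump_part \<nu> A = \<nu> (A \<inter> J)"
proof -
  show hs: "((\<lambda>t. \<nu> {t}) has_sum \<nu> (A \<inter> J)) (A \<inter> J)"
  proof (cases "finite (A \<inter> J)")
    case True
    have "\<nu> (\<Union>t\<in>A \<inter> J. {t}) = (\<Sum>t\<in>A \<inter> J. \<nu> {t})" if "finite (A \<inter> J)"
    proof -
      have "\<nu> (\<Union>t\<in>I. {t}) = (\<Sum>t\<in>I. \<nu> {t})" if "finite I" for I using that
      proof induction
        case empty then show ?case using vm_empty[OF v] by simp
      next
        case (insert t I)
        have "\<nu> ({t} \<union> (\<Union>t\<in>I. {t})) = \<nu> {t} + \<nu> (\<Union>t\<in>I. {t})"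
          using insert.hyps by (intro vm_Un[OF v]) (auto intro: borel_closed finite_imp_closed)
        then show ?case using insert by simp
      qed
      then show ?thesis using that by blast
    qed
    then show ?thesis using has_sum_finite[OF True, of "\<lambda>t. \<nu> {t}"] True by simp
  next
    case False
    have c: "countable (A \<inter> J)" using J(1) by blast
    define g where "g = from_nat_into (A \<inter> J)"
    have g: "bij_betw g UNIV (A \<inter> J)" unfolding g_def using c False by (rule bij_betw_from_nat_into)
    have inj: "inj g" using g bij_betw_def by blast
    have d: "disjoint_family (\<lambda>i. {g i})" using inj by (auto simp: disjoint_family_on_def inj_def)
    have u: "(\<Union>i. {g i}) = A \<inter> J" using g by (auto simp: bij_betw_def)
    have s: "(\<lambda>i. \<nu> {g i}) sums \<nu> (A \<inter> J)"
      using vector_measureD(2)[OF v _ d] unfolding u by (simp add: image_subset_iff)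
    have AJ: "A \<inter> J \<in> sets borel" using null_setsD2[OF countable_imp_null_set_lborel[OF J(1)]] A by auto
    \<comment> \<open>The unordered sum in \<open>jump_part\<close> requires absolute summability,
      which comes from the finite total variation.\<close>
    have "(\<Sum>i. ennreal (norm (\<nu> {g i}))) \<le> total_variation \<nu> (A \<inter> J)"
      using d u by (intro total_variation_upper) auto
    also have "\<dots> \<le> total_variation \<nu> UNIV" using AJ by (intro total_variation_mono[OF v]) auto
    also have "\<dots> < \<infinity>" by (rule total_variation_finite[OF v])
    finally have "summable (\<lambda>i. norm (\<nu> {g i}))"
      by (intro summable_suminf_not_top) (auto simp: less_top)
    then have "((\<lambda>i. \<nu> {g i}) has_sum \<nu> (A \<inter> J)) UNIV"
      by (rule norm_summable_imp_has_sum[OF _ s])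
    then show ?thesis using has_sum_reindex_bij_betw[OF g, of "\<lambda>t. \<nu> {t}"] by simp
  qed
  have "infsum (\<lambda>t. \<nu> {t}) A = infsum (\<lambda>t. \<nu> {t}) (A \<inter> J)"
    using J(2) by (intro infsum_cong_neutral) auto
  then show "jump_part \<nu> A = \<nu> (A \<inter> J)" using infsumI[OF hs] A by (simp add: jump_part_def)
qed

lemma co_density:
  fixes \<nu> :: "real set \<Rightarrow> 'a"
  assumes v: "vector_measure \<nu>" and J: "countable J" "\<And>t. t \<notin> J \<Longrightarrow> \<nu> {t} = 0"
  defines "M \<equiv> reference_measure \<nu>"
  shows "sets M = sets borel" "space M = UNIV" "integrable M (vector_density M (co_part \<nu>))"
    "\<And>A. A \<in> sets borel \<Longrightarrow> \<nu> (A - J) = (LINT t:A|M. vector_density M (co_part \<nu>) t)"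
proof -
  obtain N where N: "N \<in> null_sets lborel" "J \<subseteq> N" "\<And>A. A \<in> null_sets lborel \<Longrightarrow> A \<inter> N = {} \<Longrightarrow> \<nu> A = 0"
    "ac_part \<nu> = (\<lambda>A. if A \<in> sets borel then \<nu> (A \<inter> - N) else 0)" using ac_part_eq[OF v J(1)] by metis
  have Jb: "J \<in> sets borel" using countable_imp_null_set_lborel[OF J(1)] by auto
  have Nb: "N \<in> sets borel" using N(1) by auto
  define \<gamma> where "\<gamma> = (\<lambda>A. if A \<in> sets borel then \<nu> (A \<inter> (N - J)) else 0)"
  have \<gamma>: "vector_measure \<gamma>" unfolding \<gamma>_def using Nb Jb by (intro vm_restrict[OF v]) auto
  have ca: "cantor_part \<nu> = \<gamma>"
  proof
    fix A
    show "cantor_part \<nu> A = \<gamma> A"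
    proof (cases "A \<in> sets borel")
      case False
      then show ?thesis using vector_measureD(1)[OF v] by (simp add: cantor_part_def N(4) \<gamma>_def jump_part_def)
    next
      case True
      have "A = (A \<inter> - N) \<union> ((A \<inter> (N - J)) \<union> (A \<inter> J))" using N(2) by blast
      also have "\<nu> \<dots> = \<nu> (A \<inter> - N) + \<nu> ((A \<inter> (N - J)) \<union> (A \<inter> J))"
        using True Nb Jb N(2) by (intro vm_Un[OF v]) auto
      also have "\<nu> ((A \<inter> (N - J)) \<union> (A \<inter> J)) = \<nu> (A \<inter> (N - J)) + \<nu> (A \<inter> J)"
        using True Nb Jb by (intro vm_Un[OF v]) auto
      finally show ?thesis using True jump_part_eq(2)[OF v J True] by (simp add: cantor_part_def N(4) \<gamma>_def)
    qed
  qed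
  have co: "co_part \<nu> = (\<lambda>A. if A \<in> sets borel then \<nu> (A \<inter> - J) else 0)"
  proof
    fix A
    show "co_part \<nu> A = (if A \<in> sets borel then \<nu> (A \<inter> - J) else 0)"
    proof (cases "A \<in> sets borel")
      case False
      then show ?thesis using vector_measureD(1)[OF v]
        by (simp add: co_part_def cantor_part_def N(4) jump_part_def)
    next
      case True
      have "\<nu> (A - A \<inter> J) = \<nu> A - \<nu> (A \<inter> J)" using True Jb by (intro vm_Diff[OF v]) auto
      moreover have "A - A \<inter> J = A \<inter> - J" by blast
      ultimately show ?thesis using True jump_part_eq(2)[OF v J True] by (simp add: co_part_def cantor_part_def)
    qed
  qed
  have vco: "vector_measure (co_part \<nu>)" unfolding co using Jb by (intro vm_restrict[OF v]) auto
  define m where "m A = emeasure lborel A + total_variation \<gamma> A" for A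
  have m0: "m {} = 0" using total_variation_empty[OF \<gamma>] by (simp add: m_def)
  have mc: "countably_additive (sets borel) m" unfolding countably_additive_def
  proof (intro allI impI)
    fix A :: "nat \<Rightarrow> real set" assume A: "range A \<subseteq> sets borel" "disjoint_family A" "(\<Union>i. A i) \<in> sets borel"
    have "(\<Sum>i. m (A i)) = (\<Sum>i. emeasure lborel (A i)) + (\<Sum>i. total_variation \<gamma> (A i))"
      unfolding m_def by (intro suminf_add[symmetric]) auto
    also have "(\<Sum>i. emeasure lborel (A i)) = emeasure lborel (\<Union>i. A i)" using A by (intro suminf_emeasure) auto
    also have "(\<Sum>i. total_variation \<gamma> (A i)) = total_variation \<gamma> (\<Union>i. A i)"
      using total_variation_countably_additive[OF \<gamma>] A by (auto simp: countably_additive_def)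
    finally show "(\<Sum>i. m (A i)) = m (\<Union>i. A i)" by (simp add: m_def)
  qed
  have Mm: "M = measure_of UNIV (sets borel) m"
    unfolding M_def reference_measure_def ca m_def by simp
  note M = measure_of_borel[OF m0 mc, folded Mm]
  show "sets M = sets borel" "space M = UNIV" using M by blast+
  have sf: "sigma_finite_measure M"
  proof
    let ?A = "range (\<lambda>n. {- real n..real n})"
    have u: "(\<Union>n. {- real n..real n}) = UNIV"
    proof (safe; simp)
      fix x :: real
      obtain n where "\<bar>x\<bar> < real n" using reals_Archimedean2 by blast
      then show "\<exists>n. - real n \<le> x \<and> x \<le> real n" by (intro exI[of _ n]) auto
    qed
    have "emeasure M {- real n..real n} \<noteq> \<infinity>" for n
    proof -
      have "total_variation \<gamma> {- real n..real n} \<le> total_variation \<gamma> UNIV" by (intro total_variation_mono[OF \<gamma>]) auto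
      then have "total_variation \<gamma> {- real n..real n} < \<infinity>" using total_variation_finite[OF \<gamma>] by (rule le_less_trans)
      then show ?thesis using M(3)[of "{- real n..real n}"] by (simp add: m_def)
    qed
    then show "\<exists>A. countable A \<and> A \<subseteq> sets M \<and> \<Union> A = space M \<and> (\<forall>a\<in>A. emeasure M a \<noteq> \<infinity>)"
      using M u by (intro exI[of _ ?A]) auto
  qed
  have ac: "co_part \<nu> A = 0" if A: "A \<in> sets borel" "emeasure M A = 0" for A
  proof -
    have "emeasure lborel A = 0" "total_variation \<gamma> A = 0" using M(3)[OF A(1)] A(2) by (auto simp: m_def)
    have "\<gamma> A = 0" using norm_le_total_variation[OF \<gamma> A(1)] \<open>total_variation \<gamma> A = 0\<close> by simp
    moreover have "A \<inter> - N \<in> null_sets lborel"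
      using A(1) Nb \<open>emeasure lborel A = 0\<close> by (intro null_set_Int2) (auto simp: null_sets_def)
    then have "\<nu> (A \<inter> - N) = 0" by (intro N(3)) auto
    ultimately show ?thesis unfolding co_part_def ca N(4) using A by simp
  qed
  show "integrable M (vector_density M (co_part \<nu>))"
    by (rule vector_density(1)[OF vco sf M(1) ac])
  show "\<nu> (A - J) = (LINT t:A|M. vector_density M (co_part \<nu>) t)" if "A \<in> sets borel" for A
    using vector_density(2)[OF vco sf M(1) ac that] that unfolding co by (simp add: Diff_eq)
qed

end

section \<open>Regulated functions and their Stieltjes measures\<close>

lemma mono_left_limit:
  fixes F :: "real \<Rightarrow> real" assumes "mono F"
  shows "\<exists>l. (F \<longlongrightarrow> l) (at_left t)"
  using Lim_left_bound[of UNIV t F "F t"] monoD[OF assms] by auto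

lemma mono_right_limit:
  fixes F :: "real \<Rightarrow> real" assumes "mono F"
  shows "\<exists>l. (F \<longlongrightarrow> l) (at_right t)"
  using Lim_right_bound[of UNIV t F "F t"] monoD[OF assms] by auto

abbreviation "LL f t \<equiv> Lim (at_left t) f"
abbreviation "RL f t \<equiv> Lim (at_right t) f"

lemma
  fixes F :: "real \<Rightarrow> real" assumes F: "mono F"
  shows tendsto_mono_LL: "(F \<longlongrightarrow> LL F t) (at_left t)"
    and mono_le_LL: "s < t \<Longrightarrow> F s \<le> LL F t" and mono_LL_le: "LL F t \<le> F t"
proof -
  obtain l where l: "(F \<longlongrightarrow> l) (at_left t)" using mono_left_limit[OF F] by blast
  have e: "LL F t = l" by (rule tendsto_Lim[OF _ l]) simp
  show "(F \<longlongrightarrow> LL F t) (at_left t)" unfolding e by (rule l)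
  show "LL F t \<le> F t" unfolding e
    by (rule tendsto_upperbound[OF l]) (auto simp: eventually_at_left_field intro!: monoD[OF F] exI[of _ "t - 1"])
  show "F s \<le> LL F t" if "s < t" unfolding e
    by (rule tendsto_lowerbound[OF l]) (use that in \<open>auto simp: eventually_at_left_field intro!: monoD[OF F] exI[of _ s]\<close>)
qed

lemma
  fixes F :: "real \<Rightarrow> real" assumes F: "mono F"
  shows tendsto_mono_RL: "(F \<longlongrightarrow> RL F t) (at_right t)"
    and mono_RL_le: "t < s \<Longrightarrow> RL F t \<le> F s" and mono_le_RL: "F t \<le> RL F t"
proof -
  obtain l where l: "(F \<longlongrightarrow> l) (at_right t)" using mono_right_limit[OF F] by blast
  have e: "RL F t = l" by (rule tendsto_Lim[OF _ l]) simp
  show "(F \<longlongrightarrow> RL F t) (at_right t)" unfolding e by (rule l)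
  show "F t \<le> RL F t" unfolding e
    by (rule tendsto_lowerbound[OF l]) (auto simp: eventually_at_right_field intro!: monoD[OF F] exI[of _ "t + 1"])
  show "RL F t \<le> F s" if "t < s" unfolding e
    by (rule tendsto_upperbound[OF l]) (use that in \<open>auto simp: eventually_at_right_field intro!: monoD[OF F] exI[of _ s]\<close>)
qed

text \<open>Interval measures are built from right-continuous functions, so the right limits of
  \<open>F\<close> are used. Restriction to the open interval matches the domain of the
  distributional derivative and discards jumps at 0 and \<open>T\<close>.\<close>

lemma mono_stieltjes_measure:
  fixes F :: "real \<Rightarrow> real"
  assumes F: "mono F" and T: "T > 0"
  obtains m where "finite_measure m" "sets m = sets borel"
    "\<And>A. A \<in> sets borel \<Longrightarrow> measure m A = measure m (A \<inter> {0<..<T})"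
    "\<And>a b. 0 \<le> a \<Longrightarrow> a < b \<Longrightarrow> b \<le> T \<Longrightarrow> measure m {a<..<b} = LL F b - RL F a"
proof -
  let ?H = "RL F"
  have H: "?H x \<le> ?H y" if "x \<le> y" for x y
    using that mono_RL_le[OF F, of x y] mono_le_RL[OF F, of y] by (cases "x = y") auto
  have Hr: "continuous (at_right a) ?H" for a
    unfolding continuous_within
  proof (rule tendsto_sandwich)
    show "\<forall>\<^sub>F x in at_right a. ?H a \<le> ?H x" using H
      by (auto simp: eventually_at_right_field intro!: exI[of _ "a + 1"])
    \<comment> \<open>The point \<open>2 * x - a\<close> lies to the right of \<open>x\<close>, so
      the value of \<open>F\<close> there dominates the right limit at \<open>x\<close>; and it
      still tends to \<open>a\<close> from the right.\<close>
    show "\<forall>\<^sub>F x in at_right a. ?H x \<le> F (2 * x - a)" using mono_RL_le[OF F]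
      by (auto simp: eventually_at_right_field intro!: exI[of _ "a + 1"])
    have "filterlim (\<lambda>x. 2 * x - a) (at_right a) (at_right a)"
    proof (rule filterlim_at_withinI)
      have "((\<lambda>x. 2 * x - a) \<longlongrightarrow> 2 * a - a) (at_right a)" by (intro tendsto_intros)
      then show "filterlim (\<lambda>x. 2 * x - a) (nhds a) (at_right a)" by simp
      show "\<forall>\<^sub>F x in at_right a. 2 * x - a \<in> {a<..} - {a}"
        by (auto simp: eventually_at_right_field intro!: exI[of _ "a + 1"])
    qed
    then show "((\<lambda>x. F (2 * x - a)) \<longlongrightarrow> ?H a) (at_right a)"
      by (rule filterlim_compose[OF tendsto_mono_RL[OF F]])
  qed simp
  let ?I = "interval_measure ?H"
  define m where "m = density ?I (indicator {0<..<T})"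
  have sm: "sets m = sets borel" by (simp add: m_def)
  have e: "emeasure m A = emeasure ?I (A \<inter> {0<..<T})" if "A \<in> sets borel" for A
    using that by (simp add: m_def emeasure_density indicator_inter_arith[symmetric] Int_commute)
  have Ioc: "emeasure ?I {a<..b} = ennreal (?H b - ?H a)" if "a \<le> b" for a b
    by (rule emeasure_interval_measure_Ioc[OF that H Hr])
  have fin: "finite_measure m"
  proof (rule finite_measureI)
    have "emeasure m UNIV \<le> emeasure ?I {0<..T}" unfolding e[OF sets.top, simplified] by (auto intro!: emeasure_mono)
    then show "emeasure m (space m) \<noteq> \<infinity>" using Ioc[of 0 T] T by (auto simp: m_def top_unique)
  qed
  interpret m: finite_measure m by (rule fin)
  have me: "measure m A = measure m (A \<inter> {0<..<T})" if "A \<in> sets borel" for A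
    using e[OF that] e[of "A \<inter> {0<..<T}"] that by (simp add: measure_def Int_assoc)
  have "measure m {a<..<b} = LL F b - ?H a" if ab: "0 \<le> a" "a < b" "b \<le> T" for a b
  proof -
    define r where "r n = b - (b - a) / real (Suc (Suc n))" for n
    have r: "a \<le> r n" "r n < b" for n
    proof -
      have "(b - a) / real (Suc (Suc n)) \<le> (b - a) / 1" using ab by (intro divide_left_mono) auto
      moreover have "(b - a) / real (Suc (Suc n)) > 0" using ab by simp
      ultimately show "a \<le> r n" "r n < b" unfolding r_def by simp_all
    qed
    have rlim: "r \<longlonglongrightarrow> b"
    proof -
      have "(\<lambda>n. (b - a) / real (Suc (Suc n))) \<longlonglongrightarrow> 0"
        by (intro LIMSEQ_Suc[OF LIMSEQ_Suc[OF lim_const_over_n]])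
      then have "(\<lambda>n. b - (b - a) / real (Suc (Suc n))) \<longlonglongrightarrow> b - 0" by (intro tendsto_intros)
      then show ?thesis by (simp add: r_def[abs_def])
    qed
    have rinc: "incseq r"
    proof (rule incseq_SucI)
      fix n show "r n \<le> r (Suc n)" unfolding r_def using ab
        by (intro diff_left_mono divide_left_mono) auto
    qed
    have u: "(\<Union>n. {a<..r n}) = {a<..<b}"
    proof (intro set_eqI iffI)
      fix x assume "x \<in> (\<Union>n. {a<..r n})"
      then show "x \<in> {a<..<b}" using r by (auto intro: le_less_trans)
    next
      fix x assume x: "x \<in> {a<..<b}"
      then have "\<forall>\<^sub>F n in sequentially. x < r n" by (intro order_tendstoD(1)[OF rlim]) auto
      then obtain n where "x < r n" by (auto simp: eventually_sequentially)
      then show "x \<in> (\<Union>n. {a<..r n})" using x by (auto intro!: exI[of _ n])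
    qed
    have "{a<..r i} \<subseteq> {a<..r j}" if "i \<le> j" for i j using incseqD[OF rinc that] by auto
    then have "(\<lambda>n. measure m {a<..r n}) \<longlonglongrightarrow> measure m (\<Union>n. {a<..r n})"
      by (intro m.finite_Lim_measure_incseq) (auto simp: sm incseq_def)
    moreover have "measure m {a<..r n} = ?H (r n) - ?H a" for n
    proof -
      have "{a<..r n} \<inter> {0<..<T} = {a<..r n}" using r[of n] ab by auto
      then have "emeasure m {a<..r n} = ennreal (?H (r n) - ?H a)" using e[of "{a<..r n}"] Ioc[OF r(1)[of n]] by simp
      then show ?thesis using H[OF r(1)[of n]] by (simp add: measure_def)
    qed
    ultimately have 1: "(\<lambda>n. ?H (r n) - ?H a) \<longlonglongrightarrow> measure m {a<..<b}" unfolding u by simp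
    have "(\<lambda>n. ?H (r n)) \<longlonglongrightarrow> LL F b"
    proof (rule tendsto_sandwich)
      show "\<forall>\<^sub>F n in sequentially. F (r n) \<le> ?H (r n)" using mono_le_RL[OF F] by simp
      show "\<forall>\<^sub>F n in sequentially. ?H (r n) \<le> LL F b"
      proof (intro always_eventually allI)
        fix n
        obtain y where y: "r n < y" "y < b" using dense r(2) by blast
        show "?H (r n) \<le> LL F b" using mono_RL_le[OF F y(1)] mono_le_LL[OF F y(2)] by linarith
      qed
      have "filterlim r (at_left b) sequentially"
        using rlim r by (intro filterlim_at_withinI) (auto intro!: always_eventually simp: less_imp_neq)
      then show "(\<lambda>n. F (r n)) \<longlonglongrightarrow> LL F b" by (rule filterlim_compose[OF tendsto_mono_LL[OF F]])
    qed simp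
    then have "(\<lambda>n. ?H (r n) - ?H a) \<longlonglongrightarrow> LL F b - ?H a" by (intro tendsto_intros)
    then show ?thesis using 1 LIMSEQ_unique by blast
  qed
  then show thesis using that fin sm me by blast
qed

text \<open>A nondecreasing control of the increments stands in for bounded variation. Constancy
  outside the interval makes the one-sided limits on the line agree with the conventions at 0 and
  \<open>T\<close>.\<close>

locale bv_curve = finite_dim_basis B for B :: "'a::{banach,second_countable_topology} set" +
  fixes u :: "real \<Rightarrow> 'a" and G :: "real \<Rightarrow> real" and T :: real
  assumes T_pos: "T > 0" and mono_G: "mono G"
    and increment: "a \<le> b \<Longrightarrow> norm (u b - u a) \<le> G b - G a"
    and left_const: "t \<le> 0 \<Longrightarrow> u t = u 0" and right_const: "t \<ge> T \<Longrightarrow> u t = u T"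
begin

text \<open>Adding a multiple of the control G makes each coordinate of the curve nondecreasing.\<close>

definition F :: "'a \<Rightarrow> real \<Rightarrow> real" where "F b t = cf (u t) b + cC * G t"

lemma cf_diff: "cf (x - y) b = cf x b - cf y b"
  using cf_add[of "x - y" y b] by simp

lemma mono_F: assumes "b \<in> B" shows "mono (F b)"
proof (rule monoI)
  fix x y :: real assume xy: "x \<le> y"
  have "\<bar>cf (u y - u x) b\<bar> \<le> cC * (G y - G x)"
    using cf_le[OF assms, of "u y - u x"] mult_left_mono[OF increment[OF xy], of cC] cC(1) by linarith
  then show "F b x \<le> F b y" unfolding F_def cf_diff by (simp add: algebra_simps abs_le_iff)
qed

lemma u_expand: "u t = (\<Sum>b\<in>B. (F b t - cC * G t) *\<^sub>R b)"
  using expand[of "u t"] by (simp add: F_def)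

lemma tendsto_LL: "(u \<longlongrightarrow> LL u t) (at_left t)"
  and LL_expand: "LL u t = (\<Sum>b\<in>B. (LL (F b) t - cC * LL G t) *\<^sub>R b)"
proof -
  have "((\<lambda>t. \<Sum>b\<in>B. (F b t - cC * G t) *\<^sub>R b) \<longlongrightarrow> (\<Sum>b\<in>B. (LL (F b) t - cC * LL G t) *\<^sub>R b)) (at_left t)"
    by (intro tendsto_sum tendsto_scaleR tendsto_diff tendsto_mult tendsto_const tendsto_mono_LL mono_F mono_G)
  then have 1: "(u \<longlongrightarrow> (\<Sum>b\<in>B. (LL (F b) t - cC * LL G t) *\<^sub>R b)) (at_left t)" by (simp add: u_expand[symmetric])
  show "LL u t = (\<Sum>b\<in>B. (LL (F b) t - cC * LL G t) *\<^sub>R b)" by (rule tendsto_Lim[OF _ 1]) simp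
  then show "(u \<longlongrightarrow> LL u t) (at_left t)" using 1 by simp
qed

lemma tendsto_RL: "(u \<longlongrightarrow> RL u t) (at_right t)"
  and RL_expand: "RL u t = (\<Sum>b\<in>B. (RL (F b) t - cC * RL G t) *\<^sub>R b)"
proof -
  have "((\<lambda>t. \<Sum>b\<in>B. (F b t - cC * G t) *\<^sub>R b) \<longlongrightarrow> (\<Sum>b\<in>B. (RL (F b) t - cC * RL G t) *\<^sub>R b)) (at_right t)"
    by (intro tendsto_sum tendsto_scaleR tendsto_diff tendsto_mult tendsto_const tendsto_mono_RL mono_F mono_G)
  then have 1: "(u \<longlongrightarrow> (\<Sum>b\<in>B. (RL (F b) t - cC * RL G t) *\<^sub>R b)) (at_right t)" by (simp add: u_expand[symmetric])
  show "RL u t = (\<Sum>b\<in>B. (RL (F b) t - cC * RL G t) *\<^sub>R b)" by (rule tendsto_Lim[OF _ 1]) simp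
  then show "(u \<longlongrightarrow> RL u t) (at_right t)" using 1 by simp
qed

lemma left_lim_eq: "left_lim u t = LL u t"
proof (cases "t \<le> 0")
  case True
  have "\<forall>\<^sub>F s in at_left t. u s = u 0"
    using True by (auto simp: eventually_at_left_field intro!: exI[of _ "t - 1"] left_const)
  then have "(u \<longlongrightarrow> u 0) (at_left t)" by (rule tendsto_eventually)
  then have "LL u t = u 0" using tendsto_Lim[of "at_left t"] by simp
  then show ?thesis using True by (simp add: left_lim_def)
qed (simp add: left_lim_def)

lemma right_lim_eq: "right_lim T u t = RL u t"
proof (cases "t \<ge> T")
  case True
  have "\<forall>\<^sub>F s in at_right t. u s = u T"
    using True by (auto simp: eventually_at_right_field intro!: exI[of _ "t + 1"] right_const)
  then have "(u \<longlongrightarrow> u T) (at_right t)" by (rule tendsto_eventually)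
  then have "RL u t = u T" using tendsto_Lim[of "at_right t"] by simp
  then show ?thesis using True by (simp add: right_lim_def)
qed (simp add: right_lim_def)

lemma isCont_u: assumes "isCont G t" shows "isCont u t"
  unfolding isCont_def
proof (rule LIM_zero_cancel, rule Lim_null_comparison)
  show "\<forall>\<^sub>F s in at t. norm (u s - u t) \<le> \<bar>G s - G t\<bar>"
  proof (intro always_eventually allI)
    fix s show "norm (u s - u t) \<le> \<bar>G s - G t\<bar>"
      using increment[of s t] increment[of t s] by (cases "s \<le> t") (auto simp: norm_minus_commute)
  qed
  have "((\<lambda>s. \<bar>G s - G t\<bar>) \<longlongrightarrow> \<bar>G t - G t\<bar>) (at t)" using assms by (intro tendsto_intros) (simp add: isCont_def)
  then show "((\<lambda>s. \<bar>G s - G t\<bar>) \<longlongrightarrow> 0) (at t)" by simp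
qed

text \<open>The discontinuities of the control instead of those of the curve: monotonicity makes
  them countable, and they contain the jump set, possibly strictly.\<close>

definition JG :: "real set" where "JG = {t. \<not> isCont G t}"

lemma countable_JG: "countable JG" unfolding JG_def by (rule mono_ctble_discont[OF mono_G])

lemma no_jump: assumes "t \<notin> JG" shows "LL u t = u t" "RL u t = u t"
proof -
  have "(u \<longlongrightarrow> u t) (at t)" using isCont_u assms by (auto simp: JG_def isCont_def)
  then have "(u \<longlongrightarrow> u t) (at_left t)" "(u \<longlongrightarrow> u t) (at_right t)"
    by (auto intro: tendsto_mono[OF at_le])
  then show "LL u t = u t" "RL u t = u t" by (auto intro: tendsto_Lim)
qed

lemma jump_set_subset: "jump_set T u \<subseteq> JG"
proof
  fix t assume "t \<in> jump_set T u"
  then have "LL u t \<noteq> u t \<or> RL u t \<noteq> u t" by (auto simp: jump_set_def left_lim_eq right_lim_eq)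
  then show "t \<in> JG" using no_jump[of t] by blast
qed

lemma borel_measurable_u [measurable]: "u \<in> borel_measurable borel"
proof -
  have "(\<lambda>t. \<Sum>b\<in>B. (F b t - cC * G t) *\<^sub>R b) \<in> borel_measurable borel"
    using borel_measurable_mono[OF mono_F] borel_measurable_mono[OF mono_G] by measurable
  then show ?thesis by (simp add: u_expand[symmetric])
qed

text \<open>Each coordinate of the curve is the difference of the nondecreasing functions
  \<open>F b\<close> and \<open>cC * G\<close>. Their Stieltjes measures are subtracted and
  recombined along the basis.\<close>

lemma stieltjes_exists:
  "\<exists>\<nu>. vector_measure \<nu> \<and> (\<forall>A\<in>sets borel. \<nu> A = \<nu> (A \<inter> {0<..<T})) \<and>
     (\<forall>a b. 0 \<le> a \<longrightarrow> a < b \<longrightarrow> b \<le> T \<longrightarrow> \<nu> {a<..<b} = LL u b - RL u a)"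
proof -
  obtain mG where mG: "finite_measure mG" "sets mG = sets borel"
    "\<And>A. A \<in> sets borel \<Longrightarrow> measure mG A = measure mG (A \<inter> {0<..<T})"
    "\<And>a b. 0 \<le> a \<Longrightarrow> a < b \<Longrightarrow> b \<le> T \<Longrightarrow> measure mG {a<..<b} = LL G b - RL G a"
    using mono_stieltjes_measure[OF mono_G T_pos] by blast
  define P where "P b m \<longleftrightarrow> finite_measure m \<and> sets m = sets borel \<and>
    (\<forall>A. A \<in> sets borel \<longrightarrow> measure m A = measure m (A \<inter> {0<..<T})) \<and>
    (\<forall>c d. 0 \<le> c \<longrightarrow> c < d \<longrightarrow> d \<le> T \<longrightarrow> measure m {c<..<d} = LL (F b) d - RL (F b) c)" for b m
  have "\<exists>m. P b m" if "b \<in> B" for b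
  proof (rule mono_stieltjes_measure[OF mono_F[OF that] T_pos])
    fix m assume a: "finite_measure m" "sets m = sets borel"
      "\<And>A. A \<in> sets borel \<Longrightarrow> measure m A = measure m (A \<inter> {0<..<T})"
      "\<And>c d. 0 \<le> c \<Longrightarrow> c < d \<Longrightarrow> d \<le> T \<Longrightarrow> measure m {c<..<d} = LL (F b) d - RL (F b) c"
    have "P b m" unfolding P_def by (intro conjI allI impI; rule a; assumption)
    then show ?thesis by blast
  qed
  then obtain m where m': "\<And>b. b \<in> B \<Longrightarrow> P b (m b)" by metis
  note m = m'[unfolded P_def, THEN conjunct1] m'[unfolded P_def, THEN conjunct2, THEN conjunct1]
    m'[unfolded P_def, THEN conjunct2, THEN conjunct2, THEN conjunct1, rule_format]
    m'[unfolded P_def, THEN conjunct2, THEN conjunct2, THEN conjunct2, rule_format]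
  define \<nu> where "\<nu> A = (\<Sum>b\<in>B. (measure (m b) A - cC * measure mG A) *\<^sub>R b)" for A
  have "vector_measure \<nu>" unfolding \<nu>_def
  proof (rule vm_sum)
    fix b assume b: "b \<in> B"
    have bl: "bounded_linear (\<lambda>x. x *\<^sub>R b)" "bounded_linear (\<lambda>x. cC * x)" for b :: 'a
      by (rule bounded_linear_scaleR_left bounded_linear_mult_right)+
    have "vector_measure (\<lambda>A. measure (m b) A - cC * measure mG A)"
      using vm_measure[OF m(1)[OF b] m(2)[OF b]] vm_linear[OF vm_measure[OF mG(1,2)] bl(2)] by (rule vm_diff)
    then show "vector_measure (\<lambda>A. (measure (m b) A - cC * measure mG A) *\<^sub>R b)"
      by (rule vm_linear[OF _ bl(1)])
  qed
  moreover have "\<nu> A = \<nu> (A \<inter> {0<..<T})" if "A \<in> sets borel" for A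
    unfolding \<nu>_def using m(3)[OF _ that] mG(3)[OF that] by (intro sum.cong) auto
  moreover have "\<nu> {a<..<b} = LL u b - RL u a" if "0 \<le> a" "a < b" "b \<le> T" for a b
    unfolding \<nu>_def LL_expand RL_expand sum_subtractf[symmetric] scaleR_diff_left[symmetric]
    by (intro sum.cong refl arg_cong2[where f=scaleR])
      (use m(4)[OF _ that] mG(4)[OF that] in \<open>simp add: right_diff_distrib\<close>)
  ultimately show ?thesis by blast
qed

end

section \<open>The distributional derivative\<close>

text \<open>Squaring removes the corner of the positive part; the resulting C1 function is the
  building block of the bumps.\<close>

lemma DERIV_max_square: "((\<lambda>x::real. (max 0 x)\<^sup>2) has_real_derivative 2 * max 0 x) (at x)"
proof (cases "x = 0")
  case True
  have "((\<lambda>h. (max 0 (0 + h))\<^sup>2 / h) \<longlongrightarrow> 0) (at (0::real))"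
  proof (rule Lim_null_comparison)
    show "\<forall>\<^sub>F h in at (0::real). norm ((max 0 (0 + h))\<^sup>2 / h) \<le> \<bar>h\<bar>"
    proof (intro always_eventually allI)
      fix h :: real show "norm ((max 0 (0 + h))\<^sup>2 / h) \<le> \<bar>h\<bar>"
        by (cases "h > 0") (auto simp: power2_eq_square max_def)
    qed
    show "((\<lambda>h. \<bar>h\<bar>) \<longlongrightarrow> 0) (at (0::real))" by (rule tendsto_rabs_zero) simp
  qed
  then show ?thesis using True by (simp add: DERIV_def)
next
  case False
  show ?thesis
  proof (cases "x > 0")
    case True
    then have "((\<lambda>x::real. x\<^sup>2) has_real_derivative 2 * max 0 x) (at x)"
      by (auto intro!: derivative_eq_intros simp: max_def)
    then show ?thesis
      by (rule has_field_derivative_transform_within_open[where S="{0<..}"]) (use True in auto)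
  next
    case neg: False
    have "((\<lambda>x::real. 0) has_real_derivative 0) (at x)" by simp
    then have "((\<lambda>x::real. (max 0 x)\<^sup>2) has_real_derivative 0) (at x)"
      by (rule has_field_derivative_transform_within_open[where S="{..<0}"]) (use False neg in auto)
    moreover have "2 * max 0 x = 0" using neg by simp
    ultimately show ?thesis by simp
  qed
qed

text \<open>As k tends to infinity, these continuously differentiable bumps increase to the indicator
  of the interval from a to b.\<close>

definition bump :: "real \<Rightarrow> real \<Rightarrow> real \<Rightarrow> real \<Rightarrow> real" where
  "bump a b k t = k * (max 0 ((t - a) * (b - t)))\<^sup>2 / (1 + k * (max 0 ((t - a) * (b - t)))\<^sup>2)"

lemma bump_test_function:
  assumes ab: "0 < a" "a < b" "b < T" and k: "k \<ge> 0"
  shows "test_function T (bump a b k)"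
proof -
  let ?q = "\<lambda>t. (t - a) * (b - t)" and ?q' = "\<lambda>t. (b - t) - (t - a)"
  have P: "((\<lambda>t. (max 0 (?q t))\<^sup>2) has_real_derivative (2 * max 0 (?q t)) * ?q' t) (at t)" for t
    by (rule DERIV_chain2[OF DERIV_max_square]) (auto intro!: derivative_eq_intros)
  have pos: "1 + k * (max 0 (?q t))\<^sup>2 > 0" for t using k by (intro add_pos_nonneg) auto
  define D where "D t = k * ((2 * max 0 (?q t)) * ?q' t) / (1 + k * (max 0 (?q t))\<^sup>2)\<^sup>2" for t
  have quot: "((\<lambda>t. k * p t / (1 + k * p t)) has_real_derivative k * d / (1 + k * p t)\<^sup>2) (at t)"
    if "(p has_real_derivative d) (at t)" "1 + k * p t > 0" for p d t
    using that(2) by (auto intro!: derivative_eq_intros that(1)) (simp add: field_simps power2_eq_square)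
  have "(bump a b k has_real_derivative D t) (at t)" for t
    unfolding bump_def[abs_def] D_def by (rule quot[OF P pos])
  moreover have "continuous_on UNIV D" unfolding D_def using pos
    by (intro continuous_intros) (auto simp: less_imp_neq[symmetric])
  ultimately have "bump a b k C1_differentiable_on UNIV"
    unfolding C1_differentiable_on_def has_real_derivative_iff_has_vector_derivative by blast
  moreover have cl: "closure {t. bump a b k t \<noteq> 0} \<subseteq> {a..b}"
  proof (rule closure_minimal)
    show "{t. bump a b k t \<noteq> 0} \<subseteq> {a..b}"
    proof (safe)
      fix t assume "bump a b k t \<noteq> 0"
      then have "max 0 (?q t) \<noteq> 0" by (auto simp: bump_def)
      then have "?q t > 0" by linarith
      then show "t \<in> {a..b}" using ab by (auto simp: zero_less_mult_iff)
    qed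
  qed simp
  moreover have "compact (closure {t. bump a b k t \<noteq> 0})"
    using cl by (meson bounded_closed_interval bounded_subset closed_closure compact_eq_bounded_closed)
  ultimately show ?thesis using ab unfolding test_function_def by auto
qed

lemma bump_bound: "k \<ge> 0 \<Longrightarrow> \<bar>bump a b k t\<bar> \<le> 1"
proof -
  assume k: "k \<ge> 0"
  have "\<bar>x / (1 + x)\<bar> \<le> 1" if "x \<ge> 0" for x :: real using that by (simp add: divide_le_eq)
  from this[of "k * (max 0 ((t - a) * (b - t)))\<^sup>2"] show ?thesis unfolding bump_def using k by simp
qed

lemma bump_limit:
  assumes "a < b"
  shows "(\<lambda>n. bump a b (real n) t) \<longlonglongrightarrow> indicator {a<..<b} t"
proof (cases "t \<in> {a<..<b}")
  case True
  define p where "p = (max 0 ((t - a) * (b - t)))\<^sup>2"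
  have p: "p > 0" using True by (simp add: p_def max_def)
  have "(\<lambda>n. 1 - 1 / (1 + real n * p)) \<longlonglongrightarrow> 1 - 0"
  proof (intro tendsto_diff[OF tendsto_const] tendsto_divide_0[OF tendsto_const] filterlim_at_top_imp_at_infinity)
    show "filterlim (\<lambda>n. 1 + real n * p) at_top sequentially"
      using p by (intro filterlim_tendsto_add_at_top[OF tendsto_const] filterlim_at_top_mult_tendsto_pos[OF tendsto_const _ filterlim_real_sequentially])
  qed
  moreover have "1 - 1 / (1 + real n * p) = bump a b (real n) t" for n
  proof -
    have "1 + real n * p > 0" using p by (intro add_pos_nonneg) auto
    then show ?thesis unfolding bump_def p_def[symmetric] by (simp add: field_simps)
  qed
  ultimately show ?thesis using True by simp
next
  case False
  then have "(t - a) * (b - t) \<le> 0" using assms by (auto simp: mult_le_0_iff)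
  then show ?thesis using False by (simp add: bump_def max_def)
qed

lemma Ioo_shrink:
  assumes "a < (b::real)"
  shows "\<exists>r s. (\<forall>n::nat. a < r n \<and> r n < s n \<and> s n < b) \<and> incseq (\<lambda>n. {r n<..<s n}) \<and> (\<Union>n. {r n<..<s n}) = {a<..<b}"
proof -
  \<comment> \<open>Denominators starting at 3 keep \<open>a + d n\<close> below
    \<open>b - d n\<close> already for \<open>n = 0\<close>.\<close>
  define d where "d n = (b - a) / real (3 + n)" for n
  have d: "0 < d n" "d n \<le> (b - a) / 3" for n
    using assms divide_left_mono[of 3 "real (3 + n)" "b - a"] by (auto simp: d_def)
  have dec: "d n \<le> d m" if "m \<le> n" for m n using that assms unfolding d_def by (intro divide_left_mono) auto
  have d0: "d \<longlonglongrightarrow> 0"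
    unfolding d_def using LIMSEQ_ignore_initial_segment[OF lim_const_over_n[of "b - a"], of 3] by (simp add: add.commute)
  have "a < a + d n \<and> a + d n < b - d n \<and> b - d n < b" for n using d[of n] assms by auto
  moreover have "incseq (\<lambda>n. {a + d n<..<b - d n})" using dec by (fastforce simp: incseq_def)
  moreover have "(\<Union>n. {a + d n<..<b - d n}) = {a<..<b}"
  proof (intro set_eqI iffI)
    fix x assume "x \<in> (\<Union>n. {a + d n<..<b - d n})"
    then obtain n where "a + d n < x" "x < b - d n" by auto
    then show "x \<in> {a<..<b}" using d(1)[of n] by auto
  next
    fix x assume x: "x \<in> {a<..<b}"
    then have "\<forall>\<^sub>F n in sequentially. d n < min (x - a) (b - x)" by (intro order_tendstoD(2)[OF d0]) auto
    then obtain n where "d n < min (x - a) (b - x)" by (auto simp: eventually_sequentially)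
    then show "x \<in> (\<Union>n. {a + d n<..<b - d n})" by (auto intro!: exI[of _ n])
  qed
  ultimately show ?thesis by (intro exI[of _ "\<lambda>n. a + d n"] exI[of _ "\<lambda>n. b - d n"]) blast
qed

text \<open>Compactly supported test functions reveal only intervals whose closure lies inside the
  open interval. The other intervals are cut to it and exhausted from inside.\<close>

lemma vm_eqI_Ioo:
  fixes \<nu> \<kappa> :: "real set \<Rightarrow> 'a::real_normed_vector"
  assumes v: "vector_measure \<nu>" and k: "vector_measure \<kappa>"
    and cv: "\<And>A. A \<in> sets borel \<Longrightarrow> \<nu> A = \<nu> (A \<inter> {0<..<T})"
    and ck: "\<And>A. A \<in> sets borel \<Longrightarrow> \<kappa> A = \<kappa> (A \<inter> {0<..<T})"
    and eq: "\<And>a b. 0 < a \<Longrightarrow> a < b \<Longrightarrow> b < T \<Longrightarrow> \<nu> {a<..<b} = \<kappa> {a<..<b}"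
  shows "\<nu> = \<kappa>"
proof (rule vm_eqI[OF v k])
  fix a b :: real assume "a < b"
  let ?a = "max a 0" and ?b = "min b T"
  have i: "{a<..<b} \<inter> {0<..<T} = {?a<..<?b}" by auto
  have "\<nu> {?a<..<?b} = \<kappa> {?a<..<?b}"
  proof (cases "?a < ?b")
    case False
    then have "{?a<..<?b} = {}" by auto
    then show ?thesis using vm_empty v k by metis
  next
    case True
    then obtain r s where rs: "\<forall>n::nat. ?a < r n \<and> r n < s n \<and> s n < ?b" "incseq (\<lambda>n. {r n<..<s n})"
      "(\<Union>n. {r n<..<s n}) = {?a<..<?b}" using Ioo_shrink[OF True] by blast
    have "(\<lambda>n. \<nu> {r n<..<s n}) \<longlonglongrightarrow> \<nu> {?a<..<?b}" "(\<lambda>n. \<kappa> {r n<..<s n}) \<longlonglongrightarrow> \<kappa> {?a<..<?b}"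
      using vm_incseq[OF v _ rs(2)] vm_incseq[OF k _ rs(2)] unfolding rs(3) by (simp_all add: image_subset_iff)
    moreover have "\<nu> {r n<..<s n} = \<kappa> {r n<..<s n}" for n using rs(1)[rule_format, of n] by (intro eq) auto
    ultimately show ?thesis by (simp add: LIMSEQ_unique)
  qed
  then show "\<nu> {a<..<b} = \<kappa> {a<..<b}" using cv[of "{a<..<b}"] ck[of "{a<..<b}"] i by simp
qed

context finite_dim_basis
begin

lemma bump_integral_limit:
  fixes \<nu> :: "real set \<Rightarrow> 'a"
  assumes v: "vector_measure \<nu>" and "a < b"
  shows "(\<lambda>n. vector_measure_integral \<nu> (bump a b (real n))) \<longlonglongrightarrow> \<nu> {a<..<b}"
proof -
  let ?M = "total_variation_measure \<nu>"
  let ?f = "vector_density ?M \<nu>"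
  have sM: "sets ?M = sets borel" by (rule sets_total_variation_measure[OF v])
  have bm: "bump a b k \<in> borel_measurable ?M" for k
    unfolding measurable_cong_sets[OF sM refl] bump_def[abs_def] by measurable
  have fm: "?f \<in> borel_measurable ?M" using polar_density(1)[OF v] by (rule borel_measurable_integrable)
  have im: "(\<lambda>t. indicator {a<..<b} t :: real) \<in> borel_measurable ?M"
    unfolding measurable_cong_sets[OF sM refl] by simp
  have "(\<lambda>n. LINT t|?M. bump a b (real n) t *\<^sub>R ?f t) \<longlonglongrightarrow> (LINT t|?M. indicator {a<..<b} t *\<^sub>R ?f t)"
  proof (rule integral_dominated_convergence[where w="\<lambda>t. norm (?f t)"])
    show "integrable ?M (\<lambda>t. norm (?f t))" using polar_density(1)[OF v] by simp
    show "AE t in ?M. (\<lambda>n. bump a b (real n) t *\<^sub>R ?f t) \<longlonglongrightarrow> indicator {a<..<b} t *\<^sub>R ?f t"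
      by (intro AE_I2 tendsto_scaleR bump_limit tendsto_const assms)
    show "AE t in ?M. norm (bump a b (real n) t *\<^sub>R ?f t) \<le> norm (?f t)" for n
      using bump_bound[of "real n"] by (intro AE_I2) (auto intro!: mult_left_le_one_le)
  qed (use bm fm im in auto)
  then show ?thesis using polar_density(2)[OF v, of "{a<..<b}"]
    by (simp add: vector_measure_integral_def set_lebesgue_integral_def)
qed

text \<open>Uniqueness behind the definite description in \<open>distributional_derivative\<close>:
  integrals of the bumps converge to the values on intervals.\<close>

lemma vm_eq_of_test_functions:
  fixes \<nu> \<kappa> :: "real set \<Rightarrow> 'a"
  assumes v: "vector_measure \<nu>" and k: "vector_measure \<kappa>"
    and cv: "\<And>A. A \<in> sets borel \<Longrightarrow> \<nu> A = \<nu> (A \<inter> {0<..<T})"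
    and ck: "\<And>A. A \<in> sets borel \<Longrightarrow> \<kappa> A = \<kappa> (A \<inter> {0<..<T})"
    and eq: "\<And>\<phi>. test_function T \<phi> \<Longrightarrow> vector_measure_integral \<nu> \<phi> = vector_measure_integral \<kappa> \<phi>"
  shows "\<nu> = \<kappa>"
proof (rule vm_eqI_Ioo[OF v k cv ck])
  fix a b :: real assume ab: "0 < a" "a < b" "b < T"
  show "\<nu> {a<..<b} = \<kappa> {a<..<b}"
    using bump_integral_limit[OF v ab(2)] bump_integral_limit[OF k ab(2)] eq[OF bump_test_function[OF ab]]
    by (simp add: LIMSEQ_unique)
qed

end

context bv_curve
begin

text \<open>Integration by parts as an exchange of integrals over the triangle 0 < s < t < T. For
  almost every \<open>t\<close> the curve equals its right limit at 0 plus the mass of the interval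
  from 0 to \<open>t\<close>; integrating the derivative of \<phi> from \<open>s\<close> to
  \<open>T\<close> gives \<open>- \<phi> s\<close>.\<close>

lemma test_function_identity:
  assumes v: "vector_measure \<nu>"
    and Ioo: "\<And>a b. 0 \<le> a \<Longrightarrow> a < b \<Longrightarrow> b \<le> T \<Longrightarrow> \<nu> {a<..<b} = LL u b - RL u a"
    and tf: "test_function T \<phi>"
  shows "(LINT t:{0<..<T}|lborel. deriv \<phi> t *\<^sub>R u t) = - vector_measure_integral \<nu> \<phi>"
proof -
  let ?M = "total_variation_measure \<nu>"
  let ?f = "vector_density ?M \<nu>"
  interpret M: finite_measure ?M by (rule total_variation_sigma_finite[OF v])
  interpret P: pair_sigma_finite lborel ?M ..
  have sM[measurable_cong]: "sets ?M = sets borel" by (rule sets_total_variation_measure[OF v])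
  have fi: "integrable ?M ?f" by (rule polar_density(1)[OF v])
  have fm[measurable]: "?f \<in> borel_measurable ?M" using fi by (rule borel_measurable_integrable)
  obtain D where D: "\<And>t. (\<phi> has_real_derivative D t) (at t)" "continuous_on UNIV D"
    using tf unfolding test_function_def C1_differentiable_on_def has_real_derivative_iff_has_vector_derivative by auto
  have dD: "deriv \<phi> t = D t" for t using D(1) by (rule DERIV_imp_deriv)
  have Dm[measurable]: "D \<in> borel_measurable borel" by (rule borel_measurable_continuous_onI[OF D(2)])
  have \<phi>0: "\<phi> t = 0" if "t \<notin> {0<..<T}" for t
    using tf that closure_subset[of "{t. \<phi> t \<noteq> 0}"] unfolding test_function_def by blast
  have "compact (D ` {0..T})" by (intro compact_continuous_image continuous_on_subset[OF D(2)]) auto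
  then obtain K where "\<forall>t\<in>{0..T}. \<bar>D t\<bar> \<le> K"
    using compact_imp_bounded[of "D ` {0..T}"] by (auto simp: bounded_iff)
  then have K: "\<And>t. t \<in> {0..T} \<Longrightarrow> \<bar>D t\<bar> \<le> K" by blast
  have K0: "K \<ge> 0" using K[of 0] T_pos by force
  define g where "g t s = (if 0 < s \<and> s < t \<and> t < T then D t else 0)" for t s
  define h where "h t s = g t s *\<^sub>R ?f s" for t s
  have gm[measurable]: "(\<lambda>x. g (fst x) (snd x)) \<in> borel_measurable (lborel \<Otimes>\<^sub>M ?M)" unfolding g_def by measurable
  have hm[measurable]: "(\<lambda>x. h (fst x) (snd x)) \<in> borel_measurable (lborel \<Otimes>\<^sub>M ?M)" unfolding h_def by measurable
  have hm': "(\<lambda>(t, s). h t s) \<in> borel_measurable (lborel \<Otimes>\<^sub>M ?M)" using hm by (simp add: case_prod_beta')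
  have gb: "\<bar>g t s\<bar> \<le> indicator {0<..<T} t * K" for t s using K[of t] K0 by (auto simp: g_def split: split_indicator)
  have hb: "norm (h t s) \<le> indicator {0<..<T} t * K * norm (?f s)" for t s
    unfolding h_def using gb[of t s] by (auto intro!: mult_right_mono)
  have hs: "integrable ?M (h t)" for t
  proof (rule Bochner_Integration.integrable_bound[of _ "\<lambda>s. (indicator {0<..<T} t * K) *\<^sub>R ?f s"])
    show "AE s in ?M. norm (h t s) \<le> norm ((indicator {0<..<T} t * K) *\<^sub>R ?f s)"
      using hb[of t] K0 by (intro AE_I2) simp
    have "(\<lambda>s. g t s) \<in> borel_measurable ?M" unfolding g_def by measurable
    then show "h t \<in> borel_measurable ?M" unfolding h_def[abs_def] by (intro borel_measurable_scaleR fm)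
  qed (use fi in simp)
  have iI: "integrable lborel (indicator {0<..<T} :: real \<Rightarrow> real)"
    using T_pos by (intro integrable_real_indicator) auto
  have int: "integrable (lborel \<Otimes>\<^sub>M ?M) (\<lambda>(t, s). h t s)"
  proof (rule P.Fubini_integrable[OF hm'])
    show "AE t in lborel. integrable ?M (\<lambda>s. case (t, s) of (t, s) \<Rightarrow> h t s)" using hs by simp
    show "integrable lborel (\<lambda>t. LINT s|?M. norm (case (t, s) of (t, s) \<Rightarrow> h t s))"
    proof (rule Bochner_Integration.integrable_bound[of _ "\<lambda>t. indicator {0<..<T} t *\<^sub>R (K * (LINT s|?M. norm (?f s)))"])
      show "AE t in lborel. norm (LINT s|?M. norm (case (t, s) of (t, s) \<Rightarrow> h t s))
          \<le> norm (indicator {0<..<T} t *\<^sub>R (K * (LINT s|?M. norm (?f s))))"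
      proof (intro AE_I2)
        fix t
        have "(LINT s|?M. norm (h t s)) \<le> (LINT s|?M. (indicator {0<..<T} t * K) * norm (?f s))"
          using hs fi hb by (intro integral_mono) (auto simp: ac_simps)
        also have "\<dots> = (indicator {0<..<T} t * K) * (LINT s|?M. norm (?f s))" by simp
        finally show "norm (LINT s|?M. norm (case (t, s) of (t, s) \<Rightarrow> h t s))
          \<le> norm (indicator {0<..<T} t *\<^sub>R (K * (LINT s|?M. norm (?f s))))"
          using K0 by (simp add: ac_simps)
      qed
    qed (use iI in \<open>auto intro!: integrable_mult_left_iff simp: case_prod_beta'\<close>)
  qed
  have inner: "(LINT t|lborel. h t s) = - (\<phi> s *\<^sub>R ?f s)" for s
  proof (cases "0 < s \<and> s < T")
    case True
    have hb: "has_bochner_integral lborel (\<lambda>x. indicator {s..T} x *\<^sub>R D x) (\<phi> T - \<phi> s)"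
      using True D by (intro has_bochner_integral_FTC_Icc)
        (auto simp: has_real_derivative_iff_has_vector_derivative[symmetric]
          intro: has_field_derivative_at_within continuous_on_subset)
    have ae: "AE t in lborel. indicator {s..T} t *\<^sub>R D t = g t s"
      using AE_lborel_singleton[of s] AE_lborel_singleton[of T] by eventually_elim (use True in \<open>auto simp: g_def\<close>)
    have m: "(\<lambda>t. g t s) \<in> borel_measurable lborel" unfolding g_def by measurable
    have m0: "(\<lambda>t. indicator {s..T} t *\<^sub>R D t) \<in> borel_measurable lborel" by measurable
    have i: "integrable lborel (\<lambda>t. g t s)"
      using integrable_cong_AE[OF m0 m ae] hb unfolding has_bochner_integral_iff by (rule iffD1[OF _ conjunct1])
    have "(LINT t|lborel. g t s) = \<phi> T - \<phi> s"
      using integral_cong_AE[OF m0 m ae] hb unfolding has_bochner_integral_iff by (rule trans[OF sym conjunct2])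
    then show ?thesis unfolding h_def using \<phi>0[of T] i by simp
  next
    case False
    then have "h t s = 0" for t by (auto simp: h_def g_def)
    then show ?thesis using \<phi>0[of s] False by simp
  qed
  have Fub: "(LINT t|lborel. LINT s|?M. h t s) = (LINT s|?M. LINT t|lborel. h t s)"
    using P.Fubini_integral[OF int] by simp
  \<comment> \<open>The constant \<open>RL u 0\<close> will drop out, since the derivative of a test
    function has integral 0.\<close>
  have iD: "integrable lborel (\<lambda>t. indicator {0<..<T} t *\<^sub>R D t)" "(LINT t|lborel. indicator {0<..<T} t *\<^sub>R D t) = 0"
  proof -
    have hb: "has_bochner_integral lborel (\<lambda>x. indicator {0..T} x *\<^sub>R D x) (\<phi> T - \<phi> 0)"
      using T_pos D by (intro has_bochner_integral_FTC_Icc)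
        (auto simp: has_real_derivative_iff_has_vector_derivative[symmetric]
          intro: has_field_derivative_at_within continuous_on_subset)
    have ae: "AE t in lborel. indicator {0..T} t *\<^sub>R D t = indicator {0<..<T} t *\<^sub>R D t"
      using AE_lborel_singleton[of 0] AE_lborel_singleton[of T] by eventually_elim (auto split: split_indicator)
    have m: "(\<lambda>t. indicator {0<..<T} t *\<^sub>R D t) \<in> borel_measurable lborel" by measurable
    have m0: "(\<lambda>t. indicator {0..T} t *\<^sub>R D t) \<in> borel_measurable lborel" by measurable
    show "integrable lborel (\<lambda>t. indicator {0<..<T} t *\<^sub>R D t)"
      using integrable_cong_AE[OF m0 m ae] hb unfolding has_bochner_integral_iff by (rule iffD1[OF _ conjunct1])
    have "(LINT t|lborel. indicator {0<..<T} t *\<^sub>R D t) = \<phi> T - \<phi> 0"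
      using integral_cong_AE[OF m0 m ae] hb unfolding has_bochner_integral_iff by (rule trans[OF sym conjunct2])
    then show "(LINT t|lborel. indicator {0<..<T} t *\<^sub>R D t) = 0" using \<phi>0[of 0] \<phi>0[of T] by simp
  qed
  have m1: "(\<lambda>t. LINT s|?M. h t s) \<in> borel_measurable lborel"
    using M.borel_measurable_lebesgue_integral[OF hm'] by simp
  have i2: "integrable lborel (\<lambda>t. LINT s|?M. h t s)" using P.integrable_fst[OF int] by simp
  \<comment> \<open>The mass of the open interval produces the left limit at \<open>t\<close>, which
    is the value of the curve off this countable set.\<close>
  have "AE t in lborel. t \<notin> JG" by (rule AE_not_in[OF countable_imp_null_set_lborel[OF countable_JG]])
  then have ae: "AE t in lborel. indicator {0<..<T} t *\<^sub>R D t *\<^sub>R u t =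
      (indicator {0<..<T} t *\<^sub>R D t) *\<^sub>R RL u 0 + (LINT s|?M. h t s)"
  proof eventually_elim
    case (elim t)
    show ?case
    proof (cases "t \<in> {0<..<T}")
      case True
      have "(LINT s|?M. h t s) = (LINT s|?M. D t *\<^sub>R (indicator {0<..<t} s *\<^sub>R ?f s))"
        using True by (intro Bochner_Integration.integral_cong) (auto simp: h_def g_def split: split_indicator)
      also have "\<dots> = D t *\<^sub>R (LINT s:{0<..<t}|?M. ?f s)"
        unfolding set_lebesgue_integral_def by (rule integral_scaleR_right)
      also have "(LINT s:{0<..<t}|?M. ?f s) = \<nu> {0<..<t}" using polar_density(2)[OF v, of "{0<..<t}"] by simp
      also have "\<dots> = u t - RL u 0" using Ioo[of 0 t] True no_jump(1)[OF elim] by simp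
      finally show ?thesis using True by (simp add: algebra_simps)
    next
      case False
      then have "h t s = 0" for s by (auto simp: h_def g_def)
      then show ?thesis using False by simp
    qed
  qed
  have "(LINT t:{0<..<T}|lborel. deriv \<phi> t *\<^sub>R u t) = (LINT t|lborel. indicator {0<..<T} t *\<^sub>R D t *\<^sub>R u t)"
    unfolding set_lebesgue_integral_def dD ..
  also have "\<dots> = (LINT t|lborel. (indicator {0<..<T} t *\<^sub>R D t) *\<^sub>R RL u 0 + (LINT s|?M. h t s))"
    by (rule integral_cong_AE[OF _ _ ae]) (use m1 in measurable)
  also have "\<dots> = (LINT t|lborel. indicator {0<..<T} t *\<^sub>R D t) *\<^sub>R RL u 0 + (LINT t|lborel. LINT s|?M. h t s)"
    using iD(1) i2 by (subst Bochner_Integration.integral_add) (auto simp del: scaleR_conv_of_real)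
  also have "\<dots> = (LINT s|?M. - (\<phi> s *\<^sub>R ?f s))" unfolding iD(2) Fub inner by simp
  also have "\<dots> = - vector_measure_integral \<nu> \<phi>" by (simp add: vector_measure_integral_def)
  finally show ?thesis .
qed

definition "DU = distributional_derivative T u"

lemma DU: "vector_measure DU" "A \<in> sets borel \<Longrightarrow> DU A = DU (A \<inter> {0<..<T})"
  "0 \<le> a \<Longrightarrow> a < b \<Longrightarrow> b \<le> T \<Longrightarrow> DU {a<..<b} = LL u b - RL u a"
proof -
  obtain \<nu> where \<nu>: "vector_measure \<nu>" "\<And>A. A \<in> sets borel \<Longrightarrow> \<nu> A = \<nu> (A \<inter> {0<..<T})"
    "\<And>a b. 0 \<le> a \<Longrightarrow> a < b \<Longrightarrow> b \<le> T \<Longrightarrow> \<nu> {a<..<b} = LL u b - RL u a" using stieltjes_exists by blast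
  have "DU = \<nu>" unfolding DU_def distributional_derivative_def
  proof (rule the_equality)
    show "vector_measure \<nu> \<and> (\<forall>A\<in>sets borel. \<nu> A = \<nu> (A \<inter> {0<..<T})) \<and>
       (\<forall>\<phi>. test_function T \<phi> \<longrightarrow> (LINT t:{0<..<T}|lborel. deriv \<phi> t *\<^sub>R u t) = - vector_measure_integral \<nu> \<phi>)"
      using \<nu>(1,2) test_function_identity[OF \<nu>(1,3)] by blast
  next
    fix \<kappa> assume \<kappa>: "vector_measure \<kappa> \<and> (\<forall>A\<in>sets borel. \<kappa> A = \<kappa> (A \<inter> {0<..<T})) \<and>
       (\<forall>\<phi>. test_function T \<phi> \<longrightarrow> (LINT t:{0<..<T}|lborel. deriv \<phi> t *\<^sub>R u t) = - vector_measure_integral \<kappa> \<phi>)"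
    show "\<kappa> = \<nu>"
    proof (rule vm_eq_of_test_functions[where T=T])
      fix \<phi> assume "test_function T \<phi>"
      then show "vector_measure_integral \<kappa> \<phi> = vector_measure_integral \<nu> \<phi>"
        using \<kappa> test_function_identity[OF \<nu>(1,3)] by (metis neg_equal_iff_equal)
    qed (use \<kappa> \<nu> in blast)+
  qed
  then show "vector_measure DU" "A \<in> sets borel \<Longrightarrow> DU A = DU (A \<inter> {0<..<T})"
    "0 \<le> a \<Longrightarrow> a < b \<Longrightarrow> b \<le> T \<Longrightarrow> DU {a<..<b} = LL u b - RL u a" using \<nu> by blast+
qed

text \<open>Between 0 and \<open>T\<close> an atom is the whole jump, irrespective of the value
  taken at the time of the jump. At 0 and \<open>T\<close> there is none.\<close>

lemma DU_singleton: "DU {t} = (if 0 < t \<and> t < T then RL u t - LL u t else 0)"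
proof (cases "0 < t \<and> t < T")
  case True
  have "{0<..<T} = {0<..<t} \<union> ({t} \<union> {t<..<T})" using True by auto
  then have "DU {0<..<T} = DU {0<..<t} + DU ({t} \<union> {t<..<T})"
    using vm_Un[OF DU(1), of "{0<..<t}" "{t} \<union> {t<..<T}"] by auto
  also have "DU ({t} \<union> {t<..<T}) = DU {t} + DU {t<..<T}" by (intro vm_Un[OF DU(1)]) auto
  finally show ?thesis using DU(3)[of 0 T] DU(3)[of 0 t] DU(3)[of t T] True T_pos by (simp add: algebra_simps)
next
  case False
  then have "{t} \<inter> {0<..<T} = {}" by auto
  then show ?thesis using DU(2)[of "{t}"] vm_empty[OF DU(1)] False by auto
qed

lemma DU_atoms: "t \<notin> JG \<Longrightarrow> DU {t} = 0"
  using no_jump[of t] by (simp add: DU_singleton)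

definition "ref = reference_measure DU"
definition "dens = vector_density ref (co_part DU)"

lemma ref: "sets ref = sets borel" "space ref = UNIV" "integrable ref dens"
  using co_density[OF DU(1) countable_JG DU_atoms] unfolding ref_def dens_def by blast+

lemma dens: "countable J \<Longrightarrow> JG \<subseteq> J \<Longrightarrow> A \<in> sets borel \<Longrightarrow> DU (A - J) = (LINT t:A|ref. dens t)"
  using co_density(4)[OF DU(1), of J A] DU_atoms unfolding ref_def dens_def by blast

end

section \<open>The dissipation of the diffuse part of the derivative\<close>

locale bv_system = viscous_system B \<Psi> \<Psi>0 + bv_curve B u G T
  for B :: "'a::{banach,second_countable_topology} set" and \<Psi> \<Psi>0 u G T
begin

definition cdiss :: "real set \<Rightarrow> ennreal" where
  "cdiss A = (\<integral>\<^sup>+t. ennreal (\<Psi>0 (dens t)) * indicator A t \<partial>ref)"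

lemma measurable_dens [measurable]: "dens \<in> borel_measurable ref"
  using ref(3) by (rule borel_measurable_integrable)

lemma measurable_Psi0_dens [measurable]: "(\<lambda>t. \<Psi>0 (dens t)) \<in> borel_measurable ref"
  using borel_measurable_continuous_onI[OF continuous_Psi0] measurable_dens
  by (rule measurable_compose[rotated])

lemma apply_dens_integral:
  assumes "countable J" "JG \<subseteq> J" "A \<in> sets borel"
  shows "blinfun_apply w (DU (A - J)) = (LINT t:A|ref. blinfun_apply w (dens t))"
    "set_integrable ref A (\<lambda>t. blinfun_apply w (dens t))"
proof -
  have i: "integrable ref (\<lambda>t. indicator A t *\<^sub>R dens t)"
    using integrable_mult_indicator[OF _ ref(3)] assms(3) ref(1) by simp
  have "blinfun_apply w (DU (A - J)) = (LINT t|ref. blinfun_apply w (indicator A t *\<^sub>R dens t))"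
    unfolding dens[OF assms] set_lebesgue_integral_def
    by (rule integral_bounded_linear[OF blinfun.bounded_linear_right i, symmetric])
  then show "blinfun_apply w (DU (A - J)) = (LINT t:A|ref. blinfun_apply w (dens t))"
    by (simp add: set_lebesgue_integral_def blinfun.scaleR_right)
  show "set_integrable ref A (\<lambda>t. blinfun_apply w (dens t))"
    using integrable_bounded_linear[OF blinfun.bounded_linear_right i, of w]
    by (simp add: set_integrable_def blinfun.scaleR_right)
qed

lemma cdiss_ge:
  assumes w: "w \<in> Kstar \<Psi>0" and A: "A \<in> sets borel" and J: "countable J" "JG \<subseteq> J"
  shows "ennreal (blinfun_apply w (DU (A - J))) \<le> cdiss A"
proof -
  have i: "integrable ref (\<lambda>t. indicator A t * blinfun_apply w (dens t))"
    using apply_dens_integral(2)[OF J A, of w] by (simp add: set_integrable_def)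
  have "blinfun_apply w (DU (A - J)) = (LINT t|ref. indicator A t * blinfun_apply w (dens t))"
    using apply_dens_integral(1)[OF J A, of w] by (simp add: set_lebesgue_integral_def)
  also have "\<dots> \<le> (LINT t|ref. max 0 (indicator A t * blinfun_apply w (dens t)))"
    using i by (intro integral_mono integrable_max) auto
  finally have "ennreal (blinfun_apply w (DU (A - J))) \<le> ennreal (LINT t|ref. max 0 (indicator A t * blinfun_apply w (dens t)))"
    by (rule ennreal_leI)
  also have "\<dots> = (\<integral>\<^sup>+t. ennreal (max 0 (indicator A t * blinfun_apply w (dens t))) \<partial>ref)"
    using i by (intro nn_integral_eq_integral[symmetric] integrable_max) auto
  also have "\<dots> \<le> cdiss A" unfolding cdiss_def
    using w Psi0_nonneg by (intro nn_integral_mono) (auto simp: Kstar_def intro!: ennreal_leI split: split_indicator)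
  finally show ?thesis .
qed

lemma tendsto_apply:
  assumes "(u \<longlongrightarrow> l) net" shows "((\<lambda>t. blinfun_apply w (u t)) \<longlongrightarrow> blinfun_apply w l) net"
  using assms by (intro tendsto_intros)

text \<open>For each \<open>w\<close> in K* the function \<open>P\<close> minus \<open>w\<close>
  applied to the curve is nondecreasing, so the measure of \<open>P\<close> dominates
  \<open>w\<close> applied to \<open>DU\<close>. The gauge of the density is the supremum of
  countably many such functionals; finite maxima are integrated by cutting the set according to
  which functional is largest.\<close>

lemma cdiss_le:
  fixes P :: "real \<Rightarrow> real"
  assumes P: "mono P" and inc: "\<And>w a b. w \<in> Kstar \<Psi>0 \<Longrightarrow> a \<le> b \<Longrightarrow> blinfun_apply w (u b - u a) \<le> P b - P a"
    and m: "finite_measure m" "sets m = sets borel"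
      "\<And>A. A \<in> sets borel \<Longrightarrow> measure m A = measure m (A \<inter> {0<..<T})"
      "\<And>a b. 0 \<le> a \<Longrightarrow> a < b \<Longrightarrow> b \<le> T \<Longrightarrow> measure m {a<..<b} = LL P b - RL P a"
    and J: "countable J" "JG \<subseteq> J" and A: "A \<in> sets borel"
  shows "cdiss A \<le> ennreal (measure m (A - J))"
proof -
  have Jb: "J \<in> sets borel" using null_setsD2[OF countable_imp_null_set_lborel[OF J(1)]] by simp
  have dom: "blinfun_apply w (DU C) \<le> measure m C" if w: "w \<in> Kstar \<Psi>0" for w C
  proof -
    define H where "H t = P t - blinfun_apply w (u t)" for t
    have H: "mono H"
    proof (rule monoI)
      fix x y :: real assume "x \<le> y"
      from inc[OF w this] show "H x \<le> H y" unfolding H_def by (simp add: blinfun.diff_right)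
    qed
    have LLH: "LL H t = LL P t - blinfun_apply w (LL u t)" for t
      unfolding H_def[abs_def] by (rule tendsto_Lim) (auto intro!: tendsto_diff tendsto_mono_LL[OF P] tendsto_apply tendsto_LL)
    have RLH: "RL H t = RL P t - blinfun_apply w (RL u t)" for t
      unfolding H_def[abs_def] by (rule tendsto_Lim) (auto intro!: tendsto_diff tendsto_mono_RL[OF P] tendsto_apply tendsto_RL)
    obtain n where n: "finite_measure n" "sets n = sets borel"
      "\<And>A. A \<in> sets borel \<Longrightarrow> measure n A = measure n (A \<inter> {0<..<T})"
      "\<And>a b. 0 \<le> a \<Longrightarrow> a < b \<Longrightarrow> b \<le> T \<Longrightarrow> measure n {a<..<b} = LL H b - RL H a"
      using mono_stieltjes_measure[OF H T_pos] by blast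
    have "measure n = (\<lambda>A. measure m A - blinfun_apply w (DU A))"
    proof (rule vm_eqI_Ioo[where T=T])
      show "vector_measure (measure n)" by (rule vm_measure[OF n(1,2)])
      show "vector_measure (\<lambda>A. measure m A - blinfun_apply w (DU A))"
        by (intro vm_diff vm_measure[OF m(1,2)] vm_linear[OF DU(1)] blinfun.bounded_linear_right)
      show "measure n A = measure n (A \<inter> {0<..<T})" if "A \<in> sets borel" for A using n(3) that .
      show "measure m A - blinfun_apply w (DU A) = measure m (A \<inter> {0<..<T}) - blinfun_apply w (DU (A \<inter> {0<..<T}))"
        if "A \<in> sets borel" for A using m(3)[OF that] DU(2)[OF that] by simp
      fix a b :: real assume ab: "0 < a" "a < b" "b < T"
      show "measure n {a<..<b} = measure m {a<..<b} - blinfun_apply w (DU {a<..<b})"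
        using n(4)[of a b] m(4)[of a b] DU(3)[of a b] ab by (simp add: LLH RLH blinfun.diff_right)
    qed
    then have "measure n C = measure m C - blinfun_apply w (DU C)" by metis
    then show ?thesis using measure_nonneg[of n C] by linarith
  qed
  obtain W :: "nat \<Rightarrow> 'a \<Rightarrow>\<^sub>L real" where W: "\<And>n. W n \<in> Kstar \<Psi>0"
    "\<And>v \<eta>. \<eta> > 0 \<Longrightarrow> \<exists>n. \<Psi>0 v - \<eta> < blinfun_apply (W n) v" using Kstar_countable_support by blast
  \<comment> \<open>Starting the maxima at 0 keeps them nonnegative without exceeding the gauge, and
    makes the base case of the integral bound trivial.\<close>
  define g where "g = rec_nat (\<lambda>t::real. 0) (\<lambda>n h t. max (h t) (blinfun_apply (W n) (dens t)))"
  have g0: "g 0 t = 0" and gS: "g (Suc n) t = max (g n t) (blinfun_apply (W n) (dens t))" for n t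
    by (simp_all add: g_def)
  have gi: "integrable ref (g n)" for n
  proof (induction n)
    case 0 then show ?case by (simp add: g_def)
  next
    case (Suc n)
    have "integrable ref (\<lambda>t. max (g n t) (blinfun_apply (W n) (dens t)))"
      by (intro integrable_max Suc integrable_bounded_linear[OF blinfun.bounded_linear_right ref(3)])
    then show ?case by (simp add: gS[abs_def])
  qed
  have gnn: "0 \<le> g n t" for n t by (induction n) (auto simp: g0 gS)
  have gle: "g n t \<le> \<Psi>0 (dens t)" for n t
    using W(1) Psi0_nonneg by (induction n) (auto simp: g0 gS Kstar_def)
  have gint: "(LINT t:C|ref. g n t) \<le> measure m (C - J)" if "C \<in> sets borel" for n C
    using that
  proof (induction n arbitrary: C)
    case 0 then show ?case by (simp add: g_def set_lebesgue_integral_def)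
  next
    case (Suc n)
    \<comment> \<open>On \<open>S\<close> the earlier maximum wins and the induction hypothesis
      applies; off \<open>S\<close> the new functional wins and is dominated directly.\<close>
    define S where "S = {t. blinfun_apply (W n) (dens t) \<le> g n t}"
    have mm: "g n \<in> borel_measurable ref" "(\<lambda>t. blinfun_apply (W n) (dens t)) \<in> borel_measurable ref"
      using gi integrable_bounded_linear[OF blinfun.bounded_linear_right ref(3)] by (auto intro: borel_measurable_integrable)
    have "{t \<in> space ref. blinfun_apply (W n) (dens t) \<le> g n t} \<in> sets ref"
      using mm by measurable
    then have S: "S \<in> sets borel" using ref(1,2) by (simp add: S_def)
    have sets: "C \<inter> S \<in> sets borel" "C - S \<in> sets borel" using S Suc.prems by auto
    have si: "set_integrable ref D (g k)" if "D \<in> sets borel" for D k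
      using integrable_mult_indicator[OF _ gi, of D k] that ref(1) by (simp add: set_integrable_def)
    have "(LINT t:C|ref. g (Suc n) t) = (LINT t:(C \<inter> S) \<union> (C - S)|ref. g (Suc n) t)" by (simp add: Int_Diff_Un)
    also have "\<dots> = (LINT t:C \<inter> S|ref. g (Suc n) t) + (LINT t:C - S|ref. g (Suc n) t)"
      using sets by (intro set_integral_Un si) auto
    also have "(LINT t:C \<inter> S|ref. g (Suc n) t) = (LINT t:C \<inter> S|ref. g n t)"
      using sets ref(1) by (intro set_lebesgue_integral_cong) (auto simp: S_def gS)
    also have "(LINT t:C - S|ref. g (Suc n) t) = (LINT t:C - S|ref. blinfun_apply (W n) (dens t))"
      using sets ref(1) by (intro set_lebesgue_integral_cong) (auto simp: S_def gS)
    also have "\<dots> = blinfun_apply (W n) (DU (C - S - J))" by (rule apply_dens_integral(1)[OF J sets(2), symmetric])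
    also have "\<dots> \<le> measure m (C - S - J)" by (rule dom[OF W(1)])
    also have "(LINT t:C \<inter> S|ref. g n t) \<le> measure m (C \<inter> S - J)" by (rule Suc.IH[OF sets(1)])
    also have "measure m (C \<inter> S - J) + measure m (C - S - J) = measure m ((C \<inter> S - J) \<union> (C - S - J))"
      using sets Jb m(1,2) by (intro finite_measure.finite_measure_Union[symmetric]) auto
    also have "(C \<inter> S - J) \<union> (C - S - J) = C - J" by blast
    finally show ?case by simp
  qed
  have inc': "g n t \<le> g (Suc n) t" for n t by (simp add: gS)
  have SUP: "(SUP n. ennreal (g n t) * indicator A t) = ennreal (\<Psi>0 (dens t)) * indicator A t" for t
  proof (cases "t \<in> A")
    case True
    have "(SUP n. ennreal (g n t)) = ennreal (\<Psi>0 (dens t))"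
    proof (rule antisym)
      show "(SUP n. ennreal (g n t)) \<le> ennreal (\<Psi>0 (dens t))" using gle by (intro SUP_least ennreal_leI)
      show "ennreal (\<Psi>0 (dens t)) \<le> (SUP n. ennreal (g n t))"
      proof (rule ennreal_le_epsilon)
        fix e :: real assume "e > 0"
        then obtain n where n: "\<Psi>0 (dens t) - e < blinfun_apply (W n) (dens t)" using W(2) by blast
        then have "\<Psi>0 (dens t) \<le> g (Suc n) t + e" by (simp add: gS)
        then have "ennreal (\<Psi>0 (dens t)) \<le> ennreal (g (Suc n) t) + ennreal e"
          using gnn \<open>e > 0\<close> by (simp add: ennreal_plus[symmetric] ennreal_leI del: ennreal_plus)
        also have "\<dots> \<le> (SUP n. ennreal (g n t)) + ennreal e" by (intro add_right_mono SUP_upper) auto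
        finally show "ennreal (\<Psi>0 (dens t)) \<le> (SUP n. ennreal (g n t)) + ennreal e" .
      qed
    qed
    then show ?thesis using True by simp
  qed simp
  have "cdiss A = (\<integral>\<^sup>+t. (SUP n. ennreal (g n t) * indicator A t) \<partial>ref)" unfolding cdiss_def SUP ..
  also have "\<dots> = (SUP n. \<integral>\<^sup>+t. ennreal (g n t) * indicator A t \<partial>ref)"
  proof (rule nn_integral_monotone_convergence_SUP)
    show "incseq (\<lambda>n t. ennreal (g n t) * indicator A t)"
      using inc' by (intro incseq_SucI le_funI mult_right_mono ennreal_leI) auto
    show "(\<lambda>t. ennreal (g n t) * indicator A t) \<in> borel_measurable ref" for n
      using gi A ref(1) by (auto intro!: borel_measurable_times_ennreal measurable_compose[OF borel_measurable_integrable measurable_ennreal])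
  qed
  also have "\<dots> \<le> ennreal (measure m (A - J))"
  proof (rule SUP_least)
    fix n
    have "(\<integral>\<^sup>+t. ennreal (g n t) * indicator A t \<partial>ref) = (\<integral>\<^sup>+t. ennreal (indicator A t *\<^sub>R g n t) \<partial>ref)"
      by (intro nn_integral_cong) (auto split: split_indicator)
    also have "\<dots> = ennreal (LINT t:A|ref. g n t)"
      unfolding set_lebesgue_integral_def
      using integrable_mult_indicator[OF _ gi, of A] A ref(1) gnn
      by (intro nn_integral_eq_integral) auto
    also have "\<dots> \<le> ennreal (measure m (A - J))" by (intro ennreal_leI gint A)
    finally show "(\<integral>\<^sup>+t. ennreal (g n t) * indicator A t \<partial>ref) \<le> ennreal (measure m (A - J))" .
  qed
  finally show ?thesis .
qed

end

section \<open>Lebesgue differentiation and absolutely continuous curves\<close>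

lemma finite_measure_open_approx:
  fixes A :: "real set"
  assumes "finite_measure M" "sets M = sets borel" "A \<in> sets borel" "e > 0"
  shows "\<exists>U. open U \<and> A \<subseteq> U \<and> measure M (U - A) < e"
proof -
  interpret finite_measure M by fact
  have o: "emeasure M A = (INF U\<in>{U. A \<subseteq> U \<and> open U}. emeasure M U)"
    by (rule outer_regular[OF assms(2) _ assms(3)]) (simp add: emeasure_eq_measure)
  have "(INF U\<in>{U. A \<subseteq> U \<and> open U}. emeasure M U) < emeasure M A + ennreal e"
    unfolding o[symmetric] using assms(4)
    by (simp add: emeasure_eq_measure ennreal_plus[symmetric] ennreal_less_iff del: ennreal_plus)
  then obtain U where U: "A \<subseteq> U" "open U" "emeasure M U < emeasure M A + ennreal e"
    unfolding INF_less_iff by blast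
  have "measure M U < measure M A + e" using U(3) assms(4)
    by (simp add: emeasure_eq_measure ennreal_plus[symmetric] ennreal_less_iff del: ennreal_plus)
  moreover have "measure M (U - A) = measure M U - measure M A"
    using U assms(2,3) by (intro finite_measure_Diff) auto
  ultimately show ?thesis using U by auto
qed

lemma finite_measure_compact_approx:
  fixes A :: "real set"
  assumes "finite_measure M" "sets M = sets borel" "A \<in> sets borel" "e > 0"
  shows "\<exists>K. compact K \<and> K \<subseteq> A \<and> measure M (A - K) < e"
proof -
  interpret finite_measure M by fact
  have r: "emeasure M A = (SUP K\<in>{K. K \<subseteq> A \<and> compact K}. emeasure M K)"
    by (rule inner_regular[OF assms(2) _ assms(3)]) (simp add: emeasure_eq_measure)
  show ?thesis
  proof (cases "measure M A < e")
    case True then show ?thesis by (intro exI[of _ "{}"]) auto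
  next
    case False
    have "ennreal (measure M A - e) < (SUP K\<in>{K. K \<subseteq> A \<and> compact K}. emeasure M K)"
      unfolding r[symmetric] using assms(4) False by (simp add: emeasure_eq_measure ennreal_less_iff)
    then obtain K where K: "K \<subseteq> A" "compact K" "ennreal (measure M A - e) < emeasure M K"
      unfolding less_SUP_iff by auto
    have "measure M A - e < measure M K" using K(3) False by (simp add: emeasure_eq_measure ennreal_less_iff)
    moreover have "measure M (A - K) = measure M A - measure M K"
      using K assms(2,3) by (intro finite_measure_Diff) (auto intro: borel_compact)
    ultimately show ?thesis using K by auto
  qed
qed

text \<open>Vitali covering: the exceptional points are covered by fivefold enlargements of disjoint
  balls. The masses of these balls add up to at most the mass of an open neighbourhood of the
  \<rho>-null set \<open>A\<close>, which can be made small.\<close>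

lemma finite_measure_density_zero:
  fixes A :: "real set"
  assumes fm: "finite_measure \<rho>" and sb: "sets \<rho> = sets borel" and A: "A \<in> sets borel" and z: "measure \<rho> A = 0"
    and c: "c > 0"
  shows "negligible {x\<in>A. \<forall>d>0. \<exists>r. 0 < r \<and> r < d \<and> c * r < measure \<rho> (cball x r)}" (is "negligible ?S")
  unfolding negligible_outer_le
proof (intro allI impI)
  interpret finite_measure \<rho> by fact
  fix e :: real assume e: "e > 0"
  \<comment> \<open>An enlarged ball has ten times the length of the original radius, and this
    radius is below the mass of the ball divided by \<open>c\<close>; hence the factor
    \<open>c / 10\<close>.\<close>
  obtain U where U: "open U" "A \<subseteq> U" "measure \<rho> (U - A) < e * c / 10"
    using finite_measure_open_approx[OF fm sb A, of "e * c / 10"] e c by auto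
  have "measure \<rho> U = measure \<rho> (U - A) + measure \<rho> A"
    using U A sb finite_measure_Union[of "U - A" A] by (auto simp: Un_absorb2)
  then have Ue: "measure \<rho> U < e * c / 10" using U(3) z by simp
  define K where "K = {(x, r). x \<in> ?S \<and> 0 < r \<and> r \<le> 1 \<and> cball x r \<subseteq> U \<and> c * r < measure \<rho> (cball x r)}"
  have cov: "?S \<subseteq> (\<Union>i\<in>K. cball (fst i) (snd i))"
  proof
    fix x assume x: "x \<in> ?S"
    then obtain d where d: "d > 0" "cball x d \<subseteq> U" using U open_contains_cball by blast
    have "\<forall>d>0. \<exists>r. 0 < r \<and> r < d \<and> c * r < measure \<rho> (cball x r)" using x by blast
    from this[rule_format, of "min d 1"]
    obtain r where r: "0 < r" "r < min d 1" "c * r < measure \<rho> (cball x r)" using d by auto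
    have "cball x r \<subseteq> cball x d" using r by (intro subset_cball) auto
    then have "cball x r \<subseteq> U" using d by blast
    then have "(x, r) \<in> K" using x r by (auto simp: K_def)
    then show "x \<in> (\<Union>i\<in>K. cball (fst i) (snd i))" using r by force
  qed
  have Kr: "0 < snd i \<and> snd i \<le> 1" if "i \<in> K" for i using that by (auto simp: K_def)
  obtain C where C: "countable C" "C \<subseteq> K"
    "pairwise (\<lambda>i j. disjnt (cball (fst i) (snd i)) (cball (fst j) (snd j))) C"
    "?S \<subseteq> (\<Union>i\<in>C. cball (fst i) (5 * snd i))"
    by (rule Vitali_covering_lemma_cballs[OF cov Kr]) (assumption, rule that)
  have bound: "measure lebesgue (\<Union>i\<in>I. cball (fst i) (5 * snd i)) \<le> e" if I: "I \<subseteq> C" "finite I" for I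
  proof -
    have "measure lebesgue (\<Union>i\<in>I. cball (fst i) (5 * snd i)) \<le> (\<Sum>i\<in>I. measure lebesgue (cball (fst i) (5 * snd i)))"
      using I(2) by (intro measure_UNION_le) auto
    also have "\<dots> \<le> (\<Sum>i\<in>I. 10 / c * measure \<rho> (cball (fst i) (snd i)))"
    proof (rule sum_mono)
      fix i assume "i \<in> I"
      then have i: "0 < snd i" "c * snd i < measure \<rho> (cball (fst i) (snd i))" using I(1) C(2) by (auto simp: K_def)
      then have "measure lebesgue (cball (fst i) (5 * snd i)) = 10 * snd i" by (simp add: cball_eq_atLeastAtMost)
      also have "\<dots> \<le> 10 / c * measure \<rho> (cball (fst i) (snd i))" using i c by (simp add: field_simps)
      finally show "measure lebesgue (cball (fst i) (5 * snd i)) \<le> \<dots>" .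
    qed
    also have "\<dots> = 10 / c * measure \<rho> (\<Union>i\<in>I. cball (fst i) (snd i))"
    proof -
      have "disjoint_family_on (\<lambda>i. cball (fst i) (snd i)) I"
        unfolding disjoint_family_on_def
      proof (intro ballI impI)
        fix i j assume "i \<in> I" "j \<in> I" "i \<noteq> j"
        then have "disjnt (cball (fst i) (snd i)) (cball (fst j) (snd j))"
          using I(1) by (intro pairwiseD[OF C(3)]) auto
        then show "cball (fst i) (snd i) \<inter> cball (fst j) (snd j) = {}" by (simp add: disjnt_def)
      qed
      moreover have "(\<lambda>i. cball (fst i) (snd i)) ` I \<subseteq> sets \<rho>" unfolding sb by auto
      ultimately show ?thesis unfolding sum_distrib_left[symmetric]
        using finite_measure_finite_Union[OF I(2)] by simp
    qed
    also have "measure \<rho> (\<Union>i\<in>I. cball (fst i) (snd i)) \<le> measure \<rho> U"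
    proof (rule finite_measure_mono)
      have "cball (fst i) (snd i) \<subseteq> U" if "i \<in> I" for i
      proof -
        have "i \<in> K" using that I(1) C(2) by blast
        then show ?thesis by (cases i) (simp add: K_def)
      qed
      then show "(\<Union>i\<in>I. cball (fst i) (snd i)) \<subseteq> U" by blast
      show "U \<in> sets \<rho>" using U(1) sb by simp
    qed
    finally have 1: "measure lebesgue (\<Union>i\<in>I. cball (fst i) (5 * snd i)) \<le> 10 / c * measure \<rho> U"
      using c by (simp add: divide_right_mono)
    have "10 / c * measure \<rho> U \<le> 10 / c * (e * c / 10)" using Ue c by (intro mult_left_mono) auto
    then show ?thesis using 1 c by simp
  qed
  show "\<exists>T. ?S \<subseteq> T \<and> T \<in> lmeasurable \<and> measure lebesgue T \<le> e"
  proof (intro exI[of _ "\<Union>i\<in>C. cball (fst i) (5 * snd i)"] conjI)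
    show "?S \<subseteq> (\<Union>i\<in>C. cball (fst i) (5 * snd i))" by (rule C(4))
    show "(\<Union>i\<in>C. cball (fst i) (5 * snd i)) \<in> lmeasurable"
      by (rule fmeasurable_UN_bound[OF C(1) _ bound]) auto
    show "measure lebesgue (\<Union>i\<in>C. cball (fst i) (5 * snd i)) \<le> e"
      by (rule measure_UN_bound[OF C(1) _ bound]) auto
  qed
qed

lemma negligible_imp_AE: assumes "negligible S" shows "AE x in lborel. x \<notin> S"
proof -
  have "S \<in> null_sets lebesgue" using assms negligible_iff_null_sets by blast
  then have "AE x in lebesgue. x \<notin> S" by (rule AE_not_in)
  then show ?thesis by (simp add: AE_completion_iff)
qed

text \<open>The excess of \<open>h\<close> over a level \<open>q\<close> has density 0 at almost
  every point where \<open>h \<le> q\<close>. With rational levels one null set serves them all, and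
  a level slightly above \<open>h x\<close> bounds the averages of \<open>h\<close> near
  \<open>x\<close>.\<close>

lemma lebesgue_differentiation_upper:
  fixes h :: "real \<Rightarrow> real"
  assumes h: "integrable lborel h"
  shows "AE x in lborel. \<forall>\<eta>>0. \<exists>d>0. \<forall>a b. a \<le> x \<longrightarrow> x \<le> b \<longrightarrow> x - d < a \<longrightarrow> b < x + d \<longrightarrow>
    (LINT t:{a..b}|lborel. h t) \<le> (h x + \<eta>) * (b - a)"
proof -
  have hm[measurable]: "h \<in> borel_measurable borel" using h by (simp add: borel_measurable_integrable)
  \<comment> \<open>For negative \<open>q\<close> the excess is not integrable over the line; the
    cut-off makes its measure finite.\<close>
  define k where "k q n t = indicator {- real n..real n} t * max 0 (h t - q)" for q n t
  have km[measurable]: "k q n \<in> borel_measurable borel" for q n unfolding k_def by measurable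
  have knn: "0 \<le> k q n t" for q n t by (simp add: k_def)
  have ki: "integrable lborel (k q n)" for q n
  proof (rule Bochner_Integration.integrable_bound[of _ "\<lambda>t. \<bar>h t\<bar> + indicator {- real n..real n} t * \<bar>q\<bar>"])
    have "integrable lborel (indicator {- real n..real n} :: real \<Rightarrow> real)" by (intro integrable_real_indicator) auto
    then show "integrable lborel (\<lambda>t. \<bar>h t\<bar> + indicator {- real n..real n} t * \<bar>q\<bar>)" using h by auto
    show "AE t in lborel. norm (k q n t) \<le> norm (\<bar>h t\<bar> + indicator {- real n..real n} t * \<bar>q\<bar>)"
      by (intro AE_I2) (auto simp: k_def split: split_indicator)
  qed simp
  define \<rho> where "\<rho> q n = density lborel (\<lambda>t. ennreal (k q n t))" for q n
  have s\<rho>: "sets (\<rho> q n) = sets borel" for q n by (simp add: \<rho>_def)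
  have e\<rho>: "emeasure (\<rho> q n) S = ennreal (LINT t:S|lborel. k q n t)" if "S \<in> sets borel" for q n S
  proof -
    have "emeasure (\<rho> q n) S = (\<integral>\<^sup>+t. ennreal (k q n t) * indicator S t \<partial>lborel)"
      unfolding \<rho>_def using that by (subst emeasure_density) auto
    also have "\<dots> = (\<integral>\<^sup>+t. ennreal (indicator S t *\<^sub>R k q n t) \<partial>lborel)"
      by (intro nn_integral_cong) (auto split: split_indicator)
    also have "\<dots> = ennreal (LINT t|lborel. indicator S t *\<^sub>R k q n t)"
      using that knn by (intro nn_integral_eq_integral integrable_mult_indicator ki) auto
    finally show ?thesis by (simp add: set_lebesgue_integral_def)
  qed
  have fm: "finite_measure (\<rho> q n)" for q n by (rule finite_measureI) (use e\<rho>[of UNIV] in \<open>simp add: \<rho>_def\<close>)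
  have m\<rho>: "measure (\<rho> q n) S = (LINT t:S|lborel. k q n t)" if "S \<in> sets borel" for q n S
  proof -
    have "0 \<le> (LINT t:S|lborel. k q n t)" unfolding set_lebesgue_integral_def using knn by (intro integral_nonneg_AE) auto
    then show ?thesis using e\<rho>[OF that] by (simp add: measure_def)
  qed
  define A where "A q = {t. h t \<le> q}" for q
  have Ab: "A q \<in> sets borel" for q
  proof -
    have "{t \<in> space borel. h t \<le> q} \<in> sets borel" by measurable
    then show ?thesis by (simp add: A_def)
  qed
  have zA: "measure (\<rho> q n) (A q) = 0" for q n
  proof -
    have z: "indicator (A q) t *\<^sub>R k q n t = 0" for t by (auto simp: A_def k_def split: split_indicator)
    show ?thesis unfolding m\<rho>[OF Ab] set_lebesgue_integral_def z by simp
  qed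
  let ?S = "\<lambda>q n m. {x\<in>A q. \<forall>d>0. \<exists>r. 0 < r \<and> r < d \<and> (1 / real (Suc m)) * r < measure (\<rho> q n) (cball x r)}"
  have "AE x in lborel. x \<notin> ?S q n m" for q n m
    by (rule negligible_imp_AE[OF finite_measure_density_zero[OF fm s\<rho> Ab zA]]) simp
  then have "AE x in lborel. \<forall>q\<in>\<rat>. \<forall>n m. x \<notin> ?S q n m"
    unfolding AE_all_countable AE_ball_countable[OF countable_rat] by blast
  then show ?thesis
  proof (eventually_elim, intro allI impI)
    fix x \<eta> :: real assume x: "\<forall>q\<in>\<rat>. \<forall>n m. x \<notin> ?S q n m" and \<eta>: "\<eta> > 0"
    \<comment> \<open>The margin \<eta> is shared between the level \<open>q\<close> and the density
      tolerance \<open>1 / real (Suc m)\<close>. The bound on \<open>n\<close>, with distances below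
      1, keeps the cut-off inactive near \<open>x\<close>.\<close>
    obtain q where q: "q \<in> \<rat>" "h x < q" "q < h x + \<eta> / 2" using Rats_dense_in_real[of "h x" "h x + \<eta> / 2"] \<eta> by auto
    obtain m where m: "1 / real (Suc m) < \<eta> / 2" using nat_approx_posE[of "\<eta> / 2"] \<eta> by auto
    obtain n where n: "\<bar>x\<bar> + 1 \<le> real n" using real_arch_simple by blast
    have "x \<notin> ?S q n m" "x \<in> A q" using x q by (auto simp: A_def)
    then obtain d where d0: "d > 0" "\<forall>r. \<not> (0 < r \<and> r < d \<and> (1 / real (Suc m)) * r < measure (\<rho> q n) (cball x r))"
      by blast
    then have d: "d > 0" "\<And>r. 0 < r \<Longrightarrow> r < d \<Longrightarrow> measure (\<rho> q n) (cball x r) \<le> (1 / real (Suc m)) * r"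
      by (meson not_less)+
    show "\<exists>d>0. \<forall>a b. a \<le> x \<longrightarrow> x \<le> b \<longrightarrow> x - d < a \<longrightarrow> b < x + d \<longrightarrow>
      (LINT t:{a..b}|lborel. h t) \<le> (h x + \<eta>) * (b - a)"
    proof (intro exI[of _ "min d 1"] conjI allI impI)
      fix a b assume ab: "a \<le> x" "x \<le> b" "x - min d 1 < a" "b < x + min d 1"
      show "(LINT t:{a..b}|lborel. h t) \<le> (h x + \<eta>) * (b - a)"
      proof (cases "a = b")
        case True
        have "(LINT t:{b..b}|lborel. h t) = 0" unfolding set_lebesgue_integral_def
          by (intro integral_eq_zero_AE) (use AE_lborel_singleton[of b] in \<open>eventually_elim, simp\<close>)
        then show ?thesis using True by simp
      next
        case False
        define r where "r = max (b - x) (x - a)"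
        have r: "0 < r" "r < d" "r \<le> b - a" "{a..b} \<subseteq> cball x r" "r < 1"
          using ab False by (auto simp: r_def max_def cball_eq_atLeastAtMost)
        have si: "set_integrable lborel {a..b} f" if "integrable lborel f" for f :: "real \<Rightarrow> real"
          using integrable_mult_indicator[OF _ that, of "{a..b}"] by (simp add: set_integrable_def)
        have "integrable lborel (indicator {a..b} :: real \<Rightarrow> real)"
          by (intro integrable_real_indicator) (simp_all add: emeasure_lborel_Icc_eq)
        then have ci: "set_integrable lborel {a..b} (\<lambda>t. q)" by (simp add: set_integrable_def)
        have "(LINT t:{a..b}|lborel. h t) \<le> (LINT t:{a..b}|lborel. q + k q n t)"
        proof (rule set_integral_mono)
          show "set_integrable lborel {a..b} (\<lambda>t. q + k q n t)" using ci si[OF ki] by (rule set_integral_add(1))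
          fix t assume t: "t \<in> {a..b}"
          then have "t \<in> {- real n..real n}" using ab n by auto
          then show "h t \<le> q + k q n t" by (simp add: k_def)
        qed (rule si[OF h])
        also have "\<dots> = (LINT t:{a..b}|lborel. q) + (LINT t:{a..b}|lborel. k q n t)"
          using ci si[OF ki] by (rule set_integral_add(2))
        also have "(LINT t:{a..b}|lborel. q) = q * (b - a)" using ab by (simp add: set_lebesgue_integral_def mult.commute)
        also have "(LINT t:{a..b}|lborel. k q n t) = measure (\<rho> q n) {a..b}" by (simp add: m\<rho>)
        also have "\<dots> \<le> measure (\<rho> q n) (cball x r)"
          using r(4) by (intro finite_measure.finite_measure_mono[OF fm]) (auto simp: s\<rho>)
        also have "\<dots> \<le> (1 / real (Suc m)) * r" by (rule d(2)[OF r(1,2)])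
        also have "\<dots> \<le> (\<eta> / 2) * (b - a)" using m r \<eta> by (intro mult_mono) auto
        also have "q * (b - a) \<le> (h x + \<eta> / 2) * (b - a)" using q ab by (intro mult_right_mono) auto
        finally show ?thesis by (simp add: algebra_simps)
      qed
    qed (use d in auto)
  qed
qed

text \<open>The upper estimate for \<open>h\<close> and for \<open>- h\<close> gives the two halves
  of the derivative bound.\<close>

lemma lebesgue_differentiation:
  fixes h :: "real \<Rightarrow> real"
  assumes h: "integrable lborel h"
    and g: "\<And>x y. a \<le> x \<Longrightarrow> x \<le> y \<Longrightarrow> y \<le> b \<Longrightarrow> g y - g x = (LINT t:{x..y}|lborel. h t)"
  shows "AE x in lborel. a < x \<longrightarrow> x < b \<longrightarrow> (g has_real_derivative h x) (at x)"
proof -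
  have h': "integrable lborel (\<lambda>t. - h t)" using h by simp
  have "AE x in lborel. a < x \<longrightarrow> x < b \<longrightarrow> (\<forall>\<eta>>0. \<exists>d>0. \<forall>y. norm (y - x) < d \<longrightarrow> norm (g y - g x - (y - x) *\<^sub>R h x) \<le> \<eta> * norm (y - x))"
    using lebesgue_differentiation_upper[OF h] lebesgue_differentiation_upper[OF h']
  proof (eventually_elim, intro allI impI)
    fix x \<eta> :: real
    assume 1: "\<forall>\<eta>>0. \<exists>d>0. \<forall>a b. a \<le> x \<longrightarrow> x \<le> b \<longrightarrow> x - d < a \<longrightarrow> b < x + d \<longrightarrow> (LINT t:{a..b}|lborel. h t) \<le> (h x + \<eta>) * (b - a)"
      and 2: "\<forall>\<eta>>0. \<exists>d>0. \<forall>a b. a \<le> x \<longrightarrow> x \<le> b \<longrightarrow> x - d < a \<longrightarrow> b < x + d \<longrightarrow> (LINT t:{a..b}|lborel. - h t) \<le> (- h x + \<eta>) * (b - a)"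
      and \<eta>: "\<eta> > 0" and x: "a < x" "x < b"
    obtain d1 where d1: "d1 > 0" "\<And>a b. a \<le> x \<Longrightarrow> x \<le> b \<Longrightarrow> x - d1 < a \<Longrightarrow> b < x + d1 \<Longrightarrow> (LINT t:{a..b}|lborel. h t) \<le> (h x + \<eta>) * (b - a)"
      using 1 \<eta> by blast
    obtain d2 where d2: "d2 > 0" "\<And>a b. a \<le> x \<Longrightarrow> x \<le> b \<Longrightarrow> x - d2 < a \<Longrightarrow> b < x + d2 \<Longrightarrow> (LINT t:{a..b}|lborel. - h t) \<le> (- h x + \<eta>) * (b - a)"
      using 2 \<eta> by blast
    have neg: "(LINT t:{a..b}|lborel. - h t) = - (LINT t:{a..b}|lborel. h t)" for a b
      by (simp add: set_lebesgue_integral_def)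
    show "\<exists>d>0. \<forall>y. norm (y - x) < d \<longrightarrow> norm (g y - g x - (y - x) *\<^sub>R h x) \<le> \<eta> * norm (y - x)"
    proof (intro exI[of _ "min (min d1 d2) (min (x - a) (b - x))"] conjI allI impI)
      fix y assume y: "norm (y - x) < min (min d1 d2) (min (x - a) (b - x))"
      show "norm (g y - g x - (y - x) *\<^sub>R h x) \<le> \<eta> * norm (y - x)"
      proof (cases "x \<le> y")
        case True
        have "g y - g x = (LINT t:{x..y}|lborel. h t)" using True x y by (intro g) auto
        moreover have "(LINT t:{x..y}|lborel. h t) \<le> (h x + \<eta>) * (y - x)" using True y by (intro d1(2)) auto
        moreover have "- (LINT t:{x..y}|lborel. h t) \<le> (- h x + \<eta>) * (y - x)"
          unfolding neg[symmetric] using True y by (intro d2(2)) auto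
        ultimately show ?thesis using True by (simp add: abs_le_iff algebra_simps)
      next
        case False
        have "g x - g y = (LINT t:{y..x}|lborel. h t)" using False x y by (intro g) auto
        moreover have "(LINT t:{y..x}|lborel. h t) \<le> (h x + \<eta>) * (x - y)" using False y by (intro d1(2)) auto
        moreover have "- (LINT t:{y..x}|lborel. h t) \<le> (- h x + \<eta>) * (x - y)"
          unfolding neg[symmetric] using False y by (intro d2(2)) auto
        ultimately show ?thesis using False by (simp add: abs_le_iff algebra_simps)
      qed
    qed (use d1 d2 x in auto)
  qed
  then show ?thesis
  proof (eventually_elim, intro impI)
    fix x assume "a < x \<longrightarrow> x < b \<longrightarrow> (\<forall>\<eta>>0. \<exists>d>0. \<forall>y. norm (y - x) < d \<longrightarrow> norm (g y - g x - (y - x) *\<^sub>R h x) \<le> \<eta> * norm (y - x))"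
      "a < x" "x < b"
    then show "(g has_real_derivative h x) (at x)"
      unfolding has_real_derivative_iff_has_vector_derivative has_vector_derivative_def has_derivative_at_alt
      using bounded_linear_scaleR_left by blast
  qed
qed

section \<open>Absolutely continuous curves on a compact interval\<close>

lemma AC_curve_D:
  assumes "AC_curve a b \<theta>" "e > 0"
  obtains d where "d > 0" "\<And>n l r. (\<And>i. i < n \<Longrightarrow> a \<le> l i \<and> l i \<le> r i \<and> r i \<le> b) \<Longrightarrow>
     (\<And>i j. i < n \<Longrightarrow> j < n \<Longrightarrow> i \<noteq> j \<Longrightarrow> {l i<..<r i} \<inter> {l j<..<r j} = {}) \<Longrightarrow>
     (\<Sum>i<(n::nat). r i - l i) < d \<Longrightarrow> (\<Sum>i<n. norm (\<theta> (r i) - \<theta> (l i))) < e"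
proof -
  define P where "P n l r d \<longleftrightarrow> (\<forall>i<n. a \<le> l i \<and> l i \<le> r i \<and> r i \<le> b) \<and>
        (\<forall>i<n. \<forall>j<n. i \<noteq> j \<longrightarrow> {l i<..<r i} \<inter> {l j<..<r j} = {}) \<and> (\<Sum>i<(n::nat). r i - l i) < d" for n l r d
  define Q where "Q n l r \<longleftrightarrow> (\<Sum>i<(n::nat). norm (\<theta> (r i) - \<theta> (l i))) < e" for n l r
  have "\<forall>e>0. \<exists>d>0. \<forall>(n::nat) l r. (\<forall>i<n. a \<le> l i \<and> l i \<le> r i \<and> r i \<le> b) \<and>
        (\<forall>i<n. \<forall>j<n. i \<noteq> j \<longrightarrow> {l i<..<r i} \<inter> {l j<..<r j} = {}) \<and> (\<Sum>i<n. r i - l i) < d \<longrightarrow>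
        (\<Sum>i<n. norm (\<theta> (r i) - \<theta> (l i))) < e"
    using assms(1) unfolding AC_curve_def .
  from this[rule_format, OF assms(2), folded P_def Q_def]
  obtain d where d: "d > 0" "\<And>n l r. P n l r d \<Longrightarrow> Q n l r" by blast
  show thesis
  proof (rule that[OF d(1)])
    fix n :: nat and l r
    assume "\<And>i. i < n \<Longrightarrow> a \<le> l i \<and> l i \<le> r i \<and> r i \<le> b"
      "\<And>i j. i < n \<Longrightarrow> j < n \<Longrightarrow> i \<noteq> j \<Longrightarrow> {l i<..<r i} \<inter> {l j<..<r j} = {}" "(\<Sum>i<n. r i - l i) < d"
    then have "P n l r d" unfolding P_def by blast
    then show "(\<Sum>i<n. norm (\<theta> (r i) - \<theta> (l i))) < e" using d(2) unfolding Q_def by blast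
  qed
qed

lemma AC_curve_dominated:
  assumes AC: "AC_curve a b \<theta>" and L: "L \<ge> 0"
    and le: "\<And>x y. x \<in> {a..b} \<Longrightarrow> y \<in> {a..b} \<Longrightarrow> norm (g x - g y) \<le> L * norm (\<theta> x - \<theta> y)"
  shows "AC_curve a b g"
  unfolding AC_curve_def
proof (intro allI impI)
  fix e :: real assume e: "e > 0"
  then have "e / (L + 1) > 0" using L by simp
  then obtain d where d: "d > 0" "\<And>n l r. (\<And>i. i < n \<Longrightarrow> a \<le> l i \<and> l i \<le> r i \<and> r i \<le> b) \<Longrightarrow>
     (\<And>i j. i < n \<Longrightarrow> j < n \<Longrightarrow> i \<noteq> j \<Longrightarrow> {l i<..<r i} \<inter> {l j<..<r j} = {}) \<Longrightarrow>
     (\<Sum>i<(n::nat). r i - l i) < d \<Longrightarrow> (\<Sum>i<n. norm (\<theta> (r i) - \<theta> (l i))) < e / (L + 1)"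
    using AC_curve_D[OF AC] by blast
  show "\<exists>d>0. \<forall>(n::nat) l r. (\<forall>i<n. a \<le> l i \<and> l i \<le> r i \<and> r i \<le> b) \<and>
        (\<forall>i<n. \<forall>j<n. i \<noteq> j \<longrightarrow> {l i<..<r i} \<inter> {l j<..<r j} = {}) \<and> (\<Sum>i<n. r i - l i) < d \<longrightarrow>
        (\<Sum>i<n. norm (g (r i) - g (l i))) < e"
  proof (intro exI[of _ d] conjI allI impI d(1))
    fix n :: nat and l r
    assume h: "(\<forall>i<n. a \<le> l i \<and> l i \<le> r i \<and> r i \<le> b) \<and>
        (\<forall>i<n. \<forall>j<n. i \<noteq> j \<longrightarrow> {l i<..<r i} \<inter> {l j<..<r j} = {}) \<and> (\<Sum>i<n. r i - l i) < d"
    have "(\<Sum>i<n. norm (g (r i) - g (l i))) \<le> (\<Sum>i<n. L * norm (\<theta> (r i) - \<theta> (l i)))"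
      using h by (intro sum_mono le) force+
    also have "\<dots> \<le> (L + 1) * (\<Sum>i<n. norm (\<theta> (r i) - \<theta> (l i)))"
      unfolding sum_distrib_left[symmetric] by (intro mult_right_mono sum_nonneg) auto
    also have "\<dots> < (L + 1) * (e / (L + 1))" using d(2)[of n l r] h L by (intro mult_strict_left_mono) auto
    also have "\<dots> = e" using L by simp
    finally show "(\<Sum>i<n. norm (g (r i) - g (l i))) < e" .
  qed
qed

lemma AC_curve_lipschitz:
  assumes L: "L \<ge> 0" and le: "\<And>x y. x \<in> {a..b} \<Longrightarrow> y \<in> {a..b} \<Longrightarrow> norm (g x - g y) \<le> L * \<bar>x - y\<bar>"
  shows "AC_curve a b g"
proof (rule AC_curve_dominated[of _ _ "\<lambda>x::real. x"])
  show "AC_curve a b (\<lambda>x. x)" unfolding AC_curve_def by (intro allI impI exI conjI) (assumption, auto)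
qed (use assms in auto)

lemma AC_curve_continuous:
  assumes AC: "AC_curve a b \<theta>"
  shows "continuous_on {a..b} \<theta>"
  unfolding continuous_on_iff
proof (intro ballI allI impI)
  fix x e :: real assume x: "x \<in> {a..b}" and e: "e > 0"
  obtain d where d: "d > 0" "\<And>n l r. (\<And>i. i < n \<Longrightarrow> a \<le> l i \<and> l i \<le> r i \<and> r i \<le> b) \<Longrightarrow>
     (\<And>i j. i < n \<Longrightarrow> j < n \<Longrightarrow> i \<noteq> j \<Longrightarrow> {l i<..<r i} \<inter> {l j<..<r j} = {}) \<Longrightarrow>
     (\<Sum>i<(n::nat). r i - l i) < d \<Longrightarrow> (\<Sum>i<n. norm (\<theta> (r i) - \<theta> (l i))) < e"
    using AC_curve_D[OF AC e] by blast
  show "\<exists>d>0. \<forall>y\<in>{a..b}. dist y x < d \<longrightarrow> dist (\<theta> y) (\<theta> x) < e"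
  proof (intro exI[of _ d] conjI ballI impI d(1))
    fix y assume y: "y \<in> {a..b}" "dist y x < d"
    have "(\<Sum>i<(1::nat). norm (\<theta> (max x y) - \<theta> (min x y))) < e"
      using x y by (intro d(2)) (auto simp: dist_real_def)
    then show "dist (\<theta> y) (\<theta> x) < e" by (auto simp: dist_norm max_def min_def norm_minus_commute split: if_splits)
  qed
qed

text \<open>Over an interval shorter than \<open>d\<close> all partition sums stay below 1, and
  finitely many such intervals cover \<open>{a..b}\<close>. The control is the variation accumulated
  from \<open>a\<close>.\<close>

lemma AC_curve_variation:
  fixes \<theta> :: "real \<Rightarrow> 'a::real_normed_vector"
  assumes AC: "AC_curve a b \<theta>" and ab: "a \<le> b"
  shows "\<exists>G::real \<Rightarrow> real. \<forall>x y. a \<le> x \<longrightarrow> x \<le> y \<longrightarrow> y \<le> b \<longrightarrow> norm (\<theta> y - \<theta> x) \<le> G y - G x"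
proof -
  let ?S = "\<lambda>(n::nat) s. \<Sum>i<n. norm (\<theta> (s (Suc i)) - \<theta> (s i))"
  define W where "W x y K \<longleftrightarrow> (\<forall>n s. mono s \<longrightarrow> range s \<subseteq> {x..y} \<longrightarrow> ?S n s \<le> K)" for x y K :: real
  obtain d where d: "d > 0" "\<And>n l r. (\<And>i. i < n \<Longrightarrow> a \<le> l i \<and> l i \<le> r i \<and> r i \<le> b) \<Longrightarrow>
     (\<And>i j. i < n \<Longrightarrow> j < n \<Longrightarrow> i \<noteq> j \<Longrightarrow> {l i<..<r i} \<inter> {l j<..<r j} = {}) \<Longrightarrow>
     (\<Sum>i<(n::nat). r i - l i) < d \<Longrightarrow> (\<Sum>i<n. norm (\<theta> (r i) - \<theta> (l i))) < 1"
    using AC_curve_D[OF AC zero_less_one] by blast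
  have short: "W x y 1" if "a \<le> x" "y \<le> b" "y - x < d" for x y
    unfolding W_def
  proof (intro allI impI)
    fix n :: nat and s :: "nat \<Rightarrow> real" assume s: "mono s" "range s \<subseteq> {x..y}"
    have r: "s i \<in> {x..y}" for i using s(2) by blast
    have "?S n s < 1"
    proof (rule d(2))
      show "a \<le> s i \<and> s i \<le> s (Suc i) \<and> s (Suc i) \<le> b" for i
        using r[of i] r[of "Suc i"] monoD[OF s(1), of i "Suc i"] that by auto
      have "{s i<..<s (Suc i)} \<inter> {s j<..<s (Suc j)} = {}" if "i < j" for i j
        using monoD[OF s(1), of "Suc i" j] that by auto
      then show "{s i<..<s (Suc i)} \<inter> {s j<..<s (Suc j)} = {}" if "i \<noteq> j" for i j
        using that by (metis inf_commute linorder_neqE_nat)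
      have "(\<Sum>i<n. s (Suc i) - s i) = s n - s 0" by (induction n) auto
      then show "(\<Sum>i<n. s (Suc i) - s i) < d" using r[of n] r[of 0] that(3) by auto
    qed
    then show "?S n s \<le> 1" by simp
  qed
  have join: "W x z (K + K')" if xyz: "x \<le> y" "y \<le> z" and W: "W x y K" "W y z K'" for x y z K K'
    unfolding W_def
  proof (intro allI impI)
    fix n :: nat and s :: "nat \<Rightarrow> real" assume s: "mono s" "range s \<subseteq> {x..z}"
    have r: "s i \<in> {x..z}" for i using s(2) by blast
    \<comment> \<open>Clamping at \<open>y\<close> from above and from below splits the partition
      into two; the triangle inequality is used where \<open>y\<close> falls between two
      nodes.\<close>
    have "norm (\<theta> (s (Suc i)) - \<theta> (s i)) \<le> norm (\<theta> (min (s (Suc i)) y) - \<theta> (min (s i) y))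
        + norm (\<theta> (max (s (Suc i)) y) - \<theta> (max (s i) y))" for i
      using monoD[OF s(1), of i "Suc i"] norm_triangle_ineq[of "\<theta> y - \<theta> (s i)" "\<theta> (s (Suc i)) - \<theta> y"]
      by (auto simp: min_def max_def)
    then have "?S n s \<le> (\<Sum>i<n. norm (\<theta> (min (s (Suc i)) y) - \<theta> (min (s i) y))
        + norm (\<theta> (max (s (Suc i)) y) - \<theta> (max (s i) y)))" by (intro sum_mono)
    also have "\<dots> = ?S n (\<lambda>i. min (s i) y) + ?S n (\<lambda>i. max (s i) y)" by (rule sum.distrib)
    also have "?S n (\<lambda>i. min (s i) y) \<le> K"
    proof -
      have "mono (\<lambda>i. min (s i) y)" by (intro monoI min.mono monoD[OF s(1)]) auto
      moreover have "range (\<lambda>i. min (s i) y) \<subseteq> {x..y}" using r xyz by (auto simp: image_subset_iff)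
      ultimately show ?thesis using W(1) unfolding W_def by blast
    qed
    also have "?S n (\<lambda>i. max (s i) y) \<le> K'"
    proof -
      have "mono (\<lambda>i. max (s i) y)" by (intro monoI max.mono monoD[OF s(1)]) auto
      moreover have "range (\<lambda>i. max (s i) y) \<subseteq> {y..z}" using r xyz by (auto simp: image_subset_iff)
      ultimately show ?thesis using W(2) unfolding W_def by blast
    qed
    finally show "?S n s \<le> K + K'" by simp
  qed
  \<comment> \<open>Steps of half the length \<open>d\<close> respect the strict bound in
    \<open>short\<close>.\<close>
  have "W a (min b (a + real k * (d / 2))) (real (Suc k))" for k
  proof (induction k)
    case 0
    have "W a a 1" using ab d(1) by (intro short) auto
    then show ?case using ab by simp
  next
    case (Suc k)
    let ?y = "min b (a + real k * (d / 2))" and ?z = "min b (a + real (Suc k) * (d / 2))"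
    have e: "real (Suc k) * (d / 2) = real k * (d / 2) + d / 2" by (simp add: distrib_right add_divide_distrib)
    have "0 \<le> real k * (d / 2)" using d(1) by simp
    then have "?z - ?y < d" "a \<le> ?y" "?y \<le> ?z" unfolding e using d(1) ab by (auto simp: min_def)
    then show ?case using join[OF _ _ Suc.IH short[of ?y ?z]] by simp
  qed
  moreover obtain k where "(b - a) / (d / 2) \<le> real k" using real_arch_simple by blast
  then have "min b (a + real k * (d / 2)) = b" using d(1) by (simp add: field_simps min_def)
  ultimately have Wb: "W a b (real (Suc k))" by metis
  define V where "V x = {?S n s | n s. mono s \<and> range s \<subseteq> {a..x}}" for x
  have Vb: "v \<le> real (Suc k)" if "v \<in> V x" "x \<le> b" for v x
    using that Wb unfolding V_def W_def by fastforce
  then have bdd: "bdd_above (V x)" if "x \<le> b" for x using that by (intro bdd_aboveI) auto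
  have ne: "V x \<noteq> {}" if "a \<le> x" for x
    unfolding V_def using that by (auto intro!: exI[of _ "\<lambda>_. a"] exI[of _ "0::nat"] simp: mono_def)
  have "norm (\<theta> y - \<theta> x) \<le> Sup (V y) - Sup (V x)" if xy: "a \<le> x" "x \<le> y" "y \<le> b" for x y
  proof -
    have "v \<le> Sup (V y) - norm (\<theta> y - \<theta> x)" if v: "v \<in> V x" for v
    proof -
      obtain n s where s: "v = ?S n s" "mono s" "range s \<subseteq> {a..x}" using v unfolding V_def by blast
      have r: "s i \<in> {a..x}" for i using s(3) by blast
      \<comment> \<open>The points \<open>x\<close> and \<open>y\<close> are appended to a partition
        of the initial interval, so that the last increment is the one to be estimated.\<close>
      define t where "t i = (if i \<le> n then s i else if i = Suc n then x else y)" for i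
      have "mono t" unfolding mono_iff_le_Suc
        using monoD[OF s(2)] r xy(2) by (auto simp: t_def)
      moreover have "range t \<subseteq> {a..y}" using r xy by (fastforce simp: t_def)
      ultimately have "?S (Suc (Suc n)) t \<in> V y" unfolding V_def by blast
      then have "?S (Suc (Suc n)) t \<le> Sup (V y)" using bdd xy by (intro cSup_upper) auto
      moreover have "?S n t = ?S n s" by (intro sum.cong) (auto simp: t_def)
      moreover have "norm (\<theta> (t (Suc (Suc n))) - \<theta> (t (Suc n))) = norm (\<theta> y - \<theta> x)" by (simp add: t_def)
      moreover have "0 \<le> norm (\<theta> (t (Suc n)) - \<theta> (t n))" by simp
      ultimately show ?thesis using s(1) by (simp only: sum.lessThan_Suc)
    qed
    then have "Sup (V x) \<le> Sup (V y) - norm (\<theta> y - \<theta> x)" using ne xy by (intro cSup_least) auto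
    then show ?thesis by simp
  qed
  then show ?thesis by (intro exI[of _ "\<lambda>x. Sup (V x)"]) simp
qed

lemma open_connected_real:
  fixes C :: "real set"
  assumes "open C" "connected C" "C \<noteq> {}" "bounded C"
  shows "C = {Inf C<..<Sup C}" "Inf C < Sup C"
proof -
  have bd: "bdd_above C" "bdd_below C" using assms(4) by (auto intro: bounded_imp_bdd_above bounded_imp_bdd_below)
  have lt: "Inf C < x" "x < Sup C" if x: "x \<in> C" for x
  proof -
    obtain e where e: "e > 0" "cball x e \<subseteq> C" using assms(1) x open_contains_cball by blast
    then have "x - e \<in> C" "x + e \<in> C" by (auto simp: subset_iff dist_real_def)
    then have "Inf C \<le> x - e" "x + e \<le> Sup C" using bd by (auto intro: cInf_lower cSup_upper)
    then show "Inf C < x" "x < Sup C" using e(1) by auto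
  qed
  show "C = {Inf C<..<Sup C}"
  proof (intro set_eqI iffI)
    fix x assume x: "x \<in> {Inf C<..<Sup C}"
    obtain y where y: "y \<in> C" "y < x" using x cInf_less_iff[OF assms(3) bd(2)] by auto
    obtain z where z: "z \<in> C" "x < z" using x less_cSup_iff[OF assms(3) bd(1)] by auto
    show "x \<in> C" using connectedD_interval[OF assms(2) y(1) z(1)] y z by auto
  qed (use lt in auto)
  show "Inf C < Sup C" using assms(3) lt less_trans by blast
qed

context bv_curve
begin

lemma DU_norm_le: "A \<in> sets borel \<Longrightarrow> norm (DU A) \<le> measure (total_variation_measure DU) A"
proof -
  assume A: "A \<in> sets borel"
  interpret finite_measure "total_variation_measure DU" by (rule total_variation_sigma_finite[OF DU(1)])
  have "ennreal (norm (DU A)) \<le> ennreal (measure (total_variation_measure DU) A)"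
    using norm_le_total_variation[OF DU(1) A] emeasure_total_variation_measure[OF DU(1) A]
    by (simp add: emeasure_eq_measure)
  then show ?thesis by (subst (asm) ennreal_le_iff) auto
qed

text \<open>A compact part of an open neighbourhood of a null set is covered by finitely many of its
  components, to which the definition of absolute continuity applies.\<close>

lemma AC_imp_null:
  assumes AC: "AC_curve 0 T u" and N: "N \<in> null_sets lborel"
  shows "DU N = 0"
proof -
  let ?V = "total_variation_measure DU"
  have fV: "finite_measure ?V" by (rule total_variation_sigma_finite[OF DU(1)])
  interpret V: finite_measure ?V by (rule fV)
  have sV: "sets ?V = sets borel" by (rule sets_total_variation_measure[OF DU(1)])
  have cont: "continuous_on {0..T} u" by (rule AC_curve_continuous[OF AC])
  have LLu: "LL u t = u t" if "0 < t" "t \<le> T" for t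
  proof -
    have "(u \<longlongrightarrow> u t) (at t within {0..T})" using cont that by (simp add: continuous_on_def)
    then have "(u \<longlongrightarrow> u t) (at t within {0..t})" by (rule tendsto_within_subset) (use that in auto)
    then have "(u \<longlongrightarrow> u t) (at_left t)" using at_within_Icc_at_left[of 0 t] that by simp
    then show ?thesis by (intro tendsto_Lim) auto
  qed
  have RLu: "RL u t = u t" if "0 \<le> t" "t < T" for t
  proof -
    have "(u \<longlongrightarrow> u t) (at t within {0..T})" using cont that by (simp add: continuous_on_def)
    then have "(u \<longlongrightarrow> u t) (at t within {t..T})" by (rule tendsto_within_subset) (use that in auto)
    then have "(u \<longlongrightarrow> u t) (at_right t)" using at_within_Icc_at_right[of t T] that by simp
    then show ?thesis by (intro tendsto_Lim) auto
  qed
  have Nb: "N \<in> sets borel" using N by auto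
  define M where "M = N \<inter> {0<..<T}"
  have Mb: "M \<in> sets borel" using Nb by (simp add: M_def)
  have Mnull: "M \<in> null_sets lborel" unfolding M_def using N by (intro null_set_Int2) auto
  have "norm (DU M) \<le> 3 * e" if e: "e > 0" for e
  proof -
    obtain d where d: "d > 0" "\<And>n l r. (\<And>i. i < n \<Longrightarrow> 0 \<le> l i \<and> l i \<le> r i \<and> r i \<le> T) \<Longrightarrow>
       (\<And>i j. i < n \<Longrightarrow> j < n \<Longrightarrow> i \<noteq> j \<Longrightarrow> {l i<..<r i} \<inter> {l j<..<r j} = {}) \<Longrightarrow>
       (\<Sum>i<(n::nat). r i - l i) < d \<Longrightarrow> (\<Sum>i<n. norm (u (r i) - u (l i))) < e"
      using AC_curve_D[OF AC e] by blast
    obtain O1 where O1: "open O1" "M \<subseteq> O1" "emeasure lebesgue (O1 - M) < ennreal d"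
    proof (rule sets_lebesgue_outer_open[of M d])
      show "M \<in> sets lebesgue" using Mb by simp
    qed (use d(1) in auto)
    obtain O2 where O2: "open O2" "M \<subseteq> O2" "measure ?V (O2 - M) < e"
      using finite_measure_open_approx[OF fV sV Mb e] by blast
    \<comment> \<open>One neighbourhood is short in Lebesgue measure, the other carries little
      variation of \<open>DU\<close> outside \<open>M\<close>; the intersection has both
      properties.\<close>
    define Om where "Om = O1 \<inter> O2 \<inter> {0<..<T}"
    have Om: "open Om" "M \<subseteq> Om" "Om \<subseteq> {0<..<T}" using O1 O2 by (auto simp: Om_def M_def)
    have Ob: "Om \<in> sets borel" using Om(1) by simp
    have OM: "measure ?V (Om - M) < e"
    proof -
      have "measure ?V (Om - M) \<le> measure ?V (O2 - M)" using O2 Mb sV by (intro V.finite_measure_mono) (auto simp: Om_def)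
      then show ?thesis using O2(3) by simp
    qed
    have Ol: "emeasure lborel Om < ennreal d"
    proof -
      have "emeasure lborel Om \<le> emeasure lborel ((O1 - M) \<union> M)" using O1 Mb by (intro emeasure_mono) (auto simp: Om_def)
      also have "\<dots> = emeasure lborel (O1 - M)" using O1(1) Mb Mnull by (intro emeasure_Un_null_set) auto
      finally show ?thesis using O1 Mb by simp
    qed
    obtain K where K: "compact K" "K \<subseteq> Om" "measure ?V (Om - K) < e"
      using finite_measure_compact_approx[OF fV sV Ob e] by blast
    have "K \<subseteq> \<Union> (components Om)" using K(2) by simp
    moreover have "\<And>C. C \<in> components Om \<Longrightarrow> open C" using Om(1) open_components by blast
    ultimately obtain FF where FF: "FF \<subseteq> components Om" "finite FF" "K \<subseteq> \<Union> FF"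
      using compactE[OF K(1), of "components Om"] by blast
    have C: "C = {Inf C<..<Sup C}" "Inf C < Sup C" "0 \<le> Inf C" "Sup C \<le> T" "C \<subseteq> Om" if "C \<in> FF" for C
    proof -
      have c: "C \<in> components Om" using that FF(1) by blast
      have sub: "C \<subseteq> Om" using c by (rule in_components_subset)
      then have sub': "C \<subseteq> {0<..<T}" using Om(3) by blast
      have ne: "C \<noteq> {}" using c by (rule in_components_nonempty)
      have b: "bounded C" using sub' by (intro bounded_subset[OF bounded_closed_interval[of 0 T]]) auto
      show "C = {Inf C<..<Sup C}" "Inf C < Sup C"
        using open_connected_real[OF open_components[OF Om(1) c] in_components_connected[OF c] ne b] by blast+
      show "0 \<le> Inf C" using sub' ne by (intro cInf_greatest) auto
      show "Sup C \<le> T" using sub' ne by (intro cSup_least) auto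
      show "C \<subseteq> Om" by (rule sub)
    qed
    have dj: "C \<inter> D = {}" if "C \<in> FF" "D \<in> FF" "C \<noteq> D" for C D
      using pairwiseD[OF pairwise_disjoint_components, of C Om D] that FF(1) by blast
    obtain q where q: "bij_betw q {0..<card FF} FF" using ex_bij_betw_nat_finite[OF FF(2)] by blast
    define n where "n = card FF"
    have q: "bij_betw q {..<n} FF" using q by (simp add: n_def atLeast0LessThan)
    have qF: "q i \<in> FF" if "i < n" for i using q that bij_betwE by blast
    have qinj: "q i \<noteq> q j" if "i < n" "j < n" "i \<noteq> j" for i j
      using q that unfolding bij_betw_def inj_on_def by blast
    have W: "\<Union> FF = (\<Union>i<n. q i)" using q by (auto simp: bij_betw_def)
    have qb: "q i \<in> sets borel" if "i < n" for i
    proof -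
      have "{Inf (q i)<..<Sup (q i)} \<in> sets borel" by simp
      then show ?thesis using C(1)[OF qF[OF that]] by simp
    qed
    have djq: "disjoint_family_on q {..<n}" using dj qF qinj by (auto simp: disjoint_family_on_def)
    have Wb: "\<Union> FF \<in> sets borel" unfolding W using qb by (intro sets.finite_UN) auto
    have WO: "\<Union> FF \<subseteq> Om" using C(5) by blast
    have lq: "emeasure lborel (q i) = ennreal (Sup (q i) - Inf (q i))" if "i < n" for i
    proof -
      have "emeasure lborel {Inf (q i)<..<Sup (q i)} = ennreal (Sup (q i) - Inf (q i))"
        using C(2)[OF qF[OF that]] by simp
      then show ?thesis using C(1)[OF qF[OF that]] by simp
    qed
    have "ennreal (\<Sum>i<n. Sup (q i) - Inf (q i)) = (\<Sum>i<n. emeasure lborel (q i))"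
      using lq C(2)[OF qF] by (subst sum_ennreal[symmetric]) (auto intro: less_imp_le)
    also have "\<dots> = emeasure lborel (\<Union>i<n. q i)"
      using qb djq by (intro sum_emeasure) auto
    also have "\<dots> \<le> emeasure lborel Om" using WO Ob unfolding W by (intro emeasure_mono) auto
    also have "\<dots> < ennreal d" by (rule Ol)
    finally have "ennreal (\<Sum>i<n. Sup (q i) - Inf (q i)) < ennreal d" .
    moreover have "0 \<le> (\<Sum>i<n. Sup (q i) - Inf (q i))"
      using C(2)[OF qF] by (intro sum_nonneg) (simp add: less_imp_le)
    ultimately have len: "(\<Sum>i<n. Sup (q i) - Inf (q i)) < d" by (simp add: ennreal_less_iff)
    have DC: "DU (q i) = u (Sup (q i)) - u (Inf (q i))" if i: "i < n" for i
    proof -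
      note Ci = C[OF qF[OF i]]
      have "DU {Inf (q i)<..<Sup (q i)} = LL u (Sup (q i)) - RL u (Inf (q i))" using Ci by (intro DU(3)) auto
      also have "\<dots> = u (Sup (q i)) - u (Inf (q i))" using Ci LLu RLu by auto
      finally show ?thesis using Ci(1) by simp
    qed
    have "DU (\<Union> FF) = (\<Sum>i<n. DU (q i))" unfolding W using qb djq by (intro vm_UN_finite[OF DU(1)]) auto
    also have "norm \<dots> \<le> (\<Sum>i<n. norm (DU (q i)))" by (rule norm_sum)
    also have "\<dots> = (\<Sum>i<n. norm (u (Sup (q i)) - u (Inf (q i))))" using DC by simp
    also have "\<dots> < e"
    proof (rule d(2))
      show "0 \<le> Inf (q i) \<and> Inf (q i) \<le> Sup (q i) \<and> Sup (q i) \<le> T" if "i < n" for i using C[OF qF[OF that]] by auto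
      show "{Inf (q i)<..<Sup (q i)} \<inter> {Inf (q j)<..<Sup (q j)} = {}" if "i < n" "j < n" "i \<noteq> j" for i j
        using dj[OF qF[OF that(1)] qF[OF that(2)] qinj[OF that]] C(1)[OF qF[OF that(1)]] C(1)[OF qF[OF that(2)]] by simp
    qed (rule len)
    finally have 1: "norm (DU (\<Union> FF)) < e" .
    have "norm (DU (Om - \<Union> FF)) \<le> measure ?V (Om - \<Union> FF)" using Ob Wb by (intro DU_norm_le) auto
    also have "\<dots> \<le> measure ?V (Om - K)" using FF(3) Ob K(1) sV by (intro V.finite_measure_mono) (auto intro: borel_compact)
    finally have 2: "norm (DU (Om - \<Union> FF)) < e" using K(3) by simp
    have 3: "norm (DU (Om - M)) < e" using DU_norm_le[of "Om - M"] Ob Mb OM by simp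
    \<comment> \<open>Three errors below \<open>e\<close>: finitely many components of total length
      below \<open>d\<close>, the part of the neighbourhood that they miss, and the neighbourhood
      without the null set.\<close>
    have "DU M = DU (\<Union> FF) + DU (Om - \<Union> FF) - DU (Om - M)"
      using vm_Diff[OF DU(1) Ob Wb WO] vm_Diff[OF DU(1) Ob Mb Om(2)] by simp
    then have "norm (DU M) \<le> norm (DU (\<Union> FF) + DU (Om - \<Union> FF)) + norm (DU (Om - M))"
      by (simp only: norm_triangle_ineq4)
    then show ?thesis using norm_triangle_ineq[of "DU (\<Union> FF)" "DU (Om - \<Union> FF)"] 1 2 3 by linarith
  qed
  from this[of "e / 3" for e] have "norm (DU M) \<le> 0 + e" if "e > 0" for e using that by simp
  then have "norm (DU M) \<le> 0" by (rule field_le_epsilon)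
  then show ?thesis using DU(2)[OF Nb] by (simp add: M_def)
qed

text \<open>Vanishing on Lebesgue null sets yields a density of \<open>DU\<close>; continuity
  replaces the one-sided limits at the ends by values.\<close>

lemma AC_integral_aux:
  assumes AC: "AC_curve 0 T u"
  shows "\<exists>f. integrable lborel f \<and> (\<forall>x y. 0 \<le> x \<longrightarrow> x \<le> y \<longrightarrow> y \<le> T \<longrightarrow> u y - u x = (LINT t:{x..y}|lborel. f t))"
proof -
  have "DU A = 0" if "A \<in> sets borel" "emeasure lborel A = 0" for A
    using that by (intro AC_imp_null[OF AC]) auto
  then obtain f where f: "integrable lborel f" "\<And>A. A \<in> sets borel \<Longrightarrow> DU A = (LINT t:A|lborel. f t)"
    using vm_density_exists[OF DU(1) sigma_finite_lborel sets_lborel] by blast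
  have cont: "continuous_on {0..T} u" by (rule AC_curve_continuous[OF AC])
  have "u y - u x = (LINT t:{x..y}|lborel. f t)" if xy: "0 \<le> x" "x \<le> y" "y \<le> T" for x y
  proof (cases "x = y")
    case True
    have "(LINT t:{y..y}|lborel. f t) = 0" unfolding set_lebesgue_integral_def
      by (intro integral_eq_zero_AE) (use AE_lborel_singleton[of y] in \<open>eventually_elim, simp\<close>)
    then show ?thesis using True by simp
  next
    case False
    then have lt: "x < y" using xy by simp
    have "(u \<longlongrightarrow> u y) (at y within {0..T})" using cont xy by (simp add: continuous_on_def)
    then have "(u \<longlongrightarrow> u y) (at y within {x..y})" by (rule tendsto_within_subset) (use xy in auto)
    then have "(u \<longlongrightarrow> u y) (at_left y)" using at_within_Icc_at_left[OF lt] by simp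
    then have L: "LL u y = u y" by (intro tendsto_Lim) auto
    have "(u \<longlongrightarrow> u x) (at x within {0..T})" using cont xy by (simp add: continuous_on_def)
    then have "(u \<longlongrightarrow> u x) (at x within {x..y})" by (rule tendsto_within_subset) (use xy in auto)
    then have "(u \<longlongrightarrow> u x) (at_right x)" using at_within_Icc_at_right[OF lt] by simp
    then have R: "RL u x = u x" by (intro tendsto_Lim) auto
    have fm: "f \<in> borel_measurable borel" using f(1) by (simp add: borel_measurable_integrable)
    have ae: "AE t in lborel. indicator {x<..<y} t *\<^sub>R f t = indicator {x..y} t *\<^sub>R f t"
      using AE_lborel_singleton[of x] AE_lborel_singleton[of y] by eventually_elim (auto split: split_indicator)
    have "u y - u x = DU {x<..<y}" using DU(3)[of x y] xy lt L R by simp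
    also have "\<dots> = (LINT t:{x<..<y}|lborel. f t)" by (rule f(2)) simp
    also have "\<dots> = (LINT t:{x..y}|lborel. f t)" unfolding set_lebesgue_integral_def
      by (rule integral_cong_AE[OF _ _ ae]) (use fm in measurable)
    finally show ?thesis .
  qed
  then show ?thesis using f(1) by blast
qed

end

context finite_dim_basis
begin

text \<open>Translating the interval to start at 0 and clamping the parameter produce a curve on the
  whole line, to which the derivative measure applies.\<close>

lemma AC_integral:
  fixes \<theta> :: "real \<Rightarrow> 'a"
  assumes AC: "AC_curve a b \<theta>" and ab: "a < b"
  shows "\<exists>f. integrable lborel f \<and> (\<forall>x y. a \<le> x \<longrightarrow> x \<le> y \<longrightarrow> y \<le> b \<longrightarrow> \<theta> y - \<theta> x = (LINT t:{x..y}|lborel. f t))"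
proof -
  obtain G where G: "\<And>x y. a \<le> x \<Longrightarrow> x \<le> y \<Longrightarrow> y \<le> b \<Longrightarrow> norm (\<theta> y - \<theta> x) \<le> G y - G x"
    using AC_curve_variation[OF AC less_imp_le[OF ab]] by blast
  define T where "T = b - a"
  define cl where "cl t = a + max 0 (min T t)" for t
  have cl: "a \<le> cl t" "cl t \<le> b" "s \<le> t \<Longrightarrow> cl s \<le> cl t" "\<bar>cl t - cl s\<bar> \<le> \<bar>t - s\<bar>" for s t
    using ab by (auto simp: cl_def T_def)
  have cl': "cl t = a + t" if "0 \<le> t" "t \<le> T" for t using that by (simp add: cl_def)
  interpret c: bv_curve B "\<lambda>t. \<theta> (cl t)" "\<lambda>t. G (cl t)" T
  proof
    show "T > 0" using ab by (simp add: T_def)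
    show "mono (\<lambda>t. G (cl t))"
    proof (rule monoI)
      fix s t :: real assume "s \<le> t"
      then have "norm (\<theta> (cl t) - \<theta> (cl s)) \<le> G (cl t) - G (cl s)" using cl by (intro G) auto
      then show "G (cl s) \<le> G (cl t)" using norm_ge_zero[of "\<theta> (cl t) - \<theta> (cl s)"] by linarith
    qed
    show "norm (\<theta> (cl t) - \<theta> (cl s)) \<le> G (cl t) - G (cl s)" if "s \<le> t" for s t using cl that by (intro G) auto
    show "\<theta> (cl t) = \<theta> (cl 0)" if "t \<le> 0" for t using that ab by (simp add: cl_def T_def min_def max_def)
    show "\<theta> (cl t) = \<theta> (cl T)" if "t \<ge> T" for t using that ab by (simp add: cl_def T_def min_def max_def)
  qed
  have "AC_curve 0 T (\<lambda>t. \<theta> (cl t))"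
    unfolding AC_curve_def
  proof (intro allI impI)
    fix e :: real assume e: "e > 0"
    obtain d where d: "d > 0" "\<And>n l r. (\<And>i. i < n \<Longrightarrow> a \<le> l i \<and> l i \<le> r i \<and> r i \<le> b) \<Longrightarrow>
       (\<And>i j. i < n \<Longrightarrow> j < n \<Longrightarrow> i \<noteq> j \<Longrightarrow> {l i<..<r i} \<inter> {l j<..<r j} = {}) \<Longrightarrow>
       (\<Sum>i<(n::nat). r i - l i) < d \<Longrightarrow> (\<Sum>i<n. norm (\<theta> (r i) - \<theta> (l i))) < e"
      using AC_curve_D[OF AC e] by blast
    show "\<exists>d>0. \<forall>(n::nat) l r. (\<forall>i<n. 0 \<le> l i \<and> l i \<le> r i \<and> r i \<le> T) \<and>
        (\<forall>i<n. \<forall>j<n. i \<noteq> j \<longrightarrow> {l i<..<r i} \<inter> {l j<..<r j} = {}) \<and> (\<Sum>i<n. r i - l i) < d \<longrightarrow>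
        (\<Sum>i<n. norm (\<theta> (cl (r i)) - \<theta> (cl (l i)))) < e"
    proof (intro exI[of _ d] conjI allI impI d(1))
      fix n :: nat and l r
      assume h: "(\<forall>i<n. 0 \<le> l i \<and> l i \<le> r i \<and> r i \<le> T) \<and>
        (\<forall>i<n. \<forall>j<n. i \<noteq> j \<longrightarrow> {l i<..<r i} \<inter> {l j<..<r j} = {}) \<and> (\<Sum>i<n. r i - l i) < d"
      have "(\<Sum>i<n. norm (\<theta> (a + r i) - \<theta> (a + l i))) < e"
      proof (rule d(2))
        show "a \<le> a + l i \<and> a + l i \<le> a + r i \<and> a + r i \<le> b" if "i < n" for i using h that by (auto simp: T_def)
        show "{a + l i<..<a + r i} \<inter> {a + l j<..<a + r j} = {}" if ij: "i < n" "j < n" "i \<noteq> j" for i j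
        proof -
          have "{l i<..<r i} \<inter> {l j<..<r j} = {}" using h ij by blast
          then have *: "\<not> (x - a \<in> {l i<..<r i} \<and> x - a \<in> {l j<..<r j})" for x by blast
          show ?thesis
          proof (rule equals0I)
            fix x assume "x \<in> {a + l i<..<a + r i} \<inter> {a + l j<..<a + r j}"
            then show False using *[of x] by auto
          qed
        qed
        show "(\<Sum>i<n. (a + r i) - (a + l i)) < d" using h by simp
      qed
      moreover have "(\<Sum>i<n. norm (\<theta> (cl (r i)) - \<theta> (cl (l i)))) = (\<Sum>i<n. norm (\<theta> (a + r i) - \<theta> (a + l i)))"
      proof (intro sum.cong refl)
        fix i assume i: "i \<in> {..<n}"
        then have "0 \<le> l i" "l i \<le> r i" "r i \<le> T" using h by auto
        then show "norm (\<theta> (cl (r i)) - \<theta> (cl (l i))) = norm (\<theta> (a + r i) - \<theta> (a + l i))" by (simp add: cl')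
      qed
      ultimately show "(\<Sum>i<n. norm (\<theta> (cl (r i)) - \<theta> (cl (l i)))) < e" by simp
    qed
  qed
  then obtain f where f: "integrable lborel f"
    "\<And>x y. 0 \<le> x \<Longrightarrow> x \<le> y \<Longrightarrow> y \<le> T \<Longrightarrow> \<theta> (cl y) - \<theta> (cl x) = (LINT t:{x..y}|lborel. f t)"
    using c.AC_integral_aux by blast
  define k where "k t = f (- a + 1 * t)" for t
  have "integrable lborel k" unfolding k_def by (rule lborel_integrable_real_affine[OF f(1)]) simp
  moreover have "\<theta> y - \<theta> x = (LINT t:{x..y}|lborel. k t)" if xy: "a \<le> x" "x \<le> y" "y \<le> b" for x y
  proof -
    have "\<theta> y - \<theta> x = \<theta> (cl (y - a)) - \<theta> (cl (x - a))" using xy by (simp add: cl' T_def)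
    also have "\<dots> = (LINT t:{x - a..y - a}|lborel. f t)" using xy by (intro f(2)) (auto simp: T_def)
    also have "\<dots> = (LINT t|lborel. indicator {x - a..y - a} (- a + 1 * t) *\<^sub>R f (- a + 1 * t))"
      unfolding set_lebesgue_integral_def by (subst lborel_integral_real_affine[where c=1 and t="- a"]) auto
    also have "\<dots> = (LINT t:{x..y}|lborel. k t)"
      unfolding set_lebesgue_integral_def k_def
      by (intro Bochner_Integration.integral_cong) (auto split: split_indicator)
    finally show ?thesis .
  qed
  ultimately show ?thesis by blast
qed

lemma AC_differentiable:
  fixes \<theta> :: "real \<Rightarrow> 'a"
  assumes AC: "AC_curve a b \<theta>" and ab: "a < b"
  obtains f where "integrable lborel f" "\<And>x y. a \<le> x \<Longrightarrow> x \<le> y \<Longrightarrow> y \<le> b \<Longrightarrow> \<theta> y - \<theta> x = (LINT t:{x..y}|lborel. f t)"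
    "AE t in lborel. a < t \<longrightarrow> t < b \<longrightarrow> (\<theta> has_vector_derivative f t) (at t)"
proof -
  obtain f where f: "integrable lborel f" "\<And>x y. a \<le> x \<Longrightarrow> x \<le> y \<Longrightarrow> y \<le> b \<Longrightarrow> \<theta> y - \<theta> x = (LINT t:{x..y}|lborel. f t)"
    using AC_integral[OF AC ab] by blast
  have "AE t in lborel. a < t \<longrightarrow> t < b \<longrightarrow> ((\<lambda>t. cf (\<theta> t) c) has_real_derivative cf (f t) c) (at t)" if c: "c \<in> B" for c
  proof (rule lebesgue_differentiation)
    show "integrable lborel (\<lambda>t. cf (f t) c)" by (rule integrable_bounded_linear[OF bounded_linear_cf[OF c] f(1)])
    fix x y assume xy: "a \<le> x" "x \<le> y" "y \<le> b"
    have i: "integrable lborel (\<lambda>t. indicator {x..y} t *\<^sub>R f t)" using f(1) by (intro integrable_mult_indicator) auto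
    have "cf (\<theta> y) c - cf (\<theta> x) c = cf (\<theta> y - \<theta> x) c" by (simp add: bounded_linear.linear[OF bounded_linear_cf[OF c], THEN linear_diff])
    also have "\<dots> = cf (LINT t|lborel. indicator {x..y} t *\<^sub>R f t) c" using f(2)[OF xy] by (simp add: set_lebesgue_integral_def)
    also have "\<dots> = (LINT t|lborel. cf (indicator {x..y} t *\<^sub>R f t) c)"
      by (rule integral_bounded_linear[OF bounded_linear_cf[OF c] i, symmetric])
    finally show "cf (\<theta> y) c - cf (\<theta> x) c = (LINT t:{x..y}|lborel. cf (f t) c)"
      by (simp add: set_lebesgue_integral_def cf_scale)
  qed
  then have "AE t in lborel. \<forall>c\<in>B. a < t \<longrightarrow> t < b \<longrightarrow> ((\<lambda>t. cf (\<theta> t) c) has_real_derivative cf (f t) c) (at t)"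
    using finite_B by (intro AE_finite_allI)
  then have "AE t in lborel. a < t \<longrightarrow> t < b \<longrightarrow> (\<theta> has_vector_derivative f t) (at t)"
  proof (eventually_elim, intro impI)
    fix t assume h: "\<forall>c\<in>B. a < t \<longrightarrow> t < b \<longrightarrow> ((\<lambda>t. cf (\<theta> t) c) has_real_derivative cf (f t) c) (at t)" "a < t" "t < b"
    have "((\<lambda>t. \<Sum>c\<in>B. cf (\<theta> t) c *\<^sub>R c) has_vector_derivative (\<Sum>c\<in>B. cf (f t) c *\<^sub>R c)) (at t)"
    proof (rule has_vector_derivative_sum)
      fix c assume "c \<in> B"
      then have "((\<lambda>t. cf (\<theta> t) c) has_real_derivative cf (f t) c) (at t)" using h by blast
      from has_vector_derivative_scaleR[OF this has_vector_derivative_const, of c]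
      show "((\<lambda>t. cf (\<theta> t) c *\<^sub>R c) has_vector_derivative cf (f t) c *\<^sub>R c) (at t)" by simp
    qed
    then show "(\<theta> has_vector_derivative f t) (at t)" unfolding expand[symmetric] .
  qed
  then show thesis using that f by blast
qed

end

section \<open>Bounds for the Finsler cost\<close>

text \<open>The energy along an absolutely continuous curve is itself an absolutely continuous
  real-valued curve; this instance makes the same differentiation theorem available for it.\<close>

lemma finite_dim_basis_real: "finite_dim_basis {1::real}"
proof
  have "x \<in> span {1}" for x :: real using span_scale[OF span_base[of 1 "{1::real}"], of x] by simp
  then show "span {1::real} = UNIV" by blast
  show "independent {1::real}" using dependent_single by simp
qed simp

lemma ennreal_integral_le:
  fixes k :: "'b \<Rightarrow> real"
  assumes "integrable M k" shows "ennreal (integral\<^sup>L M k) \<le> (\<integral>\<^sup>+t. ennreal (k t) \<partial>M)"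
proof -
  have "integral\<^sup>L M k \<le> (LINT t|M. max 0 (k t))" using assms by (intro integral_mono integrable_max) auto
  then have "ennreal (integral\<^sup>L M k) \<le> ennreal (LINT t|M. max 0 (k t))" by (rule ennreal_leI)
  also have "\<dots> = (\<integral>\<^sup>+t. ennreal (max 0 (k t)) \<partial>M)"
    using assms by (intro nn_integral_eq_integral[symmetric] integrable_max) auto
  also have "\<dots> = (\<integral>\<^sup>+t. ennreal (k t) \<partial>M)" by (intro nn_integral_cong) (simp add: ennreal_max_0)
  finally show ?thesis .
qed

context finite_dim_basis
begin

lemma C1_lipschitz_on_cball:
  fixes \<phi> :: "'a \<Rightarrow> real" and D\<phi> :: "'a \<Rightarrow> 'a \<Rightarrow>\<^sub>L real"
  assumes \<phi>: "\<And>x. (\<phi> has_derivative blinfun_apply (D\<phi> x)) (at x)" and cont: "continuous_on UNIV D\<phi>"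
  shows "\<exists>L\<ge>0. \<forall>x\<in>cball 0 R. \<forall>y\<in>cball 0 R. \<bar>\<phi> x - \<phi> y\<bar> \<le> L * norm (x - y)"
proof -
  have "compact (cball (0::'a) R)"
    by (rule compact_bounded_closed) (auto simp: bounded_iff closed_cball)
  then have "compact (D\<phi> ` cball 0 R)" using cont by (intro compact_continuous_image) (auto intro: continuous_on_subset)
  then have "bounded (D\<phi> ` cball 0 R)" by (rule compact_imp_bounded)
  then obtain L where "\<forall>x\<in>cball 0 R. norm (D\<phi> x) \<le> L" by (auto simp: bounded_iff)
  then have L: "\<And>x. x \<in> cball 0 R \<Longrightarrow> norm (D\<phi> x) \<le> L" by blast
  have "\<bar>\<phi> x - \<phi> y\<bar> \<le> max 0 L * norm (x - y)" if "x \<in> cball 0 R" "y \<in> cball 0 R" for x y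
  proof -
    have "norm (\<phi> x - \<phi> y) \<le> max 0 L * norm (x - y)"
    proof (rule differentiable_bound[OF convex_cball _ _ that])
      show "(\<phi> has_derivative blinfun_apply (D\<phi> x)) (at x within cball 0 R)" for x
        using \<phi> by (rule has_derivative_at_withinI)
      show "onorm (blinfun_apply (D\<phi> x)) \<le> max 0 L" if "x \<in> cball 0 R" for x
        using L[OF that] by (simp add: norm_blinfun.rep_eq)
    qed
    then show ?thesis by simp
  qed
  then show ?thesis by (intro exI[of _ "max 0 L"]) auto
qed

text \<open>Chain rule along a competitor: the curve and \<phi> along it are both absolutely
  continuous, and wherever both are differentiable the loss rate of \<phi> is at most the integrand.
  It is applied to linear functionals in K* and to the energy at a frozen time.\<close>

lemma finsler_cost_ge:
  fixes \<phi> :: "'a \<Rightarrow> real" and D\<phi> :: "'a \<Rightarrow> 'a \<Rightarrow>\<^sub>L real"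
  assumes \<phi>: "\<And>x. (\<phi> has_derivative blinfun_apply (D\<phi> x)) (at x)" and cont: "continuous_on UNIV D\<phi>"
    and le: "\<And>x v. - blinfun_apply (D\<phi> x) v \<le> p v (- D x)"
  shows "ennreal (\<phi> u0 - \<phi> u1) \<le> finsler_cost p D u0 u1"
  unfolding finsler_cost_def
proof (rule Inf_greatest, safe)
  fix \<theta> :: "real \<Rightarrow> 'a" and r0 r1 :: real
  assume r: "r0 < r1" and AC: "AC_curve r0 r1 \<theta>"
  obtain f where f: "integrable lborel f" "\<And>x y. r0 \<le> x \<Longrightarrow> x \<le> y \<Longrightarrow> y \<le> r1 \<Longrightarrow> \<theta> y - \<theta> x = (LINT t:{x..y}|lborel. f t)"
    "AE t in lborel. r0 < t \<longrightarrow> t < r1 \<longrightarrow> (\<theta> has_vector_derivative f t) (at t)"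
    using AC_differentiable[OF AC r] by blast
  have "bounded (\<theta> ` {r0..r1})"
    using AC_curve_continuous[OF AC] by (intro compact_imp_bounded compact_continuous_image) auto
  then obtain R where "\<forall>t\<in>{r0..r1}. norm (\<theta> t) \<le> R" by (auto simp: bounded_iff)
  then have R: "\<And>t. t \<in> {r0..r1} \<Longrightarrow> \<theta> t \<in> cball 0 R" by simp
  obtain L where L: "L \<ge> 0" "\<And>x y. x \<in> cball 0 R \<Longrightarrow> y \<in> cball 0 R \<Longrightarrow> \<bar>\<phi> x - \<phi> y\<bar> \<le> L * norm (x - y)"
    using C1_lipschitz_on_cball[OF \<phi> cont] by blast
  have ACg: "AC_curve r0 r1 (\<lambda>t. \<phi> (\<theta> t))"
    by (rule AC_curve_dominated[OF AC L(1)]) (use L(2) R in auto)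
  interpret r: finite_dim_basis "{1::real}" by (rule finite_dim_basis_real)
  obtain h where h: "integrable lborel h"
    "\<And>x y. r0 \<le> x \<Longrightarrow> x \<le> y \<Longrightarrow> y \<le> r1 \<Longrightarrow> \<phi> (\<theta> y) - \<phi> (\<theta> x) = (LINT t:{x..y}|lborel. h t)"
    "AE t in lborel. r0 < t \<longrightarrow> t < r1 \<longrightarrow> ((\<lambda>t. \<phi> (\<theta> t)) has_vector_derivative h t) (at t)"
    using r.AC_differentiable[OF ACg r] by blast
  have i: "integrable lborel (\<lambda>t. indicator {r0..r1} t *\<^sub>R - h t)"
    using h(1) by (intro integrable_mult_indicator) auto
  have "\<phi> (\<theta> r0) - \<phi> (\<theta> r1) = - (\<phi> (\<theta> r1) - \<phi> (\<theta> r0))" by simp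
  also have "\<dots> = - (LINT t:{r0..r1}|lborel. h t)" using h(2)[of r0 r1] r by simp
  also have "\<dots> = (LINT t|lborel. indicator {r0..r1} t *\<^sub>R - h t)" by (simp add: set_lebesgue_integral_def)
  finally have "ennreal (\<phi> (\<theta> r0) - \<phi> (\<theta> r1)) = ennreal (LINT t|lborel. indicator {r0..r1} t *\<^sub>R - h t)" by simp
  also have "\<dots> \<le> (\<integral>\<^sup>+t. ennreal (indicator {r0..r1} t *\<^sub>R - h t) \<partial>lborel)" by (rule ennreal_integral_le[OF i])
  also have "\<dots> \<le> (\<integral>\<^sup>+t. ennreal (p (vector_derivative \<theta> (at t)) (- D (\<theta> t))) * indicator {r0..r1} t \<partial>lborel)"
  proof (rule nn_integral_mono_AE)
    show "AE t in lborel. ennreal (indicator {r0..r1} t *\<^sub>R - h t)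
        \<le> ennreal (p (vector_derivative \<theta> (at t)) (- D (\<theta> t))) * indicator {r0..r1} t"
      using f(3) h(3) AE_lborel_singleton[of r0] AE_lborel_singleton[of r1]
    proof eventually_elim
      case (elim t)
      show ?case
      proof (cases "t \<in> {r0..r1}")
        case True
        then have t: "(\<theta> has_vector_derivative f t) (at t)" "((\<lambda>t. \<phi> (\<theta> t)) has_vector_derivative h t) (at t)"
          using elim by auto
        have "((\<lambda>t. \<phi> (\<theta> t)) has_vector_derivative blinfun_apply (D\<phi> (\<theta> t)) (f t)) (at t)"
          using vector_derivative_diff_chain_within[OF t(1) has_derivative_at_withinI[OF \<phi>]] by (simp add: o_def)
        then have "h t = blinfun_apply (D\<phi> (\<theta> t)) (f t)" using t(2) vector_derivative_unique_at by blast
        then have "- h t \<le> p (f t) (- D (\<theta> t))" using le[of "\<theta> t" "f t"] by simp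
        then show ?thesis using True vector_derivative_at[OF t(1)] by (simp add: ennreal_leI)
      qed simp
    qed
  qed
  finally show "ennreal (\<phi> (\<theta> r0) - \<phi> (\<theta> r1))
      \<le> (\<integral>\<^sup>+t. ennreal (p (vector_derivative \<theta> (at t)) (- D (\<theta> t))) * indicator {r0..r1} t \<partial>lborel)" .
qed

text \<open>The polygonal line through the points x j, parametrised on the interval from 0 to m, is
  written with clamped affine functions, so that it is visibly Lipschitz.\<close>

lemma finsler_cost_polygon:
  fixes x :: "nat \<Rightarrow> 'a" and c :: "nat \<Rightarrow> real"
  assumes m: "m > 0" and c: "\<And>j. j < m \<Longrightarrow> 0 \<le> c j"
    and le: "\<And>j s. j < m \<Longrightarrow> 0 \<le> s \<Longrightarrow> s \<le> 1 \<Longrightarrow> p (x (Suc j) - x j) (- D (x j + s *\<^sub>R (x (Suc j) - x j))) \<le> c j"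
  shows "finsler_cost p D (x 0) (x m) \<le> ennreal (\<Sum>j<m. c j)"
proof -
  define cl :: "real \<Rightarrow> real" where "cl y = max 0 (min 1 y)" for y
  define v where "v j = x (Suc j) - x j" for j
  define \<theta> where "\<theta> r = x 0 + (\<Sum>j<m. cl (r - real j) *\<^sub>R v j)" for r
  have sumv: "x 0 + (\<Sum>j<k. v j) = x k" for k by (induction k) (auto simp: v_def algebra_simps)
  have AC\<theta>: "AC_curve 0 (real m) \<theta>"
  proof (rule AC_curve_lipschitz)
    show "0 \<le> (\<Sum>j<m. norm (v j))" by (intro sum_nonneg) auto
    fix r s :: real
    have "norm (\<theta> r - \<theta> s) = norm (\<Sum>j<m. (cl (r - real j) - cl (s - real j)) *\<^sub>R v j)"
      by (simp add: \<theta>_def sum_subtractf scaleR_diff_left)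
    also have "\<dots> \<le> (\<Sum>j<m. norm ((cl (r - real j) - cl (s - real j)) *\<^sub>R v j))" by (rule norm_sum)
    also have "\<dots> \<le> (\<Sum>j<m. \<bar>r - s\<bar> * norm (v j))"
    proof (rule sum_mono)
      fix j
      have "\<bar>cl (r - real j) - cl (s - real j)\<bar> \<le> \<bar>r - s\<bar>" by (auto simp: cl_def min_def max_def)
      then show "norm ((cl (r - real j) - cl (s - real j)) *\<^sub>R v j) \<le> \<bar>r - s\<bar> * norm (v j)"
        by (simp add: mult_right_mono)
    qed
    finally show "norm (\<theta> r - \<theta> s) \<le> (\<Sum>j<m. norm (v j)) * \<bar>r - s\<bar>" by (simp add: sum_distrib_left mult.commute)
  qed
  have \<theta>: "\<theta> r = x k + (r - real k) *\<^sub>R v k" if "k < m" "real k \<le> r" "r \<le> real (Suc k)" for k r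
  proof -
    have "{..<m} = {..<k} \<union> ({k} \<union> {Suc k..<m})" using that(1) by auto
    then have "(\<Sum>j<m. cl (r - real j) *\<^sub>R v j) = (\<Sum>j<k. cl (r - real j) *\<^sub>R v j)
        + (cl (r - real k) *\<^sub>R v k + (\<Sum>j=Suc k..<m. cl (r - real j) *\<^sub>R v j))"
      using sum.union_disjoint[of "{..<k}" "{k} \<union> {Suc k..<m}" "\<lambda>j. cl (r - real j) *\<^sub>R v j"]
        sum.union_disjoint[of "{k}" "{Suc k..<m}" "\<lambda>j. cl (r - real j) *\<^sub>R v j"] by fastforce
    also have "(\<Sum>j<k. cl (r - real j) *\<^sub>R v j) = (\<Sum>j<k. v j)" using that
      by (intro sum.cong refl) (auto simp: cl_def min_def max_def)
    also have "(\<Sum>j=Suc k..<m. cl (r - real j) *\<^sub>R v j) = 0" using that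
      by (intro sum.neutral) (auto simp: cl_def min_def max_def)
    also have "cl (r - real k) = r - real k" using that by (auto simp: cl_def)
    finally show ?thesis using sumv[of k] by (simp add: \<theta>_def add.assoc[symmetric])
  qed
  have ends: "\<theta> 0 = x 0" "\<theta> (real m) = x m"
  proof -
    show "\<theta> 0 = x 0" using \<theta>[of 0 0] m by simp
    have "m - 1 < m" "real (m - 1) \<le> real m" "real m \<le> real (Suc (m - 1))" using m by auto
    then show "\<theta> (real m) = x m" using \<theta>[of "m - 1" "real m"] m by (simp add: v_def of_nat_diff)
  qed
  have "finsler_cost p D (x 0) (x m) \<le> (\<integral>\<^sup>+r. ennreal (p (vector_derivative \<theta> (at r)) (- D (\<theta> r))) * indicator {0..real m} r \<partial>lborel)"
    unfolding finsler_cost_def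
  proof (rule Inf_lower)
    show "(\<integral>\<^sup>+r. ennreal (p (vector_derivative \<theta> (at r)) (- D (\<theta> r))) * indicator {0..real m} r \<partial>lborel)
      \<in> {(\<integral>\<^sup>+ r. ennreal (p (vector_derivative \<theta> (at r)) (- D (\<theta> r))) * indicator {r0..r1} r
             \<partial>lborel) | \<theta> r0 r1.
          r0 < r1 \<and> AC_curve r0 r1 \<theta> \<and> \<theta> r0 = x 0 \<and> \<theta> r1 = x m}"
      unfolding mem_Collect_eq
      by (rule exI[of _ \<theta>], rule exI[of _ 0], rule exI[of _ "real m"]) (use AC\<theta> ends m in auto)
  qed
  also have "\<dots> \<le> (\<integral>\<^sup>+r. (\<Sum>k<m. ennreal (c k) * indicator {real k..real (Suc k)} r) \<partial>lborel)"
  proof (rule nn_integral_mono_AE)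
    \<comment> \<open>At integer parameters the line may have a kink; they form a countable
      set.\<close>
    have "AE r in lborel. r \<notin> range real" by (rule AE_not_in[OF countable_imp_null_set_lborel]) simp
    then show "AE r in lborel. ennreal (p (vector_derivative \<theta> (at r)) (- D (\<theta> r))) * indicator {0..real m} r
       \<le> (\<Sum>k<m. ennreal (c k) * indicator {real k..real (Suc k)} r)"
    proof eventually_elim
      case (elim r)
      show ?case
      proof (cases "r \<in> {0..real m}")
        case True
        define k where "k = nat \<lfloor>r\<rfloor>"
        have rk: "real k = of_int \<lfloor>r\<rfloor>" using True by (simp add: k_def)
        have k1: "real k \<le> r" "real (Suc k) > r" unfolding of_nat_Suc rk by linarith+
        then have k2: "real k < r" using elim by (metis order_le_less rangeI)
        then have km: "k < m" using True by simp
        have "((\<lambda>r. x k + (r - real k) *\<^sub>R v k) has_vector_derivative v k) (at r)"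
          by (auto intro!: derivative_eq_intros)
        then have "(\<theta> has_vector_derivative v k) (at r)"
          by (rule has_vector_derivative_transform_within_open[where S="{real k<..<real (Suc k)}"])
            (use k1 k2 \<theta>[OF km] in auto)
        then have d: "vector_derivative \<theta> (at r) = v k" by (rule vector_derivative_at)
        have "p (v k) (- D (\<theta> r)) \<le> c k"
          using le[OF km, of "r - real k"] \<theta>[OF km] k1 by (simp add: v_def)
        then have "ennreal (p (vector_derivative \<theta> (at r)) (- D (\<theta> r))) * indicator {0..real m} r
           \<le> ennreal (c k) * indicator {real k..real (Suc k)} r"
          using True k1 d by (simp add: ennreal_leI)
        also have "\<dots> \<le> (\<Sum>k<m. ennreal (c k) * indicator {real k..real (Suc k)} r)"
          using km by (intro member_le_sum) auto
        finally show ?thesis .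
      qed simp
    qed
  qed
  also have "\<dots> = (\<Sum>k<m. \<integral>\<^sup>+r. ennreal (c k) * indicator {real k..real (Suc k)} r \<partial>lborel)"
    by (intro nn_integral_sum) auto
  also have "\<dots> = (\<Sum>k<m. ennreal (c k))" by (simp add: nn_integral_cmult)
  also have "\<dots> = ennreal (\<Sum>k<m. c k)" using c by (intro sum_ennreal) auto
  finally show ?thesis .
qed

end

context viscous_system
begin

lemma finsler_cost_refl: "finsler_cost pp D x x = 0"
proof -
  have "finsler_cost pp D ((\<lambda>_. x) 0) ((\<lambda>_. x) (Suc 0)) \<le> ennreal (\<Sum>j<Suc 0. 0)"
    by (rule finsler_cost_polygon) (auto simp: pp_zero)
  then show ?thesis by simp
qed

lemma finsler_cost_ge_apply:
  assumes "w \<in> Kstar \<Psi>0"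
  shows "ennreal (blinfun_apply w (y - x)) \<le> finsler_cost pp D x y"
proof -
  have "ennreal (- blinfun_apply w x - - blinfun_apply w y) \<le> finsler_cost pp D x y"
  proof (rule finsler_cost_ge[where D\<phi>="\<lambda>_. - w" and \<phi>="\<lambda>x. - blinfun_apply w x"])
    show "((\<lambda>x. - blinfun_apply w x) has_derivative blinfun_apply (- w)) (at x)" for x
      by (auto intro!: derivative_eq_intros simp: blinfun.minus_left)
    show "- blinfun_apply (- w) v \<le> pp v (- D x)" for x v
      using assms pp_ge_Psi0[of v "- D x"] by (auto simp: Kstar_def blinfun.minus_left intro: order_trans)
  qed simp
  then show ?thesis by (simp add: blinfun.diff_right)
qed

lemma finsler_cost_ge_energy:
  fixes \<phi> :: "'a \<Rightarrow> real" and D\<phi> :: "'a \<Rightarrow> 'a \<Rightarrow>\<^sub>L real"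
  assumes \<phi>: "\<And>x. (\<phi> has_derivative blinfun_apply (D\<phi> x)) (at x)" and cont: "continuous_on UNIV D\<phi>"
  shows "ennreal (\<phi> x - \<phi> y) \<le> finsler_cost pp D\<phi> x y"
  by (rule finsler_cost_ge[OF \<phi> cont]) (metis blinfun.minus_left pp_ge_apply)

end

section \<open>The energy and the incremental problem\<close>

locale rate_system = viscous_system B \<Psi> \<Psi>0
  for B :: "'a::{banach,second_countable_topology} set" and \<Psi> \<Psi>0 +
  fixes E dtE :: "real \<Rightarrow> 'a \<Rightarrow> real" and DE :: "real \<Rightarrow> 'a \<Rightarrow> ('a \<Rightarrow>\<^sub>L real)" and T :: real
  assumes T_pos': "T > 0" and energy_C1: "C1_energy T E dtE DE" and energy_bounds: "energy_bounds T E dtE"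
begin

lemma E_has_derivative:
  assumes "t \<in> {0..T}"
  shows "(E t has_derivative blinfun_apply (DE t x)) (at x)"
proof -
  have "((\<lambda>x. E (fst x) (snd x)) has_derivative
           (\<lambda>h. dtE t x * fst h + blinfun_apply (DE t x) (snd h))) (at (t, x) within {0..T} \<times> UNIV)"
    using energy_C1 assms by (simp add: C1_energy_def)
  then have "((\<lambda>x. E (fst x) (snd x)) has_derivative
           (\<lambda>h. dtE t x * fst h + blinfun_apply (DE t x) (snd h))) (at (t, x) within (\<lambda>x. (t, x)) ` UNIV)"
    by (rule has_derivative_subset) (use assms in auto)
  moreover have "((\<lambda>x. (t, x)) has_derivative (\<lambda>h. (0, h))) (at x)"
    by (auto intro!: derivative_eq_intros)
  ultimately have "((\<lambda>x. E (fst (t, x)) (snd (t, x))) has_derivative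
      (\<lambda>h. dtE t x * fst (0::real, h) + blinfun_apply (DE t x) (snd (0::real, h)))) (at x)"
    by (rule has_derivative_in_compose[rotated])
  then show ?thesis by simp
qed

lemma E_has_time_derivative:
  assumes "t \<in> {0..T}"
  shows "((\<lambda>s. E s x) has_real_derivative dtE t x) (at t within {0..T})"
proof -
  have "((\<lambda>x. E (fst x) (snd x)) has_derivative
           (\<lambda>h. dtE t x * fst h + blinfun_apply (DE t x) (snd h))) (at (t, x) within {0..T} \<times> UNIV)"
    using energy_C1 assms by (simp add: C1_energy_def)
  then have "((\<lambda>x. E (fst x) (snd x)) has_derivative
           (\<lambda>h. dtE t x * fst h + blinfun_apply (DE t x) (snd h))) (at (t, x) within (\<lambda>s. (s, x)) ` {0..T})"
    by (rule has_derivative_subset) auto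
  moreover have "((\<lambda>s. (s, x)) has_derivative (\<lambda>h. (h, 0))) (at t within {0..T})"
    by (auto intro!: derivative_eq_intros)
  ultimately have "((\<lambda>s. E (fst (s, x)) (snd (s, x))) has_derivative
      (\<lambda>h. dtE t x * fst (h, 0::'a) + blinfun_apply (DE t x) (snd (h, 0::'a)))) (at t within {0..T})"
    by (rule has_derivative_in_compose[rotated])
  then show ?thesis by (simp add: has_field_derivative_def)
qed

lemma continuous_dtE: "continuous_on ({0..T} \<times> UNIV) (\<lambda>x. dtE (fst x) (snd x))"
  and continuous_DE: "continuous_on ({0..T} \<times> UNIV) (\<lambda>x. DE (fst x) (snd x))"
  using energy_C1 by (simp_all add: C1_energy_def)

lemma continuous_DE_fixed: "t \<in> {0..T} \<Longrightarrow> continuous_on UNIV (DE t)"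
proof -
  assume t: "t \<in> {0..T}"
  have "continuous_on UNIV (\<lambda>x::'a. (t, x))" by (rule continuous_on_Pair[OF continuous_on_const continuous_on_id])
  from continuous_on_compose2[OF continuous_DE this] t show ?thesis by (simp add: image_subset_iff)
qed

lemma compact_domain: "compact ({0..T} \<times> cball (0::'a) R)"
proof -
  have "compact (cball (0::'a) R)" by (rule compact_bounded_closed) (auto simp: bounded_iff closed_cball)
  then show ?thesis by (intro compact_Times) auto
qed

lemma uniform_continuity:
  assumes e: "e > 0"
  shows "\<exists>\<delta>>0. \<forall>s t. \<forall>x y::'a. s \<in> {0..T} \<longrightarrow> t \<in> {0..T} \<longrightarrow> norm x \<le> R \<longrightarrow> norm y \<le> R \<longrightarrow> \<bar>s - t\<bar> < \<delta> \<longrightarrow> norm (x - y) < \<delta> \<longrightarrow>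
     norm (DE s x - DE t y) < e \<and> \<bar>dtE s x - dtE t y\<bar> < e"
proof -
  let ?K = "{0..T} \<times> cball (0::'a) R"
  have "uniformly_continuous_on ?K (\<lambda>x. DE (fst x) (snd x))"
    by (rule compact_uniformly_continuous[OF continuous_on_subset[OF continuous_DE] compact_domain]) auto
  then obtain d1 where d1: "d1 > 0" "\<forall>x\<in>?K. \<forall>y\<in>?K. dist y x < d1 \<longrightarrow> dist (DE (fst y) (snd y)) (DE (fst x) (snd x)) < e"
    unfolding uniformly_continuous_on_def using e by blast
  have "uniformly_continuous_on ?K (\<lambda>x. dtE (fst x) (snd x))"
    by (rule compact_uniformly_continuous[OF continuous_on_subset[OF continuous_dtE] compact_domain]) auto
  then obtain d2 where d2: "d2 > 0" "\<forall>x\<in>?K. \<forall>y\<in>?K. dist y x < d2 \<longrightarrow> dist (dtE (fst y) (snd y)) (dtE (fst x) (snd x)) < e"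
    unfolding uniformly_continuous_on_def using e by blast
  show ?thesis
  proof (intro exI[of _ "min d1 d2 / 2"] conjI allI impI)
    fix s t :: real and x y :: 'a
    assume h: "s \<in> {0..T}" "t \<in> {0..T}" "norm x \<le> R" "norm y \<le> R" "\<bar>s - t\<bar> < min d1 d2 / 2" "norm (x - y) < min d1 d2 / 2"
    have K: "(s, x) \<in> ?K" "(t, y) \<in> ?K" using h by auto
    have "dist (s, x) (t, y) \<le> dist s t + dist x y"
      unfolding dist_Pair_Pair by (rule sqrt_sum_squares_le_sum) auto
    then have d: "dist (s, x) (t, y) < min d1 d2" using h(5,6) by (simp add: dist_real_def dist_norm)
    show "norm (DE s x - DE t y) < e" using d1(2)[rule_format, OF K(2,1)] d by (simp add: dist_norm)
    show "\<bar>dtE s x - dtE t y\<bar> < e" using d2(2)[rule_format, OF K(2,1)] d by (simp add: dist_real_def)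
  qed (use d1 d2 in auto)
qed

lemma local_bounds:
  "\<exists>M>0. \<forall>t x. t \<in> {0..T} \<longrightarrow> norm x \<le> R \<longrightarrow> norm (DE t x) \<le> M \<and> \<bar>dtE t x\<bar> \<le> M"
proof -
  let ?K = "{0..T} \<times> cball (0::'a) R"
  have "bounded ((\<lambda>x. DE (fst x) (snd x)) ` ?K)"
    by (intro compact_imp_bounded compact_continuous_image continuous_on_subset[OF continuous_DE] compact_domain) auto
  then obtain M1 where M1: "\<forall>x\<in>?K. norm (DE (fst x) (snd x)) \<le> M1" by (auto simp: bounded_iff)
  have "bounded ((\<lambda>x. dtE (fst x) (snd x)) ` ?K)"
    by (intro compact_imp_bounded compact_continuous_image continuous_on_subset[OF continuous_dtE] compact_domain) auto
  then obtain M2 where M2: "\<forall>x\<in>?K. \<bar>dtE (fst x) (snd x)\<bar> \<le> M2" by (auto simp: bounded_iff)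
  have "norm (DE t x) \<le> max 1 (max M1 M2) \<and> \<bar>dtE t x\<bar> \<le> max 1 (max M1 M2)" if "t \<in> {0..T}" "norm x \<le> R" for t x
    using M1[rule_format, of "(t, x)"] M2[rule_format, of "(t, x)"] that by (simp add: le_max_iff_disj)
  then show ?thesis by (intro exI[of _ "max 1 (max M1 M2)"]) auto
qed

lemma taylor:
  assumes \<delta>: "\<And>s t x y. s \<in> {0..T} \<Longrightarrow> t \<in> {0..T} \<Longrightarrow> norm x \<le> R \<Longrightarrow> norm y \<le> R \<Longrightarrow> \<bar>s - t\<bar> < \<delta> \<Longrightarrow> norm (x - y) < \<delta> \<Longrightarrow>
     norm (DE s x - DE t y) < e" and "0 < \<delta>"
    and t: "t \<in> {0..T}" and x: "norm x \<le> R" and y: "norm y \<le> R" and xy: "norm (x - y) < \<delta>"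
  shows "\<bar>E t x - E t y - blinfun_apply (DE t y) (x - y)\<bar> \<le> e * norm (x - y)"
proof -
  have "norm (E t x - E t y - blinfun_apply (DE t y) (x - y)) \<le> norm (x - y) * e"
  proof (rule differentiable_bound_linearization[where S="closed_segment y x"])
    show "y + s *\<^sub>R (x - y) \<in> closed_segment y x" if "s \<in> {0..1}" for s
      unfolding in_segment using that by (intro exI[of _ s]) (auto simp: algebra_simps)
    show "(E t has_derivative blinfun_apply (DE t z)) (at z within closed_segment y x)" for z
      by (rule has_derivative_at_withinI[OF E_has_derivative[OF t]])
    show "y \<in> closed_segment y x" by simp
    fix z assume z: "z \<in> closed_segment y x"
    have "closed_segment y x \<subseteq> cball 0 R" using x y by (intro closed_segment_subset convex_cball) auto
    then have zR: "norm z \<le> R" using z by auto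
    have zy: "norm (z - y) < \<delta>" using segment_bound(1)[OF z] xy by simp
    have "(\<lambda>v. blinfun_apply (DE t z) v - blinfun_apply (DE t y) v) = blinfun_apply (DE t z - DE t y)"
      by (simp add: fun_eq_iff blinfun.diff_left)
    then show "onorm (blinfun_apply (DE t z) - blinfun_apply (DE t y)) \<le> e"
      using \<delta>[OF t t zR y _ zy] \<open>0 < \<delta>\<close> by (simp add: fun_diff_def norm_blinfun.rep_eq[symmetric])
  qed
  then show ?thesis by (simp add: mult.commute)
qed

text \<open>Gronwall at a fixed state. Adding \<open>C + 1\<close> makes the energy at least 1 and
  at least the factor \<open>1 + max 0 (E t x)\<close> of the power bound, so the exponentially
  discounted quantity is nonincreasing in time.\<close>

lemma energy_growth:
  obtains C where "C > 0" "\<And>t x. t \<in> {0..T} \<Longrightarrow> 1 \<le> E t x + C + 1"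
    "\<And>s t x. 0 \<le> s \<Longrightarrow> s \<le> t \<Longrightarrow> t \<le> T \<Longrightarrow> exp (- C * t) * (E t x + C + 1) \<le> exp (- C * s) * (E s x + C + 1)"
proof -
  obtain C where C: "C > 0" "\<And>t x. t \<in> {0..T} \<Longrightarrow> E t x \<ge> - C \<and> \<bar>dtE t x\<bar> \<le> C * (1 + max 0 (E t x))"
    using energy_bounds unfolding energy_bounds_def by blast
  show thesis
  proof
    show "C > 0" by (rule C)
    show "1 \<le> E t x + C + 1" if "t \<in> {0..T}" for t x using C(2)[OF that, of x] by simp
    fix s t x assume st: "0 \<le> s" "s \<le> t" "t \<le> T"
    have d: "((\<lambda>r. exp (- C * r) * (E r x + C + 1)) has_real_derivative
        exp (- C * r) * (dtE r x - C * (E r x + C + 1))) (at r within {0..T})" if "r \<in> {0..T}" for r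
      by (auto intro!: derivative_eq_intros E_has_time_derivative[OF that]) (simp add: algebra_simps)
    show "exp (- C * t) * (E t x + C + 1) \<le> exp (- C * s) * (E s x + C + 1)"
    proof (rule DERIV_nonpos_imp_decreasing_open[OF st(2)])
      fix r assume r: "s < r" "r < t"
      have rI: "r \<in> {0..T}" using r st by auto
      have "((\<lambda>r. exp (- C * r) * (E r x + C + 1)) has_real_derivative
        exp (- C * r) * (dtE r x - C * (E r x + C + 1))) (at r)"
        using d[OF rI] r st by (simp add: at_within_Icc_at)
      moreover have "dtE r x - C * (E r x + C + 1) \<le> 0"
      proof -
        have "dtE r x \<le> C * (1 + max 0 (E r x))" using C(2)[OF rI, of x] by linarith
        also have "\<dots> \<le> C * (E r x + C + 1)" using C(1) C(2)[OF rI, of x] by (intro mult_left_mono) auto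
        finally show ?thesis by simp
      qed
      then have "exp (- C * r) * (dtE r x - C * (E r x + C + 1)) \<le> 0"
        by (intro mult_nonneg_nonpos) auto
      ultimately show "\<exists>y. ((\<lambda>r. exp (- C * r) * (E r x + C + 1)) has_real_derivative y) (at r) \<and> y \<le> 0" by blast
    next
      have "continuous_on {0..T} (\<lambda>r. exp (- C * r) * (E r x + C + 1))"
        using d by (rule DERIV_continuous_on)
      then show "continuous_on {s..t} (\<lambda>r. exp (- C * r) * (E r x + C + 1))"
        by (rule continuous_on_subset) (use st in auto)
    qed
  qed
qed

lemma energy_time_integral:
  assumes "0 \<le> s" "s \<le> t" "t \<le> T"
  shows "E t x - E s x = (LINT r:{s..t}|lborel. dtE r x)" "set_integrable lborel {s..t} (\<lambda>r. dtE r x)"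
proof -
  have hb: "has_bochner_integral lborel (\<lambda>r. indicator {s..t} r *\<^sub>R dtE r x) (E t x - E s x)"
  proof (rule has_bochner_integral_FTC_Icc[OF assms(2)])
    fix r assume r: "s \<le> r" "r \<le> t"
    have "((\<lambda>s. E s x) has_real_derivative dtE r x) (at r within {s..t})"
      using E_has_time_derivative[of r x] r assms by (auto intro: DERIV_subset)
    then show "((\<lambda>s. E s x) has_vector_derivative dtE r x) (at r within {s..t})"
      by (simp add: has_real_derivative_iff_has_vector_derivative)
  next
    show "continuous_on {s..t} (\<lambda>r. dtE r x)"
    proof -
      have "continuous_on {s..t} (\<lambda>r. (r, x))" by (rule continuous_on_Pair[OF continuous_on_id continuous_on_const])
      from continuous_on_compose2[OF continuous_dtE this] assms show ?thesis by (simp add: image_subset_iff)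
    qed
  qed
  then show "E t x - E s x = (LINT r:{s..t}|lborel. dtE r x)" "set_integrable lborel {s..t} (\<lambda>r. dtE r x)"
    by (simp_all add: set_lebesgue_integral_def set_integrable_def has_bochner_integral_iff)
qed

text \<open>Comparing the minimiser with its convex combinations with an arbitrary competitor yields
  the Euler--Lagrange inclusion, stated here as the equality case of the Fenchel inequality.\<close>

lemma minimizer_Fenchel:
  assumes l: "l > 0" and e: "(e has_derivative blinfun_apply w) (at x)"
    and min: "\<And>V. rescaled \<Psi> l (x - y) + e x \<le> rescaled \<Psi> l (V - y) + e V"
  shows "(\<Psi> (l *\<^sub>R (x - y)) + leg (- w)) / l \<le> - blinfun_apply w (x - y)"
proof -
  let ?v = "x - y" and ?F = "rescaled \<Psi> l"
  have sub: "- blinfun_apply w z - ?F z \<le> - blinfun_apply w ?v - ?F ?v" for z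
  proof -
    define d where "d = z - ?v"
    have "((\<lambda>h. e (x + h *\<^sub>R d)) has_derivative (\<lambda>h. blinfun_apply w (h *\<^sub>R d))) (at 0)"
      by (rule has_derivative_compose[of "\<lambda>h. x + h *\<^sub>R d" _ 0 UNIV e]) (use e in \<open>auto intro!: derivative_eq_intros\<close>)
    then have "((\<lambda>h. e (x + h *\<^sub>R d)) has_real_derivative blinfun_apply w d) (at 0)"
      unfolding has_field_derivative_def by (rule has_derivative_eq_rhs) (simp add: fun_eq_iff blinfun.scaleR_right)
    then have "((\<lambda>h. (e (x + h *\<^sub>R d) - e x) / h) \<longlongrightarrow> blinfun_apply w d) (at 0)"
      by (simp add: DERIV_def)
    then have lim: "((\<lambda>h. (e (x + h *\<^sub>R d) - e x) / h) \<longlongrightarrow> blinfun_apply w d) (at_right 0)"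
      by (rule tendsto_within_subset) auto
    have "?F ?v - ?F z \<le> (e (x + h *\<^sub>R d) - e x) / h" if h: "0 < h" "h < 1" for h
    proof -
      have "l *\<^sub>R (x + h *\<^sub>R d - y) = (1 - h) *\<^sub>R (l *\<^sub>R ?v) + h *\<^sub>R (l *\<^sub>R z)"
        by (simp add: d_def algebra_simps)
      then have "\<Psi> (l *\<^sub>R (x + h *\<^sub>R d - y)) \<le> (1 - h) * \<Psi> (l *\<^sub>R ?v) + h * \<Psi> (l *\<^sub>R z)"
        using Psi_convexD[of h "l *\<^sub>R ?v" "l *\<^sub>R z"] h by simp
      then have "\<Psi> (l *\<^sub>R (x + h *\<^sub>R d - y)) / l \<le> ((1 - h) * \<Psi> (l *\<^sub>R ?v) + h * \<Psi> (l *\<^sub>R z)) / l"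
        using l by (intro divide_right_mono) auto
      then have "?F (x + h *\<^sub>R d - y) \<le> (1 - h) * ?F ?v + h * ?F z" by (simp add: rescaled_def add_divide_distrib)
      then have "h * (?F ?v - ?F z) \<le> e (x + h *\<^sub>R d) - e x"
        using min[of "x + h *\<^sub>R d"] by (simp add: algebra_simps)
      then show ?thesis using h by (simp add: field_simps)
    qed
    then have "\<forall>\<^sub>F h in at_right 0. ?F ?v - ?F z \<le> (e (x + h *\<^sub>R d) - e x) / h"
      unfolding eventually_at_right_field by (intro exI[of _ 1]) auto
    then have "?F ?v - ?F z \<le> blinfun_apply w d" by (intro tendsto_lowerbound[OF lim]) auto
    then show ?thesis by (simp add: d_def blinfun.diff_right)
  qed
  have "leg (- w) / l = legendre ?F (- w)" by (simp add: legendre_rescaled[OF l])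
  also have "\<dots> \<le> - blinfun_apply w ?v - ?F ?v"
    unfolding legendre_def using sub by (intro cSUP_least) (auto simp: blinfun.minus_left)
  finally show ?thesis by (simp add: rescaled_def add_divide_distrib)
qed

section \<open>Consequences of minimality for the scheme\<close>

lemma discrete_step:
  assumes ds: "discrete_solution T E \<Psi> s \<epsilon> U" and s: "s > 0" and \<epsilon>: "\<epsilon> > 0"
    and n: "n \<in> {1..num_steps T s}"
  defines "l \<equiv> \<epsilon> / s" and "t \<equiv> min (real n * s) T"
  shows "rescaled \<Psi> l (U n - U (n - 1)) + E t (U n) \<le> E t (U (n - 1))"
    "(\<Psi> (l *\<^sub>R (U n - U (n - 1))) + leg (- DE t (U n))) / l \<le> - blinfun_apply (DE t (U n)) (U n - U (n - 1))"
proof -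
  have l: "l > 0" using s \<epsilon> by (simp add: l_def)
  have t: "t \<in> {0..T}" using s T_pos' by (simp add: t_def)
  have r: "s * rescaled \<Psi> \<epsilon> (v /\<^sub>R s) = rescaled \<Psi> l v" for v
    using s \<epsilon> by (simp add: rescaled_def l_def field_simps)
  have "is_arg_min (\<lambda>V. s * rescaled \<Psi> \<epsilon> ((V - U (n - 1)) /\<^sub>R s) + E t V) (\<lambda>_. True) (U n)"
    using ds n unfolding discrete_solution_def t_def by blast
  then have min: "rescaled \<Psi> l (U n - U (n - 1)) + E t (U n) \<le> rescaled \<Psi> l (V - U (n - 1)) + E t V" for V
    unfolding is_arg_min_def r by (auto simp: not_less)
  show "rescaled \<Psi> l (U n - U (n - 1)) + E t (U n) \<le> E t (U (n - 1))"
    using min[of "U (n - 1)"] Psi_zero by (simp add: rescaled_def)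
  show "(\<Psi> (l *\<^sub>R (U n - U (n - 1))) + leg (- DE t (U n))) / l \<le> - blinfun_apply (DE t (U n)) (U n - U (n - 1))"
    by (rule minimizer_Fenchel[OF l E_has_derivative[OF t] min])
qed

text \<open>Comparison with the previous state lowers the energy at a fixed time, and the passage to
  the next time is absorbed by the discount. Every step dissipation is discounted by at least
  \<open>exp (- C * T)\<close>, whose inverse appears in the bound.\<close>

lemma discrete_a_priori:
  assumes C: "C > 0" "\<And>t x. t \<in> {0..T} \<Longrightarrow> 1 \<le> E t x + C + 1"
    "\<And>s t x. 0 \<le> s \<Longrightarrow> s \<le> t \<Longrightarrow> t \<le> T \<Longrightarrow> exp (- C * t) * (E t x + C + 1) \<le> exp (- C * s) * (E s x + C + 1)"
    and ds: "discrete_solution T E \<Psi> s \<epsilon> U" and s: "s > 0" and \<epsilon>: "\<epsilon> > 0"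
    and n: "n \<le> num_steps T s"
  shows "(\<Sum>j=1..n. rescaled \<Psi> (\<epsilon> / s) (U j - U (j - 1))) \<le> exp (C * T) * (E 0 (U 0) + C + 1)"
proof -
  let ?l = "\<epsilon> / s" and ?t = "\<lambda>n. min (real n * s) T"
  have t: "?t n \<in> {0..T}" for n using s T_pos' by simp
  have rn: "0 \<le> rescaled \<Psi> ?l v" for v using s \<epsilon> Psi_nonneg by (simp add: rescaled_def)
  have "exp (- C * ?t n) * (E (?t n) (U n) + C + 1) + exp (- C * T) * (\<Sum>j=1..n. rescaled \<Psi> ?l (U j - U (j - 1)))
      \<le> E 0 (U 0) + C + 1" using n
  proof (induction n)
    case 0 then show ?case using T_pos' by simp
  next
    case (Suc n)
    let ?r = "rescaled \<Psi> ?l (U (Suc n) - U n)"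
    have st: "?r + E (?t (Suc n)) (U (Suc n)) \<le> E (?t (Suc n)) (U n)"
      using discrete_step(1)[OF ds s \<epsilon>, of "Suc n"] Suc.prems by simp
    have "exp (- C * T) * ?r \<le> exp (- C * ?t (Suc n)) * ?r"
      using C(1) t[of "Suc n"] rn by (intro mult_right_mono) auto
    then have "exp (- C * ?t (Suc n)) * (E (?t (Suc n)) (U (Suc n)) + C + 1) + exp (- C * T) * ?r
        \<le> exp (- C * ?t (Suc n)) * (?r + E (?t (Suc n)) (U (Suc n)) + C + 1)"
      by (simp add: algebra_simps)
    also have "\<dots> \<le> exp (- C * ?t (Suc n)) * (E (?t (Suc n)) (U n) + C + 1)"
      using st by (intro mult_left_mono) auto
    also have "\<dots> \<le> exp (- C * ?t n) * (E (?t n) (U n) + C + 1)"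
      using t[of n] t[of "Suc n"] s by (intro C(3)) (auto simp: distrib_right)
    finally show ?case using Suc.IH Suc.prems by (simp add: distrib_left)
  qed
  moreover have "0 \<le> exp (- C * ?t n) * (E (?t n) (U n) + C + 1)"
    using C(2)[OF t[of n], of "U n"] by (intro mult_nonneg_nonneg) auto
  ultimately have "exp (- C * T) * (\<Sum>j=1..n. rescaled \<Psi> ?l (U j - U (j - 1))) \<le> E 0 (U 0) + C + 1" by linarith
  then have "exp (C * T) * (exp (- C * T) * (\<Sum>j=1..n. rescaled \<Psi> ?l (U j - U (j - 1))))
      \<le> exp (C * T) * (E 0 (U 0) + C + 1)" by (intro mult_left_mono) auto
  then show ?thesis by (simp add: mult.assoc[symmetric] exp_add[symmetric])
qed

end

section \<open>Selection of pointwise convergent subsequences\<close>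

lemma diagonal_convergent:
  fixes h :: "nat \<Rightarrow> 'x \<Rightarrow> 'b::metric_space"
  assumes D: "countable D"
    and sub: "\<And>x s. x \<in> D \<Longrightarrow> strict_mono (s::nat\<Rightarrow>nat) \<Longrightarrow> \<exists>r::nat\<Rightarrow>nat. strict_mono r \<and> convergent (\<lambda>k. h (s (r k)) x)"
  shows "\<exists>r::nat\<Rightarrow>nat. strict_mono r \<and> (\<forall>x\<in>D. convergent (\<lambda>k. h (r k) x))"
proof (cases "D = {}")
  case True then show ?thesis by (intro exI[of _ id]) (auto simp: strict_mono_def)
next
  case False
  then obtain x :: "nat \<Rightarrow> 'x" where x: "range x = D" using D uncountable_def by metis
  let ?P = "\<lambda>n s. convergent (\<lambda>k. h (s k) (x n))"
  interpret d: subseqs ?P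
  proof
    fix n and s :: "nat \<Rightarrow> nat" assume "strict_mono s"
    then show "\<exists>r. strict_mono r \<and> ?P n (s \<circ> r)" using sub[of "x n" s] x by (auto simp: o_def)
  qed
  have "convergent (\<lambda>k. h (d.diagseq k) (x n))" for n
  proof -
    have "?P n (d.diagseq \<circ> (+) (Suc n))"
    proof (rule d.diagseq_holds)
      fix r s :: "nat \<Rightarrow> nat" and n assume "strict_mono r" "?P n s"
      then show "?P n (s \<circ> r)" using convergent_subseq_convergent[of "\<lambda>k. h (s k) (x n)" r] by (simp add: o_def)
    qed
    then obtain a where "(\<lambda>k. h (d.diagseq (k + Suc n)) (x n)) \<longlonglongrightarrow> a"
      by (auto simp: convergent_def o_def add.commute)
    then have "(\<lambda>k. h (d.diagseq k) (x n)) \<longlonglongrightarrow> a" by (rule LIMSEQ_offset)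
    then show ?thesis by (rule convergentI)
  qed
  then show ?thesis using d.subseq_diagseq x by (intro exI[of _ d.diagseq]) auto
qed

text \<open>Helly's theorem: the limits at the rationals define a nondecreasing \<open>H\<close>. At
  its continuity points the limits at neighbouring rationals enclose the sequence, and the countably
  many other points are treated by a second diagonal sequence.\<close>

lemma monotone_selection:
  fixes g :: "nat \<Rightarrow> real \<Rightarrow> real"
  assumes mono: "\<And>k. mono (g k)" and bd: "\<And>k t. \<bar>g k t\<bar> \<le> M"
  shows "\<exists>r::nat\<Rightarrow>nat. strict_mono r \<and> (\<forall>t. convergent (\<lambda>k. g (r k) t))"
proof -
  have sub: "\<exists>r::nat\<Rightarrow>nat. strict_mono r \<and> convergent (\<lambda>k. g (s (r k)) t)" for s t
  proof -
    have "bounded (range (\<lambda>k. g (s k) t))" using bd by (intro boundedI[of _ M]) auto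
    then show ?thesis using bounded_imp_convergent_subsequence[of "\<lambda>k. g (s k) t"] by (auto simp: convergent_def o_def)
  qed
  obtain r1 :: "nat \<Rightarrow> nat" where r1: "strict_mono r1" "\<And>t. t \<in> \<rat> \<Longrightarrow> convergent (\<lambda>k. g (r1 k) t)"
    using diagonal_convergent[OF countable_rat, of g] sub by blast
  define Q where "Q t = lim (\<lambda>k. g (r1 k) t)" for t
  have Q: "(\<lambda>k. g (r1 k) t) \<longlonglongrightarrow> Q t" if "t \<in> \<rat>" for t
    using r1(2)[OF that] unfolding Q_def convergent_LIMSEQ_iff .
  have Qm: "Q s \<le> Q t" if "s \<in> \<rat>" "t \<in> \<rat>" "s \<le> t" for s t
    by (rule LIMSEQ_le[OF Q[OF that(1)] Q[OF that(2)]]) (use monoD[OF mono that(3)] in auto)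
  have Qb: "\<bar>Q t\<bar> \<le> M" if "t \<in> \<rat>" for t
    by (rule LIMSEQ_le_const2[OF tendsto_rabs[OF Q[OF that]]]) (use bd in auto)
  define H where "H t = Sup (Q ` {q\<in>\<rat>. q \<le> t})" for t
  have bdd: "bdd_above (Q ` {q\<in>\<rat>. q \<le> t})" for t using Qb by (intro bdd_aboveI[of _ M]) (auto simp: abs_le_iff)
  have ne: "{q\<in>\<rat>. q \<le> t} \<noteq> {}" for t :: real using Rats_dense_in_real[of "t - 1" t] by force
  have Hm: "mono H"
  proof (rule monoI)
    fix x y :: real assume "x \<le> y"
    then show "H x \<le> H y" unfolding H_def using ne[of x] by (intro cSup_subset_mono bdd) auto
  qed
  have HQ: "H t = Q t" if "t \<in> \<rat>" for t unfolding H_def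
    using that Qm by (intro cSup_eq_maximum) auto
  have conv: "(\<lambda>k. g (r1 k) t) \<longlonglongrightarrow> H t" if "isCont H t" for t
  proof (rule LIMSEQ_I)
    fix e :: real assume e: "e > 0"
    from that have "(H \<longlongrightarrow> H t) (at t)" by (simp add: isCont_def)
    then obtain d where d: "d > 0" "\<And>s. s \<noteq> t \<Longrightarrow> \<bar>s - t\<bar> < d \<Longrightarrow> \<bar>H s - H t\<bar> < e / 2"
      using LIM_D[of H "H t" t "e / 2"] e by auto
    obtain p where p: "p \<in> \<rat>" "t - d < p" "p < t" using Rats_dense_in_real[of "t - d" t] d by auto
    obtain q where q: "q \<in> \<rat>" "t < q" "q < t + d" using Rats_dense_in_real[of t "t + d"] d by auto
    obtain k1 where k1: "\<And>k. k \<ge> k1 \<Longrightarrow> \<bar>g (r1 k) p - Q p\<bar> < e / 2" using LIMSEQ_D[OF Q[OF p(1)], of "e / 2"] e by auto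
    obtain k2 where k2: "\<And>k. k \<ge> k2 \<Longrightarrow> \<bar>g (r1 k) q - Q q\<bar> < e / 2" using LIMSEQ_D[OF Q[OF q(1)], of "e / 2"] e by auto
    have 1: "\<bar>Q p - H t\<bar> < e / 2" "\<bar>Q q - H t\<bar> < e / 2" using d(2)[of p] d(2)[of q] p q HQ by auto
    have 2: "g (r1 k) p \<le> g (r1 k) t" "g (r1 k) t \<le> g (r1 k) q" for k using monoD[OF mono] p q by auto
    have "norm (g (r1 k) t - H t) < e" if "k \<ge> max k1 k2" for k
    proof -
      have "\<bar>g (r1 k) p - Q p\<bar> < e / 2" "\<bar>g (r1 k) q - Q q\<bar> < e / 2" using k1[of k] k2[of k] that by auto
      then show ?thesis using 1 2[of k] unfolding real_norm_def abs_less_iff by linarith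
    qed
    then show "\<exists>no. \<forall>k\<ge>no. norm (g (r1 k) t - H t) < e" by (intro exI[of _ "max k1 k2"]) simp
  qed
  have sub1: "\<exists>r::nat\<Rightarrow>nat. strict_mono r \<and> convergent (\<lambda>k. g (r1 (s (r k))) t)" for s t
    using sub[of "\<lambda>k. r1 (s k)" t] .
  obtain r2 :: "nat \<Rightarrow> nat" where r2: "strict_mono r2" "\<And>t. \<not> isCont H t \<Longrightarrow> convergent (\<lambda>k. g (r1 (r2 k)) t)"
    using diagonal_convergent[OF mono_ctble_discont[OF Hm], of "\<lambda>k. g (r1 k)"] sub1 by auto
  have "convergent (\<lambda>k. g ((r1 \<circ> r2) k) t)" for t
  proof (cases "isCont H t")
    case True
    then show ?thesis using LIMSEQ_subseq_LIMSEQ[OF conv r2(1)] by (auto simp: o_def convergent_def)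
  qed (use r2(2) in simp)
  then show ?thesis using strict_mono_o[OF r1(1) r2(1)] by blast
qed

text \<open>The increments of \<open>f\<close> are controlled by those of a convergent monotone
  family. At continuity points of its limit, convergence is therefore inherited from nearby rational
  times; the remaining times are countable.\<close>

lemma (in finite_dim_basis) dominated_selection:
  fixes g :: "nat \<Rightarrow> real \<Rightarrow> real" and f :: "nat \<Rightarrow> real \<Rightarrow> 'a"
  assumes mono: "\<And>k. mono (g k)" and bd: "\<And>k t. \<bar>g k t\<bar> \<le> M" and fb: "\<And>k t. norm (f k t) \<le> R"
    and C: "C > 0" and dom: "\<And>k a b. a \<le> b \<Longrightarrow> norm (f k b - f k a) \<le> C * (g k b - g k a)"
  shows "\<exists>r::nat\<Rightarrow>nat. strict_mono r \<and> (\<forall>t. convergent (\<lambda>k. g (r k) t)) \<and> (\<forall>t. convergent (\<lambda>k. f (r k) t))"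
proof -
  obtain r1 :: "nat \<Rightarrow> nat" where r1: "strict_mono r1" "\<And>t. convergent (\<lambda>k. g (r1 k) t)"
    using monotone_selection[of g, OF mono bd] by blast
  define H where "H t = lim (\<lambda>k. g (r1 k) t)" for t
  have H: "(\<lambda>k. g (r1 k) t) \<longlonglongrightarrow> H t" for t
    using r1(2) unfolding H_def convergent_LIMSEQ_iff .
  have Hm: "mono H"
    by (rule monoI, rule LIMSEQ_le[OF H H]) (use monoD[OF mono] in blast)
  define D where "D = \<rat> \<union> {t. \<not> isCont H t}"
  have D: "countable D" unfolding D_def using countable_rat mono_ctble_discont[OF Hm] by blast
  have sub: "\<exists>r::nat\<Rightarrow>nat. strict_mono r \<and> convergent (\<lambda>k. f (r1 (s (r k))) t)" for s t
  proof -
    have "bounded (range (\<lambda>k. f (r1 (s k)) t))" using fb by (intro boundedI[of _ R]) auto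
    then show ?thesis using bounded_subseq[of "\<lambda>k. f (r1 (s k)) t"] by (auto simp: convergent_def)
  qed
  obtain r2 :: "nat \<Rightarrow> nat" where r2: "strict_mono r2" "\<And>t. t \<in> D \<Longrightarrow> convergent (\<lambda>k. f (r1 (r2 k)) t)"
    using diagonal_convergent[OF D, of "\<lambda>k. f (r1 k)"] sub by blast
  let ?r = "\<lambda>k. r1 (r2 k)"
  have H2: "(\<lambda>k. g (?r k) t) \<longlonglongrightarrow> H t" for t
    using LIMSEQ_subseq_LIMSEQ[OF H r2(1)] by (simp add: o_def)
  have "convergent (\<lambda>k. f (?r k) t)" for t
  proof (cases "isCont H t")
    case False then show ?thesis using r2(2) by (simp add: D_def)
  next
    case True
    have "Cauchy (\<lambda>k. f (?r k) t)"
    proof (rule metric_CauchyI)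
      fix e :: real assume e: "e > 0"
      \<comment> \<open>Three distances of at most \<open>C * \<eta>\<close> have to stay below
        \<open>e\<close>; the constant 5 leaves a margin.\<close>
      define \<eta> where "\<eta> = e / (5 * C + 1)"
      have \<eta>: "\<eta> > 0" "5 * C * \<eta> < e" using e C by (auto simp: \<eta>_def field_simps)
      from True have "(H \<longlongrightarrow> H t) (at t)" by (simp add: isCont_def)
      then obtain d where d: "d > 0" "\<And>s. s \<noteq> t \<Longrightarrow> \<bar>s - t\<bar> < d \<Longrightarrow> \<bar>H s - H t\<bar> < \<eta> / 2"
        using LIM_D[of H "H t" t "\<eta> / 2"] \<eta> by auto
      obtain q where q: "q \<in> \<rat>" "t < q" "q < t + d" using Rats_dense_in_real[of t "t + d"] d by auto
      have Hq: "\<bar>H q - H t\<bar> < \<eta> / 2" using d(2)[of q] q by auto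
      obtain k1 where k1: "\<And>k. k \<ge> k1 \<Longrightarrow> \<bar>g (?r k) q - H q\<bar> < \<eta> / 4" using LIMSEQ_D[OF H2, of "\<eta> / 4"] \<eta> by auto
      obtain k2 where k2: "\<And>k. k \<ge> k2 \<Longrightarrow> \<bar>g (?r k) t - H t\<bar> < \<eta> / 4" using LIMSEQ_D[OF H2, of "\<eta> / 4"] \<eta> by auto
      have "Cauchy (\<lambda>k. f (?r k) q)" using r2(2)[of q] q by (simp add: D_def convergent_Cauchy)
      then obtain k3 where k3: "\<And>m n. m \<ge> k3 \<Longrightarrow> n \<ge> k3 \<Longrightarrow> dist (f (?r m) q) (f (?r n) q) < C * \<eta>"
        using metric_CauchyD[of _ "C * \<eta>"] C \<eta> by (metis mult_pos_pos)
      have near: "dist (f (?r k) t) (f (?r k) q) \<le> C * \<eta>" if "k \<ge> k1" "k \<ge> k2" for k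
      proof -
        have "dist (f (?r k) t) (f (?r k) q) \<le> C * (g (?r k) q - g (?r k) t)"
          using dom[of t q "?r k"] q by (simp add: dist_norm norm_minus_commute)
        also have "\<dots> \<le> C * \<eta>" using k1[OF that(1)] k2[OF that(2)] Hq C by (intro mult_left_mono) linarith+
        finally show ?thesis .
      qed
      show "\<exists>N. \<forall>m\<ge>N. \<forall>n\<ge>N. dist (f (?r m) t) (f (?r n) t) < e"
      proof (intro exI[of _ "max k1 (max k2 k3)"] allI impI)
        fix m n assume mn: "m \<ge> max k1 (max k2 k3)" "n \<ge> max k1 (max k2 k3)"
        have "dist (f (?r m) t) (f (?r n) t) \<le> dist (f (?r m) t) (f (?r m) q) + (dist (f (?r m) q) (f (?r n) q) + dist (f (?r n) q) (f (?r n) t))"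
          by (intro order_trans[OF dist_triangle add_left_mono[OF dist_triangle]])
        moreover have "dist (f (?r m) t) (f (?r m) q) \<le> C * \<eta>" "dist (f (?r n) q) (f (?r n) t) \<le> C * \<eta>"
          using near[of m] near[of n] mn by (auto simp: dist_commute)
        moreover have "dist (f (?r m) q) (f (?r n) q) < C * \<eta>" using k3 mn by simp
        moreover have "0 < C * \<eta>" using C \<eta> by simp
        ultimately show "dist (f (?r m) t) (f (?r n) t) < e" using \<eta>(2) by linarith
      qed
    qed
    then show ?thesis by (simp add: Cauchy_convergent)
  qed
  moreover have "convergent (\<lambda>k. g (?r k) t)" for t using H2 convergent_def by blast
  moreover have "strict_mono ?r" using strict_mono_o[OF r1(1) r2(1)] by (simp add: o_def)
  ultimately show ?thesis by blast
qed

section \<open>Estimates for the discrete solutions\<close>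

locale scheme = rate_system B \<Psi> \<Psi>0 E dtE DE T
  for B :: "'a::{banach,second_countable_topology} set" and \<Psi> \<Psi>0 E dtE DE T +
  fixes V :: "nat \<Rightarrow> nat \<Rightarrow> 'a" and \<tau> \<epsilon> :: "nat \<Rightarrow> real" and u0 :: 'a
  assumes discrete: "discrete_solution T E \<Psi> (\<tau> k) (\<epsilon> k) (V k)"
    and tau: "\<tau> k > 0" "\<tau> \<longlonglongrightarrow> 0" and eps: "\<epsilon> k > 0" "\<epsilon> \<longlonglongrightarrow> 0"
    and ratio: "filterlim (\<lambda>k. \<epsilon> k / \<tau> k) at_top sequentially"
    and initial: "(\<lambda>k. V k 0) \<longlonglongrightarrow> u0"
begin

text \<open>Times are clamped to the interval from 0 to T, so that all curves live on the whole line.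
  Since one step of the scheme costs \<tau> k times rescaled \<Psi> (\<epsilon> k) of Dl k n / \<tau> k, that is,
  rescaled \<Psi> (lam k) of Dl k n, the effective viscosity is the ratio lam k. The function Pk
  is the dissipation accumulated up to a time.\<close>

definition N :: "nat \<Rightarrow> nat" where "N k = num_steps T (\<tau> k)"
definition tt :: "nat \<Rightarrow> nat \<Rightarrow> real" where "tt k n = min (real n * \<tau> k) T"
definition Dl :: "nat \<Rightarrow> nat \<Rightarrow> 'a" where "Dl k n = V k n - V k (n - 1)"
definition \<xi> :: "nat \<Rightarrow> nat \<Rightarrow> 'a \<Rightarrow>\<^sub>L real" where "\<xi> k n = - DE (tt k n) (V k n)"
definition cl :: "real \<Rightarrow> real" where "cl t = max 0 (min T t)"
definition ix :: "nat \<Rightarrow> real \<Rightarrow> nat" where "ix k t = nat \<lceil>cl t / \<tau> k\<rceil>"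
definition Ui :: "nat \<Rightarrow> real \<Rightarrow> 'a" where "Ui k t = V k (ix k t)"
definition Pk :: "nat \<Rightarrow> real \<Rightarrow> real" where "Pk k t = (\<Sum>n=1..ix k t. pp (Dl k n) (\<xi> k n))"
definition lam :: "nat \<Rightarrow> real" where "lam k = \<epsilon> k / \<tau> k"

lemma lam_pos: "lam k > 0" using tau eps by (simp add: lam_def)

lemma cl: "0 \<le> cl t" "cl t \<le> T" "s \<le> t \<Longrightarrow> cl s \<le> cl t" "t \<in> {0..T} \<Longrightarrow> cl t = t"
  "t \<le> 0 \<Longrightarrow> cl t = 0" "t \<ge> T \<Longrightarrow> cl t = T"
  using T_pos' by (auto simp: cl_def)

lemma tt: "tt k n \<in> {0..T}" using tau(1)[of k] T_pos' by (simp add: tt_def)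

lemma least_ceiling:
  assumes "0 \<le> t" "s > 0"
  shows "(LEAST n. t \<le> real n * s) = nat \<lceil>t / s\<rceil>"
proof (rule Least_equality)
  have "t / s \<le> real (nat \<lceil>t / s\<rceil>)" using assms by (simp add: real_nat_ceiling_ge)
  then show "t \<le> real (nat \<lceil>t / s\<rceil>) * s" by (simp only: pos_divide_le_eq[OF assms(2)])
  fix n assume "t \<le> real n * s"
  then have "t / s \<le> real n" using assms by (simp add: pos_divide_le_eq)
  then show "nat \<lceil>t / s\<rceil> \<le> n" by (simp add: ceiling_le nat_le_iff)
qed

lemma interpolant_eq: "t \<in> {0..T} \<Longrightarrow> interpolant (\<tau> k) (V k) t = Ui k t"
  using least_ceiling[of t "\<tau> k"] tau(1)[of k] cl(4)[of t] by (simp add: interpolant_def Ui_def ix_def)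

lemma ix_mono: "s \<le> t \<Longrightarrow> ix k s \<le> ix k t"
  unfolding ix_def using cl(3)[of s t] tau(1)[of k]
  by (intro nat_mono ceiling_mono divide_right_mono) auto

lemma N_eq: "N k = ix k T"
  using least_ceiling[of T "\<tau> k"] tau(1)[of k] cl(4)[of T] T_pos' by (simp add: N_def num_steps_def ix_def)

lemma ix_le_N: "ix k t \<le> N k"
proof -
  have "ix k t = ix k (cl t)" using cl(4)[of "cl t"] cl(1,2)[of t] by (simp add: ix_def)
  also have "\<dots> \<le> ix k T" by (rule ix_mono) (rule cl)
  finally show ?thesis by (simp add: N_eq)
qed

lemma ix_zero: "t \<le> 0 \<Longrightarrow> ix k t = 0" using cl(5)[of t] by (simp add: ix_def)

lemma ix_ge: "cl t \<le> real (ix k t) * \<tau> k"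
proof -
  have "cl t / \<tau> k \<le> real (ix k t)" unfolding ix_def by (rule real_nat_ceiling_ge)
  then show ?thesis using tau(1)[of k] by (simp add: pos_divide_le_eq)
qed

lemma ix_less: "real (ix k t) * \<tau> k < cl t + \<tau> k"
proof -
  have nn: "0 \<le> cl t / \<tau> k" using cl(1)[of t] tau(1)[of k] by simp
  have "real (ix k t) = of_int \<lceil>cl t / \<tau> k\<rceil>" unfolding ix_def using nn by (simp add: ceiling_mono)
  then have "real (ix k t) < cl t / \<tau> k + 1" by linarith
  then have "real (ix k t) * \<tau> k < (cl t / \<tau> k + 1) * \<tau> k" using tau(1)[of k] by (intro mult_strict_right_mono)
  then show ?thesis using tau(1)[of k] by (simp add: distrib_right)
qed

lemma tt_ix: "cl t \<le> tt k (ix k t)" "tt k (ix k t) < cl t + \<tau> k"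
  using ix_ge[of t k] ix_less[of k t] cl(2)[of t] by (auto simp: tt_def)

lemma cl_measurable [measurable]: "cl \<in> borel_measurable borel"
  unfolding cl_def[abs_def] by measurable

lemma ix_measurable [measurable]: "ix k \<in> measurable borel (count_space UNIV)"
  unfolding ix_def[abs_def] by measurable

lemma Ui_measurable [measurable]: "Ui k \<in> borel_measurable borel"
  unfolding Ui_def[abs_def] by measurable

lemma rescaled_nonneg: "0 \<le> rescaled \<Psi> (lam k) v"
  using lam_pos[of k] Psi_nonneg by (simp add: rescaled_def)

lemma dissipation_bound: "\<exists>S>0. \<forall>k. (\<Sum>j=1..N k. rescaled \<Psi> (lam k) (Dl k j)) \<le> S"
proof -
  obtain C where C: "C > 0" "\<And>t x. t \<in> {0..T} \<Longrightarrow> 1 \<le> E t x + C + 1"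
    "\<And>s t x. 0 \<le> s \<Longrightarrow> s \<le> t \<Longrightarrow> t \<le> T \<Longrightarrow> exp (- C * t) * (E t x + C + 1) \<le> exp (- C * s) * (E s x + C + 1)"
    using energy_growth by blast
  have "isCont (E 0) u0" using E_has_derivative[of 0 u0] T_pos' by (intro has_derivative_continuous) auto
  then have "(\<lambda>k. E 0 (V k 0)) \<longlonglongrightarrow> E 0 u0" using isCont_tendsto_compose[OF _ initial] by blast
  then obtain M where M: "\<And>k. \<bar>E 0 (V k 0)\<bar> \<le> M" using convergent_imp_Bseq convergentI Bseq_def by (metis real_norm_def)
  have "(\<Sum>j=1..N k. rescaled \<Psi> (lam k) (Dl k j)) \<le> exp (C * T) * (M + C + 1)" for k
  proof -
    have "(\<Sum>j=1..N k. rescaled \<Psi> (lam k) (Dl k j)) \<le> exp (C * T) * (E 0 (V k 0) + C + 1)"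
      unfolding lam_def Dl_def N_def by (rule discrete_a_priori[OF C discrete tau(1) eps(1)]) simp_all
    also have "\<dots> \<le> exp (C * T) * (M + C + 1)" using M[of k] by (intro mult_left_mono) auto
    finally show ?thesis .
  qed
  moreover have "M \<ge> 0" using M[of 0] by linarith
  then have "exp (C * T) * (M + C + 1) > 0" using C(1) by (intro mult_pos_pos) auto
  ultimately show ?thesis by blast
qed

text \<open>The gauge lies below every rescaling, whatever the viscosity, so the dissipation bound
  controls the lengths uniformly in \<open>k\<close>.\<close>

lemma variation_bound: "\<exists>L>0. \<forall>k. (\<Sum>j=1..N k. norm (Dl k j)) \<le> L"
proof -
  obtain S where S: "S > 0" "\<And>k. (\<Sum>j=1..N k. rescaled \<Psi> (lam k) (Dl k j)) \<le> S" using dissipation_bound by blast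
  obtain c where c: "c > 0" "\<And>v. c * norm v \<le> \<Psi>0 v" using Psi0_lower by blast
  have "(\<Sum>j=1..N k. norm (Dl k j)) \<le> S / c" for k
  proof -
    have "c * (\<Sum>j=1..N k. norm (Dl k j)) \<le> (\<Sum>j=1..N k. rescaled \<Psi> (lam k) (Dl k j))"
      unfolding sum_distrib_left
      by (intro sum_mono order_trans[OF c(2) Psi0_le_rescaled] lam_pos)
    then have "c * (\<Sum>j=1..N k. norm (Dl k j)) \<le> S" using S(2)[of k] by linarith
    then show ?thesis using c(1) by (simp add: field_simps)
  qed
  then show ?thesis using S(1) c(1) by (intro exI[of _ "S / c"]) auto
qed

lemma V_diff: "m \<le> n \<Longrightarrow> V k n - V k m = (\<Sum>j=Suc m..n. Dl k j)"
proof (induction n)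
  case (Suc n)
  show ?case
  proof (cases "m \<le> n")
    case True
    then show ?thesis using Suc.IH by (simp add: Dl_def algebra_simps)
  next
    case False
    then have "m = Suc n" using Suc.prems by simp
    then show ?thesis by simp
  qed
qed simp

lemma V_bound: "\<exists>R>0. \<forall>k n. n \<le> N k \<longrightarrow> norm (V k n) \<le> R"
proof -
  obtain L where L: "L > 0" "\<And>k. (\<Sum>j=1..N k. norm (Dl k j)) \<le> L" using variation_bound by blast
  obtain M where M: "\<And>k. norm (V k 0) \<le> M" using initial convergent_imp_Bseq convergentI Bseq_def by metis
  have "norm (V k n) \<le> M + L" if n: "n \<le> N k" for k n
  proof -
    have "norm (V k n - V k 0) \<le> (\<Sum>j=Suc 0..n. norm (Dl k j))" unfolding V_diff[OF le0] by (rule norm_sum)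
    also have "\<dots> \<le> (\<Sum>j=1..N k. norm (Dl k j))" using n by (intro sum_mono2) auto
    finally have "norm (V k n - V k 0) \<le> L" using L(2)[of k] by simp
    then show ?thesis using M[of k] norm_triangle_ineq[of "V k 0" "V k n - V k 0"] by simp
  qed
  moreover have "M + L > 0" using norm_ge_zero[of "V 0 0"] M[of 0] L(1) by linarith
  ultimately show ?thesis by blast
qed

text \<open>Here the divergence of the ratio of viscosity to time step enters: by superlinearity, a
  single step of length \<delta> would cost more than the bound on the total dissipation once
  \<open>lam k\<close> is large.\<close>

lemma small_steps:
  assumes \<delta>: "\<delta> > 0" shows "\<forall>\<^sub>F k in sequentially. \<forall>n\<in>{1..N k}. norm (Dl k n) < \<delta>"
proof -
  obtain S where S: "S > 0" "\<And>k. (\<Sum>j=1..N k. rescaled \<Psi> (lam k) (Dl k j)) \<le> S" using dissipation_bound by blast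
  obtain \<rho> where \<rho>: "\<rho> > 0" "\<And>v. norm v \<ge> \<rho> \<Longrightarrow> ((S + 1) / \<delta>) * norm v \<le> \<Psi> v" using superlinear[of "(S + 1) / \<delta>"] by blast
  have "\<forall>\<^sub>F k in sequentially. lam k \<ge> \<rho> / \<delta>" using ratio unfolding filterlim_at_top lam_def by blast
  then show ?thesis
  proof eventually_elim
    case (elim k)
    show ?case
    proof (rule ballI, rule ccontr)
      fix n assume n: "n \<in> {1..N k}" and "\<not> norm (Dl k n) < \<delta>"
      then have big: "norm (Dl k n) \<ge> \<delta>" by simp
      have "rescaled \<Psi> (lam k) (Dl k n) \<le> (\<Sum>j=1..N k. rescaled \<Psi> (lam k) (Dl k j))"
        using n rescaled_nonneg by (intro member_le_sum) auto
      then have le: "\<Psi> (lam k *\<^sub>R Dl k n) / lam k \<le> S" using S(2)[of k] by (simp add: rescaled_def)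
      have nl: "norm (lam k *\<^sub>R Dl k n) = lam k * norm (Dl k n)" using lam_pos[of k] by simp
      have "\<rho> = (\<rho> / \<delta>) * \<delta>" using \<delta> by simp
      also have "\<dots> \<le> lam k * norm (Dl k n)" using elim big \<rho>(1) \<delta> lam_pos[of k] by (intro mult_mono) auto
      finally have "\<rho> \<le> norm (lam k *\<^sub>R Dl k n)" unfolding nl .
      from \<rho>(2)[OF this] have "((S + 1) / \<delta>) * (lam k * norm (Dl k n)) \<le> \<Psi> (lam k *\<^sub>R Dl k n)" unfolding nl .
      then have "((S + 1) / \<delta>) * norm (Dl k n) \<le> \<Psi> (lam k *\<^sub>R Dl k n) / lam k" using lam_pos[of k] by (simp add: field_simps)
      moreover have "((S + 1) / \<delta>) * \<delta> \<le> ((S + 1) / \<delta>) * norm (Dl k n)" using big S(1) \<delta> by (intro mult_left_mono) auto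
      ultimately show False using le \<delta> by simp
    qed
  qed
qed

lemma Pk_diff: assumes "a \<le> b" shows "Pk k b - Pk k a = (\<Sum>n=Suc (ix k a)..ix k b. pp (Dl k n) (\<xi> k n))"
proof -
  have "{1..ix k b} = {1..ix k a} \<union> {Suc (ix k a)..ix k b}" using ix_mono[OF assms, of k] by auto
  then have "Pk k b = Pk k a + (\<Sum>n=Suc (ix k a)..ix k b. pp (Dl k n) (\<xi> k n))"
    unfolding Pk_def by (simp add: sum.union_disjoint)
  then show ?thesis by simp
qed

lemma mono_Pk: "mono (Pk k)"
proof (rule monoI)
  fix a b :: real assume "a \<le> b"
  then have "0 \<le> Pk k b - Pk k a" unfolding Pk_diff[OF \<open>a \<le> b\<close>] using pp_nonneg by (intro sum_nonneg) auto
  then show "Pk k a \<le> Pk k b" by simp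
qed

lemma Ui_diff: assumes "a \<le> b" shows "Ui k b - Ui k a = (\<Sum>n=Suc (ix k a)..ix k b. Dl k n)"
  unfolding Ui_def by (rule V_diff[OF ix_mono[OF assms]])

lemma Ui_Pk: "\<exists>C>0. \<forall>k a b. a \<le> b \<longrightarrow> norm (Ui k b - Ui k a) \<le> C * (Pk k b - Pk k a)"
proof -
  obtain c where c: "c > 0" "\<And>v. c * norm v \<le> \<Psi>0 v" using Psi0_lower by blast
  have "norm (Ui k b - Ui k a) \<le> (1 / c) * (Pk k b - Pk k a)" if "a \<le> b" for k a b
  proof -
    have "norm (Ui k b - Ui k a) \<le> (\<Sum>n=Suc (ix k a)..ix k b. norm (Dl k n))"
      unfolding Ui_diff[OF that] by (rule norm_sum)
    also have "\<dots> \<le> (\<Sum>n=Suc (ix k a)..ix k b. (1 / c) * pp (Dl k n) (\<xi> k n))"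
    proof (rule sum_mono)
      fix n
      have "c * norm (Dl k n) \<le> pp (Dl k n) (\<xi> k n)" using c(2) pp_ge_Psi0 order_trans by blast
      then show "norm (Dl k n) \<le> (1 / c) * pp (Dl k n) (\<xi> k n)" using c(1) by (simp add: field_simps)
    qed
    finally show ?thesis unfolding Pk_diff[OF that] sum_distrib_left .
  qed
  then show ?thesis using c(1) by (intro exI[of _ "1 / c"]) auto
qed

lemma Ui_Pk_apply: assumes "w \<in> Kstar \<Psi>0" "a \<le> b" shows "blinfun_apply w (Ui k b - Ui k a) \<le> Pk k b - Pk k a"
proof -
  have "blinfun_apply w (Ui k b - Ui k a) = (\<Sum>n=Suc (ix k a)..ix k b. blinfun_apply w (Dl k n))"
    unfolding Ui_diff[OF assms(2)] by (rule blinfun.sum_right)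
  also have "\<dots> \<le> (\<Sum>n=Suc (ix k a)..ix k b. pp (Dl k n) (\<xi> k n))"
    using assms(1) pp_ge_Psi0 by (intro sum_mono) (auto simp: Kstar_def intro: order_trans)
  finally show ?thesis unfolding Pk_diff[OF assms(2)] .
qed

text \<open>Bounded states have bounded forces, for which the contact potential is at most a
  multiple of the step length. This bounds the accumulated dissipations, as Helly's theorem
  requires.\<close>

lemma selection:
  "\<exists>r::nat\<Rightarrow>nat. strict_mono r \<and> (\<forall>t. convergent (\<lambda>k. Pk (r k) t)) \<and> (\<forall>t. convergent (\<lambda>k. Ui (r k) t))"
proof -
  obtain R where R: "R > 0" "\<And>k n. n \<le> N k \<Longrightarrow> norm (V k n) \<le> R" using V_bound by blast
  obtain L where L: "L > 0" "\<And>k. (\<Sum>j=1..N k. norm (Dl k j)) \<le> L" using variation_bound by blast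
  obtain M where M: "M > 0" "\<And>t x. t \<in> {0..T} \<Longrightarrow> norm x \<le> R \<Longrightarrow> norm (DE t x) \<le> M" using local_bounds[of R] by blast
  obtain K where K: "K > 0" "\<And>v w. norm w \<le> M \<Longrightarrow> pp v w \<le> K * norm v" using pp_bound[of M] M(1) by auto
  obtain C where C: "C > 0" "\<And>k a b. a \<le> b \<Longrightarrow> norm (Ui k b - Ui k a) \<le> C * (Pk k b - Pk k a)" using Ui_Pk by blast
  have "\<bar>Pk k t\<bar> \<le> K * L" for k t
  proof -
    have "Pk k t \<le> (\<Sum>n=1..ix k t. K * norm (Dl k n))" unfolding Pk_def
    proof (rule sum_mono)
      fix n assume "n \<in> {1..ix k t}"
      then have "n \<le> N k" using ix_le_N[of k t] by simp
      then show "pp (Dl k n) (\<xi> k n) \<le> K * norm (Dl k n)" using M(2)[OF tt R(2)] by (intro K(2)) (simp add: \<xi>_def)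
    qed
    also have "\<dots> \<le> (\<Sum>n=1..N k. K * norm (Dl k n))" using K(1) ix_le_N[of k t] by (intro sum_mono2) auto
    also have "\<dots> \<le> K * L" unfolding sum_distrib_left[symmetric] using K(1) L(2) by (intro mult_left_mono) auto
    finally have "Pk k t \<le> K * L" .
    moreover have "0 \<le> Pk k t" unfolding Pk_def using pp_nonneg by (intro sum_nonneg) auto
    ultimately show ?thesis by simp
  qed
  moreover have "norm (Ui k t) \<le> R" for k t unfolding Ui_def by (rule R(2)[OF ix_le_N])
  ultimately show ?thesis using dominated_selection[of Pk "K * L" Ui R C] mono_Pk C by blast
qed

end

section \<open>The limit curve\<close>

text \<open>Convergence is assumed along the full sequence, so that the limit can be studied without
  carrying a subsequence through all estimates.\<close>

locale scheme_limit = scheme B \<Psi> \<Psi>0 E dtE DE T V \<tau> \<epsilon> u0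
  for B :: "'a::{banach,second_countable_topology} set" and \<Psi> \<Psi>0 E dtE DE T V \<tau> \<epsilon> u0 +
  fixes P :: "real \<Rightarrow> real" and u :: "real \<Rightarrow> 'a"
  assumes conv_P: "(\<lambda>k. Pk k t) \<longlonglongrightarrow> P t" and conv_u: "(\<lambda>k. Ui k t) \<longlonglongrightarrow> u t"
begin

lemma mono_P: "mono P"
  by (rule monoI, rule LIMSEQ_le[OF conv_P conv_P]) (use monoD[OF mono_Pk] in blast)

lemma P_zero: "P 0 = 0"
proof -
  have "Pk k 0 = 0" for k by (simp add: Pk_def ix_zero)
  then show ?thesis using conv_P[of 0] by (simp add: LIMSEQ_const_iff)
qed

lemma u_zero: "u 0 = u0"
proof -
  have "Ui k 0 = V k 0" for k by (simp add: Ui_def ix_zero)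
  then show ?thesis using LIMSEQ_unique[OF conv_u[of 0]] initial by simp
qed

definition Cu :: real where "Cu = (SOME C. C > 0 \<and> (\<forall>k a b. a \<le> b \<longrightarrow> norm (Ui k b - Ui k a) \<le> C * (Pk k b - Pk k a)))"

lemma Cu: "Cu > 0" "a \<le> b \<Longrightarrow> norm (Ui k b - Ui k a) \<le> Cu * (Pk k b - Pk k a)"
  using someI_ex[OF Ui_Pk] unfolding Cu_def by blast+

text \<open>A multiple of the limit dissipation serves as the control, so the curve can jump only at
  discontinuities of \<open>P\<close>.\<close>

sublocale bv_system B \<Psi> \<Psi>0 u "\<lambda>t. Cu * P t" T
proof
  show "T > 0" by (rule T_pos')
  show "mono (\<lambda>t. Cu * P t)" using mono_P Cu(1) by (auto simp: mono_def)
  show "norm (u b - u a) \<le> Cu * P b - Cu * P a" if "a \<le> b" for a b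
  proof (rule LIMSEQ_le)
    show "(\<lambda>k. norm (Ui k b - Ui k a)) \<longlonglongrightarrow> norm (u b - u a)" by (intro tendsto_intros conv_u)
    show "(\<lambda>k. Cu * (Pk k b - Pk k a)) \<longlonglongrightarrow> Cu * P b - Cu * P a"
      unfolding right_diff_distrib[symmetric] by (intro tendsto_intros conv_P)
  qed (use Cu(2)[OF that] in auto)
  have l: "Ui k t = Ui k 0" if "t \<le> 0" for t k using that by (simp add: Ui_def ix_zero)
  show "u t = u 0" if "t \<le> 0" for t
    by (rule LIMSEQ_unique[OF conv_u[of t]]) (simp add: l[OF that] conv_u)
  have r: "Ui k t = Ui k T" if "t \<ge> T" for t k using that by (simp add: Ui_def ix_def cl(6))
  show "u t = u T" if "t \<ge> T" for t
    by (rule LIMSEQ_unique[OF conv_u[of t]]) (simp add: r[OF that] conv_u)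
qed

lemma u_P_apply: assumes "w \<in> Kstar \<Psi>0" "a \<le> b" shows "blinfun_apply w (u b - u a) \<le> P b - P a"
proof (rule LIMSEQ_le)
  show "(\<lambda>k. blinfun_apply w (Ui k b - Ui k a)) \<longlonglongrightarrow> blinfun_apply w (u b - u a)" by (intro tendsto_intros conv_u)
  show "(\<lambda>k. Pk k b - Pk k a) \<longlonglongrightarrow> P b - P a" by (intro tendsto_intros conv_P)
qed (use Ui_Pk_apply[OF assms] in auto)

lemma BV_u: "BV_function T u"
proof -
  have "pointwise_variation u {0..T} \<le> ennreal (Cu * P T - Cu * P 0)"
    unfolding pointwise_variation_def
  proof (rule SUP_least, clarify)
    fix n :: nat and s :: "nat \<Rightarrow> real" assume s: "mono_on {..n} s" "s ` {..n} \<subseteq> {0..T}"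
    have "(\<Sum>i<n. ennreal (norm (u (s (Suc i)) - u (s i)))) = ennreal (\<Sum>i<n. norm (u (s (Suc i)) - u (s i)))"
      by (rule sum_ennreal) simp
    also have "(\<Sum>i<n. norm (u (s (Suc i)) - u (s i))) \<le> (\<Sum>i<n. Cu * P (s (Suc i)) - Cu * P (s i))"
      by (intro sum_mono increment mono_onD[OF s(1)]) auto
    also have "\<dots> = Cu * P (s n) - Cu * P (s 0)" by (induction n) auto
    also have "\<dots> \<le> Cu * P T - Cu * P 0"
    proof -
      have "s n \<in> {0..T}" "s 0 \<in> {0..T}" using s(2) by auto
      then have "P (s n) \<le> P T" "P 0 \<le> P (s 0)" using monoD[OF mono_P] by auto
      then show ?thesis using Cu(1) by (intro diff_mono mult_left_mono) auto
    qed
    finally show "(\<Sum>i<n. ennreal (norm (u (s (Suc i)) - u (s i)))) \<le> ennreal (Cu * P T - Cu * P 0)" by (simp add: ennreal_leI)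
  qed
  then show ?thesis unfolding BV_function_def by (simp add: le_less_trans)
qed

subsection \<open>Jumps\<close>

text \<open>The transition from u a to u b is approximated by the polygonal line through the discrete
  solution; close to the time t, the frozen differential along it is uniformly close to the
  forces of the scheme, since the steps become small.\<close>

lemma transition_cost:
  assumes t: "t \<in> {0..T}"
  shows "\<exists>K>0. \<forall>e>0. \<exists>d>0. \<forall>a b. 0 \<le> a \<longrightarrow> a \<le> b \<longrightarrow> b \<le> T \<longrightarrow> \<bar>a - t\<bar> < d \<longrightarrow> \<bar>b - t\<bar> < d \<longrightarrow>
     finsler_cost pp (DE t) x y \<le> ennreal (K * norm (u a - x) + (P b - P a) + e + K * norm (y - u b))"
proof -
  obtain R0 where R0: "R0 > 0" "\<And>k n. n \<le> N k \<Longrightarrow> norm (V k n) \<le> R0" using V_bound by blast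
  obtain L where L: "L > 0" "\<And>k. (\<Sum>j=1..N k. norm (Dl k j)) \<le> L" using variation_bound by blast
  define R where "R = R0 + norm x + norm y"
  have R: "norm x \<le> R" "norm y \<le> R" "\<And>k n. n \<le> N k \<Longrightarrow> norm (V k n) \<le> R"
    using R0 order_trans[OF R0(2)] by (auto simp: R_def intro: add_nonneg_nonneg)
  have seg: "norm (p + s *\<^sub>R (q - p)) \<le> R" if "norm p \<le> R" "norm q \<le> R" "0 \<le> s" "s \<le> 1" for p q :: 'a and s
  proof -
    have "p + s *\<^sub>R (q - p) = (1 - s) *\<^sub>R p + s *\<^sub>R q" by (simp add: algebra_simps)
    also have "norm \<dots> \<le> (1 - s) * norm p + s * norm q" using that norm_triangle_ineq[of "(1 - s) *\<^sub>R p" "s *\<^sub>R q"] by simp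
    also have "\<dots> \<le> (1 - s) * R + s * R" using that by (intro add_mono mult_left_mono) auto
    finally show ?thesis by (simp add: algebra_simps)
  qed
  obtain M where M: "M > 0" "\<And>t x. t \<in> {0..T} \<Longrightarrow> norm x \<le> R \<Longrightarrow> norm (DE t x) \<le> M" using local_bounds[of R] by blast
  obtain K where K: "K > 0" "\<And>v w. norm w \<le> M \<Longrightarrow> pp v w \<le> K * norm v" using pp_bound[of M] M(1) by auto
  show ?thesis
  proof (rule exI[of _ K], intro conjI allI impI K(1))
    fix e :: real assume e: "e > 0"
    \<comment> \<open>The modulus error is \<eta> times the length of the part of the polygon that
      follows the scheme, and \<open>L\<close> bounds this length.\<close>
    define \<eta> where "\<eta> = e / L"
    have \<eta>: "\<eta> > 0" "\<eta> * L = e" using e L(1) by (auto simp: \<eta>_def)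
    obtain \<delta> where \<delta>: "\<delta> > 0" "\<And>w w' v. norm w \<le> M \<Longrightarrow> norm w' \<le> M \<Longrightarrow> norm (w' - w) < \<delta> \<Longrightarrow> pp v w' \<le> pp v w + \<eta> * norm v"
      using pp_modulus[OF \<eta>(1), of M] by blast
    obtain \<delta>' where \<delta>': "\<delta>' > 0" "\<And>s t x y. s \<in> {0..T} \<Longrightarrow> t \<in> {0..T} \<Longrightarrow> norm x \<le> R \<Longrightarrow> norm y \<le> R \<Longrightarrow> \<bar>s - t\<bar> < \<delta>' \<Longrightarrow>
      norm (x - y) < \<delta>' \<Longrightarrow> norm (DE s x - DE t y) < \<delta>" using uniform_continuity[OF \<delta>(1), of R] by blast
    show "\<exists>d>0. \<forall>a b. 0 \<le> a \<longrightarrow> a \<le> b \<longrightarrow> b \<le> T \<longrightarrow> \<bar>a - t\<bar> < d \<longrightarrow> \<bar>b - t\<bar> < d \<longrightarrow>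
      finsler_cost pp (DE t) x y \<le> ennreal (K * norm (u a - x) + (P b - P a) + e + K * norm (y - u b))"
    proof (intro exI[of _ "\<delta>' / 2"] conjI allI impI)
      fix a b assume ab: "0 \<le> a" "a \<le> b" "b \<le> T" "\<bar>a - t\<bar> < \<delta>' / 2" "\<bar>b - t\<bar> < \<delta>' / 2"
      have clab: "cl a = a" "cl b = b" using ab by (auto intro: cl)
      have "\<forall>\<^sub>F k in sequentially. \<tau> k < \<delta>' / 2" using order_tendstoD(2)[OF tau(2), of "\<delta>' / 2"] \<delta>'(1) by simp
      with small_steps[OF \<delta>'(1)]
      have "\<forall>\<^sub>F k in sequentially. finsler_cost pp (DE t) x y
          \<le> ennreal (K * norm (Ui k a - x) + (Pk k b - Pk k a) + e + K * norm (y - Ui k b))"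
      proof eventually_elim
        case (elim k)
        define i where "i = ix k a"
        define m where "m = ix k b - ix k a"
        have im: "ix k b = i + m" using ix_mono[OF ab(2), of k] by (simp add: i_def m_def)
        have imN: "i + m \<le> N k" using ix_le_N[of k b] im by simp
        \<comment> \<open>The discrete states between the two times, preceded by \<open>x\<close>
          and followed by \<open>y\<close>. The two additional edges are charged with the crude
          bound \<open>K\<close> times their length.\<close>
        define X where "X j = (if j = 0 then x else if j \<le> Suc m then V k (i + j - 1) else y)" for j
        define D where "D j = pp (Dl k (i + j)) (\<xi> k (i + j)) + \<eta> * norm (Dl k (i + j))" for j
        define c where "c j = (if j = 0 then K * norm (Ui k a - x) else if j \<le> m then D j
            else K * norm (y - Ui k b))" for j
        have Ua: "Ui k a = V k i" and Ub: "Ui k b = V k (i + m)" by (simp_all add: Ui_def i_def im[unfolded i_def])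
        have far: "pp v (- DE t (p + s *\<^sub>R (q - p))) \<le> K * norm v" if "norm p \<le> R" "norm q \<le> R" "0 \<le> s" "s \<le> 1" for p q s v
          using M(2)[OF t seg[OF that]] by (intro K(2)) simp
        have near: "pp (Dl k n) (- DE t (V k (n - 1) + s *\<^sub>R (V k n - V k (n - 1)))) \<le> pp (Dl k n) (\<xi> k n) + \<eta> * norm (Dl k n)"
          if n: "i < n" "n \<le> i + m" and s: "0 \<le> s" "s \<le> 1" for n s
        proof -
          let ?z = "V k (n - 1) + s *\<^sub>R (V k n - V k (n - 1))"
          have nN: "n \<in> {1..N k}" "n \<le> N k" "n - 1 \<le> N k" using n imN by auto
          have zR: "norm ?z \<le> R" using R(3) nN s by (intro seg) auto
          have "?z - V k n = (s - 1) *\<^sub>R Dl k n" by (simp add: Dl_def algebra_simps)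
          then have "norm (?z - V k n) \<le> norm (Dl k n)" using s by (simp add: mult_left_le_one_le)
          then have zd: "norm (?z - V k n) < \<delta>'" using elim(1) nN(1) by force
          \<comment> \<open>Before truncation at \<open>T\<close>, the node times lie between
            \<open>a\<close> and \<open>b + \<tau> k\<close>. As the time step is below
            \<open>\<delta>' / 2\<close>, all truncated times are within \<open>\<delta>'\<close> of
            \<open>t\<close>.\<close>
          have "a \<le> real i * \<tau> k" using ix_ge[of a k] clab by (simp add: i_def)
          also have "\<dots> \<le> real n * \<tau> k" using n(1) tau(1)[of k] by (intro mult_right_mono) auto
          finally have n1: "a \<le> real n * \<tau> k" .
          have "real n * \<tau> k \<le> real (i + m) * \<tau> k" using n(2) tau(1)[of k] by (intro mult_right_mono) auto
          also have "\<dots> < b + \<tau> k" using ix_less[of k b] clab im by simp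
          finally have n2: "real n * \<tau> k < b + \<tau> k" .
          have ab': "t - \<delta>' / 2 < a" "b < t + \<delta>' / 2" using ab(4,5) unfolding abs_less_iff by linarith+
          have "t - \<delta>' / 2 < tt k n" "tt k n < t + \<delta>'"
            using n1 n2 ab' ab(1-3) elim(2) unfolding tt_def min_def by (simp_all split: if_splits)
          then have td: "\<bar>t - tt k n\<bar> < \<delta>'" using \<delta>'(1) unfolding abs_less_iff by linarith
          have "norm (DE t ?z - DE (tt k n) (V k n)) < \<delta>" by (rule \<delta>'(2)[OF t tt zR R(3)[OF nN(2)] td zd])
          then have "norm (- DE t ?z - \<xi> k n) < \<delta>" unfolding \<xi>_def by (metis minus_diff_minus norm_minus_cancel)
          then show ?thesis
            using M(2)[OF t zR] M(2)[OF tt R(3)[OF nN(2)], of k n] by (intro \<delta>(2)) (auto simp: \<xi>_def)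
        qed
        have "finsler_cost pp (DE t) (X 0) (X (Suc (Suc m))) \<le> ennreal (\<Sum>j<Suc (Suc m). c j)"
        proof (rule finsler_cost_polygon)
          show "0 \<le> c j" for j unfolding c_def D_def using K(1) \<eta>(1) pp_nonneg by auto
          fix j and s :: real assume j: "j < Suc (Suc m)" and s: "0 \<le> s" "s \<le> 1"
          consider "j = 0" | "0 < j" "j \<le> m" | "j = Suc m" using j by linarith
          then show "pp (X (Suc j) - X j) (- DE t (X j + s *\<^sub>R (X (Suc j) - X j))) \<le> c j"
          proof cases
            case 1
            have "norm (V k i) \<le> R" using R(3) imN by simp
            from far[OF R(1) this s, of "V k i - x"] show ?thesis using 1 by (simp add: X_def c_def Ua)
          next
            case 2
            then show ?thesis using near[of "i + j" s] s by (simp add: X_def c_def D_def Dl_def)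
          next
            case 3
            have "norm (V k (i + m)) \<le> R" using R(3) imN by simp
            from far[OF this R(2) s, of "y - V k (i + m)"] show ?thesis using 3 by (simp add: X_def c_def Ub)
          qed
        qed simp
        also have "(\<Sum>j<Suc (Suc m). c j) = K * norm (Ui k a - x) + (\<Sum>j=1..m. D j) + K * norm (y - Ui k b)"
        proof -
          have "{..<Suc (Suc m)} = {0} \<union> ({1..m} \<union> {Suc m})" by auto
          then have "(\<Sum>j<Suc (Suc m). c j) = c 0 + ((\<Sum>j=1..m. c j) + c (Suc m))"
            using sum.union_disjoint[of "{0}" "{1..m} \<union> {Suc m}" c] sum.union_disjoint[of "{1..m}" "{Suc m}" c] by auto
          also have "(\<Sum>j=1..m. c j) = (\<Sum>j=1..m. D j)" by (intro sum.cong) (auto simp: c_def)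
          finally show ?thesis by (simp add: c_def)
        qed
        also have "(\<Sum>j=1..m. D j) = (Pk k b - Pk k a) + \<eta> * (\<Sum>n=Suc i..i + m. norm (Dl k n))"
        proof -
          have sh: "(\<Sum>j=1..m. f (i + j)) = (\<Sum>n=Suc i..i + m. f n)" for f :: "nat \<Rightarrow> real"
            using sum.shift_bounds_cl_nat_ivl[of f 1 i m] by (simp add: add.commute)
          show ?thesis unfolding D_def sum.distrib sum_distrib_left[symmetric]
            using sh[of "\<lambda>n. pp (Dl k n) (\<xi> k n)"] sh[of "\<lambda>n. norm (Dl k n)"] Pk_diff[OF ab(2), of k]
            by (simp add: im) (simp add: i_def)
        qed
        finally have f: "finsler_cost pp (DE t) x y \<le> ennreal (K * norm (Ui k a - x) +
          ((Pk k b - Pk k a) + \<eta> * (\<Sum>n=Suc i..i + m. norm (Dl k n))) + K * norm (y - Ui k b))"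
          by (simp add: X_def)
        have "(\<Sum>n=Suc i..i + m. norm (Dl k n)) \<le> (\<Sum>n=1..N k. norm (Dl k n))" using imN by (intro sum_mono2) auto
        then have "\<eta> * (\<Sum>n=Suc i..i + m. norm (Dl k n)) \<le> \<eta> * L" using L(2)[of k] \<eta>(1) by (intro mult_left_mono) auto
        then show ?case using \<eta>(2) by (intro order_trans[OF f] ennreal_leI) simp
      qed
      moreover have "(\<lambda>k. ennreal (K * norm (Ui k a - x) + (Pk k b - Pk k a) + e + K * norm (y - Ui k b)))
         \<longlonglongrightarrow> ennreal (K * norm (u a - x) + (P b - P a) + e + K * norm (y - u b))"
        by (intro tendsto_ennrealI tendsto_intros conv_u conv_P)
      ultimately show "finsler_cost pp (DE t) x y \<le> ennreal (K * norm (u a - x) + (P b - P a) + e + K * norm (y - u b))"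
        by (intro tendsto_lowerbound) auto
    qed (use \<delta>'(1) in simp)
  qed
qed

text \<open>The later time is kept at \<open>t\<close>, so the last edge estimate vanishes; the
  earlier one tends to \<open>t\<close> from the left, where the curve tends to the starting point
  of the transition.\<close>

lemma left_jump_cost:
  assumes t: "0 < t" "t \<le> T"
  shows "finsler_cost pp (DE t) (LL u t) (u t) \<le> ennreal (P t - LL P t)"
proof (rule ennreal_le_epsilon)
  fix e :: real assume e: "e > 0"
  obtain K where K: "K > 0" "\<forall>e>0. \<exists>d>0. \<forall>a b. 0 \<le> a \<longrightarrow> a \<le> b \<longrightarrow> b \<le> T \<longrightarrow> \<bar>a - t\<bar> < d \<longrightarrow> \<bar>b - t\<bar> < d \<longrightarrow>
     finsler_cost pp (DE t) (LL u t) (u t) \<le> ennreal (K * norm (u a - LL u t) + (P b - P a) + e + K * norm (u t - u b))"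
    using transition_cost[of t "LL u t" "u t"] t by auto
  obtain d where d: "d > 0" "\<And>a b. 0 \<le> a \<Longrightarrow> a \<le> b \<Longrightarrow> b \<le> T \<Longrightarrow> \<bar>a - t\<bar> < d \<Longrightarrow> \<bar>b - t\<bar> < d \<Longrightarrow>
     finsler_cost pp (DE t) (LL u t) (u t) \<le> ennreal (K * norm (u a - LL u t) + (P b - P a) + e + K * norm (u t - u b))"
    using K(2) e by meson
  have lim: "((\<lambda>a. ennreal (K * norm (u a - LL u t) + (P t - P a) + e)) \<longlongrightarrow> ennreal (K * norm (LL u t - LL u t) + (P t - LL P t) + e)) (at_left t)"
    by (intro tendsto_ennrealI tendsto_intros tendsto_LL tendsto_mono_LL[OF mono_P])
  have "\<forall>\<^sub>F a in at_left t. finsler_cost pp (DE t) (LL u t) (u t) \<le> ennreal (K * norm (u a - LL u t) + (P t - P a) + e)"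
    unfolding eventually_at_left_field
  proof (intro exI[of _ "max 0 (t - d)"] conjI allI impI)
    fix a assume "a > max 0 (t - d)" "a < t"
    then show "finsler_cost pp (DE t) (LL u t) (u t) \<le> ennreal (K * norm (u a - LL u t) + (P t - P a) + e)"
      using d(2)[of a t] t d(1) by auto
  qed (use t d in auto)
  then have "finsler_cost pp (DE t) (LL u t) (u t) \<le> ennreal (K * norm (LL u t - LL u t) + (P t - LL P t) + e)"
    by (intro tendsto_lowerbound[OF lim]) auto
  also have "\<dots> = ennreal (P t - LL P t) + ennreal e" using mono_LL_le[OF mono_P, of t] e by (simp add: ennreal_plus)
  finally show "finsler_cost pp (DE t) (LL u t) (u t) \<le> ennreal (P t - LL P t) + ennreal e" .
qed

lemma right_jump_cost:
  assumes t: "0 \<le> t" "t < T"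
  shows "finsler_cost pp (DE t) (u t) (RL u t) \<le> ennreal (RL P t - P t)"
proof (rule ennreal_le_epsilon)
  fix e :: real assume e: "e > 0"
  obtain K where K: "K > 0" "\<forall>e>0. \<exists>d>0. \<forall>a b. 0 \<le> a \<longrightarrow> a \<le> b \<longrightarrow> b \<le> T \<longrightarrow> \<bar>a - t\<bar> < d \<longrightarrow> \<bar>b - t\<bar> < d \<longrightarrow>
     finsler_cost pp (DE t) (u t) (RL u t) \<le> ennreal (K * norm (u a - u t) + (P b - P a) + e + K * norm (RL u t - u b))"
    using transition_cost[of t "u t" "RL u t"] t by auto
  obtain d where d: "d > 0" "\<And>a b. 0 \<le> a \<Longrightarrow> a \<le> b \<Longrightarrow> b \<le> T \<Longrightarrow> \<bar>a - t\<bar> < d \<Longrightarrow> \<bar>b - t\<bar> < d \<Longrightarrow>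
     finsler_cost pp (DE t) (u t) (RL u t) \<le> ennreal (K * norm (u a - u t) + (P b - P a) + e + K * norm (RL u t - u b))"
    using K(2) e by meson
  have lim: "((\<lambda>b. ennreal ((P b - P t) + e + K * norm (RL u t - u b))) \<longlongrightarrow> ennreal ((RL P t - P t) + e + K * norm (RL u t - RL u t))) (at_right t)"
    by (intro tendsto_ennrealI tendsto_intros tendsto_RL tendsto_mono_RL[OF mono_P])
  have "\<forall>\<^sub>F b in at_right t. finsler_cost pp (DE t) (u t) (RL u t) \<le> ennreal ((P b - P t) + e + K * norm (RL u t - u b))"
    unfolding eventually_at_right_field
  proof (intro exI[of _ "min T (t + d)"] conjI allI impI)
    fix b assume "b > t" "b < min T (t + d)"
    then show "finsler_cost pp (DE t) (u t) (RL u t) \<le> ennreal ((P b - P t) + e + K * norm (RL u t - u b))"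
      using d(2)[of t b] t d(1) by auto
  qed (use t d in auto)
  then have "finsler_cost pp (DE t) (u t) (RL u t) \<le> ennreal ((RL P t - P t) + e + K * norm (RL u t - RL u t))"
    by (intro tendsto_lowerbound[OF lim]) auto
  also have "\<dots> = ennreal (RL P t - P t) + ennreal e" using mono_le_RL[OF mono_P, of t] e by (simp add: ennreal_plus)
  finally show "finsler_cost pp (DE t) (u t) (RL u t) \<le> ennreal (RL P t - P t) + ennreal e" .
qed

subsection \<open>Local stability\<close>

lemma tt_ix_limit: "t \<in> {0..T} \<Longrightarrow> (\<lambda>k. tt k (ix k t)) \<longlonglongrightarrow> t"
proof (rule tendsto_sandwich)
  assume t: "t \<in> {0..T}"
  show "\<forall>\<^sub>F k in sequentially. t \<le> tt k (ix k t)" using tt_ix(1)[of t] cl(4)[OF t] by simp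
  show "\<forall>\<^sub>F k in sequentially. tt k (ix k t) \<le> t + \<tau> k" using tt_ix(2)[of _ t] cl(4)[OF t] by (simp add: less_imp_le)
  have "(\<lambda>k. t + \<tau> k) \<longlonglongrightarrow> t + 0" by (intro tendsto_intros tau)
  then show "(\<lambda>k. t + \<tau> k) \<longlonglongrightarrow> t" by simp
qed simp

lemma xi_limit: assumes t: "t \<in> {0..T}" shows "(\<lambda>k. \<xi> k (ix k t)) \<longlonglongrightarrow> - DE t (u t)"
proof -
  have "((\<lambda>x. DE (fst x) (snd x)) \<longlongrightarrow> DE t (u t)) (at (t, u t) within {0..T} \<times> UNIV)"
    using continuous_DE t unfolding continuous_on_def by force
  moreover have "(\<lambda>k. (tt k (ix k t), Ui k t)) \<longlonglongrightarrow> (t, u t)" by (intro tendsto_Pair tt_ix_limit[OF t] conv_u)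
  ultimately have "(\<lambda>k. DE (fst (tt k (ix k t), Ui k t)) (snd (tt k (ix k t), Ui k t))) \<longlonglongrightarrow> DE t (u t)"
    using continuous_on_tendsto_compose[OF continuous_DE, of "\<lambda>k. (tt k (ix k t), Ui k t)" "(t, u t)"] t tt by simp
  then show ?thesis unfolding \<xi>_def Ui_def by (intro tendsto_intros) simp
qed

lemma ix_eq_bounds: assumes "t \<in> {0<..T}" "ix k t = n"
  shows "(real n - 1) * \<tau> k < t" "t \<le> real n * \<tau> k" "n \<in> {1..N k}"
proof -
  have c: "cl t = t" using assms by (intro cl) auto
  show 1: "t \<le> real n * \<tau> k" using ix_ge[of t k] c assms by simp
  show "(real n - 1) * \<tau> k < t" using ix_less[of k t] c assms by (simp add: left_diff_distrib)
  have "n \<noteq> 0"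
  proof
    assume "n = 0"
    then show False using 1 assms(1) by simp
  qed
  then show "n \<in> {1..N k}" using ix_le_N[of k t] assms by auto
qed

text \<open>The conjugate at the force of a step is at most \<open>lam k * M\<close> times the
  length of the step; weighted with the time step, the factor \<open>lam k\<close> becomes
  \<open>\<epsilon> k\<close>. Summation bounds the time integral of the conjugate by
  \<open>\<epsilon> k * (M * L)\<close>, so along a subsequence the conjugate vanishes almost
  everywhere in the limit.\<close>

lemma local_stability: "AE t in lborel. t \<in> {0..T} \<longrightarrow> - DE t (u t) \<in> Kstar \<Psi>0"
proof -
  obtain R where R: "R > 0" "\<And>k n. n \<le> N k \<Longrightarrow> norm (V k n) \<le> R" using V_bound by blast
  obtain L where L: "L > 0" "\<And>k. (\<Sum>j=1..N k. norm (Dl k j)) \<le> L" using variation_bound by blast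
  obtain M where M: "M > 0" "\<And>t x. t \<in> {0..T} \<Longrightarrow> norm x \<le> R \<Longrightarrow> norm (DE t x) \<le> M" using local_bounds[of R] by blast
  have leg: "\<tau> k * leg (\<xi> k n) \<le> \<epsilon> k * (M * norm (Dl k n))" if n: "n \<in> {1..N k}" for k n
  proof -
    have "(\<Psi> (lam k *\<^sub>R Dl k n) + leg (\<xi> k n)) / lam k \<le> - blinfun_apply (DE (tt k n) (V k n)) (Dl k n)"
      using discrete_step(2)[OF discrete tau(1) eps(1), of n k] n
      by (simp add: lam_def Dl_def \<xi>_def tt_def N_def)
    also have "\<dots> = blinfun_apply (\<xi> k n) (Dl k n)" by (simp add: \<xi>_def blinfun.minus_left)
    also have "\<dots> \<le> M * norm (Dl k n)" using M(2)[OF tt R(2), of n k k n] n by (intro apply_le) (simp add: \<xi>_def)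
    finally have "(\<Psi> (lam k *\<^sub>R Dl k n) + leg (\<xi> k n)) / lam k \<le> M * norm (Dl k n)" .
    then have "leg (\<xi> k n) \<le> lam k * (M * norm (Dl k n))"
      using lam_pos[of k] Psi_nonneg[of "lam k *\<^sub>R Dl k n"] by (simp add: field_simps)
    then have "\<tau> k * leg (\<xi> k n) \<le> \<tau> k * (lam k * (M * norm (Dl k n)))" using tau(1)[of k] by (intro mult_left_mono) auto
    also have "\<dots> = \<epsilon> k * (M * norm (Dl k n))" using tau(1)[of k] by (simp add: lam_def)
    finally show ?thesis .
  qed
  define w where "w k t = indicator {0<..T} t * leg (\<xi> k (ix k t))" for k t
  define W where "W k t = (\<Sum>n=1..N k. leg (\<xi> k n) * indicator {(real n - 1) * \<tau> k..real n * \<tau> k} t)" for k t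
  have wm [measurable]: "w k \<in> borel_measurable borel" for k unfolding w_def by measurable
  have wnn: "0 \<le> w k t" for k t unfolding w_def using leg_nonneg by simp
  have wW: "w k t \<le> W k t" for k t
  proof (cases "t \<in> {0<..T}")
    case True
    note n = ix_eq_bounds[OF True refl, of k]
    have "w k t = leg (\<xi> k (ix k t)) * indicator {(real (ix k t) - 1) * \<tau> k..real (ix k t) * \<tau> k} t"
      using True n by (simp add: w_def)
    also have "\<dots> \<le> W k t" unfolding W_def using n(3) leg_nonneg
      by (intro member_le_sum[of "ix k t" _ "\<lambda>n. leg (\<xi> k n) * indicator {(real n - 1) * \<tau> k..real n * \<tau> k} t"]) auto
    finally show ?thesis .
  next
    case False
    then show ?thesis unfolding w_def W_def using leg_nonneg by (auto intro!: sum_nonneg)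
  qed
  have ii: "integrable lborel (indicator {a..b} :: real \<Rightarrow> real)" for a b :: real
    by (intro integrable_real_indicator) (simp_all add: emeasure_lborel_Icc_eq)
  have Wi: "integrable lborel (W k)" for k unfolding W_def using ii by (intro Bochner_Integration.integrable_sum integrable_mult_right) auto
  have wi: "integrable lborel (w k)" for k
    by (rule Bochner_Integration.integrable_bound[OF Wi[of k]]) (use wnn order_trans[OF wW abs_ge_self] in auto)
  have wint: "(LINT t|lborel. norm (w k t)) \<le> \<epsilon> k * (M * L)" for k
  proof -
    have "(LINT t|lborel. norm (w k t)) \<le> (LINT t|lborel. W k t)"
      using wi Wi wW wnn by (intro integral_mono) auto
    also have "\<dots> = (\<Sum>n=1..N k. leg (\<xi> k n) * (LINT t|lborel. indicator {(real n - 1) * \<tau> k..real n * \<tau> k} t))"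
      unfolding W_def using ii by (subst Bochner_Integration.integral_sum) (auto intro!: integrable_mult_right)
    also have "\<dots> = (\<Sum>n=1..N k. \<tau> k * leg (\<xi> k n))"
      using tau(1)[of k] by (intro sum.cong refl) (simp add: left_diff_distrib)
    also have "\<dots> \<le> (\<Sum>n=1..N k. \<epsilon> k * (M * norm (Dl k n)))" by (intro sum_mono leg)
    also have "\<dots> = \<epsilon> k * (M * (\<Sum>n=1..N k. norm (Dl k n)))" by (simp add: sum_distrib_left)
    also have "\<dots> \<le> \<epsilon> k * (M * L)" using L(2)[of k] M(1) eps(1)[of k] by (intro mult_left_mono) auto
    finally show ?thesis .
  qed
  have "(\<lambda>k. LINT t|lborel. norm (w k t)) \<longlonglongrightarrow> 0"
  proof (rule tendsto_sandwich[OF _ _ tendsto_const])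
    have "(\<lambda>k. \<epsilon> k * (M * L)) \<longlonglongrightarrow> 0 * (M * L)" by (intro tendsto_intros eps)
    then show "(\<lambda>k. \<epsilon> k * (M * L)) \<longlonglongrightarrow> 0" by simp
  qed (use wint in auto)
  from tendsto_L1_AE_subseq[of lborel w, OF wi this]
  obtain r :: "nat \<Rightarrow> nat" where r: "strict_mono r" "AE t in lborel. (\<lambda>k. w (r k) t) \<longlonglongrightarrow> 0" by blast
  from r(2) AE_lborel_singleton[of 0] show ?thesis
  proof (eventually_elim, intro impI)
    fix t assume lim: "(\<lambda>k. w (r k) t) \<longlonglongrightarrow> 0" and t0: "t \<noteq> 0" and t: "t \<in> {0..T}"
    have wt: "w k t = leg (\<xi> k (ix k t))" for k using t t0 by (simp add: w_def)
    have x: "(\<lambda>k. \<xi> (r k) (ix (r k) t)) \<longlonglongrightarrow> - DE t (u t)"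
      using LIMSEQ_subseq_LIMSEQ[OF xi_limit[OF t] r(1)] by (simp add: o_def)
    \<comment> \<open>Lower semicontinuity of the conjugate, tested with one vector \<open>v\<close>
      at a time.\<close>
    have "blinfun_apply (- DE t (u t)) v - \<Psi> v \<le> 0" for v
    proof (rule LIMSEQ_le[OF _ lim])
      show "(\<lambda>k. blinfun_apply (\<xi> (r k) (ix (r k) t)) v - \<Psi> v) \<longlonglongrightarrow> blinfun_apply (- DE t (u t)) v - \<Psi> v"
        by (intro tendsto_intros x)
    qed (use leg_ge wt in auto)
    then have "leg (- DE t (u t)) \<le> 0" unfolding legendre_def[of \<Psi>] by (intro cSUP_least) auto
    then show "- DE t (u t) \<in> Kstar \<Psi>0" by (rule leg_le_zero_Kstar)
  qed
qed

subsection \<open>The energy inequality\<close>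

text \<open>Clamping the time makes the power of the external forces a Borel function on the whole
  line for every Borel curve; on the interval it is the integrand of the energy balance.\<close>

definition power :: "(real \<Rightarrow> 'a) \<Rightarrow> real \<Rightarrow> real" where "power v r = dtE (cl r) (v r)"

lemma measurable_power [measurable (raw)]:
  assumes [measurable]: "v \<in> borel_measurable borel" shows "power v \<in> borel_measurable borel"
proof -
  have "continuous_on UNIV (\<lambda>x::real \<times> 'a. (cl (fst x), snd x))"
    unfolding cl_def by (intro continuous_intros)
  then have "continuous_on UNIV (\<lambda>x::real \<times> 'a. dtE (fst (cl (fst x), snd x)) (snd (cl (fst x), snd x)))"
    using cl(1,2) by (intro continuous_on_compose2[OF continuous_dtE]) auto
  then have [measurable]: "(\<lambda>x::real \<times> 'a. dtE (cl (fst x)) (snd x)) \<in> borel_measurable borel"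
    by (simp add: borel_measurable_continuous_onI)
  have "(\<lambda>r. (r, v r)) \<in> borel_measurable borel" by measurable
  from measurable_compose[OF this \<open>(\<lambda>x::real \<times> 'a. dtE (cl (fst x)) (snd x)) \<in> borel_measurable borel\<close>]
  show ?thesis by (simp add: power_def[abs_def])
qed

lemma set_integral_Icc_combine:
  fixes f :: "real \<Rightarrow> real"
  assumes "a \<le> b" "b \<le> c" "set_integrable lborel {a..c} f"
  shows "(LINT t:{a..c}|lborel. f t) = (LINT t:{a..b}|lborel. f t) + (LINT t:{b..c}|lborel. f t)"
proof -
  have i: "set_integrable lborel {a..b} f" "set_integrable lborel {b..c} f"
    using assms by (auto intro: set_integrable_subset)
  have ae: "AE t in lborel. indicator {a..c} t *\<^sub>R f t = indicator {a..b} t *\<^sub>R f t + indicator {b..c} t *\<^sub>R f t"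
    using AE_lborel_singleton[of b] by eventually_elim (use assms in \<open>auto split: split_indicator\<close>)
  have "(LINT t:{a..c}|lborel. f t) = (LINT t|lborel. indicator {a..b} t *\<^sub>R f t + indicator {b..c} t *\<^sub>R f t)"
    unfolding set_lebesgue_integral_def
    by (rule integral_cong_AE[OF _ _ ae]) (use assms(3) i in \<open>auto simp: set_integrable_def intro: borel_measurable_integrable\<close>)
  also have "\<dots> = (LINT t:{a..b}|lborel. f t) + (LINT t:{b..c}|lborel. f t)"
    unfolding set_lebesgue_integral_def using i by (simp add: set_integrable_def)
  finally show ?thesis .
qed

lemma bounded_set_integrable:
  fixes f :: "real \<Rightarrow> real"
  assumes [measurable]: "f \<in> borel_measurable borel" and "\<And>t. \<bar>f t\<bar> \<le> M"
  shows "set_integrable lborel {a..b} f"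
  unfolding set_integrable_def
proof (rule Bochner_Integration.integrable_bound[of _ "\<lambda>t. indicator {a..b} t * M"])
  have "integrable lborel (indicator {a..b} :: real \<Rightarrow> real)"
    by (intro integrable_real_indicator) (simp_all add: emeasure_lborel_Icc_eq)
  then show "integrable lborel (\<lambda>t. indicator {a..b} t * M)" by simp
  show "AE t in lborel. norm (indicator {a..b} t *\<^sub>R f t) \<le> norm (indicator {a..b} t * M)"
    using assms(2) by (intro AE_I2) (auto split: split_indicator intro: order_trans[OF _ abs_ge_self])
qed simp

lemma energy_upper:
  assumes t: "t \<in> {0..T}"
  shows "P t + E t (u t) \<le> E 0 u0 + (LINT s:{0..t}|lborel. power u s)"
proof (rule field_le_epsilon)
  fix e' :: real assume e': "e' > 0"
  obtain R where R: "R > 0" "\<And>k n. n \<le> N k \<Longrightarrow> norm (V k n) \<le> R" using V_bound by blast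
  obtain L where L: "L > 0" "\<And>k. (\<Sum>j=1..N k. norm (Dl k j)) \<le> L" using variation_bound by blast
  obtain M where M: "M > 0" "\<And>t x. t \<in> {0..T} \<Longrightarrow> norm x \<le> R \<Longrightarrow> \<bar>dtE t x\<bar> \<le> M" using local_bounds[of R] by blast
  \<comment> \<open>The step errors add up to \<open>e\<close> times the elapsed time, at most
    \<open>T\<close>, plus \<open>e\<close> times the total length, at most
    \<open>L\<close>.\<close>
  define e where "e = e' / (T + L)"
  have "e * (T + L) = e'" using T_pos' L(1) by (simp add: e_def)
  then have e: "e > 0" "e * T + e * L = e'" using e' T_pos' L(1) by (simp_all add: e_def distrib_left)
  obtain \<delta> where \<delta>: "\<delta> > 0" "\<And>s t x y. s \<in> {0..T} \<Longrightarrow> t \<in> {0..T} \<Longrightarrow> norm x \<le> R \<Longrightarrow> norm y \<le> R \<Longrightarrow> \<bar>s - t\<bar> < \<delta> \<Longrightarrow>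
      norm (x - y) < \<delta> \<Longrightarrow> norm (DE s x - DE t y) < e \<and> \<bar>dtE s x - dtE t y\<bar> < e" using uniform_continuity[OF e(1), of R] by blast
  have UR: "norm (Ui k r) \<le> R" for k r unfolding Ui_def by (rule R(2)[OF ix_le_N])
  have pb: "\<bar>power (Ui k) r\<bar> \<le> M" for k r unfolding power_def using cl(1,2)[of r] by (intro M(2) UR) auto
  have pm: "power (Ui k) \<in> borel_measurable borel" for k by measurable
  have pint: "set_integrable lborel {a..b} (power (Ui k))" for a b k by (rule bounded_set_integrable[OF pm pb])
  have ci: "set_integrable lborel {a..b} (\<lambda>_. c)" for a b c :: real by (rule bounded_set_integrable[of _ "\<bar>c\<bar>"]) auto
  have cint: "(LINT r:{a..b}|lborel. c) = c * (b - a)" if "a \<le> b" for a b c :: real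
    using that by (simp add: set_lebesgue_integral_def mult.commute)
  have ttm: "tt k m \<le> tt k n" if "m \<le> n" for k m n
    unfolding tt_def using that tau(1)[of k] by (intro min.mono mult_right_mono) auto
  have main: "\<forall>\<^sub>F k in sequentially. Pk k t + E (tt k (ix k t)) (Ui k t)
     \<le> E 0 (V k 0) + (LINT r:{0..t}|lborel. power (Ui k) r) + M * \<tau> k + e'"
    using small_steps[OF \<delta>(1)]
  proof eventually_elim
    case (elim k)
    have step: "pp (Dl k n) (\<xi> k n) + E (tt k n) (V k n) \<le> E (tt k (n - 1)) (V k (n - 1))
        + (LINT r:{tt k (n - 1)..tt k n}|lborel. power (Ui k) r) + e * (tt k n - tt k (n - 1)) + e * norm (Dl k n)"
      if n: "n \<in> {1..N k}" for n
    proof -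
      have nN: "n \<le> N k" "n - 1 \<le> N k" using n by auto
      have Dn: "norm (Dl k n) < \<delta>" using elim n by blast
      have "pp (Dl k n) (\<xi> k n) \<le> (\<Psi> (lam k *\<^sub>R Dl k n) + leg (\<xi> k n)) / lam k" by (rule pp_le[OF lam_pos])
      also have "\<dots> \<le> - blinfun_apply (DE (tt k n) (V k n)) (Dl k n)"
        using discrete_step(2)[OF discrete tau(1) eps(1), of n k] n
        by (simp add: lam_def Dl_def \<xi>_def tt_def N_def)
      also have "\<dots> = blinfun_apply (DE (tt k n) (V k n)) (V k (n - 1) - V k n)"
        by (simp add: Dl_def blinfun.diff_right)
      also have "\<dots> \<le> E (tt k n) (V k (n - 1)) - E (tt k n) (V k n) + e * norm (V k (n - 1) - V k n)"
      proof -
        have "norm (V k (n - 1) - V k n) < \<delta>" using Dn by (simp add: Dl_def norm_minus_commute)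
        from taylor[OF _ \<delta>(1) tt R(2)[OF nN(2)] R(2)[OF nN(1)] this] \<delta>(2)
        have "\<bar>E (tt k n) (V k (n - 1)) - E (tt k n) (V k n) - blinfun_apply (DE (tt k n) (V k n)) (V k (n - 1) - V k n)\<bar>
           \<le> e * norm (V k (n - 1) - V k n)" by blast
        then show ?thesis by linarith
      qed
      also have "norm (V k (n - 1) - V k n) = norm (Dl k n)" by (simp add: Dl_def norm_minus_commute)
      finally have 1: "pp (Dl k n) (\<xi> k n) \<le> E (tt k n) (V k (n - 1)) - E (tt k n) (V k n) + e * norm (Dl k n)" .
      let ?a = "tt k (n - 1)" and ?b = "tt k n"
      have ab: "0 \<le> ?a" "?a \<le> ?b" "?b \<le> T" using tt[of k "n - 1"] tt[of k n] ttm[of "n - 1" n] by auto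
      have "E ?b (V k (n - 1)) - E ?a (V k (n - 1)) = (LINT r:{?a..?b}|lborel. dtE r (V k (n - 1)))"
        by (rule energy_time_integral[OF ab])
      also have "\<dots> \<le> (LINT r:{?a..?b}|lborel. power (Ui k) r + e)"
      proof (rule set_integral_mono)
        show "set_integrable lborel {?a..?b} (\<lambda>r. dtE r (V k (n - 1)))" by (rule energy_time_integral[OF ab])
        show "set_integrable lborel {?a..?b} (\<lambda>r. power (Ui k) r + e)" by (rule set_integral_add[OF pint ci])
        fix r assume r: "r \<in> {?a..?b}"
        then have rT: "r \<in> {0..T}" "cl r = r" using ab cl(4)[of r] by auto
        \<comment> \<open>Between consecutive node times the interpolant is \<open>V k n\<close> or
          \<open>V k (n - 1)\<close>. Both are within \<delta> of \<open>V k (n - 1)\<close>, the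
          state at which the energy is followed in time.\<close>
        have "ix k r \<le> n"
        proof -
          have "real (ix k r) * \<tau> k < r + \<tau> k" using ix_less[of k r] rT by simp
          also have "\<dots> \<le> (real n + 1) * \<tau> k" using r by (simp add: tt_def distrib_right)
          finally have "real (ix k r) < real n + 1" using tau(1)[of k] by (simp add: mult_less_cancel_right)
          then show ?thesis by linarith
        qed
        moreover have "n - 1 \<le> ix k r"
        proof (cases "real (n - 1) * \<tau> k \<le> T")
          case True
          then have "real (n - 1) * \<tau> k \<le> r" using r by (simp add: tt_def)
          also have "\<dots> \<le> real (ix k r) * \<tau> k" using ix_ge[of r k] rT by simp
          finally show ?thesis using tau(1)[of k] by (simp add: mult_le_cancel_right)
        next
          case False
          then have "tt k (n - 1) = T" by (simp add: tt_def)
          then have "r = T" using r ab by auto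
          then show ?thesis using nN(2) by (simp add: N_eq)
        qed
        ultimately have "ix k r = n \<or> ix k r = n - 1" by linarith
        then have "norm (V k (n - 1) - Ui k r) < \<delta>"
          using Dn \<delta>(1) by (auto simp: Ui_def Dl_def norm_minus_commute)
        then have "\<bar>dtE r (V k (n - 1)) - dtE r (Ui k r)\<bar> < e"
          using \<delta>(2)[OF rT(1) rT(1) R(2)[OF nN(2)] UR[of k r]] \<delta>(1) by simp
        then show "dtE r (V k (n - 1)) \<le> power (Ui k) r + e" using rT(2) by (simp add: power_def)
      qed
      also have "\<dots> = (LINT r:{?a..?b}|lborel. power (Ui k) r) + e * (?b - ?a)"
        using set_integral_add(2)[OF pint ci] cint[OF ab(2)] by simp
      finally show ?thesis using 1 by linarith
    qed
    have tt0: "tt k 0 = 0" using T_pos' by (simp add: tt_def)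
    have acc: "(\<Sum>n=1..m. pp (Dl k n) (\<xi> k n)) + E (tt k m) (V k m) \<le> E 0 (V k 0)
        + (LINT r:{0..tt k m}|lborel. power (Ui k) r) + e * tt k m + e * (\<Sum>n=1..m. norm (Dl k n))"
      if "m \<le> N k" for m
      using that
    proof (induction m)
      case 0
      have "(LINT r:{0..0}|lborel. power (Ui k) r) = 0" unfolding set_lebesgue_integral_def
        by (intro integral_eq_zero_AE) (use AE_lborel_singleton[of 0] in \<open>eventually_elim, simp\<close>)
      then show ?case by (simp add: tt0)
    next
      case (Suc m)
      have "(LINT r:{0..tt k (Suc m)}|lborel. power (Ui k) r)
          = (LINT r:{0..tt k m}|lborel. power (Ui k) r) + (LINT r:{tt k m..tt k (Suc m)}|lborel. power (Ui k) r)"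
        using tt[of k m] ttm[of m "Suc m"] pint by (intro set_integral_Icc_combine) auto
      then show ?case using Suc.IH Suc.prems step[of "Suc m"] by (simp add: algebra_simps)
    qed
    \<comment> \<open>The node used for \<open>t\<close> may lie beyond \<open>t\<close> by less
      than a time step; the additional work is at most \<open>M * \<tau> k\<close>.\<close>
    let ?m = "ix k t"
    have c: "cl t = t" by (rule cl(4)[OF t])
    have tm: "t \<le> tt k ?m" "tt k ?m < t + \<tau> k" "tt k ?m \<le> T" using tt_ix(1)[of t k] tt_ix(2)[of k t] c tt[of k ?m] by auto
    have "(LINT r:{0..tt k ?m}|lborel. power (Ui k) r) = (LINT r:{0..t}|lborel. power (Ui k) r) + (LINT r:{t..tt k ?m}|lborel. power (Ui k) r)"
      using tm t pint by (intro set_integral_Icc_combine) auto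
    moreover have "(LINT r:{t..tt k ?m}|lborel. power (Ui k) r) \<le> (LINT r:{t..tt k ?m}|lborel. M)"
      using pb by (intro set_integral_mono pint ci) (auto simp: abs_le_iff)
    moreover have "(LINT r:{t..tt k ?m}|lborel. M) \<le> M * \<tau> k" unfolding cint[OF tm(1)] using tm M(1) by (intro mult_left_mono) auto
    moreover have "e * tt k ?m \<le> e * T" using tm(3) e(1) by (intro mult_left_mono) auto
    moreover have "(\<Sum>n=1..?m. norm (Dl k n)) \<le> L"
    proof -
      have "(\<Sum>n=1..?m. norm (Dl k n)) \<le> (\<Sum>n=1..N k. norm (Dl k n))" using ix_le_N[of k t] by (intro sum_mono2) auto
      then show ?thesis using L(2)[of k] by simp
    qed
    then have "e * (\<Sum>n=1..?m. norm (Dl k n)) \<le> e * L" using e(1) by (intro mult_left_mono) auto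
    ultimately show ?case using acc[OF ix_le_N[of k t]] e(2) unfolding Pk_def Ui_def[of k t] by linarith
  qed
  show "P t + E t (u t) \<le> E 0 u0 + (LINT s:{0..t}|lborel. power u s) + e'"
  proof (rule tendsto_le[OF _ _ _ main])
    have "continuous_on ({0..T} \<times> UNIV) (\<lambda>x. E (fst x) (snd x))"
      using energy_C1 unfolding C1_energy_def by (intro continuous_on_eq_continuous_within[THEN iffD2]) (auto intro: has_derivative_continuous)
    moreover have "(\<lambda>k. (tt k (ix k t), Ui k t)) \<longlonglongrightarrow> (t, u t)" by (intro tendsto_Pair tt_ix_limit[OF t] conv_u)
    ultimately have "(\<lambda>k. E (tt k (ix k t)) (Ui k t)) \<longlonglongrightarrow> E t (u t)"
      using continuous_on_tendsto_compose[of "{0..T} \<times> UNIV" "\<lambda>x. E (fst x) (snd x)" "\<lambda>k. (tt k (ix k t), Ui k t)" "(t, u t)"] t tt by simp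
    then show "(\<lambda>k. Pk k t + E (tt k (ix k t)) (Ui k t)) \<longlonglongrightarrow> P t + E t (u t)" by (intro tendsto_intros conv_P)
    have E0: "(\<lambda>k. E 0 (V k 0)) \<longlonglongrightarrow> E 0 u0"
    proof -
      have "isCont (E 0) u0" using E_has_derivative[of 0 u0] T_pos' by (intro has_derivative_continuous) auto
      then show ?thesis using isCont_tendsto_compose[OF _ initial] by blast
    qed
    have I: "(\<lambda>k. LINT r:{0..t}|lborel. power (Ui k) r) \<longlonglongrightarrow> (LINT r:{0..t}|lborel. power u r)"
      unfolding set_lebesgue_integral_def
    proof (rule integral_dominated_convergence[where w="\<lambda>r. indicator {0..t} r * M"])
      show "integrable lborel (\<lambda>r. indicator {0..t} r * M)" using ci[of 0 t M] by (simp add: set_integrable_def)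
      show "AE r in lborel. norm (indicator {0..t} r *\<^sub>R power (Ui k) r) \<le> indicator {0..t} r * M" for k
        using pb by (intro AE_I2) (auto split: split_indicator)
      show "AE r in lborel. (\<lambda>k. indicator {0..t} r *\<^sub>R power (Ui k) r) \<longlonglongrightarrow> indicator {0..t} r *\<^sub>R power u r"
      proof (intro AE_I2 tendsto_intros)
        fix r
        have "(\<lambda>k. (cl r, Ui k r)) \<longlonglongrightarrow> (cl r, u r)" by (intro tendsto_intros conv_u)
        from continuous_on_tendsto_compose[OF continuous_dtE this]
        show "(\<lambda>k. power (Ui k) r) \<longlonglongrightarrow> power u r" using cl(1,2)[of r] by (simp add: power_def)
      qed
      have "power u \<in> borel_measurable borel" by measurable
      then show "(\<lambda>r. indicator {0..t} r *\<^sub>R power u r) \<in> borel_measurable lborel" by measurable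
      show "(\<lambda>r. indicator {0..t} r *\<^sub>R power (Ui k) r) \<in> borel_measurable lborel" for k using pm[of k] by measurable
    qed
    have "(\<lambda>k. E 0 (V k 0) + (LINT r:{0..t}|lborel. power (Ui k) r) + M * \<tau> k + e')
      \<longlonglongrightarrow> E 0 u0 + (LINT r:{0..t}|lborel. power u r) + M * 0 + e'" by (intro tendsto_intros E0 I tau)
    then show "(\<lambda>k. E 0 (V k 0) + (LINT r:{0..t}|lborel. power (Ui k) r) + M * \<tau> k + e')
      \<longlonglongrightarrow> E 0 u0 + (LINT r:{0..t}|lborel. power u r) + e'" by simp
  qed simp
qed

end

section \<open>The pseudo-total variation of the limit\<close>

text \<open>Induction along the reals: the supremum of the times \<open>s\<close> with
  \<open>K 0 \<le> K s\<close> belongs to this set by the left condition, and the right condition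
  leads beyond it unless it is \<open>t\<close>. The function may jump on either side of a
  point.\<close>

lemma nondecreasing_if_locally:
  fixes K :: "real \<Rightarrow> real"
  assumes t: "0 \<le> t"
    and left: "\<And>s. 0 < s \<Longrightarrow> s \<le> t \<Longrightarrow> \<exists>d>0. \<forall>a. 0 \<le> a \<longrightarrow> s - d < a \<longrightarrow> a < s \<longrightarrow> K a \<le> K s"
    and right: "\<And>s. 0 \<le> s \<Longrightarrow> s < t \<Longrightarrow> \<exists>d>0. \<forall>b. b \<le> t \<longrightarrow> s < b \<longrightarrow> b < s + d \<longrightarrow> K s \<le> K b"
  shows "K 0 \<le> K t"
proof -
  define S where "S = {s\<in>{0..t}. K 0 \<le> K s}"
  have S0: "0 \<in> S" using t by (simp add: S_def)
  have bd: "bdd_above S" by (intro bdd_aboveI[of _ t]) (simp add: S_def)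
  define c where "c = Sup S"
  have c: "0 \<le> c" "c \<le> t"
    unfolding c_def using S0 bd by (auto intro: cSup_upper cSup_least simp: S_def)
  have "K 0 \<le> K c"
  proof (cases "c \<in> S")
    case True then show ?thesis by (simp add: S_def)
  next
    case False
    then have c0: "0 < c" using c S0 by (cases "c = 0") auto
    obtain d where d: "d > 0" "\<And>a. 0 \<le> a \<Longrightarrow> c - d < a \<Longrightarrow> a < c \<Longrightarrow> K a \<le> K c" using left[OF c0 c(2)] by blast
    obtain a where a: "a \<in> S" "c - d < a" using less_cSup_iff[of S "c - d"] S0 bd d(1) by (auto simp: c_def)
    have "a \<le> c" unfolding c_def using a(1) bd by (rule cSup_upper)
    then have "a < c" using a(1) False by (cases "a = c") auto
    then show ?thesis using d(2)[of a] a by (auto simp: S_def)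
  qed
  moreover have "c = t"
  proof (rule ccontr)
    assume "c \<noteq> t"
    then have ct: "c < t" using c by simp
    obtain d where d: "d > 0" "\<And>b. b \<le> t \<Longrightarrow> c < b \<Longrightarrow> b < c + d \<Longrightarrow> K c \<le> K b" using right[OF c(1) ct] by blast
    define b where "b = min t (c + d / 2)"
    have b: "b \<le> t" "c < b" "b < c + d" using ct d(1) by (auto simp: b_def min_def)
    have "b \<in> S" using d(2)[OF b] \<open>K 0 \<le> K c\<close> b c by (auto simp: S_def)
    then have "b \<le> c" unfolding c_def using bd by (rule cSup_upper)
    then show False using b by simp
  qed
  ultimately show ?thesis by simp
qed

lemma AE_lborel_interval:
  assumes "AE x in lborel. Q x" "a < (b::real)"
  shows "\<exists>x. a < x \<and> x < b \<and> Q x"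
proof (rule ccontr)
  assume neg: "\<not> ?thesis"
  have "AE x in lborel. x \<notin> {a<..<b}" using assms(1) by eventually_elim (use neg in auto)
  then have "{a<..<b} \<in> null_sets lborel" by (simp add: AE_iff_null_sets)
  then show False using assms(2) by (simp add: null_sets_def)
qed

text \<open>Negative \<open>x\<close> or \<open>y\<close> are truncated to 0 in the extended
  numbers, so the inequality assumed there is the stronger one.\<close>

lemma ennreal_add_le_cancel:
  assumes "ennreal q + ennreal x + ennreal y \<le> ennreal q'" "0 \<le> q" "0 \<le> q'"
  shows "q + x + y \<le> q'"
proof -
  have "ennreal q + ennreal x + ennreal y = ennreal (q + max 0 x + max 0 y)"
    using assms(2) by (simp add: ennreal_plus ennreal_max_0)
  with assms(1) have "ennreal (q + max 0 x + max 0 y) \<le> ennreal q'" by (simp only:)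
  then have "q + max 0 x + max 0 y \<le> q'" using assms(3) by (simp only: ennreal_le_iff)
  then show ?thesis by linarith
qed

lemma ennreal_plus_le: "ennreal (x + y) \<le> ennreal x + ennreal y"
proof -
  have "ennreal (x + y) \<le> ennreal (max 0 x + max 0 y)" by (intro ennreal_leI) linarith
  also have "\<dots> = ennreal x + ennreal y" by (simp add: ennreal_plus ennreal_max_0)
  finally show ?thesis .
qed

lemma ennreal_sum_le: "ennreal (\<Sum>i\<in>I. f i) \<le> (\<Sum>i\<in>I. ennreal (f i))"
proof (induction I rule: infinite_finite_induct)
  case (insert x F)
  then show ?case using ennreal_plus_le[of "f x" "sum f F"] by (simp add: add_left_mono order_trans)
qed auto

section \<open>The pseudo-total variation compared with the limit dissipation and with stable
  forces\<close>

context scheme_limit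
begin

definition cost :: "real \<Rightarrow> ennreal" where
  "cost t = finsler_cost pp (DE t) (LL u t) (u t) + finsler_cost pp (DE t) (u t) (RL u t)"

definition PV :: "real \<Rightarrow> ennreal" where "PV t = pseudo_variation T \<Psi>0 pp DE u 0 t"

definition jumps :: "real set \<Rightarrow> ennreal" where "jumps A = (\<Sum>\<^sub>\<infinity>s\<in>jump_set T u \<inter> A. cost s)"

lemma PV_eq:
  assumes "0 < t"
  shows "PV t = cdiss {0..t} + finsler_cost pp (DE 0) (u 0) (RL u 0) + finsler_cost pp (DE t) (LL u t) (u t) + jumps {0<..<t}"
  using assms unfolding PV_def pseudo_variation_def jumps_def cost_def cdiss_def dens_def ref_def DU_def
  by (simp add: Let_def left_lim_eq right_lim_eq)

lemma PV_zero: "PV 0 = 0" by (simp add: PV_def pseudo_variation_def)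

lemma jumps_summable: "cost summable_on A"
  by (rule nonneg_summable_on_complete) simp

lemma sum_le_jumps: assumes "finite X" "X \<subseteq> jump_set T u \<inter> A" shows "sum cost X \<le> jumps A"
proof -
  have "infsum cost X \<le> jumps A"
    unfolding jumps_def by (rule infsum_mono_neutral[OF jumps_summable jumps_summable]) (use assms(2) in auto)
  then show ?thesis using assms(1) by simp
qed

lemma jumps_le: assumes "\<And>F. finite F \<Longrightarrow> F \<subseteq> jump_set T u \<inter> A \<Longrightarrow> sum cost F \<le> x" shows "jumps A \<le> x"
  unfolding jumps_def by (rule infsum_le_finite_sums[OF jumps_summable]) (use assms in auto)

lemma jumps_Un: assumes "A \<inter> C = {}" shows "jumps (A \<union> C) = jumps A + jumps C"
  unfolding jumps_def Int_Un_distrib using assms jumps_summable by (intro infsum_Un_disjoint) auto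

lemma jumps_singleton: assumes "0 \<le> t" "t \<le> T" shows "jumps {t} = cost t"
proof (cases "t \<in> jump_set T u")
  case True
  then have "jump_set T u \<inter> {t} = {t}" by auto
  then show ?thesis by (simp add: jumps_def)
next
  case False
  then have "LL u t = u t" "RL u t = u t" using assms by (auto simp: jump_set_def left_lim_eq right_lim_eq)
  then have "cost t = 0" by (simp add: cost_def finsler_cost_refl)
  moreover have "jump_set T u \<inter> {t} = {}" using False by auto
  ultimately show ?thesis by (simp add: jumps_def)
qed

text \<open>The Stieltjes measure of \<open>P\<close> is cut by a countable set: its part off the
  set bounds the diffuse dissipation, its atoms bound the inner jumps. The remaining half jumps at 0
  and \<open>t\<close> lie below the one-sided increments of \<open>P\<close>.\<close>

lemma PV_upper:
  assumes t: "0 < t" "t \<le> T"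
  shows "PV t \<le> ennreal (P t)"
proof -
  obtain m where m: "finite_measure m" "sets m = sets borel"
    "\<And>A. A \<in> sets borel \<Longrightarrow> measure m A = measure m (A \<inter> {0<..<T})"
    "\<And>a b. 0 \<le> a \<Longrightarrow> a < b \<Longrightarrow> b \<le> T \<Longrightarrow> measure m {a<..<b} = LL P b - RL P a"
    using mono_stieltjes_measure[OF mono_P T_pos] by blast
  interpret m: finite_measure m by (rule m(1))
  \<comment> \<open>With 0 and \<open>t\<close> adjoined, the closed interval of the definition and
    the open one of the Stieltjes measure agree off \<open>J\<close>.\<close>
  define J where "J = JG \<union> {0, t}"
  have J: "countable J" "JG \<subseteq> J" using countable_JG by (auto simp: J_def)
  have Jb: "J \<in> sets borel" using null_setsD2[OF countable_imp_null_set_lborel[OF J(1)]] by simp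
  have sing: "measure m {s} = RL P s - LL P s" if s: "0 < s" "s < T" for s
  proof -
    have "{0<..<T} = {0<..<s} \<union> ({s} \<union> {s<..<T})" using s by auto
    then have "measure m {0<..<T} = measure m {0<..<s} + measure m ({s} \<union> {s<..<T})"
      using m(2) m.finite_measure_Union[of "{0<..<s}" "{s} \<union> {s<..<T}"] by auto
    also have "measure m ({s} \<union> {s<..<T}) = measure m {s} + measure m {s<..<T}"
      using m(2) by (intro m.finite_measure_Union) auto
    finally show ?thesis using m(4)[of 0 T] m(4)[of 0 s] m(4)[of s T] s T_pos by simp
  qed
  have 1: "cdiss {0..t} \<le> ennreal (measure m ({0<..<t} - J))"
  proof -
    have "cdiss {0..t} \<le> ennreal (measure m ({0..t} - J))"
      by (rule cdiss_le[OF mono_P u_P_apply m J]) simp_all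
    moreover have "{0..t} - J = {0<..<t} - J" by (auto simp: J_def)
    ultimately show ?thesis by simp
  qed
  have 2: "jumps {0<..<t} \<le> ennreal (measure m ({0<..<t} \<inter> J))"
  proof (rule jumps_le)
    fix F assume F: "finite F" "F \<subseteq> jump_set T u \<inter> {0<..<t}"
    have "sum cost F \<le> (\<Sum>s\<in>F. ennreal (measure m {s}))"
    proof (rule sum_mono)
      fix s assume "s \<in> F"
      then have s: "0 < s" "s < T" using F(2) t by auto
      have "cost s \<le> ennreal (P s - LL P s) + ennreal (RL P s - P s)"
        unfolding cost_def using left_jump_cost[of s] right_jump_cost[of s] s by (intro add_mono) auto
      also have "\<dots> = ennreal (measure m {s})"
        using mono_LL_le[OF mono_P, of s] mono_le_RL[OF mono_P, of s]
        by (subst ennreal_plus[symmetric]) (auto simp: sing[OF s])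
      finally show "cost s \<le> ennreal (measure m {s})" .
    qed
    also have "\<dots> = ennreal (\<Sum>s\<in>F. measure m {s})" by (intro sum_ennreal) simp
    also have "(\<Sum>s\<in>F. measure m {s}) = measure m F"
      using F(1) m(2) by (subst m.finite_measure_eq_sum_singleton[OF F(1)]) auto
    also have "measure m F \<le> measure m ({0<..<t} \<inter> J)"
    proof (rule m.finite_measure_mono)
      show "F \<subseteq> {0<..<t} \<inter> J" using F jump_set_subset by (auto simp: J_def)
      show "{0<..<t} \<inter> J \<in> sets m" unfolding m(2) using Jb by (intro sets.Int) simp_all
    qed
    finally show "sum cost F \<le> ennreal (measure m ({0<..<t} \<inter> J))" by (simp add: ennreal_leI)
  qed
  have 3: "finsler_cost pp (DE 0) (u 0) (RL u 0) \<le> ennreal (RL P 0 - P 0)" by (rule right_jump_cost) (use t in auto)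
  have 4: "finsler_cost pp (DE t) (LL u t) (u t) \<le> ennreal (P t - LL P t)" by (rule left_jump_cost[OF t])
  have sp: "measure m ({0<..<t} - J) + measure m ({0<..<t} \<inter> J) = LL P t - RL P 0"
  proof -
    have "measure m (({0<..<t} - J) \<union> ({0<..<t} \<inter> J)) = measure m ({0<..<t} - J) + measure m ({0<..<t} \<inter> J)"
      using Jb m(2) by (intro m.finite_measure_Union) auto
    moreover have "({0<..<t} - J) \<union> ({0<..<t} \<inter> J) = {0<..<t}" by blast
    ultimately show ?thesis using m(4)[of 0 t] t by simp
  qed
  have "PV t \<le> ennreal (measure m ({0<..<t} - J)) + ennreal (RL P 0 - P 0) + ennreal (P t - LL P t) + ennreal (measure m ({0<..<t} \<inter> J))"
    unfolding PV_eq[OF t(1)] by (intro add_mono 1 2 3 4)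
  also have "\<dots> = ennreal (measure m ({0<..<t} - J) + (RL P 0 - P 0) + (P t - LL P t) + measure m ({0<..<t} \<inter> J))"
    using mono_LL_le[OF mono_P, of t] mono_le_RL[OF mono_P, of 0] by (simp add: ennreal_plus)
  also have "measure m ({0<..<t} - J) + (RL P 0 - P 0) + (P t - LL P t) + measure m ({0<..<t} \<inter> J) = P t"
    using sp P_zero by simp
  finally show ?thesis .
qed

text \<open>Superadditivity with half jumps: up to \<open>a\<close> only the arrival at
  \<open>u a\<close> is charged, up to a later time also the departure from it. Dropping end points
  only lowers the diffuse integral.\<close>

lemma PV_increment:
  assumes ab: "0 \<le> a" "a < b" "b \<le> T"
  shows "PV a + finsler_cost pp (DE a) (u a) (RL u a) + (cdiss {a<..<b} + jumps {a<..<b})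
    + finsler_cost pp (DE b) (LL u b) (u b) \<le> PV b"
proof (cases "a = 0")
  case True
  have "cdiss {0<..<b} \<le> cdiss {0..b}" unfolding cdiss_def
    by (intro nn_integral_mono mult_left_mono) (auto split: split_indicator)
  then show ?thesis unfolding PV_eq[OF less_le_trans[OF ab(2), of b, unfolded True, simplified]]
    using True by (simp add: PV_zero ac_simps add_left_mono)
next
  case False
  then have a: "0 < a" using ab by simp
  have "cdiss {0..a} + cdiss {a<..<b} = (\<integral>\<^sup>+t. ennreal (\<Psi>0 (dens t)) * indicator {0..a} t + ennreal (\<Psi>0 (dens t)) * indicator {a<..<b} t \<partial>ref)"
    unfolding cdiss_def using ref(1)
    by (intro nn_integral_add[symmetric] borel_measurable_times_ennreal measurable_compose[OF measurable_Psi0_dens measurable_ennreal] borel_measurable_indicator) auto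
  also have "\<dots> \<le> cdiss {0..b}" unfolding cdiss_def
    by (intro nn_integral_mono) (use ab in \<open>auto split: split_indicator\<close>)
  finally have 1: "cdiss {0..a} + cdiss {a<..<b} \<le> cdiss {0..b}" .
  have "{0<..<b} = {0<..<a} \<union> ({a} \<union> {a<..<b})" using ab a by auto
  then have "jumps {0<..<b} = jumps {0<..<a} + jumps ({a} \<union> {a<..<b})"
    using jumps_Un[of "{0<..<a}" "{a} \<union> {a<..<b}"] by auto
  also have "jumps ({a} \<union> {a<..<b}) = cost a + jumps {a<..<b}"
    using jumps_Un[of "{a}" "{a<..<b}"] jumps_singleton[of a] ab by simp
  finally have 2: "jumps {0<..<b} = jumps {0<..<a} + (cost a + jumps {a<..<b})" .
  have "PV a + finsler_cost pp (DE a) (u a) (RL u a) + (cdiss {a<..<b} + jumps {a<..<b}) + finsler_cost pp (DE b) (LL u b) (u b)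
     = (cdiss {0..a} + cdiss {a<..<b}) + finsler_cost pp (DE 0) (u 0) (RL u 0) + finsler_cost pp (DE b) (LL u b) (u b) + jumps {0<..<b}"
    unfolding PV_eq[OF a] 2 cost_def by (simp add: ac_simps)
  also have "\<dots> \<le> PV b" unfolding PV_eq[OF less_trans[OF a ab(2)]] by (intro add_mono 1 order_refl)
  finally show ?thesis .
qed

text \<open>Lying below the gauge, \<open>w\<close> is charged to the diffuse dissipation off
  \<open>JG\<close> and to the transition costs at the atoms, where it splits over the two halves of
  the jump. The countable sum of atoms is a limit of finite ones.\<close>

lemma middle_lower:
  assumes w: "w \<in> Kstar \<Psi>0" and ab: "0 \<le> a" "a < b" "b \<le> T"
  shows "ennreal (blinfun_apply w (LL u b - RL u a)) \<le> cdiss {a<..<b} + jumps {a<..<b}"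
proof -
  let ?A = "{a<..<b}"
  have Jb: "JG \<in> sets borel" using null_setsD2[OF countable_imp_null_set_lborel[OF countable_JG]] by simp
  have Ab: "?A \<in> sets borel" by (rule borel_open) simp
  have "DU ?A = DU ((?A - JG) \<union> (?A \<inter> JG))" by (simp add: Un_Diff_Int)
  also have "\<dots> = DU (?A - JG) + DU (?A \<inter> JG)" using Ab Jb by (intro vm_Un[OF DU(1)] sets.Diff sets.Int) blast+
  finally have "blinfun_apply w (LL u b - RL u a) = blinfun_apply w (DU (?A - JG)) + blinfun_apply w (DU (?A \<inter> JG))"
    using DU(3)[OF ab] by (simp add: blinfun.add_right)
  then have "ennreal (blinfun_apply w (LL u b - RL u a)) \<le> ennreal (blinfun_apply w (DU (?A - JG))) + ennreal (blinfun_apply w (DU (?A \<inter> JG)))"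
    by (simp add: ennreal_plus_le)
  also have "ennreal (blinfun_apply w (DU (?A - JG))) \<le> cdiss ?A"
    by (rule cdiss_ge[OF w _ countable_JG order_refl]) simp
  also have "ennreal (blinfun_apply w (DU (?A \<inter> JG))) \<le> jumps ?A"
  proof -
    have "((\<lambda>t. DU {t}) has_sum DU (?A \<inter> JG)) (?A \<inter> JG)"
      by (rule jump_part_eq(1)[OF DU(1) countable_JG DU_atoms]) (simp_all add: Ab)
    then have "((\<lambda>t. blinfun_apply w (DU {t})) has_sum blinfun_apply w (DU (?A \<inter> JG))) (?A \<inter> JG)"
      using has_sum_bounded_linear[OF blinfun.bounded_linear_right] by (auto simp: o_def)
    then have lim: "((\<lambda>F. ennreal (\<Sum>t\<in>F. blinfun_apply w (DU {t}))) \<longlongrightarrow> ennreal (blinfun_apply w (DU (?A \<inter> JG)))) (finite_subsets_at_top (?A \<inter> JG))"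
      unfolding has_sum_def by (rule tendsto_ennrealI)
    show ?thesis
    proof (rule tendsto_upperbound[OF lim])
      show "\<forall>\<^sub>F F in finite_subsets_at_top (?A \<inter> JG). ennreal (\<Sum>t\<in>F. blinfun_apply w (DU {t})) \<le> jumps ?A"
      proof (rule eventually_finite_subsets_at_top_weakI)
        fix F assume F: "finite F" "F \<subseteq> ?A \<inter> JG"
        have "ennreal (\<Sum>t\<in>F. blinfun_apply w (DU {t})) \<le> (\<Sum>t\<in>F. ennreal (blinfun_apply w (DU {t})))" by (rule ennreal_sum_le)
        also have "\<dots> = (\<Sum>t\<in>F \<inter> jump_set T u. ennreal (blinfun_apply w (DU {t})))"
        proof (rule sum.mono_neutral_right[OF F(1)])
          show "\<forall>t\<in>F - F \<inter> jump_set T u. ennreal (blinfun_apply w (DU {t})) = 0"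
          proof
            fix t assume "t \<in> F - F \<inter> jump_set T u"
            then have "t \<notin> jump_set T u" "t \<in> {0..T}" using F(2) ab by auto
            then have "LL u t = u t" "RL u t = u t" by (auto simp: jump_set_def left_lim_eq right_lim_eq)
            then show "ennreal (blinfun_apply w (DU {t})) = 0" by (simp add: DU_singleton)
          qed
        qed auto
        also have "\<dots> \<le> sum cost (F \<inter> jump_set T u)"
        proof (rule sum_mono)
          fix t assume "t \<in> F \<inter> jump_set T u"
          then have t: "0 < t" "t < T" using F(2) ab by auto
          have "blinfun_apply w (DU {t}) = blinfun_apply w (u t - LL u t) + blinfun_apply w (RL u t - u t)"
            using t by (simp add: DU_singleton blinfun.diff_right)
          then have "ennreal (blinfun_apply w (DU {t})) \<le> ennreal (blinfun_apply w (u t - LL u t)) + ennreal (blinfun_apply w (RL u t - u t))"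
            by (simp add: ennreal_plus_le)
          also have "\<dots> \<le> cost t" unfolding cost_def by (intro add_mono finsler_cost_ge_apply w)
          finally show "ennreal (blinfun_apply w (DU {t})) \<le> cost t" .
        qed
        also have "\<dots> \<le> jumps ?A" using F by (intro sum_le_jumps) auto
        finally show "ennreal (\<Sum>t\<in>F. blinfun_apply w (DU {t})) \<le> jumps ?A" .
      qed
    qed simp
  qed
  finally show ?thesis by (simp add: add_left_mono add_right_mono)
qed

text \<open>The arrival cost at \<open>s\<close> is kept aside, to be compared with the loss of
  energy; for the departure at \<open>a\<close> the functional suffices.\<close>

lemma PV_increment_left:
  assumes w: "w \<in> Kstar \<Psi>0" and s: "0 \<le> a" "a < s" "s \<le> T"
  shows "PV a + ennreal (blinfun_apply w (LL u s - u a)) + finsler_cost pp (DE s) (LL u s) (u s) \<le> PV s"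
proof -
  have "blinfun_apply w (LL u s - u a) = blinfun_apply w (RL u a - u a) + blinfun_apply w (LL u s - RL u a)"
    by (simp add: blinfun.diff_right)
  then have "ennreal (blinfun_apply w (LL u s - u a)) \<le> ennreal (blinfun_apply w (RL u a - u a)) + ennreal (blinfun_apply w (LL u s - RL u a))"
    by (simp add: ennreal_plus_le)
  also have "\<dots> \<le> finsler_cost pp (DE a) (u a) (RL u a) + (cdiss {a<..<s} + jumps {a<..<s})"
    by (intro add_mono finsler_cost_ge_apply[OF w] middle_lower[OF w s])
  finally have "PV a + ennreal (blinfun_apply w (LL u s - u a)) + finsler_cost pp (DE s) (LL u s) (u s)
     \<le> PV a + (finsler_cost pp (DE a) (u a) (RL u a) + (cdiss {a<..<s} + jumps {a<..<s})) + finsler_cost pp (DE s) (LL u s) (u s)"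
    by (intro add_mono order_refl)
  also have "\<dots> \<le> PV s" using PV_increment[OF s] by (simp add: ac_simps)
  finally show ?thesis .
qed

lemma PV_increment_right:
  assumes w: "w \<in> Kstar \<Psi>0" and s: "0 \<le> s" "s < b" "b \<le> T"
  shows "PV s + ennreal (blinfun_apply w (u b - RL u s)) + finsler_cost pp (DE s) (u s) (RL u s) \<le> PV b"
proof -
  have "blinfun_apply w (u b - RL u s) = blinfun_apply w (LL u b - RL u s) + blinfun_apply w (u b - LL u b)"
    by (simp add: blinfun.diff_right)
  then have "ennreal (blinfun_apply w (u b - RL u s)) \<le> ennreal (blinfun_apply w (LL u b - RL u s)) + ennreal (blinfun_apply w (u b - LL u b))"
    by (simp add: ennreal_plus_le)
  also have "\<dots> \<le> (cdiss {s<..<b} + jumps {s<..<b}) + finsler_cost pp (DE b) (LL u b) (u b)"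
    by (intro add_mono finsler_cost_ge_apply[OF w] middle_lower[OF w s])
  finally have "PV s + ennreal (blinfun_apply w (u b - RL u s)) + finsler_cost pp (DE s) (u s) (RL u s)
     \<le> PV s + ((cdiss {s<..<b} + jumps {s<..<b}) + finsler_cost pp (DE b) (LL u b) (u b)) + finsler_cost pp (DE s) (u s) (RL u s)"
    by (intro add_mono order_refl)
  also have "\<dots> \<le> PV b" using PV_increment[OF s] by (simp add: ac_simps)
  finally show ?thesis .
qed

subsection \<open>The energy balance\<close>

lemma DE_tendsto:
  assumes "(u \<longlongrightarrow> l) net" "((\<lambda>r. r) \<longlongrightarrow> s) net" "s \<in> {0..T}" "\<forall>\<^sub>F r in net. r \<in> {0..T}"
  shows "((\<lambda>r. - blinfun_apply (DE r (u r)) z) \<longlongrightarrow> - blinfun_apply (DE s l) z) net"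
proof -
  have "((\<lambda>r. (r, u r)) \<longlongrightarrow> (s, l)) net" by (intro tendsto_Pair assms)
  from continuous_on_tendsto_compose[OF continuous_DE this] assms(3,4)
  have "((\<lambda>r. DE r (u r)) \<longlongrightarrow> DE s l) net" by simp
  then show ?thesis by (intro tendsto_intros)
qed

text \<open>Stable times have full measure, so they accumulate at \<open>s\<close> from the left. A
  strict violation at the left limit would persist at all times shortly before \<open>s\<close>, by
  continuity of the differential.\<close>

lemma stable_LL: assumes s: "0 < s" "s \<le> T" shows "- DE s (LL u s) \<in> Kstar \<Psi>0"
proof -
  have "- blinfun_apply (DE s (LL u s)) z \<le> \<Psi>0 z" for z
  proof (rule ccontr)
    assume "\<not> ?thesis"
    then have "\<Psi>0 z < - blinfun_apply (DE s (LL u s)) z" by simp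
    moreover have "((\<lambda>r. - blinfun_apply (DE r (u r)) z) \<longlongrightarrow> - blinfun_apply (DE s (LL u s)) z) (at_left s)"
      using s by (intro DE_tendsto tendsto_LL tendsto_ident_at) (auto simp: eventually_at_left_field intro!: exI[of _ 0])
    ultimately have "\<forall>\<^sub>F r in at_left s. \<Psi>0 z < - blinfun_apply (DE r (u r)) z" by (rule order_tendstoD(1)[rotated])
    then obtain c where c: "c < s" "\<And>r. c < r \<Longrightarrow> r < s \<Longrightarrow> \<Psi>0 z < - blinfun_apply (DE r (u r)) z"
      unfolding eventually_at_left_field by blast
    have "\<exists>r. max 0 c < r \<and> r < s \<and> (r \<in> {0..T} \<longrightarrow> - DE r (u r) \<in> Kstar \<Psi>0)"
      by (rule AE_lborel_interval[OF local_stability]) (use s c in auto)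
    then obtain r where "max 0 c < r" "r < s" "r \<in> {0..T} \<longrightarrow> - DE r (u r) \<in> Kstar \<Psi>0" by blast
    then show False using c(2)[of r] s by (auto simp: Kstar_def blinfun.minus_left not_less[symmetric])
  qed
  then show ?thesis by (simp add: Kstar_def blinfun.minus_left)
qed

lemma stable_RL: assumes s: "0 \<le> s" "s < T" shows "- DE s (RL u s) \<in> Kstar \<Psi>0"
proof -
  have "- blinfun_apply (DE s (RL u s)) z \<le> \<Psi>0 z" for z
  proof (rule ccontr)
    assume "\<not> ?thesis"
    then have "\<Psi>0 z < - blinfun_apply (DE s (RL u s)) z" by simp
    moreover have "((\<lambda>r. - blinfun_apply (DE r (u r)) z) \<longlongrightarrow> - blinfun_apply (DE s (RL u s)) z) (at_right s)"
      using s by (intro DE_tendsto tendsto_RL tendsto_ident_at) (auto simp: eventually_at_right_field intro!: exI[of _ T])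
    ultimately have "\<forall>\<^sub>F r in at_right s. \<Psi>0 z < - blinfun_apply (DE r (u r)) z" by (rule order_tendstoD(1)[rotated])
    then obtain c where c: "c > s" "\<And>r. s < r \<Longrightarrow> r < c \<Longrightarrow> \<Psi>0 z < - blinfun_apply (DE r (u r)) z"
      unfolding eventually_at_right_field by blast
    have "\<exists>r. s < r \<and> r < min T c \<and> (r \<in> {0..T} \<longrightarrow> - DE r (u r) \<in> Kstar \<Psi>0)"
      by (rule AE_lborel_interval[OF local_stability]) (use s c in auto)
    then obtain r where "s < r" "r < min T c" "r \<in> {0..T} \<longrightarrow> - DE r (u r) \<in> Kstar \<Psi>0" by blast
    then show False using c(2)[of r] s by (auto simp: Kstar_def blinfun.minus_left not_less[symmetric])
  qed
  then show ?thesis by (simp add: Kstar_def blinfun.minus_left)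
qed

lemma power_u_integrable: "set_integrable lborel {a..b} (power u)"
proof -
  obtain R where R: "R > 0" "\<And>k n. n \<le> N k \<Longrightarrow> norm (V k n) \<le> R" using V_bound by blast
  obtain M where M: "M > 0" "\<And>t x. t \<in> {0..T} \<Longrightarrow> norm x \<le> R \<Longrightarrow> \<bar>dtE t x\<bar> \<le> M" using local_bounds[of R] by blast
  have "norm (u t) \<le> R" for t
    by (rule LIMSEQ_le_const2[OF tendsto_norm[OF conv_u]]) (use R(2)[OF ix_le_N] in \<open>auto simp: Ui_def\<close>)
  then have "\<bar>power u t\<bar> \<le> M" for t unfolding power_def using cl(1,2)[of t] by (intro M(2)) auto
  moreover have "power u \<in> borel_measurable borel" by measurable
  ultimately show ?thesis by (intro bounded_set_integrable)
qed

lemma energy_local: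
  assumes s: "s \<in> {0..T}" and \<delta>: "\<delta> > 0"
  shows "\<exists>d>0. (\<forall>x. norm (x - l) < d \<longrightarrow> \<bar>E s x - E s l - blinfun_apply (DE s l) (x - l)\<bar> \<le> \<delta> * norm (x - l)) \<and>
    (\<forall>a b x. 0 \<le> a \<longrightarrow> a \<le> b \<longrightarrow> b \<le> T \<longrightarrow> \<bar>a - s\<bar> < d \<longrightarrow> \<bar>b - s\<bar> < d \<longrightarrow> norm (x - l) < d \<longrightarrow>
      (\<forall>r. a < r \<longrightarrow> r < b \<longrightarrow> norm (u r - l) < d) \<longrightarrow>
      \<bar>E b x - E a x - (LINT r:{a..b}|lborel. power u r)\<bar> \<le> \<delta> * (b - a))"
proof -
  obtain d1 where d1: "d1 > 0" "\<And>x. norm (x - l) < d1 \<Longrightarrow> norm (E s x - E s l - blinfun_apply (DE s l) (x - l)) \<le> \<delta> * norm (x - l)"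
    using E_has_derivative[OF s, of l] \<delta> unfolding has_derivative_at_alt by blast
  have "continuous (at (s, l) within {0..T} \<times> UNIV) (\<lambda>x. dtE (fst x) (snd x))"
    using continuous_dtE s unfolding continuous_on_eq_continuous_within by blast
  then obtain d2 where d2: "d2 > 0" "\<And>y. y \<in> {0..T} \<times> UNIV \<Longrightarrow> dist y (s, l) < d2 \<Longrightarrow> dist (dtE (fst y) (snd y)) (dtE s l) < \<delta> / 2"
    unfolding continuous_within_eps_delta using \<delta> by (metis fst_conv half_gt_zero snd_conv)
  define d where "d = min d1 (d2 / 2)"
  have d: "d > 0" "d \<le> d1" "d \<le> d2 / 2" using d1 d2 by (auto simp: d_def)
  have near: "\<bar>dtE r x - dtE s l\<bar> < \<delta> / 2" if "r \<in> {0..T}" "\<bar>r - s\<bar> < d" "norm (x - l) < d" for r x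
  proof -
    have "dist (r, x) (s, l) \<le> dist r s + dist x l"
      unfolding dist_Pair_Pair by (rule sqrt_sum_squares_le_sum) auto
    then have "dist (r, x) (s, l) < d2" using that d(3) by (simp add: dist_real_def dist_norm)
    then show ?thesis using d2(2)[of "(r, x)"] that(1) by (simp add: dist_real_def)
  qed
  have "\<bar>E b x - E a x - (LINT r:{a..b}|lborel. power u r)\<bar> \<le> \<delta> * (b - a)"
    if ab: "0 \<le> a" "a \<le> b" "b \<le> T" "\<bar>a - s\<bar> < d" "\<bar>b - s\<bar> < d" and x: "norm (x - l) < d"
      and ur: "\<forall>r. a < r \<longrightarrow> r < b \<longrightarrow> norm (u r - l) < d" for a b x
  proof -
    note i = energy_time_integral(2)[OF ab(1-3), of x] power_u_integrable[of a b]
    have eq: "E b x - E a x - (LINT r:{a..b}|lborel. power u r) = (LINT r:{a..b}|lborel. dtE r x - power u r)"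
      using energy_time_integral(1)[OF ab(1-3), of x] set_integral_diff(2)[OF i] by simp
    have "\<bar>LINT r:{a..b}|lborel. dtE r x - power u r\<bar> \<le> (LINT r|lborel. \<bar>indicator {a..b} r *\<^sub>R (dtE r x - power u r)\<bar>)"
      unfolding set_lebesgue_integral_def by (rule integral_abs_bound)
    also have "\<dots> \<le> (LINT r|lborel. indicator {a..b} r * \<delta>)"
    proof (rule integral_mono_AE)
      show "integrable lborel (\<lambda>r. \<bar>indicator {a..b} r *\<^sub>R (dtE r x - power u r)\<bar>)"
        using set_integral_diff(1)[OF i] by (simp add: set_integrable_def)
      have "integrable lborel (indicator {a..b} :: real \<Rightarrow> real)"
        by (intro integrable_real_indicator) (simp_all add: emeasure_lborel_Icc_eq)
      then show "integrable lborel (\<lambda>r. indicator {a..b} r * \<delta>)" by simp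
      show "AE r in lborel. \<bar>indicator {a..b} r *\<^sub>R (dtE r x - power u r)\<bar> \<le> indicator {a..b} r * \<delta>"
        using AE_lborel_singleton[of a] AE_lborel_singleton[of b]
      proof eventually_elim
        case (elim r)
        show ?case
        proof (cases "r \<in> {a..b}")
          case True
          then have r: "a < r" "r < b" using elim by auto
          then have rT: "r \<in> {0..T}" "\<bar>r - s\<bar> < d" "cl r = r" using ab cl(4)[of r] by auto
          have "\<bar>dtE r x - dtE s l\<bar> < \<delta> / 2" "\<bar>dtE r (u r) - dtE s l\<bar> < \<delta> / 2"
            using near[OF rT(1,2)] x ur r by auto
          then have "\<bar>dtE r x - power u r\<bar> \<le> \<delta>" unfolding power_def rT(3) by linarith
          then show ?thesis using True by simp
        qed simp
      qed
    qed
    also have "\<dots> = \<delta> * (b - a)" using ab(2) by simp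
    finally show ?thesis unfolding eq .
  qed
  then show ?thesis using d d1(2) by (intro exI[of _ d]) auto
qed

lemma LL_increment: "a < s \<Longrightarrow> norm (LL u s - u a) \<le> Cu * P s - Cu * P a"
proof (rule tendsto_upperbound[OF tendsto_norm[OF tendsto_diff[OF tendsto_LL tendsto_const]]])
  assume "a < s"
  then show "\<forall>\<^sub>F r in at_left s. norm (u r - u a) \<le> Cu * P s - Cu * P a"
    unfolding eventually_at_left_field
  proof (intro exI[of _ a] conjI allI impI)
    fix r assume r: "a < r" "r < s"
    have "norm (u r - u a) \<le> Cu * P r - Cu * P a" using r by (intro increment) simp
    also have "Cu * P r \<le> Cu * P s" using monoD[OF mono_G] r by simp
    finally show "norm (u r - u a) \<le> Cu * P s - Cu * P a" by simp
  qed
qed simp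

lemma RL_increment: "s < b \<Longrightarrow> norm (u b - RL u s) \<le> Cu * P b - Cu * P s"
proof (rule tendsto_upperbound[OF tendsto_norm[OF tendsto_diff[OF tendsto_const tendsto_RL]]])
  assume "s < b"
  then show "\<forall>\<^sub>F r in at_right s. norm (u b - u r) \<le> Cu * P b - Cu * P s"
    unfolding eventually_at_right_field
  proof (intro exI[of _ b] conjI allI impI)
    fix r assume r: "s < r" "r < b"
    have "norm (u b - u r) \<le> Cu * P b - Cu * P r" using r by (intro increment) simp
    moreover have "Cu * P s \<le> Cu * P r" using monoD[OF mono_G] r by simp
    ultimately show "norm (u b - u r) \<le> Cu * P b - Cu * P s" by simp
  qed
qed simp

definition Q :: "real \<Rightarrow> real" where "Q t = enn2real (PV t)"

lemma PV_Q: assumes "t \<in> {0..T}" shows "PV t = ennreal (Q t)" "0 \<le> Q t"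
proof -
  have "PV t < \<infinity>"
  proof (cases "t = 0")
    case False
    then show ?thesis using PV_upper[of t] assms by (auto simp: le_less_trans)
  qed (simp add: PV_zero)
  then show "PV t = ennreal (Q t)" by (simp add: Q_def)
qed (simp add: Q_def)

text \<open>At each side of each time, the chain rule is applied with the differential frozen at the
  corresponding one-sided limit, which is stable; the remainder is absorbed by \<delta> times the
  increment of the time plus the variation.\<close>

lemma energy_lower:
  assumes t: "t \<in> {0..T}"
  shows "E 0 u0 + (LINT s:{0..t}|lborel. power u s) \<le> Q t + E t (u t)"
proof -
  \<comment> \<open>Energy reduced by the work done so far; the energy balance says that
    \<open>Q + e\<close> keeps its initial value.\<close>
  define e where "e s = E s (u s) - (LINT r:{0..s}|lborel. power u r)" for s
  have I0: "(LINT r:{0..0}|lborel. power u r) = 0" unfolding set_lebesgue_integral_def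
    by (intro integral_eq_zero_AE) (use AE_lborel_singleton[of 0] in \<open>eventually_elim, simp\<close>)
  have main: "E 0 u0 \<le> Q t + e t + \<delta> * (t + Cu * P t)" if \<delta>: "\<delta> > 0" for \<delta>
  proof -
    \<comment> \<open>The correction absorbs the first-order errors: \<delta> times the elapsed
      time, and \<delta> times an increment of the curve, which \<open>Cu * P\<close>
      controls.\<close>
    define K where "K s = Q s + e s + \<delta> * (s + Cu * P s)" for s
    have "K 0 \<le> K t"
    proof (rule nondecreasing_if_locally)
      show "0 \<le> t" using t by simp
      fix s assume s: "0 < s" "s \<le> t"
      have sT: "s \<in> {0..T}" "s \<le> T" using s t by auto
      let ?l = "LL u s"
      obtain d where d: "d > 0" "\<And>x. norm (x - ?l) < d \<Longrightarrow> \<bar>E s x - E s ?l - blinfun_apply (DE s ?l) (x - ?l)\<bar> \<le> \<delta> * norm (x - ?l)"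
        "\<And>a b x. 0 \<le> a \<Longrightarrow> a \<le> b \<Longrightarrow> b \<le> T \<Longrightarrow> \<bar>a - s\<bar> < d \<Longrightarrow> \<bar>b - s\<bar> < d \<Longrightarrow> norm (x - ?l) < d \<Longrightarrow>
          (\<forall>r. a < r \<longrightarrow> r < b \<longrightarrow> norm (u r - ?l) < d) \<Longrightarrow> \<bar>E b x - E a x - (LINT r:{a..b}|lborel. power u r)\<bar> \<le> \<delta> * (b - a)"
        using energy_local[OF sT(1) \<delta>, of ?l] by blast
      have "\<forall>\<^sub>F r in at_left s. dist (u r) ?l < d" by (rule tendstoD[OF tendsto_LL d(1)])
      then obtain c where c: "c < s" "\<And>r. c < r \<Longrightarrow> r < s \<Longrightarrow> norm (u r - ?l) < d"
        unfolding eventually_at_left_field dist_norm by blast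
      show "\<exists>d>0. \<forall>a. 0 \<le> a \<longrightarrow> s - d < a \<longrightarrow> a < s \<longrightarrow> K a \<le> K s"
      proof (intro exI[of _ "min d (s - c)"] conjI allI impI)
        fix a assume a: "0 \<le> a" "s - min d (s - c) < a" "a < s"
        have aT: "a \<in> {0..T}" using a sT by auto
        have ua: "norm (u a - ?l) < d" using c(2)[of a] a by auto
        have "PV a + ennreal (blinfun_apply (- DE s ?l) (?l - u a)) + ennreal (E s ?l - E s (u s))
          \<le> PV a + ennreal (blinfun_apply (- DE s ?l) (?l - u a)) + finsler_cost pp (DE s) ?l (u s)"
          by (intro add_mono order_refl finsler_cost_ge_energy E_has_derivative continuous_DE_fixed sT)
        also have "\<dots> \<le> PV s" by (rule PV_increment_left[OF stable_LL[OF s(1) sT(2)] a(1,3) sT(2)])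
        finally have 1: "Q a + blinfun_apply (- DE s ?l) (?l - u a) + (E s ?l - E s (u s)) \<le> Q s"
          unfolding PV_Q[OF aT] PV_Q[OF sT(1)] by (rule ennreal_add_le_cancel) (rule PV_Q aT sT)+
        have 2: "\<bar>E s (u a) - E s ?l - blinfun_apply (DE s ?l) (u a - ?l)\<bar> \<le> \<delta> * norm (u a - ?l)" by (rule d(2)[OF ua])
        have 3: "\<bar>E s (u a) - E a (u a) - (LINT r:{a..s}|lborel. power u r)\<bar> \<le> \<delta> * (s - a)"
          using a sT ua c(2) d(1) by (intro d(3)) auto
        have "norm (u a - ?l) \<le> Cu * P s - Cu * P a" using LL_increment[OF a(3)] by (simp add: norm_minus_commute)
        then have 4: "\<delta> * norm (u a - ?l) \<le> \<delta> * (Cu * P s - Cu * P a)" using \<delta> by (intro mult_left_mono) auto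
        have 5: "(LINT r:{0..s}|lborel. power u r) = (LINT r:{0..a}|lborel. power u r) + (LINT r:{a..s}|lborel. power u r)"
          using a by (intro set_integral_Icc_combine power_u_integrable) auto
        have 6: "blinfun_apply (- DE s ?l) (?l - u a) = blinfun_apply (DE s ?l) (u a - ?l)"
          by (simp add: blinfun.minus_left blinfun.diff_right)
        show "K a \<le> K s" using 1 2 3 4 5 unfolding K_def e_def 6 abs_le_iff by (simp add: algebra_simps)
      qed (use d c in auto)
    next
      fix s assume s: "0 \<le> s" "s < t"
      have sT: "s \<in> {0..T}" "s < T" using s t by auto
      let ?l = "RL u s"
      obtain d where d: "d > 0" "\<And>x. norm (x - ?l) < d \<Longrightarrow> \<bar>E s x - E s ?l - blinfun_apply (DE s ?l) (x - ?l)\<bar> \<le> \<delta> * norm (x - ?l)"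
        "\<And>a b x. 0 \<le> a \<Longrightarrow> a \<le> b \<Longrightarrow> b \<le> T \<Longrightarrow> \<bar>a - s\<bar> < d \<Longrightarrow> \<bar>b - s\<bar> < d \<Longrightarrow> norm (x - ?l) < d \<Longrightarrow>
          (\<forall>r. a < r \<longrightarrow> r < b \<longrightarrow> norm (u r - ?l) < d) \<Longrightarrow> \<bar>E b x - E a x - (LINT r:{a..b}|lborel. power u r)\<bar> \<le> \<delta> * (b - a)"
        using energy_local[OF sT(1) \<delta>, of ?l] by blast
      have "\<forall>\<^sub>F r in at_right s. dist (u r) ?l < d" by (rule tendstoD[OF tendsto_RL d(1)])
      then obtain c where c: "c > s" "\<And>r. s < r \<Longrightarrow> r < c \<Longrightarrow> norm (u r - ?l) < d"
        unfolding eventually_at_right_field dist_norm by blast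
      show "\<exists>d>0. \<forall>b. b \<le> t \<longrightarrow> s < b \<longrightarrow> b < s + d \<longrightarrow> K s \<le> K b"
      proof (intro exI[of _ "min d (c - s)"] conjI allI impI)
        fix b assume b: "b \<le> t" "s < b" "b < s + min d (c - s)"
        have bT: "b \<in> {0..T}" "b \<le> T" using b s t by auto
        have ub: "norm (u b - ?l) < d" using c(2)[of b] b by auto
        \<comment> \<open>Here the jump comes first: from \<open>u s\<close> to \<open>?l\<close>
          the loss of energy at time \<open>s\<close> is used, from \<open>?l\<close> to
          \<open>u b\<close> the stable force at the right limit.\<close>
        have "PV s + ennreal (blinfun_apply (- DE s ?l) (u b - ?l)) + ennreal (E s (u s) - E s ?l)
          \<le> PV s + ennreal (blinfun_apply (- DE s ?l) (u b - ?l)) + finsler_cost pp (DE s) (u s) ?l"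
          by (intro add_mono order_refl finsler_cost_ge_energy E_has_derivative continuous_DE_fixed sT)
        also have "\<dots> \<le> PV b" by (rule PV_increment_right[OF stable_RL[OF s(1) sT(2)] s(1) b(2) bT(2)])
        finally have 1: "Q s + blinfun_apply (- DE s ?l) (u b - ?l) + (E s (u s) - E s ?l) \<le> Q b"
          unfolding PV_Q[OF bT(1)] PV_Q[OF sT(1)] by (rule ennreal_add_le_cancel) (rule PV_Q bT sT)+
        have 2: "\<bar>E s (u b) - E s ?l - blinfun_apply (DE s ?l) (u b - ?l)\<bar> \<le> \<delta> * norm (u b - ?l)" by (rule d(2)[OF ub])
        have 3: "\<bar>E b (u b) - E s (u b) - (LINT r:{s..b}|lborel. power u r)\<bar> \<le> \<delta> * (b - s)"
          using b s bT ub c(2) d(1) by (intro d(3)) auto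
        have 4: "\<delta> * norm (u b - ?l) \<le> \<delta> * (Cu * P b - Cu * P s)" using RL_increment[OF b(2)] \<delta> by (intro mult_left_mono) auto
        have 5: "(LINT r:{0..b}|lborel. power u r) = (LINT r:{0..s}|lborel. power u r) + (LINT r:{s..b}|lborel. power u r)"
          using b s by (intro set_integral_Icc_combine power_u_integrable) auto
        have 6: "blinfun_apply (- DE s ?l) (u b - ?l) = - blinfun_apply (DE s ?l) (u b - ?l)"
          by (simp add: blinfun.minus_left)
        show "K s \<le> K b" using 1 2 3 4 5 unfolding K_def e_def 6 abs_le_iff by (simp add: algebra_simps)
      qed (use d c in auto)
    qed
    moreover have "K 0 = E 0 u0" unfolding K_def e_def I0 using P_zero u_zero by (simp add: Q_def PV_zero)
    ultimately show ?thesis by (simp add: K_def)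
  qed
  have "E 0 u0 \<le> Q t + e t"
  proof (rule field_le_epsilon)
    fix \<eta> :: real assume \<eta>: "\<eta> > 0"
    \<comment> \<open>At the fixed time \<open>t\<close> the correction is \<delta> times
      \<open>c\<close>; taking \<delta> as \<open>\<eta> / (c + 1)\<close> keeps it below \<eta> and
      covers \<open>c = 0\<close>.\<close>
    define c where "c = t + Cu * P t"
    have "P 0 \<le> P t" using t monoD[OF mono_P] by auto
    then have c: "c \<ge> 0" using t Cu(1) P_zero by (simp add: c_def)
    have "\<eta> / (c + 1) * c \<le> \<eta>" using c \<eta> by (simp add: field_simps)
    moreover have "E 0 u0 \<le> Q t + e t + \<eta> / (c + 1) * c" using main[of "\<eta> / (c + 1)"] c \<eta> by (simp add: c_def)
    ultimately show "E 0 u0 \<le> Q t + e t + \<eta>" by linarith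
  qed
  then show ?thesis by (simp add: e_def)
qed

text \<open>The upper estimate holds with \<open>P\<close> and the lower one with \<open>Q\<close>,
  while \<open>Q \<le> P\<close>. The chain closes, so the balance is an equality and no dissipation
  is lost in the limit.\<close>

lemma BV_solution_u: "BV_solution T E dtE DE \<Psi>0 pp u"
  unfolding BV_solution_def
proof (intro conjI ballI)
  show "BV_function T u" by (rule BV_u)
  show "AE t in lborel. t \<in> {0..T} - jump_set T u \<longrightarrow> - DE t (u t) \<in> Kstar \<Psi>0"
    using local_stability by eventually_elim auto
  fix t assume t: "t \<in> {0..T}"
  have QP: "Q t \<le> P t"
  proof (cases "t = 0")
    case True then show ?thesis by (simp add: Q_def PV_zero P_zero)
  next
    case False
    then have "ennreal (Q t) \<le> ennreal (P t)" using PV_upper[of t] t PV_Q(1)[OF t] by auto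
    moreover have "P 0 \<le> P t" using t monoD[OF mono_P] by auto
    ultimately show ?thesis using P_zero by (simp add: ennreal_le_iff)
  qed
  have I: "(LINT s:{0..t}|lborel. dtE s (u s)) = (LINT s:{0..t}|lborel. power u s)"
    using t cl(4) by (intro set_lebesgue_integral_cong) (auto simp: power_def)
  have "Q t + E t (u t) = E 0 (u 0) + (LINT s:{0..t}|lborel. dtE s (u s))"
    unfolding I u_zero using energy_lower[OF t] energy_upper[OF t] QP by linarith
  then show "enn2ereal (pseudo_variation T \<Psi>0 pp DE u 0 t) + ereal (E t (u t))
      = ereal (E 0 (u 0) + (LINT s:{0..t}|lborel. dtE s (u s)))"
    unfolding PV_def[symmetric] PV_Q(1)[OF t] using PV_Q(2)[OF t] by (simp add: enn2ereal_ennreal)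
qed

end

section \<open>Selection of the subsequence and conclusion\<close>

theorem theorem4p11:
  fixes \<Psi>0 \<Psi> :: "'a::{banach,second_countable_topology} \<Rightarrow> real"
    and E dtE :: "real \<Rightarrow> 'a \<Rightarrow> real"
    and DE :: "real \<Rightarrow> 'a \<Rightarrow> ('a \<Rightarrow>\<^sub>L real)"
    and U :: "real \<Rightarrow> real \<Rightarrow> nat \<Rightarrow> 'a"
    and u0 :: 'a
    and T :: real
    and \<tau> \<epsilon> :: "nat \<Rightarrow> real"
  assumes finite_dim: "\<exists>B::'a set. finite B \<and> span B = UNIV"
    and T_pos: "T > 0"
    and gauge: "gauge_functional \<Psi>0"
    and energy_C1: "C1_energy T E dtE DE"
    and energy_bounds: "energy_bounds T E dtE"
    and viscous: "viscous_potential \<Psi>"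
    and small_viscosity: "\<And>v. ((\<lambda>\<eta>. rescaled \<Psi> \<eta> v) \<longlongrightarrow> \<Psi>0 v) (at_right 0)"
    and discrete: "\<And>\<sigma> \<eta>. \<sigma> > 0 \<Longrightarrow> \<eta> > 0 \<Longrightarrow> discrete_solution T E \<Psi> \<sigma> \<eta> (U \<sigma> \<eta>)"
    and initial: "((\<lambda>(\<sigma>, \<eta>). U \<sigma> \<eta> 0) \<longlongrightarrow> u0) (at_right 0 \<times>\<^sub>F at_right 0)"
    and tau: "\<And>k. \<tau> k > 0" "\<tau> \<longlonglongrightarrow> 0"
    and eps: "\<And>k. \<epsilon> k > 0" "\<epsilon> \<longlonglongrightarrow> 0"
    and ratio: "filterlim (\<lambda>k. \<epsilon> k / \<tau> k) at_top sequentially"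
  shows "\<exists>(r :: nat \<Rightarrow> nat) u.
           strict_mono r \<and> BV_function T u \<and>
           (\<forall>t\<in>{0..T}. (\<lambda>k. interpolant (\<tau> (r k)) (U (\<tau> (r k)) (\<epsilon> (r k))) t) \<longlonglongrightarrow> u t) \<and>
           BV_solution T E dtE DE \<Psi>0 (contact_potential \<Psi>) u"
proof -
  obtain S :: "'a set" where S: "finite S" "span S = UNIV" using finite_dim by blast
  obtain B where B: "B \<subseteq> S" "independent B" "S \<subseteq> span B" using maximal_independent_subset[of S] by blast
  have spB: "span B = UNIV" using span_mono[OF B(3)] S(2) by (auto simp: span_span)
  have init: "(\<lambda>k. U (\<tau> k) (\<epsilon> k) 0) \<longlonglongrightarrow> u0"
  proof -
    have "filterlim (\<lambda>k. (\<tau> k, \<epsilon> k)) (at_right 0 \<times>\<^sub>F at_right 0) sequentially"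
      using tau eps by (intro filterlim_Pair tendsto_imp_filterlim_at_right) auto
    from filterlim_compose[OF initial this] show ?thesis by simp
  qed
  interpret s: scheme B \<Psi> \<Psi>0 E dtE DE T "\<lambda>k. U (\<tau> k) (\<epsilon> k)" \<tau> \<epsilon> u0
    by unfold_locales (use B(2) finite_subset[OF B(1) S(1)] spB T_pos gauge energy_C1 energy_bounds viscous
      small_viscosity discrete tau eps ratio init in auto)
  obtain r :: "nat \<Rightarrow> nat" where r: "strict_mono r" "\<And>t. convergent (\<lambda>k. s.Pk (r k) t)" "\<And>t. convergent (\<lambda>k. s.Ui (r k) t)"
    using s.selection by blast
  define P where "P t = lim (\<lambda>k. s.Pk (r k) t)" for t
  define u where "u t = lim (\<lambda>k. s.Ui (r k) t)" for t
  have lims: "(\<lambda>k. s.Pk (r k) t) \<longlonglongrightarrow> P t" "(\<lambda>k. s.Ui (r k) t) \<longlonglongrightarrow> u t" for t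
    using r(2,3)[of t] unfolding P_def u_def convergent_LIMSEQ_iff .
  have sub: "(\<lambda>k. f (r k)) \<longlonglongrightarrow> l" if "f \<longlonglongrightarrow> l" for f :: "nat \<Rightarrow> 'b::topological_space" and l
    using LIMSEQ_subseq_LIMSEQ[OF that r(1)] by (simp add: o_def)
  \<comment> \<open>The scheme is interpreted again along the subsequence, because
    \<open>scheme_limit\<close> asks for convergence of a full sequence. Its derived quantities are
    those of \<open>s\<close> reindexed by \<open>r\<close>.\<close>
  interpret q: scheme B \<Psi> \<Psi>0 E dtE DE T "\<lambda>k. U (\<tau> (r k)) (\<epsilon> (r k))" "\<lambda>k. \<tau> (r k)" "\<lambda>k. \<epsilon> (r k)" u0
  proof unfold_locales
    show "filterlim (\<lambda>k. \<epsilon> (r k) / \<tau> (r k)) at_top sequentially"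
      using filterlim_compose[OF ratio filterlim_subseq[OF r(1)]] .
    show "(\<lambda>k. \<tau> (r k)) \<longlonglongrightarrow> 0" "(\<lambda>k. \<epsilon> (r k)) \<longlonglongrightarrow> 0" by (rule sub[OF tau(2)]) (rule sub[OF eps(2)])
    show "(\<lambda>k. U (\<tau> (r k)) (\<epsilon> (r k)) 0) \<longlonglongrightarrow> u0" by (rule sub[OF init])
  qed (use discrete tau eps in auto)
  have Ui: "q.Ui k t = s.Ui (r k) t" for k t
    by (simp add: q.Ui_def s.Ui_def q.ix_def s.ix_def q.cl_def s.cl_def)
  have Pk: "q.Pk k t = s.Pk (r k) t" for k t
    by (simp add: q.Pk_def s.Pk_def q.ix_def s.ix_def q.cl_def s.cl_def q.Dl_def s.Dl_def q.\<xi>_def s.\<xi>_def q.tt_def s.tt_def)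
  interpret l: scheme_limit B \<Psi> \<Psi>0 E dtE DE T "\<lambda>k. U (\<tau> (r k)) (\<epsilon> (r k))" "\<lambda>k. \<tau> (r k)" "\<lambda>k. \<epsilon> (r k)" u0 P u
    by unfold_locales (use lims in \<open>simp_all add: Ui Pk\<close>)
  have "(\<lambda>k. interpolant (\<tau> (r k)) (U (\<tau> (r k)) (\<epsilon> (r k))) t) \<longlonglongrightarrow> u t" if "t \<in> {0..T}" for t
    using lims(2)[of t] s.interpolant_eq[OF that] by simp
  then show ?thesis using r(1) l.BV_u l.BV_solution_u by blast
qed

end
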